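(* For every monad $T$ on $\mathbf{Set}$, the pseudomonad $L_T$ on $\mathbf{CAT}$ extends to a left skew monad $\underline L_T$ on $\mathbf{PROF}$.
   Context: $\mathbf{CAT}$ is the 2-category of locally small categories. $\mathbf{PROF}$ is the bicategory of locally small categories and small profunctors: a profunctor $F\colon C\nrightarrow D$ is a functor $F\colon D^{\mathrm{op}}\times C\to\mathbf{Set}$, small if each $F(-,c)$ is a small colimit of representables; 2-cells are natural transformations and $(G\circ F)(e,c)=\int^{d}G(e,d)\times F(d,c)$. A functor $f\colon C\to D$ gives $f_\diamond\colon C\nrightarrow D$, $f_\diamond(d,c)=D(d,fc)$, with right adjoint $f^\diamond(c,d)=D(fc,d)$. The pseudomonad $L=L_T$, for a monad $(T,\eta^T,\mu^T)$ on $\mathbf{Set}$. Objects of $LC$: triples $(X,h,\nu)$ with $X$ a set, $h\colon X\to\mathrm{Ob}(C)$, $\nu\in TX$. Morphisms $(X,h,\nu)\to(X',h',\nu')$: pairs $(g,\alpha)$ with $g\colon X'\to X$, $Tg(\nu')=\nu$, and $\alpha=(\alpha_x\colon h(g(x))\to h'(x))_{x\in X'}$. For $f\colon C\to D$, $Lf(X,h,\nu)=(X,fh,\nu)$ and similarly on morphisms; $L$ is a 2-functor. Unit: $\eta_C(c)=(1,c,\eta^T_1( * ))$. Multiplication: for $(X,H,\nu)\in L^2C$ with $H(x)=(X_x,h_x,\nu_x)$, $\mu_C(X,H,\nu)=(S,s,\mu^T_S(Tq(\nu)))$ where $S=\sum_xX_x$, $s=\sum_xh_x$, $q\colon X\to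 TS$, $q(x)=T(i_x)(\nu_x)$ and $i_x\colon X_x\hookrightarrow S$; on morphisms, $(g,\alpha)$ with $\alpha_x=(a_x,\gamma_x)$ goes to $((x,z)\mapsto(g(x),a_x(z)),\gamma)$. Together with canonical invertible modifications this is a pseudomonad. Meaning of "extends". The underlying lax functor $\underline L$ is given by $\underline LC=LC$ and, representing $F\colon C\nrightarrow D$ by its collage $C\xrightarrow{d_1}R\xleftarrow{d_0}D$ ($R$ has objects those of $D$ and $C$, and the only additional arrows are the elements of $F(d,c)$ as arrows $d\to c$), $\underline LF=(Ld_0)^\diamond\circ(Ld_1)_\diamond$; i.e. $\underline LF((X,h,\nu),(Y,k,\xi))$ is the set of pairs $(t,\zeta)$ with $t\colon Y\to X$, $Tt(\xi)=\nu$, $\zeta=(\zeta_y\in F(h(t(y)),k(y)))_{y\in Y}$, with the evident functoriality and action on 2-cells. The lax unitor $1_{LC}\Rightarrow\underline L1_C$ is the evident identification, and the lax compositor $\underline LG\circ\underline LF\Rightarrow\underline L(G\circ F)$ sends the class of $(p,\gamma)$, $(p',\gamma')$ to $(pp',([\gamma_{p'(y)},\gamma'_y])_y)$. The unit and multiplication are lax natural transformations with components $(\eta_C)_\diamond$, $(\mu_C)_\diamond$; their structural 2-cells $\underline LF\circ(\eta_C)_\diamond\Rightarrow(\eta_D)_\diamond\circ F$ and $\underline LF\circ(\mu_C)_\diamond\Rightarrow(\mu_D)_\diamond\circ\underline L^2F$ are inverse to the canonical maps $[g\colon y\to\eta_D(d),\,r\in F(d,c)]\mapsto (\mathrm{id}_1,r)\cdot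 g$ and $[g\colon x\to\mu_D(H),\,t\in\underline L^2F(H,K)]\mapsto\mu(t)\cdot g$, where $\mu(t)$ is obtained from $t$ by taking disjoint unions of the functions and families involved. The structural modifications are induced via $(-)_\diamond$ by those of $L$. Skew monads. A right skew monad on a bicategory consists of an oplax functor $T$ with $\psi_A\colon T1_A\Rightarrow1_{TA}$, $\psi_{g,f}\colon T(gf)\Rightarrow Tg\,Tf$; oplax transformations $\eta\colon1\Rightarrow T$ ($\eta_f\colon\eta_Bf\Rightarrow Tf\,\eta_A$) and $\mu\colon T^2\Rightarrow T$ ($\mu_f\colon\mu_B\,T^2f\Rightarrow Tf\,\mu_A$); and modifications $\mathfrak m_A\colon\mu_A\,T\mu_A\Rightarrow\mu_A\,\mu_{TA}$, $\mathfrak l_A\colon1_{TA}\Rightarrow\mu_A\,\eta_{TA}$, $\mathfrak r_A\colon\mu_A\,T\eta_A\Rightarrow1_{TA}$ (compatible with the structural 2-cells of $T,\eta,\mu$ along every $f\colon A\to B$, starting for $\mathfrak m$ from $\mu_BT(\mu_B\,T^2f)$ and for $\mathfrak r$ from $\mu_BT(\eta_Bf)$), such that, at every object: (i) $\mu T(\mu\,T\mu)\xRightarrow{\psi}\mu\,T\mu\,T^2\mu\xRightarrow{\mathfrak m}\mu\,\mu_T\,T^2\mu\xRightarrow{\mu_\mu}\mu\,T\mu\,\mu_{T^2}\xRightarrow{\mathfrak m}\mu\,\mu_T\,\mu_{T^2}$ equals $\mu T(\mu\,T\mu)\xRightarrow{T\mathfrak m}\mu T(\mu\,\mu_T)\xRightarrow{\psi}\mu\,T\mu\,T\mu_T\xRightarrow{\mathfrak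 m}\mu\,\mu_T\,T\mu_T\xRightarrow{\mathfrak m_T}\mu\,\mu_T\,\mu_{T^2}$; (ii) $\mu T(1)\xRightarrow{T\mathfrak l}\mu T(\mu\,\eta_T)\xRightarrow{\psi}\mu\,T\mu\,T\eta_T\xRightarrow{\mathfrak m}\mu\,\mu_T\,T\eta_T\xRightarrow{\mathfrak r_T}\mu$ equals $\mu\psi$; (iii) $\mu\xRightarrow{\mathfrak l}\mu\,\eta_T\,\mu\xRightarrow{\eta_\mu}\mu\,T\mu\,\eta_{T^2}\xRightarrow{\mathfrak m}\mu\,\mu_T\,\eta_{T^2}$ equals $\mu\,\mathfrak l_T$; (iv) $\mu T(\mu\,T\eta)\xRightarrow{\psi}\mu\,T\mu\,T^2\eta\xRightarrow{\mathfrak m}\mu\,\mu_T\,T^2\eta\xRightarrow{\mu_\eta}\mu\,T\eta\,\mu\xRightarrow{\mathfrak r}\mu$ equals $\mu T(\mu\,T\eta)\xRightarrow{T\mathfrak r}\mu T(1)\xRightarrow{\psi}\mu$; (v) $\eta\xRightarrow{\mathfrak l}\mu\,\eta_T\,\eta\xRightarrow{\eta_\eta}\mu\,T\eta\,\eta\xRightarrow{\mathfrak r}\eta$ is the identity. A left skew monad on $\mathcal B$ is a right skew monad on $\mathcal B^{\mathrm{co}}$ (so: a lax functor, lax natural unit and multiplication, and modifications in the opposite direction).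
   Formalization: 1-cells of PROF are profunctors F with each F(-,c) a quotient of a small coproduct of representables, a class containing all small profunctors; with small colimits of representables the claim fails, since LF need not be small when F is. *)

theory Defs
  imports Main "HOL-Library.FuncSet" "HOL-Library.Nat_Bijection"
begin

section \<open>The universe of sets\<close>

text \<open>
  An element of \<open>'u\<close> is a (small) set, with set of elements \<open>elts x\<close>; a class is an arbitrary
  \<open>'u set\<close>.  The axioms are extensionality, separation, replacement, union and power set, the
  last three in second-order form.  Every Grothendieck universe is an instance.  Infinity is not
  imposed since nothing below uses it; without it the class has a concrete instance (the
  hereditarily finite sets, below).
\<close>

class zf_universe =
  fixes elts :: "'a \<Rightarrow> 'a set"
  assumes elts_inj: "inj elts"
    and elts_subset: "B \<subseteq> elts x \<Longrightarrow> B \<in> range elts"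
    and elts_image: "f ` elts x \<in> range elts"
    and elts_Union: "(\<Union>y\<in>elts x. elts y) \<in> range elts"
    and elts_Pow: "{y. elts y \<subseteq> elts x} \<in> range elts"

instantiation nat :: zf_universe
begin

definition "elts = set_decode"

instance
proof
  have rng: "A \<in> range (elts :: nat \<Rightarrow> nat set)" if "finite A" for A
    using set_encode_inverse[OF that] unfolding elts_nat_def by (metis rangeI)
  have fin: "finite (elts x)" for x :: nat
    by (simp add: elts_nat_def)
  show inj: "inj (elts :: nat \<Rightarrow> nat set)"
    unfolding elts_nat_def by (metis injI set_decode_inverse)
  fix B and x :: nat and f :: "nat \<Rightarrow> nat"
  show "B \<in> range elts" if "B \<subseteq> elts x"
    using rng finite_subset[OF that fin] .
  show "f ` elts x \<in> range elts"
    by (intro rng finite_imageI fin)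
  show "(\<Union>y\<in>elts x. elts y) \<in> range elts"
    by (intro rng finite_UN_I fin)
  have "finite (elts ` {y. elts y \<subseteq> elts x})"
    by (rule finite_subset[of _ "Pow (elts x)"]) (auto simp: fin)
  then show "{y. elts y \<subseteq> elts x} \<in> range elts"
    by (intro rng) (rule finite_imageD[OF _ inj_on_subset[OF inj subset_UNIV]])
qed

end

definition small :: "'u::zf_universe set \<Rightarrow> bool" where
  "small A \<longleftrightarrow> A \<in> range elts"

definition vset :: "'u::zf_universe set \<Rightarrow> 'u" where
  "vset A = inv elts A"

text \<open>Kuratowski pairs, and functions coded by their graphs.\<close>

definition pr :: "'u::zf_universe \<Rightarrow> 'u \<Rightarrow> 'u" where
  "pr a b = vset {vset {a}, vset {a, b}}"

definition pfst :: "'u::zf_universe \<Rightarrow> 'u" where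
  "pfst p = (THE a. \<exists>b. p = pr a b)"

definition psnd :: "'u::zf_universe \<Rightarrow> 'u" where
  "psnd p = (THE b. \<exists>a. p = pr a b)"

definition vfun :: "'u::zf_universe \<Rightarrow> ('u \<Rightarrow> 'u) \<Rightarrow> 'u" where
  "vfun X f = vset ((\<lambda>x. pr x (f x)) ` elts X)"

definition app :: "'u::zf_universe \<Rightarrow> 'u \<Rightarrow> 'u" where
  "app f x = (THE y. pr x y \<in> elts f)"

definition star :: "'u::zf_universe" where
  "star = vset {}"

definition one :: "'u::zf_universe" where
  "one = vset {star}"

lemma elts_vset [simp]: "small A \<Longrightarrow> elts (vset A) = A"
  unfolding small_def vset_def by (rule f_inv_into_f)

lemma vset_elts [simp]: "vset (elts x) = x"
  unfolding vset_def by (simp add: elts_inj)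

lemma small_elts [simp]: "small (elts x)"
  by (simp add: small_def)

lemma small_subset: "small A \<Longrightarrow> B \<subseteq> A \<Longrightarrow> small B"
  unfolding small_def by (elim rangeE) (simp only: elts_subset)

lemma small_image: "small A \<Longrightarrow> small (f ` A)" for f :: "'u::zf_universe \<Rightarrow> 'u"
  unfolding small_def by (elim rangeE) (simp only: elts_image)

lemma small_UN:
  fixes F :: "'u::zf_universe \<Rightarrow> 'u set"
  assumes "small A" "\<And>x. x \<in> A \<Longrightarrow> small (F x)"
  shows "small (\<Union>x\<in>A. F x)"
proof -
  have "small ((\<lambda>x. vset (F x)) ` A)"
    using assms(1) by (rule small_image)
  then obtain z where z: "(\<lambda>x. vset (F x)) ` A = elts z"
    unfolding small_def by blast
  have "(\<Union>x\<in>A. F x) = (\<Union>y\<in>elts z. elts y)"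
    unfolding z[symmetric] using assms(2) by simp
  then show ?thesis
    unfolding small_def by (simp only: elts_Union)
qed

lemma small_empty [simp]: "small ({} :: 'u::zf_universe set)"
  by (rule small_subset[OF small_elts]) simp

lemma small_doubleton [simp]: "small {a, b :: 'u::zf_universe}"
proof -
  have p0: "{y :: 'u. elts y \<subseteq> elts (vset {})} = {vset {}}"
  proof -
    have "y = vset {}" if "elts y = {}" for y :: 'u
      using that vset_elts[of y] by simp
    then show ?thesis
      by auto
  qed
  then have s1: "small {vset {} :: 'u}"
    unfolding small_def using elts_Pow[of "vset {} :: 'u"] by simp
  have s2: "small {y :: 'u. elts y \<subseteq> elts (vset {vset {}})}"
    unfolding small_def by (rule elts_Pow)
  have ne: "vset {} \<noteq> (vset {vset {}} :: 'u)"
  proof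
    assume "vset {} = (vset {vset {}} :: 'u)"
    then have "elts (vset {}) = elts (vset {vset {}} :: 'u)"
      by (rule arg_cong)
    then show False
      using s1 by simp
  qed
  have "{a, b} = (\<lambda>y :: 'u. if y = vset {} then a else b) ` {vset {}, vset {vset {}}}"
    using ne by auto
  moreover have "small {vset {}, vset {vset {}} :: 'u}"
    by (rule small_subset[OF s2]) (auto simp: s1)
  ultimately show ?thesis
    by (simp only: small_image)
qed

lemma small_singleton [simp]: "small {a :: 'u::zf_universe}"
  using small_doubleton[of a a] by simp

lemma elts_one [simp]: "elts one = {star}"
  by (simp add: one_def)

lemma vset_inject: "small A \<Longrightarrow> small B \<Longrightarrow> vset A = vset B \<Longrightarrow> A = B"
  using elts_vset by metis

lemma pr_inject [simp]: "pr a b = pr c d \<longleftrightarrow> a = c \<and> b = d"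
proof
  assume "pr a b = pr c d"
  then have *: "{vset {a}, vset {a, b}} = {vset {c}, vset {c, d}}"
    unfolding pr_def by (rule vset_inject[rotated 2]) simp_all
  have "elts ` {vset {a}, vset {a, b}} = elts ` {vset {c}, vset {c, d}}"
    by (simp only: *)
  then have "{{a}, {a, b}} = {{c}, {c, d}}"
    by simp
  then show "a = c \<and> b = d"
    by (metis doubleton_eq_iff singleton_insert_inj_eq)
qed simp

lemma pfst_pr [simp]: "pfst (pr a b) = a"
  by (simp add: pfst_def)

lemma psnd_pr [simp]: "psnd (pr a b) = b"
  by (simp add: psnd_def)

lemma elts_vfun [simp]: "elts (vfun X f) = (\<lambda>x. pr x (f x)) ` elts X"
  by (simp add: vfun_def small_image)

lemma app_vfun [simp]: "x \<in> elts X \<Longrightarrow> app (vfun X f) x = f x"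
  unfolding app_def by (auto simp: image_iff)

section \<open>Monads on Set\<close>

text \<open>A map of sets \<open>X \<rightarrow> Y\<close> is an element of \<open>elts X \<rightarrow>\<^sub>E elts Y\<close>.\<close>

record 'u set_monad =
  TOb :: "'u \<Rightarrow> 'u"
  TMap :: "'u \<Rightarrow> 'u \<Rightarrow> ('u \<Rightarrow> 'u) \<Rightarrow> 'u \<Rightarrow> 'u"
  TUnit :: "'u \<Rightarrow> 'u \<Rightarrow> 'u"
  TMult :: "'u \<Rightarrow> 'u \<Rightarrow> 'u"

locale set_monad =
  fixes T :: "'u::zf_universe set_monad"
  assumes TMap_closed: "f \<in> elts X \<rightarrow>\<^sub>E elts Y \<Longrightarrow> TMap T X Y f \<in> elts (TOb T X) \<rightarrow>\<^sub>E elts (TOb T Y)"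
    and TMap_id: "TMap T X X (\<lambda>x\<in>elts X. x) = (\<lambda>x\<in>elts (TOb T X). x)"
    and TMap_comp: "f \<in> elts X \<rightarrow>\<^sub>E elts Y \<Longrightarrow> g \<in> elts Y \<rightarrow>\<^sub>E elts Z \<Longrightarrow>
      TMap T X Z (compose (elts X) g f) = compose (elts (TOb T X)) (TMap T Y Z g) (TMap T X Y f)"
    and TUnit_closed: "TUnit T X \<in> elts X \<rightarrow>\<^sub>E elts (TOb T X)"
    and TUnit_natural: "f \<in> elts X \<rightarrow>\<^sub>E elts Y \<Longrightarrow>
      compose (elts X) (TUnit T Y) f = compose (elts X) (TMap T X Y f) (TUnit T X)"
    and TMult_closed: "TMult T X \<in> elts (TOb T (TOb T X)) \<rightarrow>\<^sub>E elts (TOb T X)"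
    and TMult_natural: "f \<in> elts X \<rightarrow>\<^sub>E elts Y \<Longrightarrow>
      compose (elts (TOb T (TOb T X))) (TMult T Y) (TMap T (TOb T X) (TOb T Y) (TMap T X Y f))
      = compose (elts (TOb T (TOb T X))) (TMap T X Y f) (TMult T X)"
    and TMult_assoc: "compose (elts (TOb T (TOb T (TOb T X)))) (TMult T X) (TMult T (TOb T X))
      = compose (elts (TOb T (TOb T (TOb T X)))) (TMult T X)
          (TMap T (TOb T (TOb T X)) (TOb T X) (TMult T X))"
    and TMult_TUnit: "compose (elts (TOb T X)) (TMult T X) (TUnit T (TOb T X))
      = (\<lambda>x\<in>elts (TOb T X). x)"
    and TMult_TMap_TUnit: "compose (elts (TOb T X)) (TMult T X) (TMap T X (TOb T X) (TUnit T X))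
      = (\<lambda>x\<in>elts (TOb T X). x)"

section \<open>Bicategories and skew monads\<close>

record ('o, 'f, 'c) bicat =
  BOb :: "'o set"
  BArr :: "'f set"
  BCell :: "'c set"
  bsrc :: "'f \<Rightarrow> 'o"
  btrg :: "'f \<Rightarrow> 'o"
  bdom :: "'c \<Rightarrow> 'f"
  bcod :: "'c \<Rightarrow> 'f"
  bone :: "'o \<Rightarrow> 'f" ("\<one>\<index>")
  bcomp :: "'f \<Rightarrow> 'f \<Rightarrow> 'f" (infixr "\<odot>\<index>" 70)
  bid :: "'f \<Rightarrow> 'c"
  bvcomp :: "'c \<Rightarrow> 'c \<Rightarrow> 'c" (infixr "\<bullet>\<index>" 60)
  bhcomp :: "'c \<Rightarrow> 'c \<Rightarrow> 'c" (infixr "\<star>\<index>" 65)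
  bassoc :: "'f \<Rightarrow> 'f \<Rightarrow> 'f \<Rightarrow> 'c" ("\<a>\<index>")
  bassoc_inv :: "'f \<Rightarrow> 'f \<Rightarrow> 'f \<Rightarrow> 'c" ("\<a>''\<index>")
  blunit :: "'f \<Rightarrow> 'c" ("\<l>\<index>")
  blunit_inv :: "'f \<Rightarrow> 'c" ("\<l>''\<index>")
  brunit :: "'f \<Rightarrow> 'c" ("\<r>\<index>")
  brunit_inv :: "'f \<Rightarrow> 'c" ("\<r>''\<index>")

text \<open>
  \<open>g \<odot> f\<close> is \<open>g\<close> after \<open>f\<close>, and \<open>\<a> h g f : (h \<odot> g) \<odot> f \<Rightarrow> h \<odot> (g \<odot> f)\<close>.
\<close>

definition hom1 :: "('o, 'f, 'c) bicat \<Rightarrow> 'o \<Rightarrow> 'o \<Rightarrow> 'f set" ("hom1\<index>") where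
  "hom1\<^bsub>B\<^esub> x y = {f \<in> BArr B. bsrc B f = x \<and> btrg B f = y}"

definition hom2 :: "('o, 'f, 'c) bicat \<Rightarrow> 'f \<Rightarrow> 'f \<Rightarrow> 'c set" ("hom2\<index>") where
  "hom2\<^bsub>B\<^esub> f g = {\<alpha> \<in> BCell B. bdom B \<alpha> = f \<and> bcod B \<alpha> = g}"

definition lwhisker :: "('o, 'f, 'c) bicat \<Rightarrow> 'f \<Rightarrow> 'c \<Rightarrow> 'c" (infixr "\<lhd>\<index>" 65) where
  "g \<lhd>\<^bsub>B\<^esub> \<alpha> = bid B g \<star>\<^bsub>B\<^esub> \<alpha>"

definition rwhisker :: "('o, 'f, 'c) bicat \<Rightarrow> 'c \<Rightarrow> 'f \<Rightarrow> 'c" (infixl "\<rhd>\<index>" 65) where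
  "\<alpha> \<rhd>\<^bsub>B\<^esub> f = \<alpha> \<star>\<^bsub>B\<^esub> bid B f"

text \<open>Vertical composite of a nonempty list of 2-cells, the first one applied first.\<close>

fun vpath :: "('o, 'f, 'c) bicat \<Rightarrow> 'c list \<Rightarrow> 'c" ("vpath\<index>") where
  "vpath\<^bsub>B\<^esub> [] = undefined"
| "vpath\<^bsub>B\<^esub> [\<alpha>] = \<alpha>"
| "vpath\<^bsub>B\<^esub> (\<alpha> # \<beta> # \<gamma>s) = vpath\<^bsub>B\<^esub> ((\<beta> \<bullet>\<^bsub>B\<^esub> \<alpha>) # \<gamma>s)"

locale bicategory =
  fixes B :: "('o, 'f, 'c) bicat" (structure)
  assumes src_closed: "f \<in> BArr B \<Longrightarrow> bsrc B f \<in> BOb B"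
    and trg_closed: "f \<in> BArr B \<Longrightarrow> btrg B f \<in> BOb B"
    and dom_closed: "\<alpha> \<in> BCell B \<Longrightarrow> bdom B \<alpha> \<in> BArr B"
    and cod_closed: "\<alpha> \<in> BCell B \<Longrightarrow> bcod B \<alpha> \<in> BArr B"
    and cell_src: "\<alpha> \<in> BCell B \<Longrightarrow> bsrc B (bdom B \<alpha>) = bsrc B (bcod B \<alpha>)"
    and cell_trg: "\<alpha> \<in> BCell B \<Longrightarrow> btrg B (bdom B \<alpha>) = btrg B (bcod B \<alpha>)"
    and one_closed: "x \<in> BOb B \<Longrightarrow> \<one> x \<in> hom1 x x"
    and comp_closed: "f \<in> hom1 x y \<Longrightarrow> g \<in> hom1 y z \<Longrightarrow> g \<odot> f \<in> hom1 x z"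
    and id_closed: "f \<in> BArr B \<Longrightarrow> bid B f \<in> hom2 f f"
    and vcomp_closed: "\<alpha> \<in> hom2 f g \<Longrightarrow> \<beta> \<in> hom2 g h \<Longrightarrow> \<beta> \<bullet> \<alpha> \<in> hom2 f h"
    and vcomp_id_left: "\<alpha> \<in> hom2 f g \<Longrightarrow> bid B g \<bullet> \<alpha> = \<alpha>"
    and vcomp_id_right: "\<alpha> \<in> hom2 f g \<Longrightarrow> \<alpha> \<bullet> bid B f = \<alpha>"
    and vcomp_assoc: "\<alpha> \<in> hom2 f g \<Longrightarrow> \<beta> \<in> hom2 g h \<Longrightarrow> \<gamma> \<in> hom2 h k \<Longrightarrow>
      (\<gamma> \<bullet> \<beta>) \<bullet> \<alpha> = \<gamma> \<bullet> (\<beta> \<bullet> \<alpha>)"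
    and hcomp_closed: "f \<in> hom1 x y \<Longrightarrow> g \<in> hom1 y z \<Longrightarrow> \<alpha> \<in> hom2 f f' \<Longrightarrow> \<beta> \<in> hom2 g g' \<Longrightarrow>
      \<beta> \<star> \<alpha> \<in> hom2 (g \<odot> f) (g' \<odot> f')"
    and hcomp_id: "f \<in> hom1 x y \<Longrightarrow> g \<in> hom1 y z \<Longrightarrow> bid B g \<star> bid B f = bid B (g \<odot> f)"
    and interchange: "f \<in> hom1 x y \<Longrightarrow> g \<in> hom1 y z \<Longrightarrow>
      \<alpha> \<in> hom2 f f' \<Longrightarrow> \<alpha>' \<in> hom2 f' f'' \<Longrightarrow> \<beta> \<in> hom2 g g' \<Longrightarrow> \<beta>' \<in> hom2 g' g'' \<Longrightarrow>
      (\<beta>' \<bullet> \<beta>) \<star> (\<alpha>' \<bullet> \<alpha>) = (\<beta>' \<star> \<alpha>') \<bullet> (\<beta> \<star> \<alpha>)"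
    and assoc_closed: "f \<in> hom1 w x \<Longrightarrow> g \<in> hom1 x y \<Longrightarrow> h \<in> hom1 y z \<Longrightarrow>
      \<a> h g f \<in> hom2 ((h \<odot> g) \<odot> f) (h \<odot> (g \<odot> f))"
    and assoc_inv_closed: "f \<in> hom1 w x \<Longrightarrow> g \<in> hom1 x y \<Longrightarrow> h \<in> hom1 y z \<Longrightarrow>
      \<a>' h g f \<in> hom2 (h \<odot> (g \<odot> f)) ((h \<odot> g) \<odot> f)"
    and assoc_inv_left: "f \<in> hom1 w x \<Longrightarrow> g \<in> hom1 x y \<Longrightarrow> h \<in> hom1 y z \<Longrightarrow>
      \<a>' h g f \<bullet> \<a> h g f = bid B ((h \<odot> g) \<odot> f)"
    and assoc_inv_right: "f \<in> hom1 w x \<Longrightarrow> g \<in> hom1 x y \<Longrightarrow> h \<in> hom1 y z \<Longrightarrow>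
      \<a> h g f \<bullet> \<a>' h g f = bid B (h \<odot> (g \<odot> f))"
    and assoc_natural: "f \<in> hom1 w x \<Longrightarrow> g \<in> hom1 x y \<Longrightarrow> h \<in> hom1 y z \<Longrightarrow>
      \<alpha> \<in> hom2 f f' \<Longrightarrow> \<beta> \<in> hom2 g g' \<Longrightarrow> \<gamma> \<in> hom2 h h' \<Longrightarrow>
      \<a> h' g' f' \<bullet> ((\<gamma> \<star> \<beta>) \<star> \<alpha>) = (\<gamma> \<star> (\<beta> \<star> \<alpha>)) \<bullet> \<a> h g f"
    and lunit_closed: "f \<in> hom1 x y \<Longrightarrow> \<l> f \<in> hom2 (\<one> y \<odot> f) f"
    and lunit_inv_closed: "f \<in> hom1 x y \<Longrightarrow> \<l>' f \<in> hom2 f (\<one> y \<odot> f)"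
    and lunit_inv_left: "f \<in> hom1 x y \<Longrightarrow> \<l>' f \<bullet> \<l> f = bid B (\<one> y \<odot> f)"
    and lunit_inv_right: "f \<in> hom1 x y \<Longrightarrow> \<l> f \<bullet> \<l>' f = bid B f"
    and lunit_natural: "f \<in> hom1 x y \<Longrightarrow> \<alpha> \<in> hom2 f f' \<Longrightarrow> \<l> f' \<bullet> (\<one> y \<lhd> \<alpha>) = \<alpha> \<bullet> \<l> f"
    and runit_closed: "f \<in> hom1 x y \<Longrightarrow> \<r> f \<in> hom2 (f \<odot> \<one> x) f"
    and runit_inv_closed: "f \<in> hom1 x y \<Longrightarrow> \<r>' f \<in> hom2 f (f \<odot> \<one> x)"
    and runit_inv_left: "f \<in> hom1 x y \<Longrightarrow> \<r>' f \<bullet> \<r> f = bid B (f \<odot> \<one> x)"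
    and runit_inv_right: "f \<in> hom1 x y \<Longrightarrow> \<r> f \<bullet> \<r>' f = bid B f"
    and runit_natural: "f \<in> hom1 x y \<Longrightarrow> \<alpha> \<in> hom2 f f' \<Longrightarrow> \<r> f' \<bullet> (\<alpha> \<rhd> \<one> x) = \<alpha> \<bullet> \<r> f"
    and pentagon: "f \<in> hom1 v w \<Longrightarrow> g \<in> hom1 w x \<Longrightarrow> h \<in> hom1 x y \<Longrightarrow> k \<in> hom1 y z \<Longrightarrow>
      vpath [\<a> (k \<odot> h) g f, \<a> k h (g \<odot> f)]
      = vpath [\<a> k h g \<rhd> f, \<a> k (h \<odot> g) f, k \<lhd> \<a> h g f]"
    and triangle: "f \<in> hom1 x y \<Longrightarrow> g \<in> hom1 y z \<Longrightarrow>
      vpath [\<a> g (\<one> y) f, g \<lhd> \<l> f] = \<r> g \<rhd> f"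

text \<open>The dual on 2-cells.\<close>

definition co :: "('o, 'f, 'c) bicat \<Rightarrow> ('o, 'f, 'c) bicat" where
  "co B = B\<lparr>bdom := bcod B, bcod := bdom B,
     bvcomp := (\<lambda>\<beta> \<alpha>. \<alpha> \<bullet>\<^bsub>B\<^esub> \<beta>),
     bassoc := bassoc_inv B, bassoc_inv := bassoc B,
     blunit := blunit_inv B, blunit_inv := blunit B,
     brunit := brunit_inv B, brunit_inv := brunit B\<rparr>"

text \<open>
  Data of an oplax endofunctor; \<open>Funit F x : F \<one> \<Rightarrow> \<one>\<close> and \<open>Fcomp F g f : F (g \<odot> f) \<Rightarrow> F g \<odot> F f\<close>.
\<close>

record ('o, 'f, 'c) endo =
  F0 :: "'o \<Rightarrow> 'o"
  F1 :: "'f \<Rightarrow> 'f"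
  F2 :: "'c \<Rightarrow> 'c"
  Funit :: "'o \<Rightarrow> 'c"
  Fcomp :: "'f \<Rightarrow> 'f \<Rightarrow> 'c"

locale oplax_functor = bicategory B for B :: "('o, 'f, 'c) bicat" (structure) +
  fixes F :: "('o, 'f, 'c) endo"
  assumes F0_closed: "x \<in> BOb B \<Longrightarrow> F0 F x \<in> BOb B"
    and F1_closed: "f \<in> hom1 x y \<Longrightarrow> F1 F f \<in> hom1 (F0 F x) (F0 F y)"
    and F2_closed: "\<alpha> \<in> hom2 f g \<Longrightarrow> F2 F \<alpha> \<in> hom2 (F1 F f) (F1 F g)"
    and F2_id: "f \<in> BArr B \<Longrightarrow> F2 F (bid B f) = bid B (F1 F f)"
    and F2_vcomp: "\<alpha> \<in> hom2 f g \<Longrightarrow> \<beta> \<in> hom2 g h \<Longrightarrow> F2 F (\<beta> \<bullet> \<alpha>) = F2 F \<beta> \<bullet> F2 F \<alpha>"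
    and Funit_closed: "x \<in> BOb B \<Longrightarrow> Funit F x \<in> hom2 (F1 F (\<one> x)) (\<one> (F0 F x))"
    and Fcomp_closed: "f \<in> hom1 x y \<Longrightarrow> g \<in> hom1 y z \<Longrightarrow>
      Fcomp F g f \<in> hom2 (F1 F (g \<odot> f)) (F1 F g \<odot> F1 F f)"
    and Fcomp_natural: "f \<in> hom1 x y \<Longrightarrow> g \<in> hom1 y z \<Longrightarrow> \<alpha> \<in> hom2 f f' \<Longrightarrow> \<beta> \<in> hom2 g g' \<Longrightarrow>
      Fcomp F g' f' \<bullet> F2 F (\<beta> \<star> \<alpha>) = (F2 F \<beta> \<star> F2 F \<alpha>) \<bullet> Fcomp F g f"
    and Fcomp_assoc: "f \<in> hom1 w x \<Longrightarrow> g \<in> hom1 x y \<Longrightarrow> h \<in> hom1 y z \<Longrightarrow>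
      vpath [Fcomp F (h \<odot> g) f, Fcomp F h g \<rhd> F1 F f, \<a> (F1 F h) (F1 F g) (F1 F f)]
      = vpath [F2 F (\<a> h g f), Fcomp F h (g \<odot> f), F1 F h \<lhd> Fcomp F g f]"
    and Fcomp_lunit: "f \<in> hom1 x y \<Longrightarrow>
      vpath [Fcomp F (\<one> y) f, Funit F y \<rhd> F1 F f, \<l> (F1 F f)] = F2 F (\<l> f)"
    and Fcomp_runit: "f \<in> hom1 x y \<Longrightarrow>
      vpath [Fcomp F f (\<one> x), F1 F f \<lhd> Funit F x, \<r> (F1 F f)] = F2 F (\<r> f)"

definition id_endo :: "('o, 'f, 'c) bicat \<Rightarrow> ('o, 'f, 'c) endo" where
  "id_endo B = \<lparr>F0 = (\<lambda>x. x), F1 = (\<lambda>f. f), F2 = (\<lambda>\<alpha>. \<alpha>),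
     Funit = (\<lambda>x. bid B (\<one>\<^bsub>B\<^esub> x)), Fcomp = (\<lambda>g f. bid B (g \<odot>\<^bsub>B\<^esub> f))\<rparr>"

definition square_endo :: "('o, 'f, 'c) bicat \<Rightarrow> ('o, 'f, 'c) endo \<Rightarrow> ('o, 'f, 'c) endo" where
  "square_endo B F = \<lparr>F0 = (\<lambda>x. F0 F (F0 F x)), F1 = (\<lambda>f. F1 F (F1 F f)), F2 = (\<lambda>\<alpha>. F2 F (F2 F \<alpha>)),
     Funit = (\<lambda>x. vpath\<^bsub>B\<^esub> [F2 F (Funit F x), Funit F (F0 F x)]),
     Fcomp = (\<lambda>g f. vpath\<^bsub>B\<^esub> [F2 F (Fcomp F g f), Fcomp F (F1 F g) (F1 F f)])\<rparr>"

text \<open>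
  An oplax transformation \<open>G \<Rightarrow> F\<close> between oplax functors, with components \<open>s0 x : G x \<rightarrow> F x\<close>
  and structural 2-cells \<open>s1 f : s0 y \<odot> G f \<Rightarrow> F f \<odot> s0 x\<close>.
\<close>

locale oplax_transformation =
  G: oplax_functor B G + F: oplax_functor B F
  for B :: "('o, 'f, 'c) bicat" (structure) and G F :: "('o, 'f, 'c) endo" +
  fixes s0 :: "'o \<Rightarrow> 'f" and s1 :: "'f \<Rightarrow> 'c"
  assumes s0_closed: "x \<in> BOb B \<Longrightarrow> s0 x \<in> hom1 (F0 G x) (F0 F x)"
    and s1_closed: "f \<in> hom1 x y \<Longrightarrow> s1 f \<in> hom2 (s0 y \<odot> F1 G f) (F1 F f \<odot> s0 x)"
    and s1_natural: "f \<in> hom1 x y \<Longrightarrow> \<alpha> \<in> hom2 f f' \<Longrightarrow>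
      vpath [s0 y \<lhd> F2 G \<alpha>, s1 f'] = vpath [s1 f, F2 F \<alpha> \<rhd> s0 x]"
    and s1_unit: "x \<in> BOb B \<Longrightarrow>
      vpath [s1 (\<one> x), Funit F x \<rhd> s0 x, \<l> (s0 x)] = vpath [s0 x \<lhd> Funit G x, \<r> (s0 x)]"
    and s1_comp: "f \<in> hom1 x y \<Longrightarrow> g \<in> hom1 y z \<Longrightarrow>
      vpath [s1 (g \<odot> f), Fcomp F g f \<rhd> s0 x, \<a> (F1 F g) (F1 F f) (s0 x)]
      = vpath [s0 z \<lhd> Fcomp G g f, \<a>' (s0 z) (F1 G g) (F1 G f), s1 g \<rhd> F1 G f,
          \<a> (F1 F g) (s0 y) (F1 G f), F1 F g \<lhd> s1 f]"

text \<open>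
  Data of a right skew monad: an oplax endofunctor \<open>T\<close>, with \<open>\<eta>0\<close>, \<open>\<eta>1\<close> and \<open>\<mu>0\<close>, \<open>\<mu>1\<close> the components
  and structural 2-cells of the unit and multiplication, and modifications \<open>mm\<close>, \<open>ll\<close>, \<open>rr\<close>.
\<close>

record ('o, 'f, 'c) skew =
  skfun :: "('o, 'f, 'c) endo"
  sketa0 :: "'o \<Rightarrow> 'f"
  sketa1 :: "'f \<Rightarrow> 'c"
  skmu0 :: "'o \<Rightarrow> 'f"
  skmu1 :: "'f \<Rightarrow> 'c"
  skm :: "'o \<Rightarrow> 'c"
  skl :: "'o \<Rightarrow> 'c"
  skr :: "'o \<Rightarrow> 'c"

locale skew_data =
  fixes B :: "('o, 'f, 'c) bicat" (structure) and S :: "('o, 'f, 'c) skew"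
begin

abbreviation "T0 \<equiv> F0 (skfun S)"
abbreviation "T1 \<equiv> F1 (skfun S)"
abbreviation "T2 \<equiv> F2 (skfun S)"
abbreviation "\<psi>0 \<equiv> Funit (skfun S)"
abbreviation "\<psi> \<equiv> Fcomp (skfun S)"
abbreviation "\<eta> \<equiv> sketa0 S"
abbreviation "\<eta>1 \<equiv> sketa1 S"
abbreviation "\<mu> \<equiv> skmu0 S"
abbreviation "\<mu>1 \<equiv> skmu1 S"
abbreviation "mm \<equiv> skm S"
abbreviation "ll \<equiv> skl S"
abbreviation "rr \<equiv> skr S"

end

locale right_skew_monad =
  skew_data B S +
  eta: oplax_transformation B "id_endo B" "skfun S" "sketa0 S" "sketa1 S" +
  mu: oplax_transformation B "square_endo B (skfun S)" "skfun S" "skmu0 S" "skmu1 S"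
  for B :: "('o, 'f, 'c) bicat" (structure) and S :: "('o, 'f, 'c) skew" +
  assumes m_closed: "x \<in> BOb B \<Longrightarrow> mm x \<in> hom2 (\<mu> x \<odot> T1 (\<mu> x)) (\<mu> x \<odot> \<mu> (T0 x))"
    and l_closed: "x \<in> BOb B \<Longrightarrow> ll x \<in> hom2 (\<one> (T0 x)) (\<mu> x \<odot> \<eta> (T0 x))"
    and r_closed: "x \<in> BOb B \<Longrightarrow> rr x \<in> hom2 (\<mu> x \<odot> T1 (\<eta> x)) (\<one> (T0 x))"
    and m_modification: "f \<in> hom1 x y \<Longrightarrow>
      vpath [\<mu> y \<lhd> T2 (\<mu>1 f), \<mu> y \<lhd> \<psi> (T1 f) (\<mu> x), \<a>' (\<mu> y) (T1 (T1 f)) (T1 (\<mu> x)),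
        \<mu>1 f \<rhd> T1 (\<mu> x), \<a> (T1 f) (\<mu> x) (T1 (\<mu> x)), T1 f \<lhd> mm x]
      = vpath [\<mu> y \<lhd> \<psi> (\<mu> y) (T1 (T1 f)), \<a>' (\<mu> y) (T1 (\<mu> y)) (T1 (T1 (T1 f))),
        mm y \<rhd> T1 (T1 (T1 f)), \<a> (\<mu> y) (\<mu> (T0 y)) (T1 (T1 (T1 f))), \<mu> y \<lhd> \<mu>1 (T1 f),
        \<a>' (\<mu> y) (T1 (T1 f)) (\<mu> (T0 x)), \<mu>1 f \<rhd> \<mu> (T0 x), \<a> (T1 f) (\<mu> x) (\<mu> (T0 x))]"
    and l_modification: "f \<in> hom1 x y \<Longrightarrow>
      vpath [\<l>' (T1 f), ll y \<rhd> T1 f, \<a> (\<mu> y) (\<eta> (T0 y)) (T1 f), \<mu> y \<lhd> \<eta>1 (T1 f),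
        \<a>' (\<mu> y) (T1 (T1 f)) (\<eta> (T0 x)), \<mu>1 f \<rhd> \<eta> (T0 x), \<a> (T1 f) (\<mu> x) (\<eta> (T0 x))]
      = vpath [\<r>' (T1 f), T1 f \<lhd> ll x]"
    and r_modification: "f \<in> hom1 x y \<Longrightarrow>
      vpath [\<mu> y \<lhd> T2 (\<eta>1 f), \<mu> y \<lhd> \<psi> (T1 f) (\<eta> x), \<a>' (\<mu> y) (T1 (T1 f)) (T1 (\<eta> x)),
        \<mu>1 f \<rhd> T1 (\<eta> x), \<a> (T1 f) (\<mu> x) (T1 (\<eta> x)), T1 f \<lhd> rr x, \<r> (T1 f)]
      = vpath [\<mu> y \<lhd> \<psi> (\<eta> y) f, \<a>' (\<mu> y) (T1 (\<eta> y)) (T1 f), rr y \<rhd> T1 f, \<l> (T1 f)]"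
    and axiom_i: "x \<in> BOb B \<Longrightarrow>
      vpath [\<mu> x \<lhd> \<psi> (\<mu> x) (T1 (\<mu> x)), \<a>' (\<mu> x) (T1 (\<mu> x)) (T1 (T1 (\<mu> x))),
        mm x \<rhd> T1 (T1 (\<mu> x)), \<a> (\<mu> x) (\<mu> (T0 x)) (T1 (T1 (\<mu> x))), \<mu> x \<lhd> \<mu>1 (\<mu> x),
        \<a>' (\<mu> x) (T1 (\<mu> x)) (\<mu> (T0 (T0 x))), mm x \<rhd> \<mu> (T0 (T0 x))]
      = vpath [\<mu> x \<lhd> T2 (mm x), \<mu> x \<lhd> \<psi> (\<mu> x) (\<mu> (T0 x)),
        \<a>' (\<mu> x) (T1 (\<mu> x)) (T1 (\<mu> (T0 x))), mm x \<rhd> T1 (\<mu> (T0 x)),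
        \<a> (\<mu> x) (\<mu> (T0 x)) (T1 (\<mu> (T0 x))), \<mu> x \<lhd> mm (T0 x),
        \<a>' (\<mu> x) (\<mu> (T0 x)) (\<mu> (T0 (T0 x)))]"
    and axiom_ii: "x \<in> BOb B \<Longrightarrow>
      vpath [\<mu> x \<lhd> T2 (ll x), \<mu> x \<lhd> \<psi> (\<mu> x) (\<eta> (T0 x)),
        \<a>' (\<mu> x) (T1 (\<mu> x)) (T1 (\<eta> (T0 x))), mm x \<rhd> T1 (\<eta> (T0 x)),
        \<a> (\<mu> x) (\<mu> (T0 x)) (T1 (\<eta> (T0 x))), \<mu> x \<lhd> rr (T0 x), \<r> (\<mu> x)]
      = vpath [\<mu> x \<lhd> \<psi>0 (T0 x), \<r> (\<mu> x)]"
    and axiom_iii: "x \<in> BOb B \<Longrightarrow>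
      vpath [\<l>' (\<mu> x), ll x \<rhd> \<mu> x, \<a> (\<mu> x) (\<eta> (T0 x)) (\<mu> x), \<mu> x \<lhd> \<eta>1 (\<mu> x),
        \<a>' (\<mu> x) (T1 (\<mu> x)) (\<eta> (T0 (T0 x))), mm x \<rhd> \<eta> (T0 (T0 x))]
      = vpath [\<r>' (\<mu> x), \<mu> x \<lhd> ll (T0 x), \<a>' (\<mu> x) (\<mu> (T0 x)) (\<eta> (T0 (T0 x)))]"
    and axiom_iv: "x \<in> BOb B \<Longrightarrow>
      vpath [\<mu> x \<lhd> \<psi> (\<mu> x) (T1 (\<eta> x)), \<a>' (\<mu> x) (T1 (\<mu> x)) (T1 (T1 (\<eta> x))),
        mm x \<rhd> T1 (T1 (\<eta> x)), \<a> (\<mu> x) (\<mu> (T0 x)) (T1 (T1 (\<eta> x))), \<mu> x \<lhd> \<mu>1 (\<eta> x),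
        \<a>' (\<mu> x) (T1 (\<eta> x)) (\<mu> x), rr x \<rhd> \<mu> x, \<l> (\<mu> x)]
      = vpath [\<mu> x \<lhd> T2 (rr x), \<mu> x \<lhd> \<psi>0 (T0 x), \<r> (\<mu> x)]"
    and axiom_v: "x \<in> BOb B \<Longrightarrow>
      vpath [\<l>' (\<eta> x), ll x \<rhd> \<eta> x, \<a> (\<mu> x) (\<eta> (T0 x)) (\<eta> x), \<mu> x \<lhd> \<eta>1 (\<eta> x),
        \<a>' (\<mu> x) (T1 (\<eta> x)) (\<eta> x), rr x \<rhd> \<eta> x, \<l> (\<eta> x)]
      = bid B (\<eta> x)"

definition left_skew_monad :: "('o, 'f, 'c) bicat \<Rightarrow> ('o, 'f, 'c) skew \<Rightarrow> bool" where
  "left_skew_monad B S \<longleftrightarrow> right_skew_monad (co B) S"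

section \<open>Locally small categories\<close>

text \<open>
  The objects form a class; local smallness is built in, as \<open>Hom C a b\<close> is an element of the
  universe.  Hom-sets need not be disjoint, so \<open>Cmp C a b c g f\<close> (\<open>g\<close> after \<open>f\<close>) carries the objects.
\<close>

record 'u cat =
  Ob :: "'u set"
  Hom :: "'u \<Rightarrow> 'u \<Rightarrow> 'u"
  Ide :: "'u \<Rightarrow> 'u"
  Cmp :: "'u \<Rightarrow> 'u \<Rightarrow> 'u \<Rightarrow> 'u \<Rightarrow> 'u \<Rightarrow> 'u"

locale category =
  fixes C :: "'u::zf_universe cat"
  assumes Ide_closed: "a \<in> Ob C \<Longrightarrow> Ide C a \<in> elts (Hom C a a)"
    and Cmp_closed: "a \<in> Ob C \<Longrightarrow> b \<in> Ob C \<Longrightarrow> c \<in> Ob C \<Longrightarrow>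
      f \<in> elts (Hom C a b) \<Longrightarrow> g \<in> elts (Hom C b c) \<Longrightarrow> Cmp C a b c g f \<in> elts (Hom C a c)"
    and Cmp_Ide_left: "a \<in> Ob C \<Longrightarrow> b \<in> Ob C \<Longrightarrow> f \<in> elts (Hom C a b) \<Longrightarrow>
      Cmp C a b b (Ide C b) f = f"
    and Cmp_Ide_right: "a \<in> Ob C \<Longrightarrow> b \<in> Ob C \<Longrightarrow> f \<in> elts (Hom C a b) \<Longrightarrow>
      Cmp C a a b f (Ide C a) = f"
    and Cmp_assoc: "a \<in> Ob C \<Longrightarrow> b \<in> Ob C \<Longrightarrow> c \<in> Ob C \<Longrightarrow> d \<in> Ob C \<Longrightarrow>
      f \<in> elts (Hom C a b) \<Longrightarrow> g \<in> elts (Hom C b c) \<Longrightarrow> h \<in> elts (Hom C c d) \<Longrightarrow>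
      Cmp C a b d (Cmp C b c d h g) f = Cmp C a c d h (Cmp C a b c g f)"

record 'u func =
  FSrc :: "'u cat"
  FTrg :: "'u cat"
  FOb :: "'u \<Rightarrow> 'u"
  FAr :: "'u \<Rightarrow> 'u \<Rightarrow> 'u \<Rightarrow> 'u"

locale catfunctor =
  src: category "FSrc F" + trg: category "FTrg F" for F :: "'u::zf_universe func" +
  assumes FOb_closed: "a \<in> Ob (FSrc F) \<Longrightarrow> FOb F a \<in> Ob (FTrg F)"
    and FAr_closed: "a \<in> Ob (FSrc F) \<Longrightarrow> b \<in> Ob (FSrc F) \<Longrightarrow> f \<in> elts (Hom (FSrc F) a b) \<Longrightarrow>
      FAr F a b f \<in> elts (Hom (FTrg F) (FOb F a) (FOb F b))"
    and FAr_Ide: "a \<in> Ob (FSrc F) \<Longrightarrow> FAr F a a (Ide (FSrc F) a) = Ide (FTrg F) (FOb F a)"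
    and FAr_Cmp: "a \<in> Ob (FSrc F) \<Longrightarrow> b \<in> Ob (FSrc F) \<Longrightarrow> c \<in> Ob (FSrc F) \<Longrightarrow>
      f \<in> elts (Hom (FSrc F) a b) \<Longrightarrow> g \<in> elts (Hom (FSrc F) b c) \<Longrightarrow>
      FAr F a c (Cmp (FSrc F) a b c g f)
      = Cmp (FTrg F) (FOb F a) (FOb F b) (FOb F c) (FAr F b c g) (FAr F a b f)"

definition id_func :: "'u cat \<Rightarrow> 'u func" where
  "id_func C = \<lparr>FSrc = C, FTrg = C, FOb = (\<lambda>a. a), FAr = (\<lambda>a b f. f)\<rparr>"

definition comp_func :: "'u func \<Rightarrow> 'u func \<Rightarrow> 'u func" where
  "comp_func G F = \<lparr>FSrc = FSrc F, FTrg = FTrg G, FOb = (\<lambda>a. FOb G (FOb F a)),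
     FAr = (\<lambda>a b f. FAr G (FOb F a) (FOb F b) (FAr F a b f))\<rparr>"

record 'u nattrans =
  NDom :: "'u func"
  NCod :: "'u func"
  NCpt :: "'u \<Rightarrow> 'u"

section \<open>Profunctors\<close>

text \<open>
  A profunctor \<open>F : C \<nrightarrow> D\<close> has \<open>Src F = C\<close>, \<open>Trg F = D\<close>, sets \<open>El F d c = F(d, c)\<close>, and for
  \<open>u : d' \<rightarrow> d\<close> in \<open>D\<close> and \<open>v : c \<rightarrow> c'\<close> in \<open>C\<close> the map \<open>Act F d' d c c' u v : F(d, c) \<rightarrow> F(d', c')\<close>.
\<close>

record 'u prof =
  Src :: "'u cat"
  Trg :: "'u cat"
  El :: "'u \<Rightarrow> 'u \<Rightarrow> 'u"
  Act :: "'u \<Rightarrow> 'u \<Rightarrow> 'u \<Rightarrow> 'u \<Rightarrow> 'u \<Rightarrow> 'u \<Rightarrow> 'u \<Rightarrow> 'u"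

locale profunctor =
  src: category "Src F" + trg: category "Trg F" for F :: "'u::zf_universe prof" +
  assumes Act_closed: "d \<in> Ob (Trg F) \<Longrightarrow> d' \<in> Ob (Trg F) \<Longrightarrow> c \<in> Ob (Src F) \<Longrightarrow> c' \<in> Ob (Src F) \<Longrightarrow>
      u \<in> elts (Hom (Trg F) d' d) \<Longrightarrow> v \<in> elts (Hom (Src F) c c') \<Longrightarrow> x \<in> elts (El F d c) \<Longrightarrow>
      Act F d' d c c' u v x \<in> elts (El F d' c')"
    and Act_Ide: "d \<in> Ob (Trg F) \<Longrightarrow> c \<in> Ob (Src F) \<Longrightarrow> x \<in> elts (El F d c) \<Longrightarrow>
      Act F d d c c (Ide (Trg F) d) (Ide (Src F) c) x = x"
    and Act_Cmp: "d \<in> Ob (Trg F) \<Longrightarrow> d' \<in> Ob (Trg F) \<Longrightarrow> d'' \<in> Ob (Trg F) \<Longrightarrow>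
      c \<in> Ob (Src F) \<Longrightarrow> c' \<in> Ob (Src F) \<Longrightarrow> c'' \<in> Ob (Src F) \<Longrightarrow>
      u \<in> elts (Hom (Trg F) d' d) \<Longrightarrow> u' \<in> elts (Hom (Trg F) d'' d') \<Longrightarrow>
      v \<in> elts (Hom (Src F) c c') \<Longrightarrow> v' \<in> elts (Hom (Src F) c' c'') \<Longrightarrow> x \<in> elts (El F d c) \<Longrightarrow>
      Act F d'' d c c'' (Cmp (Trg F) d'' d' d u u') (Cmp (Src F) c c' c'' v' v) x
      = Act F d'' d' c' c'' u' v' (Act F d' d c c' u v x)"

definition lact :: "'u prof \<Rightarrow> 'u \<Rightarrow> 'u \<Rightarrow> 'u \<Rightarrow> 'u \<Rightarrow> 'u \<Rightarrow> 'u" where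
  "lact F d' d c u x = Act F d' d c c u (Ide (Src F) c) x"

definition ract :: "'u prof \<Rightarrow> 'u \<Rightarrow> 'u \<Rightarrow> 'u \<Rightarrow> 'u \<Rightarrow> 'u \<Rightarrow> 'u" where
  "ract F d c c' v x = Act F d d c c' (Ide (Trg F) d) v x"

text \<open>
  Size condition on 1-cells: every \<open>F(-, c)\<close> is a quotient of a small coproduct
  \<open>\<Coprod>i. Trg F(-, d i)\<close> of representables, the quotient map being given by elements
  \<open>x i \<in> F(d i, c)\<close> via Yoneda.  This is all that is needed for composites to take values in sets.

  The condition \<open>small_colimit\<close> that every \<open>F(-, c)\<close> be a colimit of a small diagram of representables
  is stronger, and is not preserved by the extension of \<open>L\<close> to profunctors once there are infinite
  sets: the values of the latter involve infinite products of the \<open>F(-, c)\<close>, and an infinite product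
  of connected categories need not be connected.
\<close>

definition small_generated :: "'u::zf_universe prof \<Rightarrow> bool" where
  "small_generated F \<longleftrightarrow> (\<forall>c\<in>Ob (Src F). \<exists>(I :: 'u) d x.
     (\<forall>i\<in>elts I. d i \<in> Ob (Trg F) \<and> x i \<in> elts (El F (d i) c)) \<and>
     (\<forall>e\<in>Ob (Trg F). \<forall>y\<in>elts (El F e c).
        \<exists>i\<in>elts I. \<exists>u\<in>elts (Hom (Trg F) e (d i)). y = lact F e (d i) c u (x i)))"

text \<open>
  A cocone from the representables \<open>D(-, \<Delta> j)\<close> to \<open>F(-, c)\<close>, given by elements \<open>q j \<in> F(\<Delta> j, c)\<close> via
  Yoneda; and natural transformations \<open>F(-, c) \<rightarrow> G(-, c')\<close>.  Every presheaf is of the form \<open>G(-, c')\<close>.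
\<close>

definition cocone :: "'u::zf_universe func \<Rightarrow> 'u prof \<Rightarrow> 'u \<Rightarrow> ('u \<Rightarrow> 'u) \<Rightarrow> bool" where
  "cocone \<Delta> F c q \<longleftrightarrow>
     (\<forall>j\<in>Ob (FSrc \<Delta>). q j \<in> elts (El F (FOb \<Delta> j) c)) \<and>
     (\<forall>j\<in>Ob (FSrc \<Delta>). \<forall>j'\<in>Ob (FSrc \<Delta>). \<forall>u\<in>elts (Hom (FSrc \<Delta>) j j').
        lact F (FOb \<Delta> j) (FOb \<Delta> j') c (FAr \<Delta> j j' u) (q j') = q j)"

definition psh_map :: "'u::zf_universe prof \<Rightarrow> 'u \<Rightarrow> 'u prof \<Rightarrow> 'u \<Rightarrow> ('u \<Rightarrow> 'u \<Rightarrow> 'u) \<Rightarrow> bool" where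
  "psh_map F c G c' \<tau> \<longleftrightarrow>
     (\<forall>d x. d \<in> Ob (Trg F) \<and> x \<in> elts (El F d c) \<longrightarrow> \<tau> d x \<in> elts (El G d c')) \<and>
     (\<forall>d x. \<not> (d \<in> Ob (Trg F) \<and> x \<in> elts (El F d c)) \<longrightarrow> \<tau> d x = undefined) \<and>
     (\<forall>d\<in>Ob (Trg F). \<forall>e\<in>Ob (Trg F). \<forall>u\<in>elts (Hom (Trg F) e d). \<forall>x\<in>elts (El F d c).
        \<tau> e (lact F e d c u x) = lact G e d c' u (\<tau> d x))"

definition small_colimit :: "'u::zf_universe prof \<Rightarrow> bool" where
  "small_colimit F \<longleftrightarrow> (\<forall>c\<in>Ob (Src F). \<exists>\<Delta> q.
     catfunctor \<Delta> \<and> small (Ob (FSrc \<Delta>)) \<and> FTrg \<Delta> = Trg F \<and> cocone \<Delta> F c q \<and>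
     (\<forall>G c' r. profunctor G \<and> Trg G = Trg F \<and> c' \<in> Ob (Src G) \<and> cocone \<Delta> G c' r \<longrightarrow>
        (\<exists>!\<tau>. psh_map F c G c' \<tau> \<and> (\<forall>j\<in>Ob (FSrc \<Delta>). \<tau> (FOb \<Delta> j) (q j) = r j))))"

lemma small_colimit_imp_small_generated:
  assumes F: "profunctor F" and sc: "small_colimit F"
  shows "small_generated F"
  unfolding small_generated_def
proof
  fix c assume c: "c \<in> Ob (Src F)"
  interpret profunctor F by fact
  let ?D = "Trg F" let ?C = "Src F"
  obtain \<Delta> q where \<Delta>: "catfunctor \<Delta>" and sm: "small (Ob (FSrc \<Delta>))" and trg: "FTrg \<Delta> = ?D"
    and q: "cocone \<Delta> F c q"
    and univ: "\<And>G c' r. profunctor G \<Longrightarrow> Trg G = ?D \<Longrightarrow> c' \<in> Ob (Src G) \<Longrightarrow> cocone \<Delta> G c' r \<Longrightarrow>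
      \<exists>!\<tau>. psh_map F c G c' \<tau> \<and> (\<forall>j\<in>Ob (FSrc \<Delta>). \<tau> (FOb \<Delta> j) (q j) = r j)"
    using bspec[OF sc[unfolded small_colimit_def] c] by (elim exE conjE) simp
  interpret \<Delta>: catfunctor \<Delta> by fact
  let ?J = "Ob (FSrc \<Delta>)"
  have q_in: "q j \<in> elts (El F (FOb \<Delta> j) c)" if "j \<in> ?J" for j
    using q that unfolding cocone_def by blast
  have \<Delta>_ob: "FOb \<Delta> j \<in> Ob ?D" if "j \<in> ?J" for j
    using \<Delta>.FOb_closed[OF that] trg by simp
  have idC: "Ide ?C c \<in> elts (Hom ?C c c)"
    using c by (rule src.Ide_closed)
  have lact_in: "lact F e d c u x \<in> elts (El F e c)"
    if "d \<in> Ob ?D" "e \<in> Ob ?D" "u \<in> elts (Hom ?D e d)" "x \<in> elts (El F d c)" for d e u x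
    using that Act_closed[OF that(1,2) c c that(3) idC that(4)] by (simp add: lact_def)
  have lact_id: "lact F d d c (Ide ?D d) x = x" if "d \<in> Ob ?D" "x \<in> elts (El F d c)" for d x
    using that c Act_Ide by (simp add: lact_def)
  have lact_comp: "lact F e' d c (Cmp ?D e' e d u u') x = lact F e' e c u' (lact F e d c u x)"
    if "d \<in> Ob ?D" "e \<in> Ob ?D" "e' \<in> Ob ?D" "u \<in> elts (Hom ?D e d)" "u' \<in> elts (Hom ?D e' e)"
      "x \<in> elts (El F d c)" for d e e' u u' x
    using Act_Cmp[OF that(1-3) c c c that(4,5) idC idC that(6)] c idC
    by (simp add: lact_def src.Cmp_Ide_left)
  define gen where "gen e = {y \<in> elts (El F e c). \<exists>j\<in>?J. \<exists>u\<in>elts (Hom ?D e (FOb \<Delta> j)).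
    y = lact F e (FOb \<Delta> j) c u (q j)}" for e
  have gen_small: "small (gen e)" for e
    unfolding gen_def by (rule small_subset[OF small_elts]) auto
  have gen_sub: "x \<in> elts (El F e c)" if "x \<in> gen e" for e x
    using that by (simp add: gen_def)
  have gen_lact: "lact F e d c u x \<in> gen e"
    if d: "d \<in> Ob ?D" and e: "e \<in> Ob ?D" and u: "u \<in> elts (Hom ?D e d)" and x: "x \<in> gen d" for d e u x
  proof -
    obtain j w where j: "j \<in> ?J" and w: "w \<in> elts (Hom ?D d (FOb \<Delta> j))"
      and xw: "x = lact F d (FOb \<Delta> j) c w (q j)"
      using x unfolding gen_def by blast
    have "lact F e d c u x = lact F e (FOb \<Delta> j) c (Cmp ?D e d (FOb \<Delta> j) w u) (q j)"
      unfolding xw by (rule lact_comp[symmetric]) (use d e u w j \<Delta>_ob q_in in auto)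
    moreover have "Cmp ?D e d (FOb \<Delta> j) w u \<in> elts (Hom ?D e (FOb \<Delta> j))"
      by (rule trg.Cmp_closed) (use d e u w j \<Delta>_ob in auto)
    moreover have "lact F e d c u x \<in> elts (El F e c)"
      using lact_in[OF d e u] x unfolding gen_def by blast
    ultimately show ?thesis
      unfolding gen_def using j by blast
  qed
  have gen_q: "q j \<in> gen (FOb \<Delta> j)" if "j \<in> ?J" for j
    unfolding gen_def using that q_in \<Delta>_ob trg.Ide_closed lact_id by (smt (verit) mem_Collect_eq)
  define G where "G = \<lparr>Src = \<lparr>Ob = {star}, Hom = (\<lambda>_ _. one), Ide = (\<lambda>_. star), Cmp = (\<lambda>_ _ _ _ _. star)\<rparr>,
    Trg = ?D, El = (\<lambda>d _. vset (gen d)), Act = (\<lambda>d' d _ _ u _ x. lact F d' d c u x)\<rparr>"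
  have G: "profunctor G"
  proof
    show "\<And>a b f. a \<in> Ob (Src G) \<Longrightarrow> b \<in> Ob (Src G) \<Longrightarrow> f \<in> elts (Hom (Src G) a b) \<Longrightarrow>
      Cmp (Src G) a b b (Ide (Src G) b) f = f"
      by (simp add: G_def)
  qed (auto simp: G_def gen_small gen_lact lact_id lact_comp gen_sub trg.Ide_closed trg.Cmp_closed
      trg.Cmp_Ide_left trg.Cmp_Ide_right trg.Cmp_assoc intro: gen_lact)
  show "\<exists>(I :: 'a) d x. (\<forall>i\<in>elts I. d i \<in> Ob ?D \<and> x i \<in> elts (El F (d i) c)) \<and>
     (\<forall>e\<in>Ob ?D. \<forall>y\<in>elts (El F e c). \<exists>i\<in>elts I. \<exists>u\<in>elts (Hom ?D e (d i)). y = lact F e (d i) c u (x i))"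
  proof (intro exI conjI ballI)
    show "FOb \<Delta> i \<in> Ob ?D" "q i \<in> elts (El F (FOb \<Delta> i) c)" if "i \<in> elts (vset ?J)" for i
      using that \<Delta>_ob q_in sm by simp_all
    fix e y assume e: "e \<in> Ob ?D" and y: "y \<in> elts (El F e c)"
    have G_lact: "lact G e d star u x = lact F e d c u x" for e d u x
      by (simp add: lact_def G_def)
    have "cocone \<Delta> G star q"
      using q gen_q by (auto simp: cocone_def G_lact) (simp_all add: G_def gen_small)
    then obtain \<tau> where \<tau>: "psh_map F c G star \<tau>" "\<forall>j\<in>?J. \<tau> (FOb \<Delta> j) (q j) = q j"
      using univ[OF G, of star q] by (auto simp: G_def)
    define \<iota> where "\<iota> d x = (if d \<in> Ob ?D \<and> x \<in> elts (El F d c) then x else undefined)" for d x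
    have "psh_map F c F c \<tau>"
      using \<tau>(1) by (auto simp: psh_map_def G_lact) (simp add: G_def gen_small gen_sub)
    moreover have "psh_map F c F c \<iota>"
      by (auto simp: psh_map_def \<iota>_def lact_in)
    moreover have "\<forall>j\<in>?J. \<iota> (FOb \<Delta> j) (q j) = q j"
      by (simp add: \<iota>_def \<Delta>_ob q_in)
    ultimately have "\<tau> = \<iota>"
      using univ[OF F refl c q] \<tau>(2) by blast
    then have "y = \<tau> e y"
      using e y by (simp add: \<iota>_def)
    also have "\<dots> \<in> gen e"
      using \<tau>(1) e y by (simp add: psh_map_def G_def gen_small)
    finally show "\<exists>i\<in>elts (vset ?J). \<exists>u\<in>elts (Hom ?D e (FOb \<Delta> i)). y = lact F e (FOb \<Delta> i) c u (q i)"
      using sm by (simp add: gen_def)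
  qed
qed

record 'u ptrans =
  Dom :: "'u prof"
  Cod :: "'u prof"
  Cpt :: "'u \<Rightarrow> 'u \<Rightarrow> 'u \<Rightarrow> 'u"

text \<open>2-cells carry extensional components, so that equality of 2-cells is HOL equality.\<close>

definition ptr :: "'u::zf_universe prof \<Rightarrow> 'u prof \<Rightarrow> ('u \<Rightarrow> 'u \<Rightarrow> 'u \<Rightarrow> 'u) \<Rightarrow> 'u ptrans" where
  "ptr F G \<phi> = \<lparr>Dom = F, Cod = G, Cpt = (\<lambda>d c x.
     if d \<in> Ob (Trg F) \<and> c \<in> Ob (Src F) \<and> x \<in> elts (El F d c) then \<phi> d c x else undefined)\<rparr>"

definition prof_cell :: "'u::zf_universe ptrans \<Rightarrow> bool" where
  "prof_cell \<alpha> \<longleftrightarrow> Src (Dom \<alpha>) = Src (Cod \<alpha>) \<and> Trg (Dom \<alpha>) = Trg (Cod \<alpha>) \<and>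
     \<alpha> = ptr (Dom \<alpha>) (Cod \<alpha>) (Cpt \<alpha>) \<and>
     (\<forall>d\<in>Ob (Trg (Dom \<alpha>)). \<forall>c\<in>Ob (Src (Dom \<alpha>)). \<forall>x\<in>elts (El (Dom \<alpha>) d c).
        Cpt \<alpha> d c x \<in> elts (El (Cod \<alpha>) d c)) \<and>
     (\<forall>d\<in>Ob (Trg (Dom \<alpha>)). \<forall>d'\<in>Ob (Trg (Dom \<alpha>)). \<forall>c\<in>Ob (Src (Dom \<alpha>)). \<forall>c'\<in>Ob (Src (Dom \<alpha>)).
        \<forall>u\<in>elts (Hom (Trg (Dom \<alpha>)) d' d). \<forall>v\<in>elts (Hom (Src (Dom \<alpha>)) c c').
        \<forall>x\<in>elts (El (Dom \<alpha>) d c).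
          Cpt \<alpha> d' c' (Act (Dom \<alpha>) d' d c c' u v x) = Act (Cod \<alpha>) d' d c c' u v (Cpt \<alpha> d c x))"

definition hom_prof :: "'u cat \<Rightarrow> 'u prof" where
  "hom_prof C = \<lparr>Src = C, Trg = C, El = Hom C,
     Act = (\<lambda>d' d c c' u v x. Cmp C d' c c' v (Cmp C d' d c x u))\<rparr>"

text \<open>
  The coend \<open>\<integral>\<^sup>d G(e, d) \<times> F(d, c)\<close>: triples \<open>(d, x, y)\<close> modulo the equivalence relation generated by
  \<open>(d', v x, y) \<sim> (d, x, y v)\<close> for \<open>v : d \<rightarrow> d'\<close>.  Equivalence classes may be proper classes, so
  the quotient is represented by a chosen element \<open>coend_in G F e c d x y\<close> of each class.
\<close>

definition coend_step :: "'u::zf_universe prof \<Rightarrow> 'u prof \<Rightarrow> 'u \<Rightarrow> 'u \<Rightarrow> (('u \<times> 'u \<times> 'u) \<times> ('u \<times> 'u \<times> 'u)) set" where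
  "coend_step G F e c = {((d', ract G e d d' v x, y), (d, x, lact F d d' c v y)) | d d' v x y.
     d \<in> Ob (Trg F) \<and> d' \<in> Ob (Trg F) \<and> v \<in> elts (Hom (Trg F) d d') \<and>
     x \<in> elts (El G e d) \<and> y \<in> elts (El F d' c)}"

definition coend_eq :: "'u::zf_universe prof \<Rightarrow> 'u prof \<Rightarrow> 'u \<Rightarrow> 'u \<Rightarrow> (('u \<times> 'u \<times> 'u) \<times> ('u \<times> 'u \<times> 'u)) set" where
  "coend_eq G F e c = (coend_step G F e c \<union> (coend_step G F e c)\<inverse>)\<^sup>*"

definition coend_in :: "'u::zf_universe prof \<Rightarrow> 'u prof \<Rightarrow> 'u \<Rightarrow> 'u \<Rightarrow> 'u \<Rightarrow> 'u \<Rightarrow> 'u \<Rightarrow> 'u" where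
  "coend_in G F e c d x y =
     (case (SOME t. ((d, x, y), t) \<in> coend_eq G F e c) of (d', x', y') \<Rightarrow> pr d' (pr x' y'))"

definition comp1 :: "'u::zf_universe \<Rightarrow> 'u" where "comp1 p = pfst p"
definition comp2 :: "'u::zf_universe \<Rightarrow> 'u" where "comp2 p = pfst (psnd p)"
definition comp3 :: "'u::zf_universe \<Rightarrow> 'u" where "comp3 p = psnd (psnd p)"

definition comp_prof :: "'u::zf_universe prof \<Rightarrow> 'u prof \<Rightarrow> 'u prof" where
  "comp_prof G F = \<lparr>Src = Src F, Trg = Trg G,
     El = (\<lambda>e c. vset {coend_in G F e c d x y | d x y.
       d \<in> Ob (Trg F) \<and> x \<in> elts (El G e d) \<and> y \<in> elts (El F d c)}),
     Act = (\<lambda>e' e c c' u v p. coend_in G F e' c' (comp1 p)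
       (lact G e' e (comp1 p) u (comp2 p)) (ract F (comp1 p) c c' v (comp3 p)))\<rparr>"

definition prof_bicat :: "('u::zf_universe cat, 'u prof, 'u ptrans) bicat" ("PROF") where
  "PROF = \<lparr>
     BOb = {C. category C},
     BArr = {F. profunctor F \<and> small_generated F},
     BCell = {\<alpha>. profunctor (Dom \<alpha>) \<and> small_generated (Dom \<alpha>) \<and>
       profunctor (Cod \<alpha>) \<and> small_generated (Cod \<alpha>) \<and> prof_cell \<alpha>},
     bsrc = Src, btrg = Trg, bdom = Dom, bcod = Cod,
     bone = hom_prof,
     bcomp = comp_prof,
     bid = (\<lambda>F. ptr F F (\<lambda>d c x. x)),
     bvcomp = (\<lambda>\<beta> \<alpha>. ptr (Dom \<alpha>) (Cod \<beta>) (\<lambda>d c x. Cpt \<beta> d c (Cpt \<alpha> d c x))),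
     bhcomp = (\<lambda>\<beta> \<alpha>. ptr (comp_prof (Dom \<beta>) (Dom \<alpha>)) (comp_prof (Cod \<beta>) (Cod \<alpha>))
       (\<lambda>e c p. coend_in (Cod \<beta>) (Cod \<alpha>) e c (comp1 p)
         (Cpt \<beta> e (comp1 p) (comp2 p)) (Cpt \<alpha> (comp1 p) c (comp3 p)))),
     bassoc = (\<lambda>H G F. ptr (comp_prof (comp_prof H G) F) (comp_prof H (comp_prof G F))
       (\<lambda>e a p. coend_in H (comp_prof G F) e a (comp1 (comp2 p)) (comp2 (comp2 p))
         (coend_in G F (comp1 (comp2 p)) a (comp1 p) (comp3 (comp2 p)) (comp3 p)))),
     bassoc_inv = (\<lambda>H G F. ptr (comp_prof H (comp_prof G F)) (comp_prof (comp_prof H G) F)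
       (\<lambda>e a p. coend_in (comp_prof H G) F e a (comp1 (comp3 p))
         (coend_in H G e (comp1 (comp3 p)) (comp1 p) (comp2 p) (comp2 (comp3 p)))
         (comp3 (comp3 p)))),
     blunit = (\<lambda>F. ptr (comp_prof (hom_prof (Trg F)) F) F
       (\<lambda>d c p. lact F d (comp1 p) c (comp2 p) (comp3 p))),
     blunit_inv = (\<lambda>F. ptr F (comp_prof (hom_prof (Trg F)) F)
       (\<lambda>d c x. coend_in (hom_prof (Trg F)) F d c d (Ide (Trg F) d) x)),
     brunit = (\<lambda>F. ptr (comp_prof F (hom_prof (Src F))) F
       (\<lambda>d c p. ract F d (comp1 p) c (comp3 p) (comp2 p))),
     brunit_inv = (\<lambda>F. ptr F (comp_prof F (hom_prof (Src F)))
       (\<lambda>d c x. coend_in F (hom_prof (Src F)) d c c x (Ide (Src F) c)))\<rparr>"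

text \<open>\<open>diamond f = f\<^sub>\<diamond>\<close>, and the pseudofunctoriality of \<open>(-)\<^sub>\<diamond>\<close>.\<close>

definition diamond :: "'u func \<Rightarrow> 'u prof" where
  "diamond f = \<lparr>Src = FSrc f, Trg = FTrg f, El = (\<lambda>d c. Hom (FTrg f) d (FOb f c)),
     Act = (\<lambda>d' d c c' u v x. Cmp (FTrg f) d' (FOb f c) (FOb f c') (FAr f c c' v)
       (Cmp (FTrg f) d' d (FOb f c) x u))\<rparr>"

definition diamond_cell :: "'u::zf_universe nattrans \<Rightarrow> 'u ptrans" where
  "diamond_cell n = ptr (diamond (NDom n)) (diamond (NCod n))
     (\<lambda>d c x. Cmp (FTrg (NDom n)) d (FOb (NDom n) c) (FOb (NCod n) c) (NCpt n c) x)"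

definition diamond_unit :: "'u::zf_universe cat \<Rightarrow> 'u ptrans" where
  "diamond_unit C = ptr (diamond (id_func C)) (hom_prof C) (\<lambda>d c x. x)"

definition diamond_unit_inv :: "'u::zf_universe cat \<Rightarrow> 'u ptrans" where
  "diamond_unit_inv C = ptr (hom_prof C) (diamond (id_func C)) (\<lambda>d c x. x)"

definition diamond_comp :: "'u::zf_universe func \<Rightarrow> 'u func \<Rightarrow> 'u ptrans" where
  "diamond_comp g f = ptr (comp_prof (diamond g) (diamond f)) (diamond (comp_func g f))
     (\<lambda>e a p. Cmp (FTrg g) e (FOb g (comp1 p)) (FOb g (FOb f a))
       (FAr g (comp1 p) (FOb f a) (comp3 p)) (comp2 p))"

definition diamond_comp_inv :: "'u::zf_universe func \<Rightarrow> 'u func \<Rightarrow> 'u ptrans" where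
  "diamond_comp_inv g f = ptr (diamond (comp_func g f)) (comp_prof (diamond g) (diamond f))
     (\<lambda>e a x. coend_in (diamond g) (diamond f) e a (FOb f a) x (Ide (FTrg f) (FOb f a)))"

section \<open>The pseudomonad L\<close>

text \<open>
  An object \<open>(X, h, \<nu>)\<close> of \<open>LC\<close> is coded as \<open>fam_ob X h \<nu>\<close>, with selectors \<open>idx\<close>, \<open>ob\<close>, \<open>lab\<close>; a pair of
  families \<open>(g, \<alpha>)\<close> indexed by \<open>X\<close> is coded as \<open>fam_ar X g \<alpha>\<close>, with selectors \<open>rdx\<close>, \<open>cpt\<close>.
\<close>

definition fam_ob :: "'u::zf_universe \<Rightarrow> ('u \<Rightarrow> 'u) \<Rightarrow> 'u \<Rightarrow> 'u" where
  "fam_ob X h \<nu> = pr X (pr (vfun X h) \<nu>)"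

definition idx :: "'u::zf_universe \<Rightarrow> 'u" where "idx A = pfst A"
definition ob :: "'u::zf_universe \<Rightarrow> 'u \<Rightarrow> 'u" where "ob A x = app (pfst (psnd A)) x"
definition lab :: "'u::zf_universe \<Rightarrow> 'u" where "lab A = psnd (psnd A)"

definition fam_ar :: "'u::zf_universe \<Rightarrow> ('u \<Rightarrow> 'u) \<Rightarrow> ('u \<Rightarrow> 'u) \<Rightarrow> 'u" where
  "fam_ar X g \<alpha> = pr (vfun X g) (vfun X \<alpha>)"

definition rdx :: "'u::zf_universe \<Rightarrow> 'u \<Rightarrow> 'u" where "rdx p x = app (pfst p) x"
definition cpt :: "'u::zf_universe \<Rightarrow> 'u \<Rightarrow> 'u" where "cpt p x = app (psnd p) x"

text \<open>
  \<open>L_el T E A B\<close> is the set of pairs \<open>(t, \<zeta>)\<close> with \<open>t : idx B \<rightarrow> idx A\<close>, \<open>T t (lab B) = lab A\<close> and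
  \<open>\<zeta>\<^sub>y \<in> E (ob A (t y)) (ob B y)\<close>.  It gives both the hom-sets of \<open>LC\<close> (\<open>E = Hom C\<close>) and the values
  of the extension of \<open>L\<close> to profunctors (\<open>E = El F\<close>).
\<close>

definition L_el :: "'u::zf_universe set_monad \<Rightarrow> ('u \<Rightarrow> 'u \<Rightarrow> 'u) \<Rightarrow> 'u \<Rightarrow> 'u \<Rightarrow> 'u" where
  "L_el T E A B = vset {fam_ar (idx B) t \<zeta> | t \<zeta>.
     t \<in> elts (idx B) \<rightarrow>\<^sub>E elts (idx A) \<and> TMap T (idx B) (idx A) t (lab B) = lab A \<and>
     (\<forall>y\<in>elts (idx B). \<zeta> y \<in> elts (E (ob A (t y)) (ob B y)))}"

definition L_cat :: "'u::zf_universe set_monad \<Rightarrow> 'u cat \<Rightarrow> 'u cat" where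
  "L_cat T C = \<lparr>
     Ob = {fam_ob X h \<nu> | X h \<nu>. h \<in> elts X \<rightarrow> Ob C \<and> \<nu> \<in> elts (TOb T X)},
     Hom = L_el T (Hom C),
     Ide = (\<lambda>A. fam_ar (idx A) (\<lambda>x. x) (\<lambda>x. Ide C (ob A x))),
     Cmp = (\<lambda>A A' A'' q p. fam_ar (idx A'') (\<lambda>x. rdx p (rdx q x))
       (\<lambda>x. Cmp C (ob A (rdx p (rdx q x))) (ob A' (rdx q x)) (ob A'' x) (cpt q x) (cpt p (rdx q x))))\<rparr>"

definition L_func :: "'u::zf_universe set_monad \<Rightarrow> 'u func \<Rightarrow> 'u func" where
  "L_func T f = \<lparr>FSrc = L_cat T (FSrc f), FTrg = L_cat T (FTrg f),
     FOb = (\<lambda>A. fam_ob (idx A) (\<lambda>x. FOb f (ob A x)) (lab A)),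
     FAr = (\<lambda>A B p. fam_ar (idx B) (rdx p) (\<lambda>x. FAr f (ob A (rdx p x)) (ob B x) (cpt p x)))\<rparr>"

definition eta_ob :: "'u::zf_universe set_monad \<Rightarrow> 'u \<Rightarrow> 'u" where
  "eta_ob T c = fam_ob one (\<lambda>x. c) (TUnit T one star)"

definition eta_el :: "'u::zf_universe \<Rightarrow> 'u" where
  "eta_el r = fam_ar one (\<lambda>x. x) (\<lambda>x. r)"

definition L_eta :: "'u::zf_universe set_monad \<Rightarrow> 'u cat \<Rightarrow> 'u func" where
  "L_eta T C = \<lparr>FSrc = C, FTrg = L_cat T C, FOb = eta_ob T, FAr = (\<lambda>a b f. eta_el f)\<rparr>"

text \<open>\<open>mu_idx A\<close> is the disjoint union \<open>\<Sum>\<^sub>x X\<^sub>x\<close>, as a set of pairs \<open>pr x z\<close>.\<close>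

definition mu_idx :: "'u::zf_universe \<Rightarrow> 'u" where
  "mu_idx A = vset {pr x z | x z. x \<in> elts (idx A) \<and> z \<in> elts (idx (ob A x))}"

definition mu_ob :: "'u::zf_universe set_monad \<Rightarrow> 'u \<Rightarrow> 'u" where
  "mu_ob T A = fam_ob (mu_idx A) (\<lambda>s. ob (ob A (pfst s)) (psnd s))
     (TMult T (mu_idx A) (TMap T (idx A) (TOb T (mu_idx A))
       (\<lambda>x\<in>elts (idx A). TMap T (idx (ob A x)) (mu_idx A) (\<lambda>z\<in>elts (idx (ob A x)). pr x z) (lab (ob A x)))
       (lab A)))"

text \<open>The action of \<open>\<mu>\<close> on \<open>t = (g, (a\<^sub>x, \<gamma>\<^sub>x)\<^sub>x)\<close>, an arrow of \<open>L\<^sup>2C\<close> or an element of \<open>L\<^sup>2F\<close>, with target \<open>B\<close>.\<close>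

definition mu_el :: "'u::zf_universe \<Rightarrow> 'u \<Rightarrow> 'u" where
  "mu_el B t = fam_ar (mu_idx B) (\<lambda>s. pr (rdx t (pfst s)) (rdx (cpt t (pfst s)) (psnd s)))
     (\<lambda>s. cpt (cpt t (pfst s)) (psnd s))"

definition L_mu :: "'u::zf_universe set_monad \<Rightarrow> 'u cat \<Rightarrow> 'u func" where
  "L_mu T C = \<lparr>FSrc = L_cat T (L_cat T C), FTrg = L_cat T C, FOb = mu_ob T, FAr = (\<lambda>A B t. mu_el B t)\<rparr>"

text \<open>
  The invertible modifications of \<open>L\<close>, in the directions \<open>\<mu> \<circ> \<mu>\<^sub>L \<Rightarrow> \<mu> \<circ> L\<mu>\<close>, \<open>\<mu> \<circ> \<eta>\<^sub>L \<Rightarrow> 1\<close> and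
  \<open>1 \<Rightarrow> \<mu> \<circ> L\<eta>\<close>: the canonical bijections of index sets
  \<open>(x, (z, w)) \<mapsto> ((x, z), w)\<close>, \<open>z \<mapsto> (*, z)\<close> and \<open>(x, *) \<mapsto> x\<close>, with identity families.
\<close>

definition reindex :: "'u::zf_universe cat \<Rightarrow> 'u \<Rightarrow> ('u \<Rightarrow> 'u) \<Rightarrow> 'u" where
  "reindex C B g = fam_ar (idx B) g (\<lambda>s. Ide C (ob B s))"

definition L_assoc :: "'u::zf_universe set_monad \<Rightarrow> 'u cat \<Rightarrow> 'u nattrans" where
  "L_assoc T C = \<lparr>NDom = comp_func (L_mu T C) (L_mu T (L_cat T C)),
     NCod = comp_func (L_mu T C) (L_func T (L_mu T C)),
     NCpt = (\<lambda>W. reindex C (FOb (comp_func (L_mu T C) (L_func T (L_mu T C))) W)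
       (\<lambda>s. pr (pr (pfst s) (pfst (psnd s))) (psnd (psnd s))))\<rparr>"

definition L_lunit :: "'u::zf_universe set_monad \<Rightarrow> 'u cat \<Rightarrow> 'u nattrans" where
  "L_lunit T C = \<lparr>NDom = comp_func (L_mu T C) (L_eta T (L_cat T C)), NCod = id_func (L_cat T C),
     NCpt = (\<lambda>A. reindex C A (\<lambda>z. pr star z))\<rparr>"

definition L_runit :: "'u::zf_universe set_monad \<Rightarrow> 'u cat \<Rightarrow> 'u nattrans" where
  "L_runit T C = \<lparr>NDom = id_func (L_cat T C), NCod = comp_func (L_mu T C) (L_func T (L_eta T C)),
     NCpt = (\<lambda>A. reindex C (FOb (comp_func (L_mu T C) (L_func T (L_eta T C))) A) pfst)\<rparr>"

section \<open>The extension of L to profunctors\<close>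

definition L_prof :: "'u::zf_universe set_monad \<Rightarrow> 'u prof \<Rightarrow> 'u prof" where
  "L_prof T F = \<lparr>Src = L_cat T (Src F), Trg = L_cat T (Trg F), El = L_el T (El F),
     Act = (\<lambda>A' A B B' u v t. fam_ar (idx B') (\<lambda>y. rdx u (rdx t (rdx v y)))
       (\<lambda>y. Act F (ob A' (rdx u (rdx t (rdx v y)))) (ob A (rdx t (rdx v y))) (ob B (rdx v y)) (ob B' y)
         (cpt u (rdx t (rdx v y))) (cpt v y) (cpt t (rdx v y))))\<rparr>"

definition L_cell :: "'u::zf_universe set_monad \<Rightarrow> 'u ptrans \<Rightarrow> 'u ptrans" where
  "L_cell T \<alpha> = ptr (L_prof T (Dom \<alpha>)) (L_prof T (Cod \<alpha>))
     (\<lambda>A B t. fam_ar (idx B) (rdx t) (\<lambda>y. Cpt \<alpha> (ob A (rdx t y)) (ob B y) (cpt t y)))"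

definition L_unitor :: "'u::zf_universe set_monad \<Rightarrow> 'u cat \<Rightarrow> 'u ptrans" where
  "L_unitor T C = ptr (hom_prof (L_cat T C)) (L_prof T (hom_prof C)) (\<lambda>A B t. t)"

definition L_compositor :: "'u::zf_universe set_monad \<Rightarrow> 'u prof \<Rightarrow> 'u prof \<Rightarrow> 'u ptrans" where
  "L_compositor T G F = ptr (comp_prof (L_prof T G) (L_prof T F)) (L_prof T (comp_prof G F))
     (\<lambda>A C q. let B = comp1 q; p = comp2 q; p' = comp3 q in
       fam_ar (idx C) (\<lambda>y. rdx p (rdx p' y))
         (\<lambda>y. coend_in G F (ob A (rdx p (rdx p' y))) (ob C y) (ob B (rdx p' y))
           (cpt p (rdx p' y)) (cpt p' y)))"

text \<open>
  The canonical maps \<open>(\<eta>\<^sub>D)\<^sub>\<diamond> \<circ> F \<Rightarrow> LF \<circ> (\<eta>\<^sub>C)\<^sub>\<diamond>\<close> and \<open>(\<mu>\<^sub>D)\<^sub>\<diamond> \<circ> L\<^sup>2F \<Rightarrow> LF \<circ> (\<mu>\<^sub>C)\<^sub>\<diamond>\<close>; an element \<open>t\<close> of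
  \<open>P(y, f c)\<close> is regarded as the element \<open>[t, 1]\<close> of \<open>(P \<circ> f\<^sub>\<diamond>)(y, c)\<close> by the co-Yoneda lemma.
\<close>

definition coyoneda :: "'u::zf_universe prof \<Rightarrow> 'u func \<Rightarrow> 'u \<Rightarrow> 'u \<Rightarrow> 'u \<Rightarrow> 'u" where
  "coyoneda P f y c t = coend_in P (diamond f) y c (FOb f c) t (Ide (FTrg f) (FOb f c))"

definition eta_canonical :: "'u::zf_universe set_monad \<Rightarrow> 'u prof \<Rightarrow> 'u ptrans" where
  "eta_canonical T F = ptr (comp_prof (diamond (L_eta T (Trg F))) F)
     (comp_prof (L_prof T F) (diamond (L_eta T (Src F))))
     (\<lambda>y c p. let d = comp1 p; g = comp2 p; r = comp3 p in
       coyoneda (L_prof T F) (L_eta T (Src F)) y c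
         (lact (L_prof T F) y (eta_ob T d) (eta_ob T c) g (eta_el r)))"

definition mu_canonical :: "'u::zf_universe set_monad \<Rightarrow> 'u prof \<Rightarrow> 'u ptrans" where
  "mu_canonical T F = ptr (comp_prof (diamond (L_mu T (Trg F))) (L_prof T (L_prof T F)))
     (comp_prof (L_prof T F) (diamond (L_mu T (Src F))))
     (\<lambda>y K p. let H = comp1 p; g = comp2 p; t = comp3 p in
       coyoneda (L_prof T F) (L_mu T (Src F)) y K
         (lact (L_prof T F) y (mu_ob T H) (mu_ob T K) g (mu_el K t)))"

text \<open>
  The identification of \<open>L(f\<^sub>\<diamond>)\<close> with \<open>(Lf)\<^sub>\<diamond>\<close>, and the modifications induced via \<open>(-)\<^sub>\<diamond>\<close> by those of \<open>L\<close>.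
\<close>

definition L_diamond_inv :: "'u::zf_universe set_monad \<Rightarrow> 'u func \<Rightarrow> 'u ptrans" where
  "L_diamond_inv T f = ptr (diamond (L_func T f)) (L_prof T (diamond f)) (\<lambda>A B t. t)"

definition L_skew_m :: "'u::zf_universe set_monad \<Rightarrow> 'u cat \<Rightarrow> 'u ptrans" where
  "L_skew_m T C = vpath\<^bsub>PROF\<^esub>
     [diamond_comp (L_mu T C) (L_mu T (L_cat T C)),
      diamond_cell (L_assoc T C),
      diamond_comp_inv (L_mu T C) (L_func T (L_mu T C)),
      diamond (L_mu T C) \<lhd>\<^bsub>PROF\<^esub> L_diamond_inv T (L_mu T C)]"

definition L_skew_l :: "'u::zf_universe set_monad \<Rightarrow> 'u cat \<Rightarrow> 'u ptrans" where
  "L_skew_l T C = vpath\<^bsub>PROF\<^esub>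
     [diamond_comp (L_mu T C) (L_eta T (L_cat T C)),
      diamond_cell (L_lunit T C),
      diamond_unit (L_cat T C)]"

definition L_skew_r :: "'u::zf_universe set_monad \<Rightarrow> 'u cat \<Rightarrow> 'u ptrans" where
  "L_skew_r T C = vpath\<^bsub>PROF\<^esub>
     [diamond_unit_inv (L_cat T C),
      diamond_cell (L_runit T C),
      diamond_comp_inv (L_mu T C) (L_func T (L_eta T C)),
      diamond (L_mu T C) \<lhd>\<^bsub>PROF\<^esub> L_diamond_inv T (L_eta T C)]"

definition mutually_inverse :: "('o, 'f, 'c) bicat \<Rightarrow> 'c \<Rightarrow> 'c \<Rightarrow> bool" where
  "mutually_inverse B \<alpha> \<beta> \<longleftrightarrow> \<alpha> \<in> BCell B \<and> \<beta> \<in> BCell B \<and>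
     bdom B \<beta> = bcod B \<alpha> \<and> bcod B \<beta> = bdom B \<alpha> \<and>
     \<beta> \<bullet>\<^bsub>B\<^esub> \<alpha> = bid B (bdom B \<alpha>) \<and> \<alpha> \<bullet>\<^bsub>B\<^esub> \<beta> = bid B (bcod B \<alpha>)"

text \<open>
  For a left skew monad \<open>S\<close>, \<open>sketa1 S F : LF \<circ> (\<eta>\<^sub>C)\<^sub>\<diamond> \<Rightarrow> (\<eta>\<^sub>D)\<^sub>\<diamond> \<circ> F\<close>, \<open>Fcomp (skfun S) G F : LG \<circ> LF \<Rightarrow> L(G \<circ> F)\<close>
  etc., since the 2-cells of \<open>co PROF\<close> are those of \<open>PROF\<close> reversed.
\<close>

definition extends_L :: "'u::zf_universe set_monad \<Rightarrow> ('u cat, 'u prof, 'u ptrans) skew \<Rightarrow> bool" where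
  "extends_L T S \<longleftrightarrow>
     (\<forall>C\<in>BOb PROF.
        F0 (skfun S) C = L_cat T C \<and>
        Funit (skfun S) C = L_unitor T C \<and>
        sketa0 S C = diamond (L_eta T C) \<and>
        skmu0 S C = diamond (L_mu T C) \<and>
        skm S C = L_skew_m T C \<and>
        skl S C = L_skew_l T C \<and>
        skr S C = L_skew_r T C) \<and>
     (\<forall>F\<in>BArr PROF.
        F1 (skfun S) F = L_prof T F \<and>
        mutually_inverse PROF (eta_canonical T F) (sketa1 S F) \<and>
        mutually_inverse PROF (mu_canonical T F) (skmu1 S F)) \<and>
     (\<forall>F\<in>BArr PROF. \<forall>G\<in>BArr PROF. Src G = Trg F \<longrightarrow>
        Fcomp (skfun S) G F = L_compositor T G F) \<and>
     (\<forall>\<alpha>\<in>BCell PROF. F2 (skfun S) \<alpha> = L_cell T \<alpha>)"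

end

theory Submission
  imports Defs
begin

text \<open>
  A 2-cell of \<open>PROF\<close> is determined by its values at elements, and an element of a composite is the class
  \<open>[x, y]\<close> of a pair, so an equation between pasted 2-cells is proved by following one class through both
  sides; the two resulting representatives are then linked by a single instance of the coend relation.

  What has to be found is the inverse of the canonical map \<open>(\<mu>\<^sub>D)\<^sub>\<diamond> \<circ> L\<^sup>2F \<Rightarrow> LF \<circ> (\<mu>\<^sub>C)\<^sub>\<diamond>\<close>.  By the co-Yoneda
  lemma an element of the right-hand side is some \<open>t \<in> LF(A, \<mu>K)\<close>.  Pulling the objects of \<open>A\<close> back along the
  index map of \<open>t\<close> gives \<open>H\<close> with the index sets and labels of \<open>K\<close>, and \<open>t\<close> factors as a reindexing \<open>A \<rightarrow> \<mu>H\<close>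
  followed by \<open>\<mu>(t\<^sub>0)\<close>, where \<open>t\<^sub>0 \<in> L\<^sup>2F(H, K)\<close> is the identity on indices.  Every other factorization is
  equivalent to this one.  The unit is treated in the same way.
\<close>

text \<open>A left skew monad on \<open>PROF\<close> is a right skew monad on
  \<open>co PROF\<close>, so every law is needed with its 2-cells reversed. Unfolding
  \<open>vpath\<close> in \<open>co PROF\<close> gives composites nested to the left in which the
  first cell of the path is applied last, while associators and unitors trade places with their
  inverses. The coherence lemmas are stated in this form, so that the final assembly is by
  rewriting.

  The quotient shapes the rest: an element of a composite is the code of a representative picked by
  choice, and a cell is a formula in it, usable only after invariance under the generating relation
  has been shown. Size is the second obstacle: composites are sets because each
  \<open>F(-, c)\<close> has a small family of generators, and choosing one generator per index
  shows that this form of smallness survives \<open>L\<close>.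

  The arrows to glide along are found by comparing index maps. In axioms (i) and (ii), for instance,
  the two representatives differ by the associativity or unit reindexings taken at all entries of a
  family, and these form one arrow a level higher.\<close>

abbreviation PROF_vcomp (infixr "\<cdot>" 60) where "\<beta> \<cdot> \<alpha> \<equiv> \<beta> \<bullet>\<^bsub>PROF\<^esub> \<alpha>"
abbreviation PROF_hcomp (infixr "\<ast>" 65) where "\<beta> \<ast> \<alpha> \<equiv> \<beta> \<star>\<^bsub>PROF\<^esub> \<alpha>"
abbreviation PROF_lwhisker (infixr "\<triangleleft>" 65) where "G \<triangleleft> \<alpha> \<equiv> G \<lhd>\<^bsub>PROF\<^esub> \<alpha>"
abbreviation PROF_rwhisker (infixl "\<triangleright>" 65) where "\<alpha> \<triangleright> F \<equiv> \<alpha> \<rhd>\<^bsub>PROF\<^esub> F"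
abbreviation "\<aa> \<equiv> \<a>\<^bsub>PROF\<^esub>"
abbreviation "\<aa>' \<equiv> \<a>'\<^bsub>PROF\<^esub>"
abbreviation "\<ll> \<equiv> \<l>\<^bsub>PROF\<^esub>"
abbreviation "\<ll>' \<equiv> \<l>'\<^bsub>PROF\<^esub>"
abbreviation "\<rr> \<equiv> \<r>\<^bsub>PROF\<^esub>"
abbreviation "\<rr>' \<equiv> \<r>'\<^bsub>PROF\<^esub>"
abbreviation "cells \<equiv> hom2\<^bsub>PROF\<^esub>"

section \<open>Elements of profunctors\<close>

text \<open>\<open>el\<close> and \<open>ar\<close> record the objects together with the element,
  since hom-sets and values of profunctors may overlap and the laws of the locales ask for the
  objects separately. One fact then carries all typing hypotheses of an action or a
  composite.\<close>

definition el :: "'u::zf_universe prof \<Rightarrow> 'u \<Rightarrow> 'u \<Rightarrow> 'u \<Rightarrow> bool" where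
  "el F d c x \<longleftrightarrow> d \<in> Ob (Trg F) \<and> c \<in> Ob (Src F) \<and> x \<in> elts (El F d c)"

definition ar :: "'u::zf_universe cat \<Rightarrow> 'u \<Rightarrow> 'u \<Rightarrow> 'u \<Rightarrow> bool" where
  "ar C a b f \<longleftrightarrow> a \<in> Ob C \<and> b \<in> Ob C \<and> f \<in> elts (Hom C a b)"

definition PR :: "'u::zf_universe prof \<Rightarrow> bool" where
  "PR F \<longleftrightarrow> profunctor F \<and> small_generated F"

lemma PR_profunctor: "PR F \<Longrightarrow> profunctor F"
  by (simp add: PR_def)

lemma PR_Src: "PR F \<Longrightarrow> category (Src F)"
  by (simp add: PR_def profunctor_def)

lemma PR_Trg: "PR F \<Longrightarrow> category (Trg F)"
  by (simp add: PR_def profunctor_def)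

lemma ar_Ide: "category C \<Longrightarrow> a \<in> Ob C \<Longrightarrow> ar C a a (Ide C a)"
  by (simp add: ar_def category.Ide_closed)

lemma ar_Cmp: "category C \<Longrightarrow> ar C a b f \<Longrightarrow> ar C b c g \<Longrightarrow> ar C a c (Cmp C a b c g f)"
  by (simp add: ar_def category.Cmp_closed)

lemma Cmp_Ide_l: "category C \<Longrightarrow> ar C a b f \<Longrightarrow> Cmp C a b b (Ide C b) f = f"
  by (simp add: ar_def category.Cmp_Ide_left)

lemma Cmp_Ide_r: "category C \<Longrightarrow> ar C a b f \<Longrightarrow> Cmp C a a b f (Ide C a) = f"
  by (simp add: ar_def category.Cmp_Ide_right)

lemma Cmp_Cmp: "category C \<Longrightarrow> ar C a b f \<Longrightarrow> ar C b c g \<Longrightarrow> ar C c d h \<Longrightarrow>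
    Cmp C a b d (Cmp C b c d h g) f = Cmp C a c d h (Cmp C a b c g f)"
  by (simp add: ar_def category.Cmp_assoc)

lemma el_Act: "profunctor F \<Longrightarrow> ar (Trg F) d' d u \<Longrightarrow> ar (Src F) c c' v \<Longrightarrow> el F d c x \<Longrightarrow>
    el F d' c' (Act F d' d c c' u v x)"
  by (simp add: ar_def el_def profunctor.Act_closed)

lemma Act_Act: "profunctor F \<Longrightarrow> ar (Trg F) d' d u \<Longrightarrow> ar (Trg F) d'' d' u' \<Longrightarrow>
    ar (Src F) c c' v \<Longrightarrow> ar (Src F) c' c'' v' \<Longrightarrow> el F d c x \<Longrightarrow>
    Act F d'' d' c' c'' u' v' (Act F d' d c c' u v x)
    = Act F d'' d c c'' (Cmp (Trg F) d'' d' d u u') (Cmp (Src F) c c' c'' v' v) x"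
  unfolding ar_def el_def by (rule profunctor.Act_Cmp[symmetric]) auto

lemma Act_Ide_Ide: "profunctor F \<Longrightarrow> el F d c x \<Longrightarrow>
    Act F d d c c (Ide (Trg F) d) (Ide (Src F) c) x = x"
  by (simp add: el_def profunctor.Act_Ide)

lemma el_lact: "profunctor F \<Longrightarrow> ar (Trg F) d' d u \<Longrightarrow> el F d c x \<Longrightarrow> el F d' c (lact F d' d c u x)"
  unfolding lact_def by (rule el_Act) (auto simp: el_def profunctor_def intro: ar_Ide)

lemma el_ract: "profunctor F \<Longrightarrow> ar (Src F) c c' v \<Longrightarrow> el F d c x \<Longrightarrow> el F d c' (ract F d c c' v x)"
  unfolding ract_def by (rule el_Act) (auto simp: el_def profunctor_def intro: ar_Ide)

lemma lact_Ide: "profunctor F \<Longrightarrow> el F d c x \<Longrightarrow> lact F d d c (Ide (Trg F) d) x = x"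
  by (simp add: lact_def Act_Ide_Ide)

lemma ract_Ide: "profunctor F \<Longrightarrow> el F d c x \<Longrightarrow> ract F d c c (Ide (Src F) c) x = x"
  by (simp add: ract_def Act_Ide_Ide)

context
  fixes F :: "'u::zf_universe prof"
  assumes F: "profunctor F"
begin

private lemma cats: "category (Src F)" "category (Trg F)"
  using F by (simp_all add: profunctor_def)

private lemma obs: "el F d c x \<Longrightarrow> d \<in> Ob (Trg F)" "el F d c x \<Longrightarrow> c \<in> Ob (Src F)"
    "ar C a b f \<Longrightarrow> a \<in> Ob C" "ar C a b f \<Longrightarrow> b \<in> Ob C"
  by (simp_all add: el_def ar_def)

lemma lact_lact: "ar (Trg F) d' d u \<Longrightarrow> ar (Trg F) d'' d' u' \<Longrightarrow> el F d c x \<Longrightarrow>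
    lact F d'' d' c u' (lact F d' d c u x) = lact F d'' d c (Cmp (Trg F) d'' d' d u u') x"
  unfolding lact_def
  by (subst Act_Act[OF F]) (auto intro: ar_Ide obs cats simp: Cmp_Ide_l[OF cats(1) ar_Ide[OF cats(1)]] obs)

lemma ract_ract: "ar (Src F) c c' v \<Longrightarrow> ar (Src F) c' c'' v' \<Longrightarrow> el F d c x \<Longrightarrow>
    ract F d c' c'' v' (ract F d c c' v x) = ract F d c c'' (Cmp (Src F) c c' c'' v' v) x"
  unfolding ract_def
  by (subst Act_Act[OF F]) (auto intro: ar_Ide obs cats simp: Cmp_Ide_l[OF cats(2) ar_Ide[OF cats(2)]] obs)

text \<open>Each one-sided action is \<open>Act\<close> with an identity in the other variable, so
  \<open>Act_Act\<close> merges the two and the identities cancel. Together with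
  \<open>ract_lact\<close> this is the bimodule law in the form used when an arrow glides past
  another action.\<close>

lemma lact_ract: "ar (Trg F) d' d u \<Longrightarrow> ar (Src F) c c' v \<Longrightarrow> el F d c x \<Longrightarrow>
    lact F d' d c' u (ract F d c c' v x) = Act F d' d c c' u v x"
  unfolding lact_def ract_def
  by (subst Act_Act[OF F]) (auto intro: ar_Ide obs cats simp: Cmp_Ide_l[OF cats(1)] Cmp_Ide_l[OF cats(2)] obs)

lemma ract_lact: "ar (Trg F) d' d u \<Longrightarrow> ar (Src F) c c' v \<Longrightarrow> el F d c x \<Longrightarrow>
    ract F d' c c' v (lact F d' d c u x) = Act F d' d c c' u v x"
  unfolding lact_def ract_def
  by (subst Act_Act[OF F]) (auto intro: ar_Ide obs cats simp: Cmp_Ide_r[OF cats(1)] Cmp_Ide_r[OF cats(2)] obs)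

end

section \<open>Coends\<close>

lemma coend_eq_refl: "(t, t) \<in> coend_eq G F e c"
  by (simp add: coend_eq_def)

lemma coend_eq_sym: "(s, t) \<in> coend_eq G F e c \<Longrightarrow> (t, s) \<in> coend_eq G F e c"
  unfolding coend_eq_def using sym_rtrancl[OF sym_Un_converse] by (rule symD)

lemma coend_eq_trans: "(s, t) \<in> coend_eq G F e c \<Longrightarrow> (t, u) \<in> coend_eq G F e c \<Longrightarrow> (s, u) \<in> coend_eq G F e c"
  unfolding coend_eq_def by (rule rtrancl_trans)

text \<open>Related triples are related to exactly the same triples, so the choice in
  \<open>coend_in\<close> is made from the same predicate and returns the same
  representative.\<close>

lemma coend_in_eqI:
  assumes "((d, x, y), (d', x', y')) \<in> coend_eq G F e c"
  shows "coend_in G F e c d x y = coend_in G F e c d' x' y'"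
proof -
  have "((d, x, y), t) \<in> coend_eq G F e c \<longleftrightarrow> ((d', x', y'), t) \<in> coend_eq G F e c" for t
    using assms coend_eq_sym coend_eq_trans by metis
  then show ?thesis
    by (simp add: coend_in_def)
qed

text \<open>One generating step of the relation, with typing. Identifications between classes in a
  composite are all reduced to this form.\<close>

lemma coend_glide:
  assumes "ar (Trg F) d d' v" "el G e d x" "el F d' c y"
  shows "coend_in G F e c d' (ract G e d d' v x) y = coend_in G F e c d x (lact F d d' c v y)"
  using assms by (intro coend_in_eqI) (auto simp: coend_eq_def coend_step_def ar_def el_def)

text \<open>By reflexivity the given triple is itself a candidate for the choice, so the chosen
  triple is related to it; \<open>comp1\<close>, \<open>comp2\<close> and \<open>comp3\<close>
  decode the chosen one.\<close>

lemma coend_rep: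
  assumes "p = coend_in G F e c d x y"
  shows "((d, x, y), (comp1 p, comp2 p, comp3 p)) \<in> coend_eq G F e c"
proof -
  obtain d' x' y' where t: "(SOME t. ((d, x, y), t) \<in> coend_eq G F e c) = (d', x', y')"
    by (metis prod_cases3)
  have "((d, x, y), (d', x', y')) \<in> coend_eq G F e c"
    unfolding t[symmetric] by (rule someI) (rule coend_eq_refl)
  then show ?thesis
    using assms t by (simp add: coend_in_def comp1_def comp2_def comp3_def)
qed

text \<open>The universal property of the coend on elements: an expression in
  \<open>(d, x, y)\<close> that is unchanged by a generating step has at the chosen representative
  the value it has at the given triple. The typing of the representative comes out of the same
  induction along the zigzag.\<close>

lemma coend_rec:
  assumes G: "profunctor G" and F: "profunctor F" and GF: "Src G = Trg F"
    and x: "el G e d x" and y: "el F d c y"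
    and inv: "\<And>d d' v x y. ar (Trg F) d d' v \<Longrightarrow> el G e d x \<Longrightarrow> el F d' c y \<Longrightarrow>
      \<phi> d' (ract G e d d' v x) y = \<phi> d x (lact F d d' c v y)"
    and p: "p = coend_in G F e c d x y"
  shows "\<phi> (comp1 p) (comp2 p) (comp3 p) = \<phi> d x y"
    and "el G e (comp1 p) (comp2 p)" and "el F (comp1 p) c (comp3 p)"
proof -
  \<comment> \<open>\<open>coend_step\<close> does not say that \<open>e\<close> and
    \<open>c\<close> are objects, so the typing has to travel along the zigzag together with the
    value.\<close>
  let ?P = "\<lambda>(d', x', y'). el G e d' x' \<and> el F d' c y' \<and> \<phi> d' x' y' = \<phi> d x y"
  have "?P t" if "((d, x, y), t) \<in> coend_eq G F e c" for t
    using that unfolding coend_eq_def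
  proof (induction rule: rtrancl_induct)
    case base
    then show ?case using x y by simp
  next
    case (step s t)
    from step(2) have "(s, t) \<in> coend_step G F e c \<or> (t, s) \<in> coend_step G F e c"
      by auto
    then show ?case
    proof
      assume "(s, t) \<in> coend_step G F e c"
      then obtain d d' v x y where s: "s = (d', ract G e d d' v x, y)" and t: "t = (d, x, lact F d d' c v y)"
        and v: "d \<in> Ob (Trg F)" "d' \<in> Ob (Trg F)" "v \<in> elts (Hom (Trg F) d d')"
          "x \<in> elts (El G e d)" "y \<in> elts (El F d' c)"
        unfolding coend_step_def by blast
      have *: "ar (Trg F) d d' v" "el G e d x" "el F d' c y"
        using v step(3) x GF s by (auto simp: ar_def el_def)
      show ?thesis
        using step(3) * inv[OF *] el_lact[OF F *(1,3)] by (simp add: s t)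
    next
      assume "(t, s) \<in> coend_step G F e c"
      then obtain d d' v x y where t: "t = (d', ract G e d d' v x, y)" and s: "s = (d, x, lact F d d' c v y)"
        and v: "d \<in> Ob (Trg F)" "d' \<in> Ob (Trg F)" "v \<in> elts (Hom (Trg F) d d')"
          "x \<in> elts (El G e d)" "y \<in> elts (El F d' c)"
        unfolding coend_step_def by blast
      have *: "ar (Trg F) d d' v" "el G e d x" "el F d' c y"
        using v step(3) x GF s by (auto simp: ar_def el_def)
      show ?thesis
        using step(3) * inv[OF *] el_ract[OF G _ *(2)] GF by (simp add: s t)
    qed
  qed
  from this[OF coend_rep[OF p]]
  show "\<phi> (comp1 p) (comp2 p) (comp3 p) = \<phi> d x y"
    and "el G e (comp1 p) (comp2 p)" and "el F (comp1 p) c (comp3 p)" by auto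
qed

lemma comp_prof_simps [simp]:
  "Src (comp_prof G F) = Src F" "Trg (comp_prof G F) = Trg G"
  by (simp_all add: comp_prof_def)

lemma hom_prof_simps [simp]:
  "Src (hom_prof C) = C" "Trg (hom_prof C) = C"
  by (simp_all add: hom_prof_def)

lemma el_hom_prof [simp]: "el (hom_prof C) a b f = ar C a b f"
  by (simp add: el_def ar_def hom_prof_def)

lemma el_Ob: "el F d c x \<Longrightarrow> d \<in> Ob (Trg F)" "el F d c x \<Longrightarrow> c \<in> Ob (Src F)"
  by (simp_all add: el_def)

lemma ar_Ob: "ar C a b f \<Longrightarrow> a \<in> Ob C" "ar C a b f \<Longrightarrow> b \<in> Ob C"
  by (simp_all add: ar_def)

lemma PR_generators:
  fixes F :: "'u::zf_universe prof"
  assumes "PR F" "c \<in> Ob (Src F)"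
  obtains I :: 'u and d x where "\<And>i. i \<in> elts I \<Longrightarrow> el F (d i) c (x i)"
    and "\<And>e y. el F e c y \<Longrightarrow> \<exists>i\<in>elts I. \<exists>u. ar (Trg F) e (d i) u \<and> y = lact F e (d i) c u (x i)"
proof -
  have "\<exists>(I :: 'u) d x.
     (\<forall>i\<in>elts I. d i \<in> Ob (Trg F) \<and> x i \<in> elts (El F (d i) c)) \<and>
     (\<forall>e\<in>Ob (Trg F). \<forall>y\<in>elts (El F e c).
        \<exists>i\<in>elts I. \<exists>u\<in>elts (Hom (Trg F) e (d i)). y = lact F e (d i) c u (x i))"
    using assms by (simp add: PR_def small_generated_def)
  then obtain I :: 'u and d x where 1: "\<forall>i\<in>elts I. d i \<in> Ob (Trg F) \<and> x i \<in> elts (El F (d i) c)"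
    and 2: "\<forall>e\<in>Ob (Trg F). \<forall>y\<in>elts (El F e c).
        \<exists>i\<in>elts I. \<exists>u\<in>elts (Hom (Trg F) e (d i)). y = lact F e (d i) c u (x i)"
    by (elim exE conjE)
  show thesis
  proof (rule that)
    show "el F (d i) c (x i)" if "i \<in> elts I" for i
      using 1 assms that by (simp add: el_def)
    show "\<exists>i\<in>elts I. \<exists>u. ar (Trg F) e (d i) u \<and> y = lact F e (d i) c u (x i)" if "el F e c y" for e y
      using 1 2 that unfolding el_def ar_def by metis
  qed
qed

lemma small_generatedI:
  fixes F :: "'u::zf_universe prof"
  assumes "\<And>c. c \<in> Ob (Src F) \<Longrightarrow> \<exists>(I :: 'u) d x. (\<forall>i\<in>elts I. el F (d i) c (x i)) \<and>
     (\<forall>e y. el F e c y \<longrightarrow> (\<exists>i\<in>elts I. \<exists>u. ar (Trg F) e (d i) u \<and> y = lact F e (d i) c u (x i)))"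
  shows "small_generated F"
  unfolding small_generated_def
proof
  fix c assume c: "c \<in> Ob (Src F)"
  obtain I :: 'u and d x where *: "\<forall>i\<in>elts I. el F (d i) c (x i)"
    "\<forall>e y. el F e c y \<longrightarrow> (\<exists>i\<in>elts I. \<exists>u. ar (Trg F) e (d i) u \<and> y = lact F e (d i) c u (x i))"
    using assms[OF c] by blast
  show "\<exists>(I :: 'u) d x. (\<forall>i\<in>elts I. d i \<in> Ob (Trg F) \<and> x i \<in> elts (El F (d i) c)) \<and>
     (\<forall>e\<in>Ob (Trg F). \<forall>y\<in>elts (El F e c).
        \<exists>i\<in>elts I. \<exists>u\<in>elts (Hom (Trg F) e (d i)). y = lact F e (d i) c u (x i))"
  proof (intro exI conjI ballI)
    show "d i \<in> Ob (Trg F)" "x i \<in> elts (El F (d i) c)" if "i \<in> elts I" for i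
      using *(1) that by (auto simp: el_def)
    show "\<exists>i\<in>elts I. \<exists>u\<in>elts (Hom (Trg F) e (d i)). y = lact F e (d i) c u (x i)"
      if "e \<in> Ob (Trg F)" "y \<in> elts (El F e c)" for e y
    proof -
      have "el F e c y"
        using that c by (simp add: el_def)
      then obtain i u where "i \<in> elts I" "ar (Trg F) e (d i) u" "y = lact F e (d i) c u (x i)"
        using *(2) by blast
      then show ?thesis
        unfolding ar_def by blast
    qed
  qed
qed

text \<open>The second factor is a generator of \<open>F(-, c)\<close> acted on by some arrow, and
  that arrow glides to the first factor. Hence the classes are images of the sets
  \<open>G(e, d i)\<close> for \<open>i\<close> in a small index set; this is how small generation
  keeps composites within sets.\<close>

lemma small_comp:
  fixes F G :: "'u::zf_universe prof"
  assumes G: "profunctor G" and F: "PR F" and GF: "Src G = Trg F" and e: "e \<in> Ob (Trg G)" and c: "c \<in> Ob (Src F)"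
  shows "small {coend_in G F e c d x y | d x y. d \<in> Ob (Trg F) \<and> x \<in> elts (El G e d) \<and> y \<in> elts (El F d c)}"
    (is "small ?A")
proof -
  obtain I :: 'u and d z where I: "\<And>i. i \<in> elts I \<Longrightarrow> el F (d i) c (z i)"
    and gen: "\<And>e y. el F e c y \<Longrightarrow> \<exists>i\<in>elts I. \<exists>u. ar (Trg F) e (d i) u \<and> y = lact F e (d i) c u (z i)"
    using PR_generators[OF F c] by metis
  have "?A \<subseteq> (\<Union>i\<in>elts I. (\<lambda>x. coend_in G F e c (d i) x (z i)) ` elts (El G e (d i)))"
  proof safe
    fix d' x y assume *: "d' \<in> Ob (Trg F)" "x \<in> elts (El G e d')" "y \<in> elts (El F d' c)"
    then obtain i u where i: "i \<in> elts I" and u: "ar (Trg F) d' (d i) u" and y: "y = lact F d' (d i) c u (z i)"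
      using gen[of d' y] c by (auto simp: el_def)
    have x: "el G e d' x"
      using * e GF by (simp add: el_def)
    have "coend_in G F e c d' x y = coend_in G F e c (d i) (ract G e d' (d i) u x) (z i)"
      unfolding y using coend_glide[OF u x I[OF i]] by simp
    moreover have "ract G e d' (d i) u x \<in> elts (El G e (d i))"
      using el_ract[OF G _ x] u GF by (simp add: el_def)
    ultimately show "coend_in G F e c d' x y \<in> (\<Union>i\<in>elts I. (\<lambda>x. coend_in G F e c (d i) x (z i)) ` elts (El G e (d i)))"
      using i by blast
  qed
  moreover have "small (\<Union>i\<in>elts I. (\<lambda>x. coend_in G F e c (d i) x (z i)) ` elts (El G e (d i)))"
    by (intro small_UN small_image small_elts)
  ultimately show ?thesis
    by (rule small_subset[rotated])
qed

context
  fixes G F :: "'u::zf_universe prof"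
  assumes G: "PR G" and F: "PR F" and GF: "Src G = Trg F"
begin

text \<open>\<open>El (comp_prof G F) e c\<close> is a \<open>vset\<close>, which has the intended
  elements because the collection of classes is small. If \<open>e\<close> or \<open>c\<close> is
  not an object, both sides fail by typing.\<close>

lemma el_comp_iff: "el (comp_prof G F) e c p \<longleftrightarrow> (\<exists>d x y. p = coend_in G F e c d x y \<and> el G e d x \<and> el F d c y)"
proof (cases "e \<in> Ob (Trg G) \<and> c \<in> Ob (Src F)")
  case True
  then show ?thesis
    using GF by (auto simp: el_def) (auto simp: comp_prof_def small_comp[OF PR_profunctor[OF G] F GF])
qed (auto simp: el_def)

lemma el_comp: "el G e d x \<Longrightarrow> el F d c y \<Longrightarrow> el (comp_prof G F) e c (coend_in G F e c d x y)"
  using el_comp_iff by blast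

lemma el_compE:
  assumes "el (comp_prof G F) e c p"
  obtains d x y where "p = coend_in G F e c d x y" "el G e d x" "el F d c y"
  using assms el_comp_iff by blast

lemmas coend_rec_PR = coend_rec[OF PR_profunctor[OF G] PR_profunctor[OF F] GF]

text \<open>The action in \<open>comp_prof\<close> is a formula in the chosen representative. The
  outer actions commute with gliding in the middle variable, so \<open>coend_rec\<close> permits any
  representative instead.\<close>

lemma Act_comp:
  assumes x: "el G e d x" and y: "el F d c y" and u: "ar (Trg G) e' e u" and v: "ar (Src F) c c' v"
  shows "Act (comp_prof G F) e' e c c' u v (coend_in G F e c d x y)
    = coend_in G F e' c' d (lact G e' e d u x) (ract F d c c' v y)"
proof -
  define \<phi> where "\<phi> d x y = coend_in G F e' c' d (lact G e' e d u x) (ract F d c c' v y)" for d x y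
  have "\<phi> (comp1 p) (comp2 p) (comp3 p) = \<phi> d x y" if "p = coend_in G F e c d x y" for p
  proof (rule coend_rec_PR(1)[OF x y _ that])
    fix d d' w x y assume w: "ar (Trg F) d d' w" and x: "el G e d x" and y: "el F d' c y"
    note PG = PR_profunctor[OF G] and PF = PR_profunctor[OF F]
    have w': "ar (Src G) d d' w" using w GF by simp
    \<comment> \<open>The bimodule law is used in both directions on each factor, so that
      \<open>w\<close> acts last on either side and one gliding step applies.\<close>
    show "\<phi> d' (ract G e d d' w x) y = \<phi> d x (lact F d d' c w y)"
      unfolding \<phi>_def lact_ract[OF PG u w' x] ract_lact[OF PF w v y]
      unfolding ract_lact[OF PG u w' x, symmetric] lact_ract[OF PF w v y, symmetric]
      by (rule coend_glide[OF w el_lact[OF PG u x] el_ract[OF PF v y]])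
  qed
  then show ?thesis
    by (simp add: comp_prof_def \<phi>_def)
qed

text \<open>Generators of the composite at \<open>c\<close> are the classes \<open>[w, z]\<close>
  with \<open>z\<close> a generator of \<open>F(-, c)\<close> and \<open>w\<close> a generator of
  \<open>G(-, d)\<close>, where \<open>d\<close> is the object at which \<open>z\<close> lives. The
  profunctor laws are read off on representatives.\<close>

lemma PR_comp: "PR (comp_prof G F)"
proof -
  note PG = PR_profunctor[OF G] and PF = PR_profunctor[OF F]
  have P: "profunctor (comp_prof G F)"
  proof (intro profunctor.intro profunctor_axioms.intro)
    show "category (Src (comp_prof G F))" "category (Trg (comp_prof G F))"
      using G F by (simp_all add: PR_Src PR_Trg)
  next
    fix d d' c c' u v x
    assume *: "d \<in> Ob (Trg (comp_prof G F))" "d' \<in> Ob (Trg (comp_prof G F))" "c \<in> Ob (Src (comp_prof G F))"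
     "c' \<in> Ob (Src (comp_prof G F))" "u \<in> elts (Hom (Trg (comp_prof G F)) d' d)"
     "v \<in> elts (Hom (Src (comp_prof G F)) c c')" "x \<in> elts (El (comp_prof G F) d c)"
    then have uv: "ar (Trg G) d' d u" "ar (Src F) c c' v" and x: "el (comp_prof G F) d c x"
      by (auto simp: ar_def el_def)
    from x obtain b y z where x: "x = coend_in G F d c b y z" and y: "el G d b y" and z: "el F b c z"
      by (rule el_compE)
    have "el (comp_prof G F) d' c' (Act (comp_prof G F) d' d c c' u v x)"
      unfolding x Act_comp[OF y z uv] by (intro el_comp el_lact el_ract PG PF uv y z)
    then show "Act (comp_prof G F) d' d c c' u v x \<in> elts (El (comp_prof G F) d' c')"
      by (simp add: el_def)
  next
    fix d c x
    assume "d \<in> Ob (Trg (comp_prof G F))" "c \<in> Ob (Src (comp_prof G F))" "x \<in> elts (El (comp_prof G F) d c)"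
    then have x: "el (comp_prof G F) d c x" and d: "d \<in> Ob (Trg G)" and c: "c \<in> Ob (Src F)"
      by (auto simp: el_def)
    from x obtain b y z where x: "x = coend_in G F d c b y z" and y: "el G d b y" and z: "el F b c z"
      by (rule el_compE)
    have "ar (Trg G) d d (Ide (Trg G) d)" "ar (Src F) c c (Ide (Src F) c)"
      using G F d c by (auto intro: ar_Ide PR_Src PR_Trg)
    from Act_comp[OF y z this]
    show "Act (comp_prof G F) d d c c (Ide (Trg (comp_prof G F)) d) (Ide (Src (comp_prof G F)) c) x = x"
      by (simp add: x lact_Ide[OF PG y] ract_Ide[OF PF z])
  next
    fix d d' d'' c c' c'' u u' v v' x
    assume *: "d \<in> Ob (Trg (comp_prof G F))" "d' \<in> Ob (Trg (comp_prof G F))" "d'' \<in> Ob (Trg (comp_prof G F))"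
     "c \<in> Ob (Src (comp_prof G F))" "c' \<in> Ob (Src (comp_prof G F))" "c'' \<in> Ob (Src (comp_prof G F))"
     "u \<in> elts (Hom (Trg (comp_prof G F)) d' d)" "u' \<in> elts (Hom (Trg (comp_prof G F)) d'' d')"
     "v \<in> elts (Hom (Src (comp_prof G F)) c c')" "v' \<in> elts (Hom (Src (comp_prof G F)) c' c'')"
     "x \<in> elts (El (comp_prof G F) d c)"
    then have uv: "ar (Trg G) d' d u" "ar (Src F) c c' v" and uv': "ar (Trg G) d'' d' u'" "ar (Src F) c' c'' v'"
      and x: "el (comp_prof G F) d c x"
      by (auto simp: ar_def el_def)
    from x obtain b y z where x: "x = coend_in G F d c b y z" and y: "el G d b y" and z: "el F b c z"
      by (rule el_compE)
    have "ar (Trg G) d'' d (Cmp (Trg G) d'' d' d u u')" "ar (Src F) c c'' (Cmp (Src F) c c' c'' v' v)"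
      using G F uv uv' by (auto intro: ar_Cmp PR_Src PR_Trg)
    from Act_comp[OF y z this]
    show "Act (comp_prof G F) d'' d c c'' (Cmp (Trg (comp_prof G F)) d'' d' d u u') (Cmp (Src (comp_prof G F)) c c' c'' v' v) x
      = Act (comp_prof G F) d'' d' c' c'' u' v' (Act (comp_prof G F) d' d c c' u v x)"
      unfolding x Act_comp[OF y z uv] Act_comp[OF el_lact[OF PG uv(1) y] el_ract[OF PF uv(2) z] uv']
      by (simp add: lact_lact[OF PG uv(1) uv'(1) y] ract_ract[OF PF uv(2) uv'(2) z])
  qed
  moreover have "small_generated (comp_prof G F)"
  proof (rule small_generatedI)
    fix c assume "c \<in> Ob (Src (comp_prof G F))"
    then have c: "c \<in> Ob (Src F)" by simp
    obtain I :: 'u and d z where I: "\<And>i. i \<in> elts I \<Longrightarrow> el F (d i) c (z i)"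
      and gen: "\<And>e y. el F e c y \<Longrightarrow> \<exists>i\<in>elts I. \<exists>u. ar (Trg F) e (d i) u \<and> y = lact F e (d i) c u (z i)"
      using PR_generators[OF F c] by metis
    have "\<exists>(J :: 'u) e w. (\<forall>j\<in>elts J. el G (e j) (d i) (w j)) \<and>
      (\<forall>a y. el G a (d i) y \<longrightarrow> (\<exists>j\<in>elts J. \<exists>u. ar (Trg G) a (e j) u \<and> y = lact G a (e j) (d i) u (w j)))"
      if "i \<in> elts I" for i
    proof -
      have "d i \<in> Ob (Src G)" using el_Ob(1)[OF I[OF that]] GF by simp
      from PR_generators[OF G this] show ?thesis by metis
    qed
    then obtain J :: "'u \<Rightarrow> 'u" and e w where J: "\<And>i j. i \<in> elts I \<Longrightarrow> j \<in> elts (J i) \<Longrightarrow> el G (e i j) (d i) (w i j)"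
      and genJ: "\<And>i a y. i \<in> elts I \<Longrightarrow> el G a (d i) y \<Longrightarrow>
        (\<exists>j\<in>elts (J i). \<exists>u. ar (Trg G) a (e i j) u \<and> y = lact G a (e i j) (d i) u (w i j))"
      by metis
    \<comment> \<open>The disjoint union of the sets \<open>J i\<close>, coded by pairs, so that
      \<open>pfst\<close> and \<open>psnd\<close> recover the two choices.\<close>
    define K where "K = vset (\<Union>i\<in>elts I. pr i ` elts (J i))"
    have K: "elts K = (\<Union>i\<in>elts I. pr i ` elts (J i))"
      unfolding K_def by (intro elts_vset small_UN small_image small_elts)
    show "\<exists>(K :: 'u) d x. (\<forall>k\<in>elts K. el (comp_prof G F) (d k) c (x k)) \<and>
     (\<forall>a y. el (comp_prof G F) a c y \<longrightarrow>
       (\<exists>k\<in>elts K. \<exists>u. ar (Trg (comp_prof G F)) a (d k) u \<and> y = lact (comp_prof G F) a (d k) c u (x k)))"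
    proof (intro exI conjI ballI allI impI)
      let ?x = "\<lambda>k. coend_in G F (e (pfst k) (psnd k)) c (d (pfst k)) (w (pfst k) (psnd k)) (z (pfst k))"
      show "el (comp_prof G F) (e (pfst k) (psnd k)) c (?x k)" if "k \<in> elts K" for k
        using that K by (auto intro!: el_comp J I)
      fix a y assume "el (comp_prof G F) a c y"
      then obtain b y1 y2 where y: "y = coend_in G F a c b y1 y2" and y1: "el G a b y1" and y2: "el F b c y2"
        by (rule el_compE)
      obtain i u where i: "i \<in> elts I" and u: "ar (Trg F) b (d i) u" and y2': "y2 = lact F b (d i) c u (z i)"
        using gen[OF y2] by blast
      \<comment> \<open>The middle arrow \<open>u\<close> is absorbed into \<open>y1\<close> before
        a generator of \<open>G\<close> is chosen, so that this generator lives over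
        \<open>d i\<close>.\<close>
      have "el G a (d i) (ract G a b (d i) u y1)"
        using u GF y1 PG by (auto intro: el_ract)
      then obtain j u' where j: "j \<in> elts (J i)" and u': "ar (Trg G) a (e i j) u'"
        and y1': "ract G a b (d i) u y1 = lact G a (e i j) (d i) u' (w i j)"
        using genJ[OF i] by blast
      have k: "pr i j \<in> elts K" using i j K by blast
      have "y = coend_in G F a c (d i) (lact G a (e i j) (d i) u' (w i j)) (z i)"
        using coend_glide[OF u y1 I[OF i]] by (simp add: y y2' y1'[symmetric])
      also have "\<dots> = lact (comp_prof G F) a (e i j) c u' (?x (pr i j))"
        using Act_comp[OF J[OF i j] I[OF i] u' ar_Ide[OF PR_Src[OF F] c]]
        by (simp add: lact_def ract_Ide[OF PF I[OF i]])
      finally show "\<exists>k\<in>elts K. \<exists>u. ar (Trg (comp_prof G F)) a (e (pfst k) (psnd k)) u \<and>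
          y = lact (comp_prof G F) a (e (pfst k) (psnd k)) c u (?x k)"
        using k u' by (intro bexI[of _ "pr i j"] exI[of _ u']) simp_all
    qed
  qed
  ultimately show ?thesis
    by (simp add: PR_def)
qed

lemma lact_comp:
  assumes "el G e d x" "el F d c y" "ar (Trg G) e' e u"
  shows "lact (comp_prof G F) e' e c u (coend_in G F e c d x y) = coend_in G F e' c d (lact G e' e d u x) y"
  using Act_comp[OF assms ar_Ide[OF PR_Src[OF F] el_Ob(2)[OF assms(2)]]] assms
  by (simp add: lact_def ract_Ide[OF PR_profunctor[OF F]])

lemma ract_comp:
  assumes "el G e d x" "el F d c y" "ar (Src F) c c' v"
  shows "ract (comp_prof G F) e c c' v (coend_in G F e c d x y) = coend_in G F e c' d x (ract F d c c' v y)"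
  using Act_comp[OF assms(1,2) ar_Ide[OF PR_Trg[OF G] el_Ob(1)[OF assms(1)]] assms(3)] assms
  by (simp add: ract_def lact_Ide[OF PR_profunctor[OF G]])

end

section \<open>Evaluation of 2-cells\<close>

lemma ptr_simps [simp]: "Dom (ptr F G \<phi>) = F" "Cod (ptr F G \<phi>) = G"
  by (simp_all add: ptr_def)

lemma Cpt_ptr: "el F d c x \<Longrightarrow> Cpt (ptr F G \<phi>) d c x = \<phi> d c x"
  by (simp add: ptr_def el_def)

text \<open>An extensional cell is rebuilt from its values at elements, with
  \<open>undefined\<close> elsewhere. The predicate isolates this part of \<open>prof_cell\<close>,
  so that two sides of an equation can be compared without first showing that they are
  natural.\<close>

definition ext_cell :: "'u::zf_universe ptrans \<Rightarrow> bool" where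
  "ext_cell \<alpha> \<longleftrightarrow> \<alpha> = ptr (Dom \<alpha>) (Cod \<alpha>) (Cpt \<alpha>)"

lemma ext_cell_ptr [simp]: "ext_cell (ptr F G \<phi>)"
  by (simp add: ext_cell_def ptr_def fun_eq_iff)

lemma PROF_simps [simp]:
  "BOb PROF = {C. category C}" "BArr PROF = {F. PR F}"
  "bsrc PROF = Src" "btrg PROF = Trg" "bdom PROF = Dom" "bcod PROF = Cod"
  "bone PROF = hom_prof" "bcomp PROF = comp_prof"
  by (simp_all add: prof_bicat_def PR_def)

lemma vcomp_PROF_eq: "\<beta> \<cdot> \<alpha> = ptr (Dom \<alpha>) (Cod \<beta>) (\<lambda>d c x. Cpt \<beta> d c (Cpt \<alpha> d c x))"
  by (simp add: prof_bicat_def)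

lemma hcomp_PROF_eq: "\<beta> \<ast> \<alpha> = ptr (comp_prof (Dom \<beta>) (Dom \<alpha>)) (comp_prof (Cod \<beta>) (Cod \<alpha>))
    (\<lambda>e c p. coend_in (Cod \<beta>) (Cod \<alpha>) e c (comp1 p)
      (Cpt \<beta> e (comp1 p) (comp2 p)) (Cpt \<alpha> (comp1 p) c (comp3 p)))"
  by (simp add: prof_bicat_def)

lemma hom1_PROF [simp]: "F \<in> hom1\<^bsub>PROF\<^esub> C D \<longleftrightarrow> PR F \<and> Src F = C \<and> Trg F = D"
  by (simp add: hom1_def)

lemma cellI:
  assumes "PR F" "PR G" "Src F = Src G" "Trg F = Trg G"
    and "\<And>d c x. el F d c x \<Longrightarrow> el G d c (\<phi> d c x)"
    and "\<And>d d' c c' u v x. ar (Trg F) d' d u \<Longrightarrow> ar (Src F) c c' v \<Longrightarrow> el F d c x \<Longrightarrow>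
      \<phi> d' c' (Act F d' d c c' u v x) = Act G d' d c c' u v (\<phi> d c x)"
  shows "ptr F G \<phi> \<in> cells F G"
proof -
  have "Cpt (ptr F G \<phi>) d c x \<in> elts (El G d c)" if "el F d c x" for d c x
    using assms(5)[OF that] that by (simp add: Cpt_ptr) (simp add: el_def)
  moreover have "Cpt (ptr F G \<phi>) d' c' (Act F d' d c c' u v x) = Act G d' d c c' u v (Cpt (ptr F G \<phi>) d c x)"
    if "ar (Trg F) d' d u" "ar (Src F) c c' v" "el F d c x" for d d' c c' u v x
    using assms(6)[OF that] that el_Act[OF PR_profunctor[OF assms(1)] that] by (simp add: Cpt_ptr)
  moreover have "ptr F G \<phi> = ptr F G (Cpt (ptr F G \<phi>))"
    using ext_cell_ptr[of F G \<phi>] by (simp add: ext_cell_def)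
  ultimately have "prof_cell (ptr F G \<phi>)"
    unfolding prof_cell_def ptr_simps using assms(3,4) by (simp add: el_def ar_def)
  then show ?thesis
    using assms(1,2) by (simp add: hom2_def prof_bicat_def PR_def)
qed

lemma BCell_PROF: "\<alpha> \<in> BCell PROF \<longleftrightarrow> \<alpha> \<in> cells (Dom \<alpha>) (Cod \<alpha>)"
  by (simp add: hom2_def)

lemma cell_Dom: "\<alpha> \<in> cells F G \<Longrightarrow> Dom \<alpha> = F"
  and cell_Cod: "\<alpha> \<in> cells F G \<Longrightarrow> Cod \<alpha> = G"
  by (simp_all add: hom2_def)

lemma cell_PR: "\<alpha> \<in> cells F G \<Longrightarrow> PR F" "\<alpha> \<in> cells F G \<Longrightarrow> PR G"
  by (auto simp: hom2_def prof_bicat_def PR_def)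

lemma cell_Src: "\<alpha> \<in> cells F G \<Longrightarrow> Src G = Src F"
  and cell_Trg: "\<alpha> \<in> cells F G \<Longrightarrow> Trg G = Trg F"
  by (auto simp: hom2_def prof_bicat_def prof_cell_def)

lemma cell_ext: "\<alpha> \<in> cells F G \<Longrightarrow> ext_cell \<alpha>"
  by (auto simp: hom2_def prof_bicat_def prof_cell_def ext_cell_def)

lemma cell_el: "\<alpha> \<in> cells F G \<Longrightarrow> el F d c x \<Longrightarrow> el G d c (Cpt \<alpha> d c x)"
  by (auto simp: hom2_def prof_bicat_def prof_cell_def el_def)

lemma cell_Act: "\<alpha> \<in> cells F G \<Longrightarrow> ar (Trg F) d' d u \<Longrightarrow> ar (Src F) c c' v \<Longrightarrow> el F d c x \<Longrightarrow>
    Cpt \<alpha> d' c' (Act F d' d c c' u v x) = Act G d' d c c' u v (Cpt \<alpha> d c x)"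
  by (auto simp: hom2_def prof_bicat_def prof_cell_def el_def ar_def)

lemma cell_lact:
  assumes "\<alpha> \<in> cells F G" "ar (Trg F) d' d u" "el F d c x"
  shows "Cpt \<alpha> d' c (lact F d' d c u x) = lact G d' d c u (Cpt \<alpha> d c x)"
  using cell_Act[OF assms(1,2) ar_Ide[OF PR_Src[OF cell_PR(1)[OF assms(1)]] el_Ob(2)[OF assms(3)]] assms(3)]
  by (simp add: lact_def cell_Src[OF assms(1)])

lemma cell_ract:
  assumes "\<alpha> \<in> cells F G" "ar (Src F) c c' v" "el F d c x"
  shows "Cpt \<alpha> d c' (ract F d c c' v x) = ract G d c c' v (Cpt \<alpha> d c x)"
  using cell_Act[OF assms(1) ar_Ide[OF PR_Trg[OF cell_PR(1)[OF assms(1)]] el_Ob(1)[OF assms(3)]] assms(2,3)]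
  by (simp add: ract_def cell_Trg[OF assms(1)])

text \<open>A relation with typing built in: \<open>x\<close> is an element of the source and its
  image is \<open>y\<close>. Such facts compose without side conditions, whereas rewriting with
  \<open>Cpt\<close> would ask for the typing of each intermediate element.\<close>

definition sends :: "'u::zf_universe ptrans \<Rightarrow> 'u \<Rightarrow> 'u \<Rightarrow> 'u \<Rightarrow> 'u \<Rightarrow> bool" where
  "sends \<alpha> d c x y \<longleftrightarrow> el (Dom \<alpha>) d c x \<and> Cpt \<alpha> d c x = y"

lemma sends_Cpt: "\<alpha> \<in> cells F G \<Longrightarrow> el F d c x \<Longrightarrow> sends \<alpha> d c x (Cpt \<alpha> d c x)"
  by (simp add: sends_def cell_Dom)

lemma sends_el: "\<alpha> \<in> cells F G \<Longrightarrow> sends \<alpha> d c x y \<Longrightarrow> el G d c y"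
  using cell_el[of \<alpha> F G d c x] by (simp add: sends_def cell_Dom)

lemma sends_ptr: "el F d c x \<Longrightarrow> \<phi> d c x = y \<Longrightarrow> sends (ptr F G \<phi>) d c x y"
  by (simp add: sends_def Cpt_ptr)

text \<open>It suffices to name a common value at each element, so the two sides can be evaluated
  along separate chains of \<open>sends\<close> facts.\<close>

lemma cell_eqI:
  assumes "ext_cell \<alpha>" "ext_cell \<beta>" "Dom \<alpha> = Dom \<beta>" "Cod \<alpha> = Cod \<beta>"
    and "\<And>d c x. el (Dom \<beta>) d c x \<Longrightarrow> \<exists>y. sends \<alpha> d c x y \<and> sends \<beta> d c x y"
  shows "\<alpha> = \<beta>"
proof -
  have "Cpt \<alpha> d c x = Cpt \<beta> d c x" if "el (Dom \<beta>) d c x" for d c x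
    using assms(5)[OF that] by (auto simp: sends_def)
  then have "ptr (Dom \<beta>) (Cod \<beta>) (Cpt \<alpha>) = ptr (Dom \<beta>) (Cod \<beta>) (Cpt \<beta>)"
    by (simp add: ptr_def el_def fun_eq_iff)
  then show ?thesis
    using assms(1-4) unfolding ext_cell_def by metis
qed

lemma vcomp_PROF [simp]: "Dom (\<beta> \<cdot> \<alpha>) = Dom \<alpha>" "Cod (\<beta> \<cdot> \<alpha>) = Cod \<beta>"
    "ext_cell (\<beta> \<cdot> \<alpha>)"
  by (simp_all add: prof_bicat_def)

lemma hcomp_PROF [simp]: "Dom (\<beta> \<ast> \<alpha>) = comp_prof (Dom \<beta>) (Dom \<alpha>)"
    "Cod (\<beta> \<ast> \<alpha>) = comp_prof (Cod \<beta>) (Cod \<alpha>)" "ext_cell (\<beta> \<ast> \<alpha>)"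
  by (simp_all add: prof_bicat_def)

lemma bid_PROF [simp]: "Dom (bid PROF F) = F" "Cod (bid PROF F) = F" "ext_cell (bid PROF F)"
  by (simp_all add: prof_bicat_def)

lemma whisker_PROF [simp]: "Dom (G \<triangleleft> \<alpha>) = comp_prof G (Dom \<alpha>)"
    "Cod (G \<triangleleft> \<alpha>) = comp_prof G (Cod \<alpha>)" "ext_cell (G \<triangleleft> \<alpha>)"
    "Dom (\<alpha> \<triangleright> F) = comp_prof (Dom \<alpha>) F"
    "Cod (\<alpha> \<triangleright> F) = comp_prof (Cod \<alpha>) F" "ext_cell (\<alpha> \<triangleright> F)"
  by (simp_all add: lwhisker_def rwhisker_def)

lemma assoc_PROF [simp]:
  "Dom (\<aa> H G F) = comp_prof (comp_prof H G) F" "Cod (\<aa> H G F) = comp_prof H (comp_prof G F)"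
  "Dom (\<aa>' H G F) = comp_prof H (comp_prof G F)" "Cod (\<aa>' H G F) = comp_prof (comp_prof H G) F"
  "ext_cell (\<aa> H G F)" "ext_cell (\<aa>' H G F)"
  by (simp_all add: prof_bicat_def)

lemma unit_PROF [simp]:
  "Dom (\<ll> F) = comp_prof (hom_prof (Trg F)) F" "Cod (\<ll> F) = F"
  "Dom (\<ll>' F) = F" "Cod (\<ll>' F) = comp_prof (hom_prof (Trg F)) F"
  "Dom (\<rr> F) = comp_prof F (hom_prof (Src F))" "Cod (\<rr> F) = F"
  "Dom (\<rr>' F) = F" "Cod (\<rr>' F) = comp_prof F (hom_prof (Src F))"
  "ext_cell (\<ll> F)" "ext_cell (\<ll>' F)" "ext_cell (\<rr> F)" "ext_cell (\<rr>' F)"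
  by (simp_all add: prof_bicat_def)

lemma sends_vcomp: "sends \<alpha> d c x y \<Longrightarrow> sends \<beta> d c y z \<Longrightarrow> sends (\<beta> \<cdot> \<alpha>) d c x z"
  by (simp add: sends_def vcomp_PROF_eq Cpt_ptr)

lemma sends_bid: "el F d c x \<Longrightarrow> sends (bid PROF F) d c x x"
  unfolding prof_bicat_def by (simp add: sends_ptr)

lemma vcomp_cell:
  assumes "\<alpha> \<in> cells F G" "\<beta> \<in> cells G H"
  shows "\<beta> \<cdot> \<alpha> \<in> cells F H"
proof -
  have "\<beta> \<cdot> \<alpha> = ptr F H (\<lambda>d c x. Cpt \<beta> d c (Cpt \<alpha> d c x))"
    by (simp add: vcomp_PROF_eq cell_Dom[OF assms(1)] cell_Cod[OF assms(2)])
  also have "\<dots> \<in> cells F H"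
  proof (rule cellI)
    show "Cpt \<beta> d' c' (Cpt \<alpha> d' c' (Act F d' d c c' u v x)) = Act H d' d c c' u v (Cpt \<beta> d c (Cpt \<alpha> d c x))"
      if "ar (Trg F) d' d u" "ar (Src F) c c' v" "el F d c x" for d d' c c' u v x
      using cell_Act[OF assms(1) that] cell_Act[OF assms(2) _ _ cell_el[OF assms(1) that(3)]] that
      by (simp add: cell_Src[OF assms(1)] cell_Trg[OF assms(1)])
  qed (use cell_PR[OF assms(1)] cell_PR[OF assms(2)] cell_Src[OF assms(1)] cell_Trg[OF assms(1)]
      cell_Src[OF assms(2)] cell_Trg[OF assms(2)] cell_el[OF assms(1)] cell_el[OF assms(2)] in simp_all)
  finally show ?thesis .
qed

lemma bid_cell: "PR F \<Longrightarrow> bid PROF F \<in> cells F F"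
  using cellI[of F F "\<lambda>d c x. x"] by (simp add: prof_bicat_def)

text \<open>The main source of cells out of a composite: a formula on pairs that is invariant under
  gliding, lands in \<open>K\<close> and commutes with the outer actions. The second conclusion
  evaluates the cell at an arbitrary class, after which \<open>comp1\<close>, \<open>comp2\<close>
  and \<open>comp3\<close> disappear from the argument.\<close>

lemma coend_cell:
  fixes G F K :: "'u::zf_universe prof"
  assumes G: "PR G" and F: "PR F" and GF: "Src G = Trg F" and K: "PR K" "Src K = Src F" "Trg K = Trg G"
    and inv: "\<And>e c d d' v x y. ar (Trg F) d d' v \<Longrightarrow> el G e d x \<Longrightarrow> el F d' c y \<Longrightarrow>
      \<phi> e c d' (ract G e d d' v x) y = \<phi> e c d x (lact F d d' c v y)"
    and closed: "\<And>e c d x y. el G e d x \<Longrightarrow> el F d c y \<Longrightarrow> el K e c (\<phi> e c d x y)"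
    and nat: "\<And>e e' c c' d u v x y. ar (Trg G) e' e u \<Longrightarrow> ar (Src F) c c' v \<Longrightarrow> el G e d x \<Longrightarrow> el F d c y \<Longrightarrow>
      \<phi> e' c' d (lact G e' e d u x) (ract F d c c' v y) = Act K e' e c c' u v (\<phi> e c d x y)"
    and \<alpha>: "\<alpha> = ptr (comp_prof G F) K (\<lambda>e c p. \<phi> e c (comp1 p) (comp2 p) (comp3 p))"
  shows "\<alpha> \<in> cells (comp_prof G F) K"
    and "el G e d x \<Longrightarrow> el F d c y \<Longrightarrow> sends \<alpha> e c (coend_in G F e c d x y) (\<phi> e c d x y)"
proof -
  note PG = PR_profunctor[OF G] and PF = PR_profunctor[OF F]
  have eval: "\<phi> e c (comp1 p) (comp2 p) (comp3 p) = \<phi> e c d x y"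
    if "el G e d x" "el F d c y" "p = coend_in G F e c d x y" for e c d x y p
    by (rule coend_rec_PR(1)[OF G F GF that(1,2) inv that(3)])
  show "\<alpha> \<in> cells (comp_prof G F) K"
    unfolding \<alpha>
  proof (rule cellI)
    fix e c p assume "el (comp_prof G F) e c p"
    then obtain d x y where p: "p = coend_in G F e c d x y" and x: "el G e d x" and y: "el F d c y"
      by (rule el_compE[OF G F GF])
    show "el K e c (\<phi> e c (comp1 p) (comp2 p) (comp3 p))"
      by (simp only: eval[OF x y p] closed[OF x y])
    fix e' c' u v assume "ar (Trg (comp_prof G F)) e' e u" "ar (Src (comp_prof G F)) c c' v"
    then have uv: "ar (Trg G) e' e u" "ar (Src F) c c' v" by simp_all
    let ?q = "Act (comp_prof G F) e' e c c' u v p"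
    have q: "?q = coend_in G F e' c' d (lact G e' e d u x) (ract F d c c' v y)"
      unfolding p by (rule Act_comp[OF G F GF x y uv])
    show "\<phi> e' c' (comp1 ?q) (comp2 ?q) (comp3 ?q) = Act K e' e c c' u v (\<phi> e c (comp1 p) (comp2 p) (comp3 p))"
      unfolding eval[OF x y p] eval[OF el_lact[OF PG uv(1) x] el_ract[OF PF uv(2) y] q] by (rule nat[OF uv x y])
  qed (use PR_comp[OF G F GF] K in simp_all)
  show "sends \<alpha> e c (coend_in G F e c d x y) (\<phi> e c d x y)" if "el G e d x" "el F d c y"
    unfolding \<alpha> by (rule sends_ptr, rule el_comp[OF G F GF that], rule eval[OF that refl])
qed

section \<open>The bicategory of profunctors\<close>

text \<open>A component of \<beta> commutes with the right action and one of \<alpha> with the left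
  action, so an arrow gliding in the source glides in the target as well.\<close>

lemma
  assumes \<beta>: "\<beta> \<in> cells G G'" and \<alpha>: "\<alpha> \<in> cells F F'" and GF: "Src G = Trg F"
  shows hcomp_cell: "\<beta> \<ast> \<alpha> \<in> cells (comp_prof G F) (comp_prof G' F')"
    and sends_hcomp_Cpt: "el G e d x \<Longrightarrow> el F d c y \<Longrightarrow>
      sends (\<beta> \<ast> \<alpha>) e c (coend_in G F e c d x y) (coend_in G' F' e c d (Cpt \<beta> e d x) (Cpt \<alpha> d c y))"
proof -
  let ?\<phi> = "\<lambda>e c d x y. coend_in G' F' e c d (Cpt \<beta> e d x) (Cpt \<alpha> d c y)"
  have eq: "\<beta> \<ast> \<alpha> = ptr (comp_prof G F) (comp_prof G' F') (\<lambda>e c p. ?\<phi> e c (comp1 p) (comp2 p) (comp3 p))"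
    by (simp add: hcomp_PROF_eq cell_Dom[OF \<alpha>] cell_Dom[OF \<beta>] cell_Cod[OF \<alpha>] cell_Cod[OF \<beta>])
  have GF': "Src G' = Trg F'"
    using GF cell_Src[OF \<beta>] cell_Trg[OF \<alpha>] by simp
  note PR = cell_PR[OF \<beta>] cell_PR[OF \<alpha>]
  have 1: "?\<phi> e c d' (ract G e d d' v x) y = ?\<phi> e c d x (lact F d d' c v y)"
    if "ar (Trg F) d d' v" "el G e d x" "el F d' c y" for e c d d' v x y
    using that cell_Trg[OF \<alpha>]
    by (simp add: cell_ract[OF \<beta>] cell_lact[OF \<alpha>] GF coend_glide cell_el[OF \<alpha>] cell_el[OF \<beta>])
  have 2: "el (comp_prof G' F') e c (?\<phi> e c d x y)" if "el G e d x" "el F d c y" for e c d x y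
    by (intro el_comp PR GF' cell_el[OF \<alpha>] cell_el[OF \<beta>] that)
  have 3: "?\<phi> e' c' d (lact G e' e d u x) (ract F d c c' v y) = Act (comp_prof G' F') e' e c c' u v (?\<phi> e c d x y)"
    if "ar (Trg G) e' e u" "ar (Src F) c c' v" "el G e d x" "el F d c y" for e e' c c' d u v x y
    using that by (simp add: cell_ract[OF \<alpha>] cell_lact[OF \<beta>] Act_comp[OF PR(2,4) GF'] cell_Src[OF \<alpha>]
        cell_Trg[OF \<beta>] cell_el[OF \<alpha>] cell_el[OF \<beta>])
  note * = coend_cell[where \<phi> = ?\<phi>, OF PR(1,3) GF PR_comp[OF PR(2,4) GF'] _ _ 1 2 3 eq]
  show "\<beta> \<ast> \<alpha> \<in> cells (comp_prof G F) (comp_prof G' F')"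
    by (rule *(1)) (simp_all add: cell_Src[OF \<alpha>] cell_Trg[OF \<beta>])
  show "sends (\<beta> \<ast> \<alpha>) e c (coend_in G F e c d x y) (?\<phi> e c d x y)" if "el G e d x" "el F d c y"
    by (rule *(2)) (simp_all add: cell_Src[OF \<alpha>] cell_Trg[OF \<beta>] that)
qed

lemma sends_hcomp:
  assumes "\<beta> \<in> cells G G'" "\<alpha> \<in> cells F F'" "Src G = Trg F"
    and "sends \<beta> e d x x'" "sends \<alpha> d c y y'"
  shows "sends (\<beta> \<ast> \<alpha>) e c (coend_in G F e c d x y) (coend_in G' F' e c d x' y')"
  using sends_hcomp_Cpt[OF assms(1-3), of e d x c y] assms by (auto simp: sends_def cell_Dom)

lemma lwhisker_cell: "PR G \<Longrightarrow> \<alpha> \<in> cells F F' \<Longrightarrow> Src G = Trg F \<Longrightarrow>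
    G \<triangleleft> \<alpha> \<in> cells (comp_prof G F) (comp_prof G F')"
  unfolding lwhisker_def by (intro hcomp_cell bid_cell)

lemma sends_lwhisker:
  assumes "\<alpha> \<in> cells F F'" "PR G" "Src G = Trg F" "el G e d x" "sends \<alpha> d c y y'"
  shows "sends (G \<triangleleft> \<alpha>) e c (coend_in G F e c d x y) (coend_in G F' e c d x y')"
  unfolding lwhisker_def by (rule sends_hcomp[OF bid_cell[OF assms(2)] assms(1,3) sends_bid[OF assms(4)] assms(5)])

lemma sends_rwhisker:
  assumes "\<beta> \<in> cells G G'" "PR F" "Src G = Trg F" "el F d c y" "sends \<beta> e d x x'"
  shows "sends (\<beta> \<triangleright> F) e c (coend_in G F e c d x y) (coend_in G' F e c d x' y)"
  unfolding rwhisker_def by (rule sends_hcomp[OF assms(1) bid_cell[OF assms(2)] assms(3,5) sends_bid[OF assms(4)]])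

section \<open>The associator and its inverse on classes\<close>

context
  fixes H G F :: "'u::zf_universe prof"
  assumes H: "PR H" and G: "PR G" and F: "PR F" and HG: "Src H = Trg G" and GF: "Src G = Trg F"
begin

private lemma HG_F: "Src (comp_prof H G) = Trg F" and H_GF: "Src H = Trg (comp_prof G F)"
  by (simp_all add: GF HG)

private lemmas PH = PR_profunctor[OF H] and PG = PR_profunctor[OF G] and PF = PR_profunctor[OF F]
private lemmas PHG = PR_comp[OF H G HG] and PGF = PR_comp[OF G F GF]

text \<open>The associator decodes an outer and an inner class; here the inner one is varied alone.
  An arrow gliding between \<open>H\<close> and \<open>G\<close> also glides between
  \<open>H\<close> and the composite of \<open>G\<close> and \<open>F\<close>, because it acts on an
  inner pair through its first factor.\<close>

private lemma assoc_inner: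
  assumes "el H e d' h" "el G d' d g" "el F d a f" "p = coend_in H G e d d' h g"
  shows "coend_in H (comp_prof G F) e a (comp1 p) (comp2 p) (coend_in G F (comp1 p) a d (comp3 p) f)
    = coend_in H (comp_prof G F) e a d' h (coend_in G F d' a d g f)"
  using assms(3)
  by (intro coend_rec_PR(1)[where \<phi> = "\<lambda>d' h g. coend_in H (comp_prof G F) e a d' h (coend_in G F d' a d g f)",
        OF H G HG assms(1,2) _ assms(4)])
    (simp add: coend_glide el_comp[OF G F GF] lact_comp[OF G F GF, symmetric])

private lemma assoc_inv_inner:
  assumes "el H e d h" "el G d d' g" "el F d' a f" "p = coend_in G F d a d' g f"
  shows "coend_in (comp_prof H G) F e a (comp1 p) (coend_in H G e (comp1 p) d h (comp2 p)) (comp3 p)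
    = coend_in (comp_prof H G) F e a d' (coend_in H G e d' d h g) f"
  using assms(1)
  by (intro coend_rec_PR(1)[where \<phi> = "\<lambda>d' g f. coend_in (comp_prof H G) F e a d' (coend_in H G e d' d h g) f",
        OF G F GF assms(2,3) _ assms(4)])
    (simp add: coend_glide[symmetric] el_comp[OF H G HG] ract_comp[OF H G HG, symmetric] GF)

lemma assoc_cell: "\<aa> H G F \<in> cells (comp_prof (comp_prof H G) F) (comp_prof H (comp_prof G F))" (is ?C)
  and sends_assoc: "el H e d' h \<Longrightarrow> el G d' d g \<Longrightarrow> el F d a f \<Longrightarrow>
    sends (\<aa> H G F) e a (coend_in (comp_prof H G) F e a d (coend_in H G e d d' h g) f)
      (coend_in H (comp_prof G F) e a d' h (coend_in G F d' a d g f))" (is "_ \<Longrightarrow> _ \<Longrightarrow> _ \<Longrightarrow> ?S")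
proof -
  let ?\<phi> = "\<lambda>e a d p f. coend_in H (comp_prof G F) e a (comp1 p) (comp2 p) (coend_in G F (comp1 p) a d (comp3 p) f)"
  have eq: "\<aa> H G F = ptr (comp_prof (comp_prof H G) F) (comp_prof H (comp_prof G F))
      (\<lambda>e c p. ?\<phi> e c (comp1 p) (comp2 p) (comp3 p))"
    by (simp add: prof_bicat_def)
  have 1: "?\<phi> e c d' (ract (comp_prof H G) e d d' v x) y = ?\<phi> e c d x (lact F d d' c v y)"
    if v: "ar (Trg F) d d' v" and x: "el (comp_prof H G) e d x" and y: "el F d' c y" for e c d d' v x y
  proof -
    obtain b h g where x: "x = coend_in H G e d b h g" and h: "el H e b h" and g: "el G b d g"
      by (rule el_compE[OF H G HG x])
    have v': "ar (Src G) d d' v" using v GF by simp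
    note * = assoc_inner[OF h g el_lact[OF PF v y] x]
      assoc_inner[OF h el_ract[OF PG v' g] y ract_comp[OF H G HG h g v', folded x]]
    show ?thesis
      unfolding * coend_glide[OF v g y] ..
  qed
  have 2: "el (comp_prof H (comp_prof G F)) e c (?\<phi> e c d x y)"
    if x: "el (comp_prof H G) e d x" and y: "el F d c y" for e c d x y
  proof -
    obtain b h g where x: "x = coend_in H G e d b h g" and h: "el H e b h" and g: "el G b d g"
      by (rule el_compE[OF H G HG x])
    show ?thesis
      unfolding assoc_inner[OF h g y x] by (intro el_comp H PGF H_GF G F GF h g y)
  qed
  have 3: "?\<phi> e' c' d (lact (comp_prof H G) e' e d u x) (ract F d c c' v y)
      = Act (comp_prof H (comp_prof G F)) e' e c c' u v (?\<phi> e c d x y)"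
    if u: "ar (Trg (comp_prof H G)) e' e u" and v: "ar (Src F) c c' v"
      and x: "el (comp_prof H G) e d x" and y: "el F d c y" for e e' c c' d u v x y
  proof -
    obtain b h g where x: "x = coend_in H G e d b h g" and h: "el H e b h" and g: "el G b d g"
      by (rule el_compE[OF H G HG x])
    have u: "ar (Trg H) e' e u" using u by simp
    have v': "ar (Src (comp_prof G F)) c c' v" using v by simp
    note * = assoc_inner[OF h g y x]
      assoc_inner[OF el_lact[OF PH u h] g el_ract[OF PF v y] lact_comp[OF H G HG h g u, folded x]]
    show ?thesis
      unfolding * Act_comp[OF H PGF H_GF h el_comp[OF G F GF g y] u v'] ract_comp[OF G F GF g y v] ..
  qed
  note * = coend_cell[where \<phi> = ?\<phi>, OF PHG F HG_F PR_comp[OF H PGF H_GF] _ _ 1 2 3 eq]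
  show ?C by (rule *(1)) simp_all
  show ?S if h: "el H e d' h" and g: "el G d' d g" and f: "el F d a f"
    by (subst assoc_inner[OF that refl, symmetric]) (rule *(2), simp_all add: f el_comp[OF H G HG h g])
qed

lemma assoc_inv_cell: "\<aa>' H G F \<in> cells (comp_prof H (comp_prof G F)) (comp_prof (comp_prof H G) F)" (is ?C)
  and sends_assoc_inv: "el H e d h \<Longrightarrow> el G d d' g \<Longrightarrow> el F d' a f \<Longrightarrow>
    sends (\<aa>' H G F) e a (coend_in H (comp_prof G F) e a d h (coend_in G F d a d' g f))
      (coend_in (comp_prof H G) F e a d' (coend_in H G e d' d h g) f)" (is "_ \<Longrightarrow> _ \<Longrightarrow> _ \<Longrightarrow> ?S")
proof -
  let ?\<phi> = "\<lambda>e a d h p. coend_in (comp_prof H G) F e a (comp1 p) (coend_in H G e (comp1 p) d h (comp2 p)) (comp3 p)"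
  have eq: "\<aa>' H G F = ptr (comp_prof H (comp_prof G F)) (comp_prof (comp_prof H G) F)
      (\<lambda>e c p. ?\<phi> e c (comp1 p) (comp2 p) (comp3 p))"
    by (simp add: prof_bicat_def)
  have 1: "?\<phi> e c d' (ract H e d d' v x) y = ?\<phi> e c d x (lact (comp_prof G F) d d' c v y)"
    if v: "ar (Trg (comp_prof G F)) d d' v" and x: "el H e d x" and y: "el (comp_prof G F) d' c y" for e c d d' v x y
  proof -
    obtain b g f where y: "y = coend_in G F d' c b g f" and g: "el G d' b g" and f: "el F b c f"
      by (rule el_compE[OF G F GF y])
    have v: "ar (Trg G) d d' v" using v by simp
    have v': "ar (Src H) d d' v" using v HG by simp
    note * = assoc_inv_inner[OF el_ract[OF PH v' x] g f y]
      assoc_inv_inner[OF x el_lact[OF PG v g] f lact_comp[OF G F GF g f v, folded y]]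
    show ?thesis
      unfolding * coend_glide[OF v x g] ..
  qed
  have 2: "el (comp_prof (comp_prof H G) F) e c (?\<phi> e c d x y)"
    if x: "el H e d x" and y: "el (comp_prof G F) d c y" for e c d x y
  proof -
    obtain b g f where y: "y = coend_in G F d c b g f" and g: "el G d b g" and f: "el F b c f"
      by (rule el_compE[OF G F GF y])
    show ?thesis
      unfolding assoc_inv_inner[OF x g f y] by (intro el_comp F PHG HG_F H G HG x g f)
  qed
  have 3: "?\<phi> e' c' d (lact H e' e d u x) (ract (comp_prof G F) d c c' v y)
      = Act (comp_prof (comp_prof H G) F) e' e c c' u v (?\<phi> e c d x y)"
    if u: "ar (Trg H) e' e u" and v: "ar (Src (comp_prof G F)) c c' v"
      and x: "el H e d x" and y: "el (comp_prof G F) d c y" for e e' c c' d u v x y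
  proof -
    obtain b g f where y: "y = coend_in G F d c b g f" and g: "el G d b g" and f: "el F b c f"
      by (rule el_compE[OF G F GF y])
    have v: "ar (Src F) c c' v" using v by simp
    have u': "ar (Trg (comp_prof H G)) e' e u" using u by simp
    note * = assoc_inv_inner[OF x g f y]
      assoc_inv_inner[OF el_lact[OF PH u x] g el_ract[OF PF v f] ract_comp[OF G F GF g f v, folded y]]
    show ?thesis
      unfolding * Act_comp[OF PHG F HG_F el_comp[OF H G HG x g] f u' v] lact_comp[OF H G HG x g u] ..
  qed
  note * = coend_cell[where \<phi> = ?\<phi>, OF H PGF H_GF PR_comp[OF PHG F HG_F] _ _ 1 2 3 eq]
  show ?C by (rule *(1)) simp_all
  show ?S if h: "el H e d h" and g: "el G d d' g" and f: "el F d' a f"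
    by (subst assoc_inv_inner[OF that refl, symmetric]) (rule *(2), simp_all add: h el_comp[OF G F GF g f])
qed

end

section \<open>Hom profunctors as identity 1-cells, and the unitors\<close>

lemma small_generated_hom_prof: "category C \<Longrightarrow> profunctor (hom_prof C) \<Longrightarrow> small_generated (hom_prof C)"
proof (rule small_generatedI)
  fix c assume C: "category C" and "c \<in> Ob (Src (hom_prof C))"
  then have c: "c \<in> Ob C" by simp
  \<comment> \<open>By Yoneda the identity of \<open>c\<close> generates \<open>C(-, c)\<close>,
    which explains the index set \<open>one\<close>.\<close>
  have "ar C e c u \<Longrightarrow> u = lact (hom_prof C) e c c u (Ide C c)" for e u
    using C by (simp add: lact_def hom_prof_def Cmp_Ide_l)
  then show "\<exists>(I::'a) d x. (\<forall>i\<in>elts I. el (hom_prof C) (d i) c (x i)) \<and> (\<forall>e y. el (hom_prof C) e c y \<longrightarrow>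
    (\<exists>i\<in>elts I. \<exists>u. ar (Trg (hom_prof C)) e (d i) u \<and> y = lact (hom_prof C) e (d i) c u (x i)))"
    using ar_Ide[OF C c]
    by (intro exI[of _ one] exI[of _ "\<lambda>_. c"] exI[of _ "\<lambda>_. Ide C c"]) auto
qed

lemma PR_hom_prof: "category C \<Longrightarrow> PR (hom_prof C)"
proof -
  assume C: "category C"
  have "profunctor (hom_prof C)"
  proof (intro profunctor.intro profunctor_axioms.intro)
    fix d d' c c' u v x
    assume "d \<in> Ob (Trg (hom_prof C))" "d' \<in> Ob (Trg (hom_prof C))" "c \<in> Ob (Src (hom_prof C))"
      "c' \<in> Ob (Src (hom_prof C))" "u \<in> elts (Hom (Trg (hom_prof C)) d' d)"
      "v \<in> elts (Hom (Src (hom_prof C)) c c')" "x \<in> elts (El (hom_prof C) d c)"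
    then show "Act (hom_prof C) d' d c c' u v x \<in> elts (El (hom_prof C) d' c')"
      by (auto simp: hom_prof_def intro: category.Cmp_closed[OF C])
  next
    fix d d' d'' c c' c'' u u' v v' x
    assume "d \<in> Ob (Trg (hom_prof C))" "d' \<in> Ob (Trg (hom_prof C))" "d'' \<in> Ob (Trg (hom_prof C))"
     "c \<in> Ob (Src (hom_prof C))" "c' \<in> Ob (Src (hom_prof C))" "c'' \<in> Ob (Src (hom_prof C))"
     "u \<in> elts (Hom (Trg (hom_prof C)) d' d)" "u' \<in> elts (Hom (Trg (hom_prof C)) d'' d')"
     "v \<in> elts (Hom (Src (hom_prof C)) c c')" "v' \<in> elts (Hom (Src (hom_prof C)) c' c'')"
     "x \<in> elts (El (hom_prof C) d c)"
    then have *: "ar C d' d u" "ar C d'' d' u'" "ar C c c' v" "ar C c' c'' v'" "ar C d c x"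
      by (auto simp: ar_def hom_prof_def)
    note x1 = ar_Cmp[OF C *(1,5)] ar_Cmp[OF C *(2,1)] ar_Cmp[OF C *(3,4)]
    note x2 = ar_Cmp[OF C *(2) x1(1)]
    have "Cmp C d'' c c'' (Cmp C c c' c'' v' v) (Cmp C d'' d c x (Cmp C d'' d' d u u'))
      = Cmp C d'' c c'' (Cmp C c c' c'' v' v) (Cmp C d'' d' c (Cmp C d' d c x u) u')"
      by (simp only: Cmp_Cmp[OF C *(2,1,5)])
    also have "\<dots> = Cmp C d'' c' c'' v' (Cmp C d'' c c' v (Cmp C d'' d' c (Cmp C d' d c x u) u'))"
      by (rule Cmp_Cmp[OF C x2 *(3,4)])
    also have "\<dots> = Cmp C d'' c' c'' v' (Cmp C d'' d' c' (Cmp C d' c c' v (Cmp C d' d c x u)) u')"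
      by (simp only: Cmp_Cmp[OF C *(2) x1(1) *(3)])
    finally show "Act (hom_prof C) d'' d c c'' (Cmp (Trg (hom_prof C)) d'' d' d u u') (Cmp (Src (hom_prof C)) c c' c'' v' v) x
      = Act (hom_prof C) d'' d' c' c'' u' v' (Act (hom_prof C) d' d c c' u v x)"
      by (simp add: hom_prof_def)
  qed (use C in \<open>auto simp: hom_prof_def category.Cmp_Ide_left category.Cmp_Ide_right\<close>)
  with C show "PR (hom_prof C)"
    by (simp add: PR_def small_generated_hom_prof)
qed

lemma lact_hom_prof: "category C \<Longrightarrow> ar C e d u \<Longrightarrow> ar C d c x \<Longrightarrow> lact (hom_prof C) e d c u x = Cmp C e d c x u"
  by (simp add: lact_def) (simp add: hom_prof_def Cmp_Ide_l ar_Cmp)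

lemma ract_hom_prof: "category C \<Longrightarrow> ar C c c' v \<Longrightarrow> ar C d c x \<Longrightarrow> ract (hom_prof C) d c c' v x = Cmp C d c c' v x"
  by (simp add: ract_def) (simp add: hom_prof_def Cmp_Ide_r)

context
  fixes F :: "'u::zf_universe prof"
  assumes F: "PR F"
begin

private lemmas PFF = PR_profunctor[OF F] and S = PR_Src[OF F] and T = PR_Trg[OF F]
private lemmas ST = PR_hom_prof[OF S] PR_hom_prof[OF T]

lemma lunit_cell: "\<ll> F \<in> cells (comp_prof (hom_prof (Trg F)) F) F"
  and sends_lunit: "ar (Trg F) e d u \<Longrightarrow> el F d c y \<Longrightarrow>
    sends (\<ll> F) e c (coend_in (hom_prof (Trg F)) F e c d u y) (lact F e d c u y)"
proof -
  have eq: "\<ll> F = ptr (comp_prof (hom_prof (Trg F)) F) F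
      (\<lambda>e c p. (\<lambda>e c d. lact F e d c) e c (comp1 p) (comp2 p) (comp3 p))"
    by (simp add: prof_bicat_def)
  note * = coend_cell[where \<phi> = "\<lambda>e c d. lact F e d c", OF ST(2) F _ F _ _ _ _ _ eq]
  note nat = lact_lact[OF PFF] ract_hom_prof[OF T]
  have nat': "lact F e' d c' (lact (hom_prof (Trg F)) e' e d u x) (ract F d c c' v y) = Act F e' e c c' u v (lact F e d c x y)"
    if "ar (Trg F) e' e u" "ar (Src F) c c' v" "ar (Trg F) e d x" "el F d c y" for e e' c c' d u v x y
    using that lact_ract[OF PFF ar_Cmp[OF T that(1,3)] that(2,4)] ract_lact[OF PFF ar_Cmp[OF T that(1,3)] that(2,4)]
    by (simp add: ract_lact[OF PFF, symmetric] lact_lact[OF PFF] lact_hom_prof[OF T] el_lact[OF PFF])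
  show "\<ll> F \<in> cells (comp_prof (hom_prof (Trg F)) F) F"
    by (rule *(1)) (simp_all add: nat' nat el_lact[OF PFF])
  show "sends (\<ll> F) e c (coend_in (hom_prof (Trg F)) F e c d u y) (lact F e d c u y)"
    if "ar (Trg F) e d u" "el F d c y"
    by (rule *(2)) (simp_all add: nat nat' el_lact[OF PFF] that)
qed

lemma runit_cell: "\<rr> F \<in> cells (comp_prof F (hom_prof (Src F))) F"
  and sends_runit: "el F d b x \<Longrightarrow> ar (Src F) b c v \<Longrightarrow>
    sends (\<rr> F) d c (coend_in F (hom_prof (Src F)) d c b x v) (ract F d b c v x)"
proof -
  have eq: "\<rr> F = ptr (comp_prof F (hom_prof (Src F))) F
      (\<lambda>e c p. (\<lambda>e c b x v. ract F e b c v x) e c (comp1 p) (comp2 p) (comp3 p))"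
    by (simp add: prof_bicat_def)
  note * = coend_cell[where \<phi> = "\<lambda>e c b x v. ract F e b c v x", OF F ST(1) _ F _ _ _ _ _ eq]
  have nat': "ract F e' d c' (ract (hom_prof (Src F)) d c c' v y) (lact F e' e d u x) = Act F e' e c c' u v (ract F e d c y x)"
    if "ar (Trg F) e' e u" "ar (Src F) c c' v" "el F e d x" "ar (Src F) d c y" for e e' c c' d u v x y
    using that lact_ract[OF PFF that(1) ar_Cmp[OF S that(4,2)] that(3)] ract_lact[OF PFF that(1) ar_Cmp[OF S that(4,2)] that(3)]
    by (simp add: lact_ract[OF PFF, symmetric] ract_ract[OF PFF] ract_hom_prof[OF S] el_ract[OF PFF])
  note nat = ract_ract[OF PFF] lact_hom_prof[OF S]
  show "\<rr> F \<in> cells (comp_prof F (hom_prof (Src F))) F"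
    by (rule *(1)) (simp_all add: nat' nat el_ract[OF PFF])
  show "sends (\<rr> F) d c (coend_in F (hom_prof (Src F)) d c b x v) (ract F d b c v x)"
    if "el F d b x" "ar (Src F) b c v"
    by (rule *(2)) (simp_all add: nat nat' el_ract[OF PFF] that)
qed

lemma lunit_inv_cell: "\<ll>' F \<in> cells F (comp_prof (hom_prof (Trg F)) F)"
  and sends_lunit_inv: "el F d c x \<Longrightarrow>
    sends (\<ll>' F) d c x (coend_in (hom_prof (Trg F)) F d c d (Ide (Trg F) d) x)"
proof -
  let ?\<phi> = "\<lambda>d c x. coend_in (hom_prof (Trg F)) F d c d (Ide (Trg F) d) x"
  have eq: "\<ll>' F = ptr F (comp_prof (hom_prof (Trg F)) F) ?\<phi>"
    by (simp add: prof_bicat_def)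
  have nat: "?\<phi> d' c' (Act F d' d c c' u v x) = Act (comp_prof (hom_prof (Trg F)) F) d' d c c' u v (?\<phi> d c x)"
    if "ar (Trg F) d' d u" "ar (Src F) c c' v" "el F d c x" for d d' c c' u v x
  proof -
    have "?\<phi> d' c' (Act F d' d c c' u v x) = ?\<phi> d' c' (lact F d' d c' u (ract F d c c' v x))"
      by (simp add: lact_ract[OF PFF that])
    \<comment> \<open>The arrow \<open>u\<close> glides from the element to the hom factor. There it
      meets an identity, and composing with the identity on the other side gives the same
      arrow.\<close>
    also have "\<dots> = coend_in (hom_prof (Trg F)) F d' c' d (ract (hom_prof (Trg F)) d' d' d u (Ide (Trg F) d')) (ract F d c c' v x)"
      using that by (simp add: coend_glide el_ract[OF PFF] ar_Ide[OF T] ar_Ob)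
    also have "ract (hom_prof (Trg F)) d' d' d u (Ide (Trg F) d') = lact (hom_prof (Trg F)) d' d d u (Ide (Trg F) d)"
      using that by (simp add: ract_hom_prof[OF T] lact_hom_prof[OF T] ar_Ide[OF T] ar_Ob Cmp_Ide_l[OF T] Cmp_Ide_r[OF T])
    finally show ?thesis
      using that by (simp add: Act_comp[OF ST(2) F] ar_Ide[OF T] ar_Ob)
  qed
  show "\<ll>' F \<in> cells F (comp_prof (hom_prof (Trg F)) F)"
    unfolding eq by (rule cellI) (simp_all add: F PR_comp[OF ST(2) F] el_comp[OF ST(2) F] nat ar_Ide[OF T] el_Ob)
  show "sends (\<ll>' F) d c x (coend_in (hom_prof (Trg F)) F d c d (Ide (Trg F) d) x)" if "el F d c x"
    unfolding eq by (rule sends_ptr[OF that refl])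
qed

lemma runit_inv_cell: "\<rr>' F \<in> cells F (comp_prof F (hom_prof (Src F)))"
  and sends_runit_inv: "el F d c x \<Longrightarrow>
    sends (\<rr>' F) d c x (coend_in F (hom_prof (Src F)) d c c x (Ide (Src F) c))"
proof -
  let ?\<phi> = "\<lambda>d c x. coend_in F (hom_prof (Src F)) d c c x (Ide (Src F) c)"
  have eq: "\<rr>' F = ptr F (comp_prof F (hom_prof (Src F))) ?\<phi>"
    by (simp add: prof_bicat_def)
  have nat: "?\<phi> d' c' (Act F d' d c c' u v x) = Act (comp_prof F (hom_prof (Src F))) d' d c c' u v (?\<phi> d c x)"
    if "ar (Trg F) d' d u" "ar (Src F) c c' v" "el F d c x" for d d' c c' u v x
  proof -
    have "?\<phi> d' c' (Act F d' d c c' u v x) = ?\<phi> d' c' (ract F d' c c' v (lact F d' d c u x))"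
      by (simp add: ract_lact[OF PFF that])
    also have "\<dots> = coend_in F (hom_prof (Src F)) d' c' c (lact F d' d c u x) (lact (hom_prof (Src F)) c c' c' v (Ide (Src F) c'))"
      using that by (simp add: coend_glide el_lact[OF PFF] ar_Ide[OF S] ar_Ob)
    also have "lact (hom_prof (Src F)) c c' c' v (Ide (Src F) c') = ract (hom_prof (Src F)) c c c' v (Ide (Src F) c)"
      using that by (simp add: ract_hom_prof[OF S] lact_hom_prof[OF S] ar_Ide[OF S] ar_Ob Cmp_Ide_l[OF S] Cmp_Ide_r[OF S])
    finally show ?thesis
      using that by (simp add: Act_comp[OF F ST(1)] ar_Ide[OF S] ar_Ob)
  qed
  show "\<rr>' F \<in> cells F (comp_prof F (hom_prof (Src F)))"
    unfolding eq by (rule cellI) (simp_all add: F PR_comp[OF F ST(1)] el_comp[OF F ST(1)] nat ar_Ide[OF S] el_Ob)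
  show "sends (\<rr>' F) d c x (coend_in F (hom_prof (Src F)) d c c x (Ide (Src F) c))" if "el F d c x"
    unfolding eq by (rule sends_ptr[OF that refl])
qed

end

section \<open>The dual on 2-cells and its bicategory laws\<close>

lemma co_simps [simp]:
  "BOb (co B) = BOb B" "BArr (co B) = BArr B" "BCell (co B) = BCell B"
  "bsrc (co B) = bsrc B" "btrg (co B) = btrg B" "bdom (co B) = bcod B" "bcod (co B) = bdom B"
  "bone (co B) = bone B" "bcomp (co B) = bcomp B" "bid (co B) = bid B" "bhcomp (co B) = bhcomp B"
  "\<beta> \<bullet>\<^bsub>co B\<^esub> \<alpha> = \<alpha> \<bullet>\<^bsub>B\<^esub> \<beta>"
  "bassoc (co B) = bassoc_inv B" "bassoc_inv (co B) = bassoc B"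
  "blunit (co B) = blunit_inv B" "blunit_inv (co B) = blunit B"
  "brunit (co B) = brunit_inv B" "brunit_inv (co B) = brunit B"
  by (simp_all add: co_def)

lemma hom1_co [simp]: "hom1\<^bsub>co B\<^esub> = hom1\<^bsub>B\<^esub>"
  by (simp add: hom1_def fun_eq_iff)

lemma hom2_co [simp]: "hom2\<^bsub>co B\<^esub> F G = hom2\<^bsub>B\<^esub> G F"
  by (auto simp: hom2_def)

lemma whisker_co [simp]: "G \<lhd>\<^bsub>co B\<^esub> \<alpha> = G \<lhd>\<^bsub>B\<^esub> \<alpha>" "\<alpha> \<rhd>\<^bsub>co B\<^esub> F = \<alpha> \<rhd>\<^bsub>B\<^esub> F"
  by (simp_all add: lwhisker_def rwhisker_def)

lemma vcomp_assoc_PROF: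
  assumes "\<alpha> \<in> cells F G" "\<beta> \<in> cells G H" "\<gamma> \<in> cells H K"
  shows "(\<gamma> \<cdot> \<beta>) \<cdot> \<alpha> = \<gamma> \<cdot> (\<beta> \<cdot> \<alpha>)"
proof (rule cell_eqI)
  fix d c x assume "el (Dom (\<gamma> \<cdot> (\<beta> \<cdot> \<alpha>))) d c x"
  then have x: "el F d c x" using cell_Dom[OF assms(1)] by simp
  note 1 = sends_Cpt[OF assms(1) x] note y = cell_el[OF assms(1) x]
  note 2 = sends_Cpt[OF assms(2) y] note z = cell_el[OF assms(2) y]
  note 3 = sends_Cpt[OF assms(3) z]
  show "\<exists>y. sends ((\<gamma> \<cdot> \<beta>) \<cdot> \<alpha>) d c x y \<and> sends (\<gamma> \<cdot> (\<beta> \<cdot> \<alpha>)) d c x y"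
    using sends_vcomp[OF 1 sends_vcomp[OF 2 3]] sends_vcomp[OF sends_vcomp[OF 1 2] 3] by blast
qed simp_all

lemma vcomp_id_left_PROF: "\<alpha> \<in> cells F G \<Longrightarrow> bid PROF G \<cdot> \<alpha> = \<alpha>"
  by (rule cell_eqI) (auto simp: cell_ext cell_Cod cell_Dom intro!: exI sends_vcomp[OF sends_Cpt sends_bid] sends_Cpt cell_el)

lemma vcomp_id_right_PROF: "\<alpha> \<in> cells F G \<Longrightarrow> \<alpha> \<cdot> bid PROF F = \<alpha>"
  by (rule cell_eqI) (auto simp: cell_ext cell_Cod cell_Dom intro!: exI sends_vcomp[OF sends_bid sends_Cpt] sends_Cpt cell_el)

lemma interchange_PROF:
  assumes GF: "Src G = Trg F" and \<alpha>: "\<alpha> \<in> cells F F'" and \<alpha>': "\<alpha>' \<in> cells F' F''"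
    and \<beta>: "\<beta> \<in> cells G G'" and \<beta>': "\<beta>' \<in> cells G' G''"
  shows "(\<beta>' \<cdot> \<beta>) \<ast> (\<alpha>' \<cdot> \<alpha>) = (\<beta>' \<ast> \<alpha>') \<cdot> (\<beta> \<ast> \<alpha>)"
proof (rule cell_eqI)
  fix d c p assume "el (Dom ((\<beta>' \<ast> \<alpha>') \<cdot> (\<beta> \<ast> \<alpha>))) d c p"
  then have "el (comp_prof G F) d c p" by (simp add: cell_Dom[OF \<alpha>] cell_Dom[OF \<beta>])
  then obtain b x y where p: "p = coend_in G F d c b x y" and x: "el G d b x" and y: "el F b c y"
    by (rule el_compE[OF cell_PR(1)[OF \<beta>] cell_PR(1)[OF \<alpha>] GF])
  have GF': "Src G' = Trg F'"
    using GF cell_Src[OF \<beta>] cell_Trg[OF \<alpha>] by simp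
  note a = sends_Cpt[OF \<alpha> y] sends_Cpt[OF \<alpha>' cell_el[OF \<alpha> y]]
  note b = sends_Cpt[OF \<beta> x] sends_Cpt[OF \<beta>' cell_el[OF \<beta> x]]
  show "\<exists>y. sends ((\<beta>' \<cdot> \<beta>) \<ast> (\<alpha>' \<cdot> \<alpha>)) d c p y
      \<and> sends ((\<beta>' \<ast> \<alpha>') \<cdot> (\<beta> \<ast> \<alpha>)) d c p y"
    unfolding p
    using sends_hcomp[OF vcomp_cell[OF \<beta> \<beta>'] vcomp_cell[OF \<alpha> \<alpha>'] GF sends_vcomp[OF b] sends_vcomp[OF a]]
      sends_vcomp[OF sends_hcomp[OF \<beta> \<alpha> GF b(1) a(1)] sends_hcomp[OF \<beta>' \<alpha>' GF' b(2) a(2)]]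
    by blast
qed simp_all

lemma hcomp_id_PROF:
  assumes "PR G" "PR F" "Src G = Trg F"
  shows "bid PROF G \<ast> bid PROF F = bid PROF (comp_prof G F)"
proof (rule cell_eqI)
  fix d c p assume "el (Dom (bid PROF (comp_prof G F))) d c p"
  then have p': "el (comp_prof G F) d c p" by simp
  then obtain b x y where p: "p = coend_in G F d c b x y" and x: "el G d b x" and y: "el F b c y"
    by (rule el_compE[OF assms])
  show "\<exists>y. sends (bid PROF G \<ast> bid PROF F) d c p y \<and> sends (bid PROF (comp_prof G F)) d c p y"
    using sends_bid[OF p'] sends_hcomp[OF bid_cell bid_cell assms(3) sends_bid[OF x] sends_bid[OF y]] assms p by blast
qed simp_all

lemma assoc_inverse:
  assumes H: "PR H" and G: "PR G" and F: "PR F" and HG: "Src H = Trg G" and GF: "Src G = Trg F"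
  shows "\<aa>' H G F \<cdot> \<aa> H G F = bid PROF (comp_prof (comp_prof H G) F)"
    and "\<aa> H G F \<cdot> \<aa>' H G F = bid PROF (comp_prof H (comp_prof G F))"
proof -
  note * = sends_assoc[OF assms] sends_assoc_inv[OF assms]
  have HG_F: "Src (comp_prof H G) = Trg F" and H_GF: "Src H = Trg (comp_prof G F)"
    using HG GF by simp_all
  show "\<aa>' H G F \<cdot> \<aa> H G F = bid PROF (comp_prof (comp_prof H G) F)"
  proof (rule cell_eqI)
    fix e c p assume "el (Dom (bid PROF (comp_prof (comp_prof H G) F))) e c p"
    then have p': "el (comp_prof (comp_prof H G) F) e c p" by simp
    then obtain d q z where p: "p = coend_in (comp_prof H G) F e c d q z" and q': "el (comp_prof H G) e d q" and z: "el F d c z"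
      by (rule el_compE[OF PR_comp[OF H G HG] F HG_F])
    obtain b x y where q: "q = coend_in H G e d b x y" and x: "el H e b x" and y: "el G b d y"
      using q' by (rule el_compE[OF H G HG])
    show "\<exists>y. sends (\<aa>' H G F \<cdot> \<aa> H G F) e c p y \<and> sends (bid PROF (comp_prof (comp_prof H G) F)) e c p y"
      using sends_vcomp[OF *[OF x y z]] sends_bid[OF p'] unfolding p q by blast
  qed simp_all
  show "\<aa> H G F \<cdot> \<aa>' H G F = bid PROF (comp_prof H (comp_prof G F))"
  proof (rule cell_eqI)
    fix e c p assume "el (Dom (bid PROF (comp_prof H (comp_prof G F)))) e c p"
    then have p': "el (comp_prof H (comp_prof G F)) e c p" by simp
    then obtain d x q where p: "p = coend_in H (comp_prof G F) e c d x q" and x: "el H e d x" and q': "el (comp_prof G F) d c q"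
      by (rule el_compE[OF H PR_comp[OF G F GF] H_GF])
    obtain b y z where q: "q = coend_in G F d c b y z" and y: "el G d b y" and z: "el F b c z"
      using q' by (rule el_compE[OF G F GF])
    show "\<exists>y. sends (\<aa> H G F \<cdot> \<aa>' H G F) e c p y \<and> sends (bid PROF (comp_prof H (comp_prof G F))) e c p y"
      using sends_vcomp[OF *(2,1)[OF x y z]] sends_bid[OF p'] unfolding p q by blast
  qed simp_all
qed

text \<open>Stated for the inverse associator, which is the associator of \<open>co PROF\<close>.
  Both paths send \<open>[x, [y, z]]\<close> to the left-bracketed class of the three
  images.\<close>

lemma assoc_inv_natural:
  assumes HG: "Src H = Trg G" and GF: "Src G = Trg F" and \<alpha>: "\<alpha> \<in> cells F F'" and \<beta>: "\<beta> \<in> cells G G'"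
    and \<gamma>: "\<gamma> \<in> cells H H'"
  shows "\<aa>' H' G' F' \<cdot> (\<gamma> \<ast> (\<beta> \<ast> \<alpha>)) = ((\<gamma> \<ast> \<beta>) \<ast> \<alpha>) \<cdot> \<aa>' H G F"
proof (rule cell_eqI)
  note H = cell_PR(1)[OF \<gamma>] and G = cell_PR(1)[OF \<beta>] and F = cell_PR(1)[OF \<alpha>]
  note H' = cell_PR(2)[OF \<gamma>] and G' = cell_PR(2)[OF \<beta>] and F' = cell_PR(2)[OF \<alpha>]
  have HG_F: "Src (comp_prof H G) = Trg F" and H_GF: "Src H = Trg (comp_prof G F)"
    using HG GF by simp_all
  have HG': "Src H' = Trg G'" and GF': "Src G' = Trg F'"
    using HG GF by (simp_all add: cell_Src[OF \<gamma>] cell_Trg[OF \<beta>] cell_Src[OF \<beta>] cell_Trg[OF \<alpha>])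
  fix e c p assume "el (Dom (((\<gamma> \<ast> \<beta>) \<ast> \<alpha>) \<cdot> \<aa>' H G F)) e c p"
  then have "el (comp_prof H (comp_prof G F)) e c p" by simp
  then obtain d x q where p: "p = coend_in H (comp_prof G F) e c d x q" and x: "el H e d x" and q': "el (comp_prof G F) d c q"
    by (rule el_compE[OF H PR_comp[OF G F GF] H_GF])
  obtain b y z where q: "q = coend_in G F d c b y z" and y: "el G d b y" and z: "el F b c z"
    using q' by (rule el_compE[OF G F GF])
  note s = sends_Cpt[OF \<gamma> x] sends_Cpt[OF \<beta> y] sends_Cpt[OF \<alpha> z]
  note 1 = sends_hcomp[OF \<gamma> hcomp_cell[OF \<beta> \<alpha> GF] H_GF s(1) sends_hcomp[OF \<beta> \<alpha> GF s(2,3)]]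
  note 2 = sends_assoc_inv[OF H' G' F' HG' GF' cell_el[OF \<gamma> x] cell_el[OF \<beta> y] cell_el[OF \<alpha> z]]
  note 3 = sends_hcomp[OF hcomp_cell[OF \<gamma> \<beta> HG] \<alpha> HG_F sends_hcomp[OF \<gamma> \<beta> HG s(1,2)] s(3)]
  note 4 = sends_assoc_inv[OF H G F HG GF x y z]
  show "\<exists>y. sends (\<aa>' H' G' F' \<cdot> (\<gamma> \<ast> (\<beta> \<ast> \<alpha>))) e c p y
      \<and> sends (((\<gamma> \<ast> \<beta>) \<ast> \<alpha>) \<cdot> \<aa>' H G F) e c p y"
    unfolding p q using sends_vcomp[OF 1 2] sends_vcomp[OF 4 3] by blast
qed (simp_all add: cell_Dom[OF \<alpha>] cell_Dom[OF \<beta>] cell_Dom[OF \<gamma>] cell_Cod[OF \<alpha>] cell_Cod[OF \<beta>] cell_Cod[OF \<gamma>])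

text \<open>One composite is the coend relation \<open>[u, x] = [1, x u]\<close>, the other is the
  unit law of the left action.\<close>

lemma lunit_inverse:
  assumes F: "PR F"
  shows "\<ll>' F \<cdot> \<ll> F = bid PROF (comp_prof (hom_prof (Trg F)) F)"
    and "\<ll> F \<cdot> \<ll>' F = bid PROF F"
proof -
  note T = PR_Trg[OF F] note HT = PR_hom_prof[OF T]
  show "\<ll>' F \<cdot> \<ll> F = bid PROF (comp_prof (hom_prof (Trg F)) F)"
  proof (rule cell_eqI)
    fix e c p assume "el (Dom (bid PROF (comp_prof (hom_prof (Trg F)) F))) e c p"
    then have p': "el (comp_prof (hom_prof (Trg F)) F) e c p" by simp
    then obtain d u x where p: "p = coend_in (hom_prof (Trg F)) F e c d u x" and u: "ar (Trg F) e d u" and x: "el F d c x"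
      using el_compE[OF HT F] by (metis el_hom_prof hom_prof_simps(1))
    have "coend_in (hom_prof (Trg F)) F e c e (Ide (Trg F) e) (lact F e d c u x)
        = coend_in (hom_prof (Trg F)) F e c d (ract (hom_prof (Trg F)) e e d u (Ide (Trg F) e)) x"
      using u x by (simp add: coend_glide ar_Ide[OF T] ar_Ob)
    also have "\<dots> = p"
      using u by (simp add: ract_hom_prof[OF T] ar_Ide[OF T] ar_Ob Cmp_Ide_r[OF T] p)
    finally show "\<exists>y. sends (\<ll>' F \<cdot> \<ll> F) e c p y \<and> sends (bid PROF (comp_prof (hom_prof (Trg F)) F)) e c p y"
      using sends_vcomp[OF sends_lunit[OF F u x] sends_lunit_inv[OF F el_lact[OF PR_profunctor[OF F] u x]]] sends_bid[OF p'] p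
      by auto
  qed simp_all
  show "\<ll> F \<cdot> \<ll>' F = bid PROF F"
  proof (rule cell_eqI)
    fix e c x assume "el (Dom (bid PROF F)) e c x"
    then have x: "el F e c x" by simp
    show "\<exists>y. sends (\<ll> F \<cdot> \<ll>' F) e c x y \<and> sends (bid PROF F) e c x y"
      using sends_vcomp[OF sends_lunit_inv[OF F x] sends_lunit[OF F ar_Ide[OF T el_Ob(1)[OF x]] x]] sends_bid[OF x]
      by (auto simp: lact_Ide[OF PR_profunctor[OF F] x])
  qed simp_all
qed

lemma runit_inverse:
  assumes F: "PR F"
  shows "\<rr>' F \<cdot> \<rr> F = bid PROF (comp_prof F (hom_prof (Src F)))"
    and "\<rr> F \<cdot> \<rr>' F = bid PROF F"
proof -
  note S = PR_Src[OF F] note HS = PR_hom_prof[OF S]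
  show "\<rr>' F \<cdot> \<rr> F = bid PROF (comp_prof F (hom_prof (Src F)))"
  proof (rule cell_eqI)
    fix e c p assume "el (Dom (bid PROF (comp_prof F (hom_prof (Src F))))) e c p"
    then have p': "el (comp_prof F (hom_prof (Src F))) e c p" by simp
    then obtain d u x where p: "p = coend_in F (hom_prof (Src F)) e c d x u" and u: "ar (Src F) d c u" and x: "el F e d x"
      using el_compE[OF F HS] by (metis el_hom_prof hom_prof_simps(2))
    have "coend_in F (hom_prof (Src F)) e c c (ract F e d c u x) (Ide (Src F) c)
        = coend_in F (hom_prof (Src F)) e c d x (lact (hom_prof (Src F)) d c c u (Ide (Src F) c))"
      using u x by (simp add: coend_glide ar_Ide[OF S] ar_Ob)
    also have "\<dots> = p"
      using u by (simp add: lact_hom_prof[OF S] ar_Ide[OF S] ar_Ob Cmp_Ide_l[OF S] p)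
    finally show "\<exists>y. sends (\<rr>' F \<cdot> \<rr> F) e c p y \<and> sends (bid PROF (comp_prof F (hom_prof (Src F)))) e c p y"
      using sends_vcomp[OF sends_runit[OF F x u] sends_runit_inv[OF F el_ract[OF PR_profunctor[OF F] u x]]] sends_bid[OF p'] p
      by auto
  qed simp_all
  show "\<rr> F \<cdot> \<rr>' F = bid PROF F"
  proof (rule cell_eqI)
    fix e c x assume "el (Dom (bid PROF F)) e c x"
    then have x: "el F e c x" by simp
    show "\<exists>y. sends (\<rr> F \<cdot> \<rr>' F) e c x y \<and> sends (bid PROF F) e c x y"
      using sends_vcomp[OF sends_runit_inv[OF F x] sends_runit[OF F x ar_Ide[OF S el_Ob(2)[OF x]]]] sends_bid[OF x]
      by (auto simp: ract_Ide[OF PR_profunctor[OF F] x])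
  qed simp_all
qed

lemma lunit_inv_natural:
  assumes \<alpha>: "\<alpha> \<in> cells F F'"
  shows "(hom_prof (Trg F) \<triangleleft> \<alpha>) \<cdot> \<ll>' F = \<ll>' F' \<cdot> \<alpha>"
proof (rule cell_eqI)
  note F = cell_PR[OF \<alpha>] and T = PR_Trg[OF cell_PR(1)[OF \<alpha>]]
  fix e c x assume "el (Dom (\<ll>' F' \<cdot> \<alpha>)) e c x"
  then have x: "el F e c x" using \<alpha> by (simp add: cell_Dom)
  have i: "el (hom_prof (Trg F)) e e (Ide (Trg F) e)" using ar_Ide[OF T el_Ob(1)[OF x]] by simp
  have "sends ((hom_prof (Trg F) \<triangleleft> \<alpha>) \<cdot> \<ll>' F) e c x
      (coend_in (hom_prof (Trg F)) F' e c e (Ide (Trg F) e) (Cpt \<alpha> e c x))"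
    by (rule sends_vcomp[OF sends_lunit_inv[OF F(1) x] sends_lwhisker[OF \<alpha> PR_hom_prof[OF T] _ i sends_Cpt[OF \<alpha> x]]]) simp
  moreover have "sends (\<ll>' F' \<cdot> \<alpha>) e c x
      (coend_in (hom_prof (Trg F)) F' e c e (Ide (Trg F) e) (Cpt \<alpha> e c x))"
    using sends_vcomp[OF sends_Cpt[OF \<alpha> x] sends_lunit_inv[OF F(2) cell_el[OF \<alpha> x]]] by (simp add: cell_Trg[OF \<alpha>])
  ultimately show "\<exists>y. sends ((hom_prof (Trg F) \<triangleleft> \<alpha>) \<cdot> \<ll>' F) e c x y \<and> sends (\<ll>' F' \<cdot> \<alpha>) e c x y"
    by blast
qed (use assms in \<open>simp_all add: cell_Dom cell_Cod cell_Trg\<close>)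

lemma runit_inv_natural:
  assumes \<alpha>: "\<alpha> \<in> cells F F'"
  shows "(\<alpha> \<triangleright> hom_prof (Src F)) \<cdot> \<rr>' F = \<rr>' F' \<cdot> \<alpha>"
proof (rule cell_eqI)
  note F = cell_PR[OF \<alpha>] and S = PR_Src[OF cell_PR(1)[OF \<alpha>]]
  fix e c x assume "el (Dom (\<rr>' F' \<cdot> \<alpha>)) e c x"
  then have x: "el F e c x" using \<alpha> by (simp add: cell_Dom)
  have i: "el (hom_prof (Src F)) c c (Ide (Src F) c)" using ar_Ide[OF S el_Ob(2)[OF x]] by simp
  have "sends ((\<alpha> \<triangleright> hom_prof (Src F)) \<cdot> \<rr>' F) e c x
      (coend_in F' (hom_prof (Src F)) e c c (Cpt \<alpha> e c x) (Ide (Src F) c))"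
    by (rule sends_vcomp[OF sends_runit_inv[OF F(1) x] sends_rwhisker[OF \<alpha> PR_hom_prof[OF S] _ i sends_Cpt[OF \<alpha> x]]]) simp
  moreover have "sends (\<rr>' F' \<cdot> \<alpha>) e c x
      (coend_in F' (hom_prof (Src F)) e c c (Cpt \<alpha> e c x) (Ide (Src F) c))"
    using sends_vcomp[OF sends_Cpt[OF \<alpha> x] sends_runit_inv[OF F(2) cell_el[OF \<alpha> x]]] by (simp add: cell_Src[OF \<alpha>])
  ultimately show "\<exists>y. sends ((\<alpha> \<triangleright> hom_prof (Src F)) \<cdot> \<rr>' F) e c x y \<and> sends (\<rr>' F' \<cdot> \<alpha>) e c x y"
    by blast
qed (use assms in \<open>simp_all add: cell_Dom cell_Cod cell_Src\<close>)

text \<open>Both paths rebracket \<open>[x, [y, [z, w]]]\<close> to \<open>[[[x, y], z], w]\<close>,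
  and each stage is evaluated by \<open>sends_assoc_inv\<close> at a visible representative.\<close>

lemma pentagon_co:
  assumes K: "PR K" and H: "PR H" and G: "PR G" and F: "PR F"
    and KH: "Src K = Trg H" and HG: "Src H = Trg G" and GF: "Src G = Trg F"
  shows "\<aa>' (comp_prof K H) G F \<cdot> \<aa>' K H (comp_prof G F)
    = ((\<aa>' K H G \<triangleright> F) \<cdot> \<aa>' K (comp_prof H G) F) \<cdot> (K \<triangleleft> \<aa>' H G F)"
proof (rule cell_eqI)
  note KHp = PR_comp[OF K H KH] and HGp = PR_comp[OF H G HG] and GFp = PR_comp[OF G F GF]
  have *: "Src (comp_prof K H) = Trg G" "Src K = Trg (comp_prof H G)" "Src (comp_prof H G) = Trg F"
    "Src H = Trg (comp_prof G F)" "Src K = Trg (comp_prof H (comp_prof G F))" "Src (comp_prof K (comp_prof H G)) = Trg F"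
    using KH HG GF by simp_all
  note HGFp = PR_comp[OF H GFp *(4)]
  fix a b p assume "el (Dom (((\<aa>' K H G \<triangleright> F) \<cdot> \<aa>' K (comp_prof H G) F) \<cdot> (K \<triangleleft> \<aa>' H G F))) a b p"
  then have "el (comp_prof K (comp_prof H (comp_prof G F))) a b p" by simp
  then obtain c x q where p: "p = coend_in K (comp_prof H (comp_prof G F)) a b c x q" and x: "el K a c x"
    and q': "el (comp_prof H (comp_prof G F)) c b q"
    by (rule el_compE[OF K HGFp *(5)])
  from q' obtain d y r where q: "q = coend_in H (comp_prof G F) c b d y r" and y: "el H c d y" and r': "el (comp_prof G F) d b r"
    by (rule el_compE[OF H GFp *(4)])
  from r' obtain e z w where r: "r = coend_in G F d b e z w" and z: "el G d e z" and w: "el F e b w"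
    by (rule el_compE[OF G F GF])
  note 1 = sends_assoc_inv[OF K H GFp KH *(4) x y r']
  note 2 = sends_assoc_inv[OF KHp G F *(1) GF el_comp[OF K H KH x y] z w]
  note 3 = sends_lwhisker[OF assoc_inv_cell[OF H G F HG GF] K *(5) x sends_assoc_inv[OF H G F HG GF y z w]]
  note 4 = sends_assoc_inv[OF K HGp F *(2,3) x el_comp[OF H G HG y z] w]
  note 5 = sends_rwhisker[OF assoc_inv_cell[OF K H G KH HG] F *(6) w sends_assoc_inv[OF K H G KH HG x y z]]
  show "\<exists>y. sends (\<aa>' (comp_prof K H) G F \<cdot> \<aa>' K H (comp_prof G F)) a b p y
      \<and> sends (((\<aa>' K H G \<triangleright> F) \<cdot> \<aa>' K (comp_prof H G) F) \<cdot> (K \<triangleleft> \<aa>' H G F)) a b p y"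
    using sends_vcomp[OF 1 2[folded r]] sends_vcomp[OF 3 sends_vcomp[OF 4 5]]
    unfolding p q r by blast
qed simp_all

lemma triangle_co:
  assumes G: "PR G" and F: "PR F" and GF: "Src G = Trg F"
  shows "\<aa>' G (hom_prof (Trg F)) F \<cdot> (G \<triangleleft> \<ll>' F) = \<rr>' G \<triangleright> F"
proof (rule cell_eqI)
  note T = PR_Trg[OF F] note HT = PR_hom_prof[OF T]
  fix a b p assume "el (Dom (\<rr>' G \<triangleright> F)) a b p"
  then have "el (comp_prof G F) a b p" by simp
  then obtain c x y where p: "p = coend_in G F a b c x y" and x: "el G a c x" and y: "el F c b y"
    by (rule el_compE[OF G F GF])
  have i: "el (hom_prof (Trg F)) c c (Ide (Trg F) c)" using ar_Ide[OF T el_Ob(1)[OF y]] by simp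
  have *: "Src G = Trg (hom_prof (Trg F))" "Src (hom_prof (Trg F)) = Trg F" using GF by simp_all
  note 1 = sends_lwhisker[OF lunit_inv_cell[OF F] G GF x sends_lunit_inv[OF F y]]
  note 2 = sends_assoc_inv[OF G HT F * x i y]
  note 3 = sends_rwhisker[OF runit_inv_cell[OF G] F GF y sends_runit_inv[OF G x]]
  show "\<exists>y. sends (\<aa>' G (hom_prof (Trg F)) F \<cdot> (G \<triangleleft> \<ll>' F)) a b p y \<and> sends (\<rr>' G \<triangleright> F) a b p y"
    using sends_vcomp[OF 1 2] 3 GF unfolding p by auto
qed (simp_all add: GF)

text \<open>Duality reverses vertical composites and exchanges each structural cell with its
  inverse. The laws of the locale thus become the lemmas above, with the two invertibility equations
  of each constraint swapped.\<close>

lemma bicategory_co_PROF: "bicategory (co (PROF :: ('u::zf_universe cat, 'u prof, 'u ptrans) bicat))"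
proof
  fix \<alpha> :: "'u ptrans" assume "\<alpha> \<in> BCell (co PROF)"
  then have *: "\<alpha> \<in> cells (Dom \<alpha>) (Cod \<alpha>)" by (simp add: BCell_PROF)
  show "bdom (co PROF) \<alpha> \<in> BArr (co PROF)" "bcod (co PROF) \<alpha> \<in> BArr (co PROF)"
    "bsrc (co PROF) (bdom (co PROF) \<alpha>) = bsrc (co PROF) (bcod (co PROF) \<alpha>)"
    "btrg (co PROF) (bdom (co PROF) \<alpha>) = btrg (co PROF) (bcod (co PROF) \<alpha>)"
    using cell_PR[OF *] cell_Src[OF *] cell_Trg[OF *] by simp_all
qed (auto simp: PR_Src PR_Trg PR_hom_prof PR_comp bid_cell vcomp_cell vcomp_id_left_PROF vcomp_id_right_PROF
    vcomp_assoc_PROF[symmetric] hcomp_cell cell_Src cell_Trg hcomp_id_PROF interchange_PROF assoc_cell assoc_inv_cell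
    assoc_inverse assoc_inv_natural lunit_cell lunit_inv_cell lunit_inverse lunit_inv_natural
    runit_cell runit_inv_cell runit_inverse runit_inv_natural pentagon_co triangle_co)

section \<open>Families\<close>

lemma idx_fam_ob [simp]: "idx (fam_ob X h \<nu>) = X"
  and lab_fam_ob [simp]: "lab (fam_ob X h \<nu>) = \<nu>"
  and ob_fam_ob [simp]: "x \<in> elts X \<Longrightarrow> ob (fam_ob X h \<nu>) x = h x"
  by (simp_all add: fam_ob_def idx_def lab_def ob_def)

lemma rdx_fam_ar [simp]: "x \<in> elts X \<Longrightarrow> rdx (fam_ar X g \<alpha>) x = g x"
  and cpt_fam_ar [simp]: "x \<in> elts X \<Longrightarrow> cpt (fam_ar X g \<alpha>) x = \<alpha> x"
  by (simp_all add: fam_ar_def rdx_def cpt_def)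

lemma vfun_cong: "(\<And>x. x \<in> elts X \<Longrightarrow> f x = g x) \<Longrightarrow> vfun X f = vfun X g"
  by (simp add: vfun_def cong: image_cong)

text \<open>\<open>vfun\<close> sees only the values on \<open>X\<close>. As a congruence rule this
  lets the simplifier work under a family with \<open>x\<close> known to lie in \<open>X\<close>,
  which is the condition of all selector rules.\<close>

lemma fam_ar_cong [cong]:
  "X = X' \<Longrightarrow> (\<And>x. x \<in> elts X' \<Longrightarrow> g x = g' x) \<Longrightarrow> (\<And>x. x \<in> elts X' \<Longrightarrow> \<alpha> x = \<alpha>' x) \<Longrightarrow>
    fam_ar X g \<alpha> = fam_ar X' g' \<alpha>'"
  unfolding fam_ar_def by (simp add: vfun_cong[of X' g g'] vfun_cong[of X' \<alpha> \<alpha>'])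

lemma fam_ob_cong [cong]:
  "X = X' \<Longrightarrow> (\<And>x. x \<in> elts X' \<Longrightarrow> h x = h' x) \<Longrightarrow> \<nu> = \<nu>' \<Longrightarrow> fam_ob X h \<nu> = fam_ob X' h' \<nu>'"
  unfolding fam_ob_def by (simp add: vfun_cong[of X' h h'])

text \<open>Every such graph is a subset of the small set of pairs \<open>pr x y\<close> with
  \<open>y\<close> in \<open>Y x\<close>, so the power set axiom bounds all of them at once.\<close>

lemma small_vfun:
  fixes X :: "'u::zf_universe"
  shows "small {vfun X f | f. \<forall>x\<in>elts X. f x \<in> elts (Y x)}"
proof -
  let ?S = "\<Union>x\<in>elts X. pr x ` elts (Y x)"
  have S: "small ?S"
    by (intro small_UN small_image small_elts)
  have "small {z :: 'u. elts z \<subseteq> elts (vset ?S)}"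
    unfolding small_def by (rule elts_Pow)
  then show ?thesis
    by (rule small_subset) (auto simp: S image_iff)
qed

section \<open>Kleisli calculus of a monad on Set\<close>

context set_monad
begin

text \<open>The monad record acts on extensional functions. Restricting the argument first makes
  arbitrary functions admissible, and \<open>tm_cong\<close> then compares them on \<open>X\<close>
  alone.\<close>

definition tm :: "'u \<Rightarrow> 'u \<Rightarrow> ('u \<Rightarrow> 'u) \<Rightarrow> 'u \<Rightarrow> 'u" where
  "tm X Y f = TMap T X Y (restrict f (elts X))"

text \<open>Kleisli extension. The label of a disjoint union is a \<open>bind\<close>, so the
  associativity and unit laws of the monad enter below as laws of \<open>bind\<close>.\<close>

definition bind :: "'u \<Rightarrow> 'u \<Rightarrow> 'u \<Rightarrow> ('u \<Rightarrow> 'u) \<Rightarrow> 'u" where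
  "bind X Y \<nu> q = TMult T Y (tm X (TOb T Y) q \<nu>)"

lemma tm_cong: "(\<And>x. x \<in> elts X \<Longrightarrow> f x = g x) \<Longrightarrow> tm X Y f = tm X Y g"
  unfolding tm_def by (rule arg_cong[where f = "TMap T X Y"]) auto

lemma bind_cong: "(\<And>x. x \<in> elts X \<Longrightarrow> q x = r x) \<Longrightarrow> bind X Y \<nu> q = bind X Y \<nu> r"
  unfolding bind_def by (simp cong: tm_cong)

lemma restrict_PiE: "(\<And>x. x \<in> elts X \<Longrightarrow> f x \<in> elts Y) \<Longrightarrow> restrict f (elts X) \<in> elts X \<rightarrow>\<^sub>E elts Y"
  by simp

lemma tm_closed: "(\<And>x. x \<in> elts X \<Longrightarrow> f x \<in> elts Y) \<Longrightarrow> \<nu> \<in> elts (TOb T X) \<Longrightarrow> tm X Y f \<nu> \<in> elts (TOb T Y)"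
  unfolding tm_def using TMap_closed[OF restrict_PiE, of X f Y] by auto

lemma tm_id: "\<nu> \<in> elts (TOb T X) \<Longrightarrow> tm X X (\<lambda>x. x) \<nu> = \<nu>"
  unfolding tm_def using TMap_id[of X] by simp

lemma tm_tm:
  assumes "\<And>x. x \<in> elts X \<Longrightarrow> f x \<in> elts Y" "\<And>x. x \<in> elts Y \<Longrightarrow> g x \<in> elts Z" "\<nu> \<in> elts (TOb T X)"
  shows "tm Y Z g (tm X Y f \<nu>) = tm X Z (\<lambda>x. g (f x)) \<nu>"
proof -
  have "restrict (\<lambda>x. g (f x)) (elts X) = compose (elts X) (restrict g (elts Y)) (restrict f (elts X))"
    using assms(1) by (auto simp: compose_def restrict_def fun_eq_iff)
  then show ?thesis
    unfolding tm_def using TMap_comp[OF restrict_PiE[of X f Y] restrict_PiE[of Y g Z]] assms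
    by (simp add: compose_eq)
qed

lemma TUnit_in: "x \<in> elts X \<Longrightarrow> TUnit T X x \<in> elts (TOb T X)"
  using TUnit_closed[of X] by auto

lemma TMult_in: "\<nu> \<in> elts (TOb T (TOb T X)) \<Longrightarrow> TMult T X \<nu> \<in> elts (TOb T X)"
  using TMult_closed[of X] by auto

lemma tm_TUnit: "(\<And>x. x \<in> elts X \<Longrightarrow> f x \<in> elts Y) \<Longrightarrow> x \<in> elts X \<Longrightarrow> tm X Y f (TUnit T X x) = TUnit T Y (f x)"
  using fun_cong[OF TUnit_natural[OF restrict_PiE[of X f Y]], of x] by (simp add: tm_def compose_eq)

lemma tm_TMult:
  assumes f: "\<And>x. x \<in> elts X \<Longrightarrow> f x \<in> elts Y" and \<nu>: "\<nu> \<in> elts (TOb T (TOb T X))"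
  shows "tm X Y f (TMult T X \<nu>) = TMult T Y (tm (TOb T X) (TOb T Y) (tm X Y f) \<nu>)"
proof -
  \<comment> \<open>\<open>TMap\<close> of a map is already extensional, so restricting
    \<open>tm X Y f\<close> changes nothing. This passes between the two ways of writing the functor
    applied twice.\<close>
  have "restrict (tm X Y f) (elts (TOb T X)) = TMap T X Y (restrict f (elts X))"
    using TMap_closed[OF restrict_PiE[OF f]] by (auto simp: tm_def PiE_def extensional_restrict)
  then show ?thesis
    using fun_cong[OF TMult_natural[OF restrict_PiE[of X f Y]], of \<nu>] f \<nu> by (simp add: tm_def compose_eq)
qed

lemma TMult_TMult: "\<nu> \<in> elts (TOb T (TOb T (TOb T X))) \<Longrightarrow>
    TMult T X (TMult T (TOb T X) \<nu>) = TMult T X (tm (TOb T (TOb T X)) (TOb T X) (TMult T X) \<nu>)"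
  using fun_cong[OF TMult_assoc[of X], of \<nu>] TMult_closed[of X]
  by (simp add: tm_def compose_eq PiE_def extensional_restrict)

lemma bind_closed: "(\<And>x. x \<in> elts X \<Longrightarrow> q x \<in> elts (TOb T Y)) \<Longrightarrow> \<nu> \<in> elts (TOb T X) \<Longrightarrow> bind X Y \<nu> q \<in> elts (TOb T Y)"
  unfolding bind_def by (intro TMult_in tm_closed)

lemma tm_bind:
  assumes "\<And>x. x \<in> elts X \<Longrightarrow> q x \<in> elts (TOb T Y)" "\<nu> \<in> elts (TOb T X)" "\<And>y. y \<in> elts Y \<Longrightarrow> f y \<in> elts Z"
  shows "tm Y Z f (bind X Y \<nu> q) = bind X Z \<nu> (\<lambda>x. tm Y Z f (q x))"
  unfolding bind_def using assms by (simp add: tm_TMult tm_closed tm_tm)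

lemma bind_tm:
  assumes "\<And>x. x \<in> elts X \<Longrightarrow> f x \<in> elts Y" "\<nu> \<in> elts (TOb T X)" "\<And>y. y \<in> elts Y \<Longrightarrow> q y \<in> elts (TOb T Z)"
  shows "bind Y Z (tm X Y f \<nu>) q = bind X Z \<nu> (\<lambda>x. q (f x))"
  unfolding bind_def using assms by (simp add: tm_tm)

text \<open>Naturality moves the multiplication out of the inner \<open>tm\<close>; associativity of
  the multiplication then merges the two extensions.\<close>

lemma bind_bind:
  assumes "\<And>x. x \<in> elts X \<Longrightarrow> q x \<in> elts (TOb T Y)" "\<nu> \<in> elts (TOb T X)" "\<And>y. y \<in> elts Y \<Longrightarrow> r y \<in> elts (TOb T Z)"
  shows "bind Y Z (bind X Y \<nu> q) r = bind X Z \<nu> (\<lambda>x. bind Y Z (q x) r)"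
  unfolding bind_def using assms
  by (simp add: tm_TMult tm_closed tm_tm TMult_TMult TMult_in)

lemma bind_TUnit_left: "x \<in> elts X \<Longrightarrow> (\<And>x. x \<in> elts X \<Longrightarrow> q x \<in> elts (TOb T Y)) \<Longrightarrow> bind X Y (TUnit T X x) q = q x"
  unfolding bind_def using fun_cong[OF TMult_TUnit[of Y], of "q x"] by (simp add: tm_TUnit compose_eq)

lemma bind_TUnit_right: "\<nu> \<in> elts (TOb T X) \<Longrightarrow> bind X X \<nu> (TUnit T X) = \<nu>"
  unfolding bind_def using fun_cong[OF TMult_TMap_TUnit[of X], of \<nu>] TUnit_closed[of X]
  by (simp add: tm_def compose_eq PiE_def extensional_restrict)

section \<open>The category of families\<close>

lemma L_Ob_iff: "A \<in> Ob (L_cat T C) \<longleftrightarrow> A = fam_ob (idx A) (ob A) (lab A) \<and>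
    (\<forall>x\<in>elts (idx A). ob A x \<in> Ob C) \<and> lab A \<in> elts (TOb T (idx A))"
proof
  assume "A \<in> Ob (L_cat T C)"
  then obtain X h \<nu> where "A = fam_ob X h \<nu>" "h \<in> elts X \<rightarrow> Ob C" "\<nu> \<in> elts (TOb T X)"
    unfolding L_cat_def by auto
  then show "A = fam_ob (idx A) (ob A) (lab A) \<and> (\<forall>x\<in>elts (idx A). ob A x \<in> Ob C) \<and> lab A \<in> elts (TOb T (idx A))"
    by auto
next
  assume "A = fam_ob (idx A) (ob A) (lab A) \<and> (\<forall>x\<in>elts (idx A). ob A x \<in> Ob C) \<and> lab A \<in> elts (TOb T (idx A))"
  then show "A \<in> Ob (L_cat T C)"
    unfolding L_cat_def by auto
qed

lemma fam_ob_Ob [simp]: "fam_ob X h \<nu> \<in> Ob (L_cat T C) \<longleftrightarrow> (\<forall>x\<in>elts X. h x \<in> Ob C) \<and> \<nu> \<in> elts (TOb T X)"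
  unfolding L_Ob_iff by simp

lemma L_Ob_ob: "A \<in> Ob (L_cat T C) \<Longrightarrow> x \<in> elts (idx A) \<Longrightarrow> ob A x \<in> Ob C"
  and L_Ob_lab: "A \<in> Ob (L_cat T C) \<Longrightarrow> lab A \<in> elts (TOb T (idx A))"
  and L_Ob_eta: "A \<in> Ob (L_cat T C) \<Longrightarrow> fam_ob (idx A) (ob A) (lab A) = A"
  by (simp_all add: L_Ob_iff)

text \<open>The condition on index maps and labels, which is common to arrows of \<open>LC\<close>
  and elements of \<open>LF\<close> and does not see the families. The map runs backwards, from the
  indices of \<open>B\<close> to those of \<open>A\<close>.\<close>

definition lmap :: "'u \<Rightarrow> 'u \<Rightarrow> ('u \<Rightarrow> 'u) \<Rightarrow> bool" where
  "lmap A B r \<longleftrightarrow> (\<forall>y\<in>elts (idx B). r y \<in> elts (idx A)) \<and> tm (idx B) (idx A) r (lab B) = lab A"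

lemma lmap_cong: "(\<And>y. y \<in> elts (idx B) \<Longrightarrow> r y = s y) \<Longrightarrow> lmap A B r \<longleftrightarrow> lmap A B s"
  by (simp add: lmap_def cong: tm_cong)

lemma lmapD: "lmap A B r \<Longrightarrow> y \<in> elts (idx B) \<Longrightarrow> r y \<in> elts (idx A)"
  by (simp add: lmap_def)

lemma lmap_id: "A \<in> Ob (L_cat T C) \<Longrightarrow> lmap A A (\<lambda>x. x)"
  by (simp add: lmap_def tm_id L_Ob_lab)

lemma lmap_comp: "lmap A B r \<Longrightarrow> lmap B D s \<Longrightarrow> D \<in> Ob (L_cat T C) \<Longrightarrow> lmap A D (\<lambda>y. r (s y))"
  unfolding lmap_def using tm_tm[of "idx D" s "idx B" r "idx A" "lab D"] by (simp add: L_Ob_lab)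

text \<open>The range of the family depends on the index map through \<open>t y\<close>. Enlarging
  it to the union over all indices of \<open>A\<close> removes this dependence, and what remains is
  contained in a small set of pairs of graphs.\<close>

lemma small_L_el: "small {fam_ar (idx B) t \<zeta> | t \<zeta>.
     t \<in> elts (idx B) \<rightarrow>\<^sub>E elts (idx A) \<and> TMap T (idx B) (idx A) t (lab B) = lab A \<and>
     (\<forall>y\<in>elts (idx B). \<zeta> y \<in> elts (E (ob A (t y)) (ob B y)))}" (is "small ?S")
proof -
  let ?U = "\<lambda>y. \<Union>x\<in>elts (idx A). elts (E (ob A x) (ob B y))"
  let ?V = "{vfun (idx B) f | f. \<forall>x\<in>elts (idx B). f x \<in> elts (idx A)}"
  let ?W = "{vfun (idx B) f | f. \<forall>x\<in>elts (idx B). f x \<in> elts (vset (?U x))}"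
  have U: "elts (vset (?U y)) = ?U y" for y
    by (intro elts_vset small_UN small_elts)
  have "?S \<subseteq> (\<Union>v\<in>?V. pr v ` ?W)"
  proof
    fix p assume "p \<in> ?S"
    then obtain t \<zeta> where p: "p = fam_ar (idx B) t \<zeta>" and t: "t \<in> elts (idx B) \<rightarrow>\<^sub>E elts (idx A)"
      and \<zeta>: "\<forall>y\<in>elts (idx B). \<zeta> y \<in> elts (E (ob A (t y)) (ob B y))" by blast
    have "vfun (idx B) t \<in> ?V" using t by blast
    moreover have "vfun (idx B) \<zeta> \<in> ?W" using t \<zeta> unfolding U by blast
    ultimately show "p \<in> (\<Union>v\<in>?V. pr v ` ?W)" unfolding p fam_ar_def by blast
  qed
  moreover have "small (\<Union>v\<in>?V. pr v ` ?W)"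
    by (intro small_UN small_image small_vfun)
  ultimately show ?thesis
    by (rule small_subset[rotated])
qed

text \<open>\<open>L_el\<close> quantifies over extensional index maps, while the selectors give
  arbitrary functions; the two descriptions agree because an extensional map equals its restriction.
  From here on elements are handled through \<open>rdx\<close> and \<open>cpt\<close>.\<close>

lemma L_el_iff: "t \<in> elts (L_el T E A B) \<longleftrightarrow> t = fam_ar (idx B) (rdx t) (cpt t) \<and> lmap A B (rdx t) \<and>
    (\<forall>y\<in>elts (idx B). cpt t y \<in> elts (E (ob A (rdx t y)) (ob B y)))"
proof
  assume "t \<in> elts (L_el T E A B)"
  then obtain r \<zeta> where t: "t = fam_ar (idx B) r \<zeta>" and r: "r \<in> elts (idx B) \<rightarrow>\<^sub>E elts (idx A)"
    "TMap T (idx B) (idx A) r (lab B) = lab A"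
    and \<zeta>: "\<forall>y\<in>elts (idx B). \<zeta> y \<in> elts (E (ob A (r y)) (ob B y))"
    unfolding L_el_def elts_vset[OF small_L_el] by blast
  have "restrict r (elts (idx B)) = r"
    using r(1) by (simp add: PiE_def extensional_restrict)
  then have "lmap A B r"
    using r by (auto simp: lmap_def tm_def)
  then show "t = fam_ar (idx B) (rdx t) (cpt t) \<and> lmap A B (rdx t) \<and>
    (\<forall>y\<in>elts (idx B). cpt t y \<in> elts (E (ob A (rdx t y)) (ob B y)))"
    using \<zeta> lmap_cong[of B "rdx t" r A] by (simp add: t)
next
  assume *: "t = fam_ar (idx B) (rdx t) (cpt t) \<and> lmap A B (rdx t) \<and>
    (\<forall>y\<in>elts (idx B). cpt t y \<in> elts (E (ob A (rdx t y)) (ob B y)))"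
  have "t = fam_ar (idx B) (restrict (rdx t) (elts (idx B))) (cpt t)"
    using * by simp
  moreover have "restrict (rdx t) (elts (idx B)) \<in> elts (idx B) \<rightarrow>\<^sub>E elts (idx A)"
    using * by (simp add: lmap_def)
  moreover have "TMap T (idx B) (idx A) (restrict (rdx t) (elts (idx B))) (lab B) = lab A"
    using * by (simp add: lmap_def tm_def)
  moreover have "\<forall>y\<in>elts (idx B). cpt t y \<in> elts (E (ob A (restrict (rdx t) (elts (idx B)) y)) (ob B y))"
    using * by simp
  ultimately show "t \<in> elts (L_el T E A B)"
    unfolding L_el_def elts_vset[OF small_L_el] by blast
qed

lemma L_cat_Hom [simp]: "Hom (L_cat T C) = L_el T (Hom C)"
  by (simp add: L_cat_def)

lemma L_prof_simps [simp]: "Src (L_prof T F) = L_cat T (Src F)" "Trg (L_prof T F) = L_cat T (Trg F)"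
  "El (L_prof T F) = L_el T (El F)"
  by (simp_all add: L_prof_def)

lemma el_L_prof: "el (L_prof T F) A B t \<longleftrightarrow> A \<in> Ob (L_cat T (Trg F)) \<and> B \<in> Ob (L_cat T (Src F)) \<and>
    t = fam_ar (idx B) (rdx t) (cpt t) \<and> lmap A B (rdx t) \<and>
    (\<forall>y\<in>elts (idx B). el F (ob A (rdx t y)) (ob B y) (cpt t y))"
  by (auto simp: el_def L_el_iff L_Ob_ob lmapD)

lemma ar_L_cat: "ar (L_cat T C) A B t \<longleftrightarrow> A \<in> Ob (L_cat T C) \<and> B \<in> Ob (L_cat T C) \<and>
    t = fam_ar (idx B) (rdx t) (cpt t) \<and> lmap A B (rdx t) \<and>
    (\<forall>y\<in>elts (idx B). ar C (ob A (rdx t y)) (ob B y) (cpt t y))"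
  by (auto simp: ar_def L_el_iff L_Ob_ob lmapD)

text \<open>At a hom profunctor the extension has the elements of the hom profunctor of
  \<open>LC\<close>. This is why the unitor can be the identity on elements.\<close>

lemma el_L_hom_prof [simp]: "el (L_prof T (hom_prof C)) A B t = ar (L_cat T C) A B t"
  by (simp add: el_L_prof ar_L_cat)

lemma el_L_fam: "A \<in> Ob (L_cat T (Trg F)) \<Longrightarrow> B \<in> Ob (L_cat T (Src F)) \<Longrightarrow> X = idx B \<Longrightarrow> lmap A B r \<Longrightarrow>
    (\<And>y. y \<in> elts (idx B) \<Longrightarrow> el F (ob A (r y)) (ob B y) (\<zeta> y)) \<Longrightarrow> el (L_prof T F) A B (fam_ar X r \<zeta>)"
  using lmap_cong[of B "rdx (fam_ar (idx B) r \<zeta>)" r A] by (simp add: el_L_prof)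

lemma ar_L_fam: "A \<in> Ob (L_cat T C) \<Longrightarrow> B \<in> Ob (L_cat T C) \<Longrightarrow> X = idx B \<Longrightarrow> lmap A B r \<Longrightarrow>
    (\<And>y. y \<in> elts (idx B) \<Longrightarrow> ar C (ob A (r y)) (ob B y) (\<zeta> y)) \<Longrightarrow> ar (L_cat T C) A B (fam_ar X r \<zeta>)"
  using el_L_fam[of A "hom_prof C" B X r \<zeta>] by simp

lemma el_L_lmap: "el (L_prof T F) A B t \<Longrightarrow> lmap A B (rdx t)"
  and el_L_rdx: "el (L_prof T F) A B t \<Longrightarrow> y \<in> elts (idx B) \<Longrightarrow> rdx t y \<in> elts (idx A)"
  and el_L_cpt: "el (L_prof T F) A B t \<Longrightarrow> y \<in> elts (idx B) \<Longrightarrow> el F (ob A (rdx t y)) (ob B y) (cpt t y)"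
  and el_L_eta: "el (L_prof T F) A B t \<Longrightarrow> fam_ar (idx B) (rdx t) (cpt t) = t"
  unfolding el_L_prof by (blast dest: lmapD sym)+

lemma ar_L_lmap: "ar (L_cat T C) A B t \<Longrightarrow> lmap A B (rdx t)"
  and ar_L_rdx: "ar (L_cat T C) A B t \<Longrightarrow> y \<in> elts (idx B) \<Longrightarrow> rdx t y \<in> elts (idx A)"
  and ar_L_cpt: "ar (L_cat T C) A B t \<Longrightarrow> y \<in> elts (idx B) \<Longrightarrow> ar C (ob A (rdx t y)) (ob B y) (cpt t y)"
  and ar_L_eta: "ar (L_cat T C) A B t \<Longrightarrow> fam_ar (idx B) (rdx t) (cpt t) = t"
  unfolding ar_L_cat by (blast dest: lmapD sym)+

lemma fam_eqI:
  assumes "fam_ar X (rdx s) (cpt s) = s" "fam_ar X (rdx t) (cpt t) = t"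
    and "\<And>y. y \<in> elts X \<Longrightarrow> rdx s y = rdx t y" "\<And>y. y \<in> elts X \<Longrightarrow> cpt s y = cpt t y"
  shows "s = t"
  using assms fam_ar_cong by metis

lemma Ide_L: "Ide (L_cat T C) A = fam_ar (idx A) (\<lambda>x. x) (\<lambda>x. Ide C (ob A x))"
  by (simp add: L_cat_def)

lemma Cmp_L: "Cmp (L_cat T C) A A' A'' q p = fam_ar (idx A'') (\<lambda>x. rdx p (rdx q x))
       (\<lambda>x. Cmp C (ob A (rdx p (rdx q x))) (ob A' (rdx q x)) (ob A'' x) (cpt q x) (cpt p (rdx q x)))"
  by (simp add: L_cat_def)

lemma ar_L_Ide: "category C \<Longrightarrow> A \<in> Ob (L_cat T C) \<Longrightarrow> ar (L_cat T C) A A (Ide (L_cat T C) A)"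
  unfolding Ide_L by (rule ar_L_fam) (auto simp: lmap_id L_Ob_ob intro: ar_Ide)

lemma ar_L_Cmp: "category C \<Longrightarrow> ar (L_cat T C) A A' p \<Longrightarrow> ar (L_cat T C) A' A'' q \<Longrightarrow>
    ar (L_cat T C) A A'' (Cmp (L_cat T C) A A' A'' q p)"
  unfolding Cmp_L
  by (rule ar_L_fam) (auto simp: ar_Ob intro!: lmap_comp[OF ar_L_lmap ar_L_lmap, where C = C] ar_Cmp ar_L_cpt ar_L_rdx)

lemma category_L_cat: "category C \<Longrightarrow> category (L_cat T C)"
proof -
  assume C: "category C"
  show ?thesis
  proof
    fix A A' A'' p q assume "A \<in> Ob (L_cat T C)" "A' \<in> Ob (L_cat T C)" "A'' \<in> Ob (L_cat T C)"
      "p \<in> elts (Hom (L_cat T C) A A')" "q \<in> elts (Hom (L_cat T C) A' A'')"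
    then show "Cmp (L_cat T C) A A' A'' q p \<in> elts (Hom (L_cat T C) A A'')"
      using ar_L_Cmp[OF C, of A A' p A'' q] by (simp add: ar_def)
  next
    fix A assume "A \<in> Ob (L_cat T C)"
    then show "Ide (L_cat T C) A \<in> elts (Hom (L_cat T C) A A)"
      using ar_L_Ide[OF C, of A] by (simp add: ar_def)
  next
    fix A B p assume "A \<in> Ob (L_cat T C)" "B \<in> Ob (L_cat T C)" "p \<in> elts (Hom (L_cat T C) A B)"
    then have p: "ar (L_cat T C) A B p" by (simp add: ar_def)
    show "Cmp (L_cat T C) A B B (Ide (L_cat T C) B) p = p"
      unfolding Cmp_L Ide_L
      by (rule fam_eqI[OF _ ar_L_eta[OF p]]) (simp_all add: Cmp_Ide_l[OF C ar_L_cpt[OF p]])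
    show "Cmp (L_cat T C) A A B p (Ide (L_cat T C) A) = p"
      unfolding Cmp_L Ide_L
      by (rule fam_eqI[OF _ ar_L_eta[OF p]]) (simp_all add: ar_L_rdx[OF p] Cmp_Ide_r[OF C ar_L_cpt[OF p]])
  next
    fix A B D E p q r assume "A \<in> Ob (L_cat T C)" "B \<in> Ob (L_cat T C)" "D \<in> Ob (L_cat T C)" "E \<in> Ob (L_cat T C)"
      "p \<in> elts (Hom (L_cat T C) A B)" "q \<in> elts (Hom (L_cat T C) B D)" "r \<in> elts (Hom (L_cat T C) D E)"
    then have *: "ar (L_cat T C) A B p" "ar (L_cat T C) B D q" "ar (L_cat T C) D E r" by (simp_all add: ar_def)
    show "Cmp (L_cat T C) A B E (Cmp (L_cat T C) B D E r q) p = Cmp (L_cat T C) A D E r (Cmp (L_cat T C) A B D q p)"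
      unfolding Cmp_L by (rule fam_ar_cong) (simp_all add: ar_L_rdx[OF *(3)] ar_L_rdx[OF *(2)]
          Cmp_Cmp[OF C ar_L_cpt[OF *(1)] ar_L_cpt[OF *(2)] ar_L_cpt[OF *(3)]])
  qed
qed

section \<open>The extension to profunctors\<close>

lemma Act_L: "Act (L_prof T F) A' A B B' u v t = fam_ar (idx B') (\<lambda>y. rdx u (rdx t (rdx v y)))
       (\<lambda>y. Act F (ob A' (rdx u (rdx t (rdx v y)))) (ob A (rdx t (rdx v y))) (ob B (rdx v y)) (ob B' y)
         (cpt u (rdx t (rdx v y))) (cpt v y) (cpt t (rdx v y)))"
  by (simp add: L_prof_def)

lemma lact_L: "lact (L_prof T F) A' A B u t = fam_ar (idx B) (\<lambda>y. rdx u (rdx t y))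
       (\<lambda>y. lact F (ob A' (rdx u (rdx t y))) (ob A (rdx t y)) (ob B y) (cpt u (rdx t y)) (cpt t y))"
  unfolding lact_def Act_L L_prof_simps Ide_L by simp

text \<open>The identity of \<open>A\<close> is evaluated at the index
  \<open>rdx t (rdx v y)\<close>, so this index must be known to lie in \<open>idx A\<close>; in
  \<open>lact_L\<close> the identity is evaluated at \<open>y\<close> itself.\<close>

lemma ract_L: "el (L_prof T F) A B t \<Longrightarrow> ar (L_cat T (Src F)) B B' v \<Longrightarrow>
    ract (L_prof T F) A B B' v t = fam_ar (idx B') (\<lambda>y. rdx t (rdx v y))
       (\<lambda>y. ract F (ob A (rdx t (rdx v y))) (ob B (rdx v y)) (ob B' y) (cpt v y) (cpt t (rdx v y)))"
  unfolding ract_def Act_L L_prof_simps Ide_L by (simp add: ar_L_rdx el_L_rdx)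

lemma el_L_Act:
  assumes F: "profunctor F" and u: "ar (L_cat T (Trg F)) A' A u" and v: "ar (L_cat T (Src F)) B B' v"
    and t: "el (L_prof T F) A B t"
  shows "el (L_prof T F) A' B' (Act (L_prof T F) A' A B B' u v t)"
  unfolding Act_L
proof (rule el_L_fam)
  show "lmap A' B' (\<lambda>y. rdx u (rdx t (rdx v y)))"
    by (rule lmap_comp[OF ar_L_lmap[OF u] lmap_comp[OF el_L_lmap[OF t] ar_L_lmap[OF v]]]) (rule ar_Ob[OF v])+
qed (use u v in \<open>auto simp: ar_Ob intro!: el_Act[OF F] ar_L_cpt[OF u] ar_L_cpt[OF v] el_L_cpt[OF t]
      el_L_rdx[OF t] ar_L_rdx[OF v]\<close>)

lemma profunctor_L_prof:
  assumes F: "profunctor F"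
  shows "profunctor (L_prof T F)"
proof (intro profunctor.intro profunctor_axioms.intro)
  show "category (Src (L_prof T F))" "category (Trg (L_prof T F))"
    using F by (simp_all add: profunctor_def category_L_cat)
next
  fix d d' c c' u v x
  assume "d \<in> Ob (Trg (L_prof T F))" "d' \<in> Ob (Trg (L_prof T F))" "c \<in> Ob (Src (L_prof T F))"
   "c' \<in> Ob (Src (L_prof T F))" "u \<in> elts (Hom (Trg (L_prof T F)) d' d)"
   "v \<in> elts (Hom (Src (L_prof T F)) c c')" "x \<in> elts (El (L_prof T F) d c)"
  then have uv: "ar (L_cat T (Trg F)) d' d u" "ar (L_cat T (Src F)) c c' v" and x: "el (L_prof T F) d c x"
    by (auto simp: ar_def el_def)
  from el_L_Act[OF F uv x]
  show "Act (L_prof T F) d' d c c' u v x \<in> elts (El (L_prof T F) d' c')"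
    by (simp add: el_def)
next
  fix d c x
  assume "d \<in> Ob (Trg (L_prof T F))" "c \<in> Ob (Src (L_prof T F))" "x \<in> elts (El (L_prof T F) d c)"
  then have x: "el (L_prof T F) d c x" by (simp add: el_def)
  show "Act (L_prof T F) d d c c (Ide (Trg (L_prof T F)) d) (Ide (Src (L_prof T F)) c) x = x"
    unfolding Act_L L_prof_simps Ide_L
    by (rule fam_eqI[OF _ el_L_eta[OF x]]) (simp_all add: el_L_rdx[OF x] Act_Ide_Ide[OF F el_L_cpt[OF x]])
next
  fix d d' d'' c c' c'' u u' v v' x
  assume *: "d \<in> Ob (Trg (L_prof T F))" "d' \<in> Ob (Trg (L_prof T F))" "d'' \<in> Ob (Trg (L_prof T F))"
   "c \<in> Ob (Src (L_prof T F))" "c' \<in> Ob (Src (L_prof T F))" "c'' \<in> Ob (Src (L_prof T F))"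
   "u \<in> elts (Hom (Trg (L_prof T F)) d' d)" "u' \<in> elts (Hom (Trg (L_prof T F)) d'' d')"
   "v \<in> elts (Hom (Src (L_prof T F)) c c')" "v' \<in> elts (Hom (Src (L_prof T F)) c' c'')"
   "x \<in> elts (El (L_prof T F) d c)"
  then have uv: "ar (L_cat T (Trg F)) d' d u" "ar (L_cat T (Src F)) c c' v"
    and uv': "ar (L_cat T (Trg F)) d'' d' u'" "ar (L_cat T (Src F)) c' c'' v'"
    and x: "el (L_prof T F) d c x"
    by (auto simp: ar_def el_def)
  show "Act (L_prof T F) d'' d c c'' (Cmp (Trg (L_prof T F)) d'' d' d u u') (Cmp (Src (L_prof T F)) c c' c'' v' v) x
    = Act (L_prof T F) d'' d' c' c'' u' v' (Act (L_prof T F) d' d c c' u v x)"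
    unfolding Act_L L_prof_simps Cmp_L
    by (rule fam_ar_cong) (simp_all add: ar_L_rdx[OF uv(1)] ar_L_rdx[OF uv(2)] ar_L_rdx[OF uv'(2)] el_L_rdx[OF x]
      Act_Act[OF F ar_L_cpt[OF uv(1)] ar_L_cpt[OF uv'(1)] ar_L_cpt[OF uv(2)] ar_L_cpt[OF uv'(2)] el_L_cpt[OF x]])
qed

text \<open>A generator of \<open>LF(-, B)\<close> is a choice of a generator of \<open>F(-, ob B y)\<close> for every \<open>y\<close>.\<close>

lemma PR_L_prof:
  assumes F: "PR F"
  shows "PR (L_prof T F)"
proof -
  have "small_generated (L_prof T F)"
  proof (rule small_generatedI)
    fix B assume "B \<in> Ob (Src (L_prof T F))"
    then have B: "B \<in> Ob (L_cat T (Src F))" by simp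
    have "\<exists>(I :: 'u) d x. (\<forall>i\<in>elts I. el F (d i) (ob B y) (x i)) \<and>
      (\<forall>e z. el F e (ob B y) z \<longrightarrow> (\<exists>i\<in>elts I. \<exists>u. ar (Trg F) e (d i) u \<and> z = lact F e (d i) (ob B y) u (x i)))"
      if "y \<in> elts (idx B)" for y
      using PR_generators[OF F L_Ob_ob[OF B that]] by metis
    then obtain I :: "'u \<Rightarrow> 'u" and d x
      where I: "\<And>y i. y \<in> elts (idx B) \<Longrightarrow> i \<in> elts (I y) \<Longrightarrow> el F (d y i) (ob B y) (x y i)"
        and gen: "\<And>y e z. y \<in> elts (idx B) \<Longrightarrow> el F e (ob B y) z \<Longrightarrow>
          \<exists>i\<in>elts (I y). \<exists>u. ar (Trg F) e (d y i) u \<and> z = lact F e (d y i) (ob B y) u (x y i)"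
      by metis
    define J where "J = vset {vfun (idx B) i | i. \<forall>y\<in>elts (idx B). i y \<in> elts (I y)}"
    have J: "elts J = {vfun (idx B) i | i. \<forall>y\<in>elts (idx B). i y \<in> elts (I y)}"
      unfolding J_def by (rule elts_vset[OF small_vfun])
    \<comment> \<open>Index set and label are those of \<open>B\<close>, so \<open>X j\<close> is
      the identity on indices, and the index map of an arbitrary element is left to the arrow acting
      on \<open>X j\<close>.\<close>
    define D where "D j = fam_ob (idx B) (\<lambda>y. d y (app j y)) (lab B)" for j
    define X where "X j = fam_ar (idx B) (\<lambda>y. y) (\<lambda>y. x y (app j y))" for j
    have X: "el (L_prof T F) (D j) B (X j)" if "j \<in> elts J" for j
      unfolding X_def
    proof (rule el_L_fam[OF _ B refl])
      have *: "app j y \<in> elts (I y)" if "y \<in> elts (idx B)" for y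
        using \<open>j \<in> elts J\<close> that unfolding J by auto
      show "D j \<in> Ob (L_cat T (Trg F))"
        unfolding D_def using I * by (auto simp: L_Ob_lab[OF B] intro: el_Ob)
      show "lmap (D j) B (\<lambda>y. y)"
        using lmap_id[OF B] by (simp add: lmap_def D_def)
      show "el F (ob (D j) y) (ob B y) (x y (app j y))" if "y \<in> elts (idx B)" for y
        using I * that by (simp add: D_def)
    qed
    have "\<exists>i\<in>elts J. \<exists>u. ar (Trg (L_prof T F)) A (D i) u \<and> t = lact (L_prof T F) A (D i) B u (X i)"
      if t: "el (L_prof T F) A B t" for A t
    proof -
      obtain i u where i: "\<And>y. y \<in> elts (idx B) \<Longrightarrow> i y \<in> elts (I y)"
        and u: "\<And>y. y \<in> elts (idx B) \<Longrightarrow> ar (Trg F) (ob A (rdx t y)) (d y (i y)) (u y)"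
        and cpt: "\<And>y. y \<in> elts (idx B) \<Longrightarrow> cpt t y = lact F (ob A (rdx t y)) (d y (i y)) (ob B y) (u y) (x y (i y))"
        using gen[OF _ el_L_cpt[OF t]] by metis
      \<comment> \<open>Generators and arrows are chosen separately at each index; the choices of
        generators form one code in \<open>J\<close>, the arrows one arrow over the index map of
        \<open>t\<close>.\<close>
      let ?j = "vfun (idx B) i" and ?u = "fam_ar (idx B) (rdx t) u"
      have j: "?j \<in> elts J" using i unfolding J by blast
      have A: "A \<in> Ob (L_cat T (Trg F))" using el_Ob(1)[OF t] by simp
      have "ar (Trg (L_prof T F)) A (D ?j) ?u"
        using el_Ob(1)[OF X[OF j]] el_L_lmap[OF t] u
        by (auto simp: D_def A lmap_def intro!: ar_L_fam)
      moreover have "t = lact (L_prof T F) A (D ?j) B ?u (X ?j)"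
        by (rule fam_eqI[OF el_L_eta[OF t]]) (simp_all add: lact_L X_def D_def cpt)
      ultimately show ?thesis
        using j by blast
    qed
    with X show "\<exists>(I :: 'u) d x. (\<forall>i\<in>elts I. el (L_prof T F) (d i) B (x i)) \<and>
     (\<forall>A t. el (L_prof T F) A B t \<longrightarrow>
        (\<exists>i\<in>elts I. \<exists>u. ar (Trg (L_prof T F)) A (d i) u \<and> t = lact (L_prof T F) A (d i) B u (x i)))"
      by blast
  qed
  then show ?thesis
    using F profunctor_L_prof by (simp add: PR_def)
qed

lemma L_cell_simps [simp]: "Dom (L_cell T \<alpha>) = L_prof T (Dom \<alpha>)" "Cod (L_cell T \<alpha>) = L_prof T (Cod \<alpha>)"
    "ext_cell (L_cell T \<alpha>)"
  by (simp_all add: L_cell_def)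

lemma sends_L_cell:
  assumes "el (L_prof T (Dom \<alpha>)) A B t"
    and "\<And>y. y \<in> elts (idx B) \<Longrightarrow> sends \<alpha> (ob A (rdx t y)) (ob B y) (cpt t y) (\<zeta> y)"
    and "\<And>y. y \<in> elts (idx B) \<Longrightarrow> r y = rdx t y"
  shows "sends (L_cell T \<alpha>) A B t (fam_ar (idx B) r \<zeta>)"
  unfolding L_cell_def using assms by (intro sends_ptr) (simp_all add: sends_def)

lemma L_cell_cell:
  assumes \<alpha>: "\<alpha> \<in> cells F G"
  shows "L_cell T \<alpha> \<in> cells (L_prof T F) (L_prof T G)"
  unfolding L_cell_def cell_Dom[OF \<alpha>] cell_Cod[OF \<alpha>]
proof (rule cellI)
  note ST = cell_Src[OF \<alpha>] cell_Trg[OF \<alpha>]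
  fix A B t assume t: "el (L_prof T F) A B t"
  show "el (L_prof T G) A B (fam_ar (idx B) (rdx t) (\<lambda>y. Cpt \<alpha> (ob A (rdx t y)) (ob B y) (cpt t y)))"
    using el_Ob[OF t] by (intro el_L_fam el_L_lmap[OF t] cell_el[OF \<alpha>] el_L_cpt[OF t]) (simp_all add: ST)
  fix A' B' u v assume "ar (Trg (L_prof T F)) A' A u" "ar (Src (L_prof T F)) B B' v"
  then have u: "ar (L_cat T (Trg F)) A' A u" and v: "ar (L_cat T (Src F)) B B' v" by simp_all
  show "fam_ar (idx B') (rdx (Act (L_prof T F) A' A B B' u v t))
       (\<lambda>y. Cpt \<alpha> (ob A' (rdx (Act (L_prof T F) A' A B B' u v t) y)) (ob B' y) (cpt (Act (L_prof T F) A' A B B' u v t) y))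
     = Act (L_prof T G) A' A B B' u v (fam_ar (idx B) (rdx t) (\<lambda>y. Cpt \<alpha> (ob A (rdx t y)) (ob B y) (cpt t y)))"
    unfolding Act_L by (rule fam_ar_cong)
      (simp_all add: ar_L_rdx[OF v] el_L_rdx[OF t] cell_Act[OF \<alpha> ar_L_cpt[OF u] ar_L_cpt[OF v] el_L_cpt[OF t]])
qed (simp_all add: PR_L_prof cell_PR[OF \<alpha>] cell_Src[OF \<alpha>] cell_Trg[OF \<alpha>])

text \<open>Composition in \<open>LC\<close> is, index by index, the two-sided action of the hom
  profunctor of \<open>C\<close>, so the identity on elements is natural.\<close>

lemma L_unitor_cell: "category C \<Longrightarrow> L_unitor T C \<in> cells (hom_prof (L_cat T C)) (L_prof T (hom_prof C))"
  and sends_L_unitor: "ar (L_cat T C) A B t \<Longrightarrow> sends (L_unitor T C) A B t t"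
proof -
  show "sends (L_unitor T C) A B t t" if "ar (L_cat T C) A B t"
    unfolding L_unitor_def by (rule sends_ptr) (simp_all add: that)
  assume C: "category C"
  show "L_unitor T C \<in> cells (hom_prof (L_cat T C)) (L_prof T (hom_prof C))"
    unfolding L_unitor_def
  proof (rule cellI)
    fix A B A' B' u v t
    assume "ar (Trg (hom_prof (L_cat T C))) A' A u" "ar (Src (hom_prof (L_cat T C))) B B' v" "el (hom_prof (L_cat T C)) A B t"
    then have u: "ar (L_cat T C) A' A u" and v: "ar (L_cat T C) B B' v" and t: "ar (L_cat T C) A B t" by simp_all
    show "Act (hom_prof (L_cat T C)) A' A B B' u v t = Act (L_prof T (hom_prof C)) A' A B B' u v t"
      unfolding Act_L by (simp add: hom_prof_def Cmp_L ar_L_rdx[OF v] ar_L_rdx[OF t])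
  qed (simp_all add: PR_hom_prof PR_L_prof C category_L_cat)
qed

lemma L_unitor_simps [simp]: "Dom (L_unitor T C) = hom_prof (L_cat T C)" "Cod (L_unitor T C) = L_prof T (hom_prof C)"
    "ext_cell (L_unitor T C)"
  by (simp_all add: L_unitor_def)

lemma L_compositor_simps [simp]: "Dom (L_compositor T G F) = comp_prof (L_prof T G) (L_prof T F)"
    "Cod (L_compositor T G F) = L_prof T (comp_prof G F)" "ext_cell (L_compositor T G F)"
  by (simp_all add: L_compositor_def)

text \<open>The formula of \<open>L_compositor\<close> as a function of the pair, in the shape that
  \<open>coend_cell\<close> expects.\<close>

definition comp_fam :: "'u prof \<Rightarrow> 'u prof \<Rightarrow> 'u \<Rightarrow> 'u \<Rightarrow> 'u \<Rightarrow> 'u \<Rightarrow> 'u \<Rightarrow> 'u" where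
  "comp_fam G F A C B p q = fam_ar (idx C) (\<lambda>y. rdx p (rdx q y))
         (\<lambda>y. coend_in G F (ob A (rdx p (rdx q y))) (ob C y) (ob B (rdx q y)) (cpt p (rdx q y)) (cpt q y))"

text \<open>Gliding along an arrow \<open>v\<close> of families is, at each index, gliding along a
  component of \<open>v\<close>. Hence the family of classes depends only on the class of the
  pair.\<close>

lemma
  fixes G F :: "'u prof"
  assumes G: "PR G" and F: "PR F" and GF: "Src G = Trg F"
  shows L_compositor_cell: "L_compositor T G F \<in> cells (comp_prof (L_prof T G) (L_prof T F)) (L_prof T (comp_prof G F))"
    and sends_L_compositor_fam: "el (L_prof T G) A B p \<Longrightarrow> el (L_prof T F) B D q \<Longrightarrow>
      sends (L_compositor T G F) A D (coend_in (L_prof T G) (L_prof T F) A D B p q) (comp_fam G F A D B p q)"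
proof -
  let ?\<phi> = "comp_fam G F"
  note LG = PR_L_prof[OF G] and LF = PR_L_prof[OF F]
  have LGF: "Src (L_prof T G) = Trg (L_prof T F)" using GF by simp
  have eq: "L_compositor T G F = ptr (comp_prof (L_prof T G) (L_prof T F)) (L_prof T (comp_prof G F))
      (\<lambda>e c p. ?\<phi> e c (comp1 p) (comp2 p) (comp3 p))"
    by (simp add: L_compositor_def comp_fam_def Let_def)
  have 1: "?\<phi> e c d' (ract (L_prof T G) e d d' v x) y = ?\<phi> e c d x (lact (L_prof T F) d d' c v y)"
    if v': "ar (Trg (L_prof T F)) d d' v" and x: "el (L_prof T G) e d x" and y: "el (L_prof T F) d' c y" for e c d d' v x y
  proof -
    have v: "ar (L_cat T (Trg F)) d d' v" "ar (L_cat T (Src G)) d d' v" using v' GF by simp_all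
    show ?thesis
      unfolding comp_fam_def ract_L[OF x v(2)] lact_L
      by (rule fam_ar_cong) (simp_all add: el_L_rdx[OF y] coend_glide[OF ar_L_cpt[OF v(1)] el_L_cpt[OF x] el_L_cpt[OF y]] ar_L_rdx[OF v(1)])
  qed
  have 2: "el (L_prof T (comp_prof G F)) e c (?\<phi> e c d x y)"
    if x: "el (L_prof T G) e d x" and y: "el (L_prof T F) d c y" for e c d x y
    unfolding comp_fam_def
    using el_Ob[OF x] el_Ob[OF y]
    by (intro el_L_fam lmap_comp[OF el_L_lmap[OF x] el_L_lmap[OF y]])
      (auto intro!: el_comp[OF G F GF el_L_cpt[OF x] el_L_cpt[OF y]] el_L_rdx[OF y])
  have 3: "?\<phi> e' c' d (lact (L_prof T G) e' e d u x) (ract (L_prof T F) d c c' v y)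
      = Act (L_prof T (comp_prof G F)) e' e c c' u v (?\<phi> e c d x y)"
    if u: "ar (Trg (L_prof T G)) e' e u" and v: "ar (Src (L_prof T F)) c c' v" and x: "el (L_prof T G) e d x"
      and y: "el (L_prof T F) d c y" for e e' c c' d u v x y
  proof -
    have u: "ar (L_cat T (Trg G)) e' e u" and v: "ar (L_cat T (Src F)) c c' v" using u v by simp_all
    show ?thesis
      unfolding comp_fam_def ract_L[OF y v] lact_L Act_L
      by (rule fam_ar_cong) (simp_all add: ar_L_rdx[OF v] el_L_rdx[OF y] el_L_rdx[OF x]
         Act_comp[OF G F GF el_L_cpt[OF x] el_L_cpt[OF y] ar_L_cpt[OF u] ar_L_cpt[OF v]])
  qed
  note * = coend_cell[where \<phi> = ?\<phi>, OF LG LF LGF PR_L_prof[OF PR_comp[OF G F GF]] _ _ 1 2 3 eq]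
  show "L_compositor T G F \<in> cells (comp_prof (L_prof T G) (L_prof T F)) (L_prof T (comp_prof G F))"
    by (rule *(1)) simp_all
  show "sends (L_compositor T G F) A D (coend_in (L_prof T G) (L_prof T F) A D B p q) (comp_fam G F A D B p q)"
    if "el (L_prof T G) A B p" "el (L_prof T F) B D q"
    by (rule *(2)) (simp_all add: that)
qed

text \<open>The resulting family may be given in simplified form, by agreement at each index; the
  diagram chases below always name their values this way.\<close>

lemma sends_L_compositor:
  assumes "PR G" "PR F" "Src G = Trg F" "el (L_prof T G) A B p" "el (L_prof T F) B D q"
    and "\<And>y. y \<in> elts (idx D) \<Longrightarrow> rdx p (rdx q y) = r y"
    and "\<And>y. y \<in> elts (idx D) \<Longrightarrow>
      coend_in G F (ob A (rdx p (rdx q y))) (ob D y) (ob B (rdx q y)) (cpt p (rdx q y)) (cpt q y) = \<zeta> y"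
  shows "sends (L_compositor T G F) A D (coend_in (L_prof T G) (L_prof T F) A D B p q) (fam_ar (idx D) r \<zeta>)"
proof -
  have "comp_fam G F A D B p q = fam_ar (idx D) r \<zeta>"
    unfolding comp_fam_def using assms(6,7) by (rule fam_ar_cong[OF refl])
  then show ?thesis
    using sends_L_compositor_fam[OF assms(1-5)] by simp
qed

end

section \<open>Composites of oplax functors\<close>

context bicategory
begin

lemma hom1_Arr: "f \<in> hom1 x y \<Longrightarrow> f \<in> BArr B"
  by (simp add: hom1_def)

lemma hom1_Ob: "f \<in> hom1 x y \<Longrightarrow> x \<in> BOb B" "f \<in> hom1 x y \<Longrightarrow> y \<in> BOb B"
  using src_closed[of f] trg_closed[of f] by (auto simp: hom1_def)

lemma hom2_hom1: "\<alpha> \<in> hom2 f g \<Longrightarrow> f \<in> hom1 x y \<Longrightarrow> g \<in> hom1 x y"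
  using cell_src[of \<alpha>] cell_trg[of \<alpha>] cod_closed[of \<alpha>] by (auto simp: hom1_def hom2_def)

lemma lwhisker_closed: "f \<in> hom1 x y \<Longrightarrow> g \<in> hom1 y z \<Longrightarrow> \<alpha> \<in> hom2 f f' \<Longrightarrow> g \<lhd> \<alpha> \<in> hom2 (g \<odot> f) (g \<odot> f')"
  unfolding lwhisker_def by (rule hcomp_closed[OF _ _ _ id_closed]) (auto dest: hom1_Arr)

lemma rwhisker_closed: "f \<in> hom1 x y \<Longrightarrow> g \<in> hom1 y z \<Longrightarrow> \<beta> \<in> hom2 g g' \<Longrightarrow> \<beta> \<rhd> f \<in> hom2 (g \<odot> f) (g' \<odot> f)"
  unfolding rwhisker_def by (rule hcomp_closed[OF _ _ id_closed]) (auto dest: hom1_Arr)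

lemma lwhisker_vcomp: "f \<in> hom1 x y \<Longrightarrow> g \<in> hom1 y z \<Longrightarrow> \<alpha> \<in> hom2 f f' \<Longrightarrow> \<alpha>' \<in> hom2 f' f'' \<Longrightarrow>
    g \<lhd> (\<alpha>' \<bullet> \<alpha>) = (g \<lhd> \<alpha>') \<bullet> (g \<lhd> \<alpha>)"
  unfolding lwhisker_def
  using interchange[of f x y g z \<alpha> f' \<alpha>' f'' "bid B g" g "bid B g" g] id_closed[OF hom1_Arr, of g y z]
  by (simp add: vcomp_id_left)

lemma rwhisker_vcomp: "f \<in> hom1 x y \<Longrightarrow> g \<in> hom1 y z \<Longrightarrow> \<beta> \<in> hom2 g g' \<Longrightarrow> \<beta>' \<in> hom2 g' g'' \<Longrightarrow>
    (\<beta>' \<bullet> \<beta>) \<rhd> f = (\<beta>' \<rhd> f) \<bullet> (\<beta> \<rhd> f)"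
  unfolding rwhisker_def
  using interchange[of f x y g z "bid B f" f "bid B f" f \<beta> g' \<beta>' g''] id_closed[OF hom1_Arr, of f x y]
  by (simp add: vcomp_id_left)

lemma lwhisker_id: "f \<in> hom1 x y \<Longrightarrow> g \<in> hom1 y z \<Longrightarrow> g \<lhd> bid B f = bid B (g \<odot> f)"
  and rwhisker_id: "f \<in> hom1 x y \<Longrightarrow> g \<in> hom1 y z \<Longrightarrow> bid B g \<rhd> f = bid B (g \<odot> f)"
  by (simp_all add: lwhisker_def rwhisker_def hcomp_id)

lemma oplax_functor_id: "oplax_functor B (id_endo B)"
proof (intro oplax_functor.intro oplax_functor_axioms.intro bicategory_axioms, unfold id_endo_def endo.simps)
  fix f g x y z \<alpha> \<beta> f' g'
  assume *: "f \<in> hom1 x y" "g \<in> hom1 y z" "\<alpha> \<in> hom2 f f'" "\<beta> \<in> hom2 g g'"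
  show "bid B (g' \<odot> f') \<bullet> (\<beta> \<star> \<alpha>) = (\<beta> \<star> \<alpha>) \<bullet> bid B (g \<odot> f)"
    using hcomp_closed[OF *] by (simp add: vcomp_id_left vcomp_id_right)
next
  fix f w x g y h z
  assume f: "f \<in> hom1 w x" and g: "g \<in> hom1 x y" and h: "h \<in> hom1 y z"
  note gf = comp_closed[OF f g] and hg = comp_closed[OF g h]
  note a = assoc_closed[OF f g h] and i1 = id_closed[OF hom1_Arr[OF comp_closed[OF f hg]]]
  show "vpath [bid B ((h \<odot> g) \<odot> f), bid B (h \<odot> g) \<rhd> f, \<a> h g f] = vpath [\<a> h g f, bid B (h \<odot> g \<odot> f), h \<lhd> bid B (g \<odot> f)]"
    by (simp add: rwhisker_id[OF f hg] lwhisker_id[OF gf h] vcomp_id_left[OF i1] vcomp_id_left[OF a] vcomp_id_right[OF a])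
next
  fix f x y assume f: "f \<in> hom1 x y"
  note y = one_closed[OF hom1_Ob(2)[OF f]] and x = one_closed[OF hom1_Ob(1)[OF f]]
  note i = id_closed[OF hom1_Arr[OF comp_closed[OF f y]]] id_closed[OF hom1_Arr[OF comp_closed[OF x f]]]
  show "vpath [bid B (\<one> y \<odot> f), bid B (\<one> y) \<rhd> f, \<l> f] = \<l> f"
    by (simp add: rwhisker_id[OF f y] vcomp_id_left[OF i(1)] vcomp_id_right[OF lunit_closed[OF f]])
  show "vpath [bid B (f \<odot> \<one> x), f \<lhd> bid B (\<one> x), \<r> f] = \<r> f"
    by (simp add: lwhisker_id[OF x f] vcomp_id_left[OF i(2)] vcomp_id_right[OF runit_closed[OF f]])
qed (auto intro: id_closed comp_closed one_closed hom1_Arr)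

end

context oplax_functor
begin

abbreviation "F_0 \<equiv> F0 F"
abbreviation "F_1 \<equiv> F1 F"
abbreviation "F_2 \<equiv> F2 F"
abbreviation "u \<equiv> Funit F"
abbreviation "c \<equiv> Fcomp F"

lemma F1_Arr: "f \<in> BArr B \<Longrightarrow> F_1 f \<in> BArr B"
  using F1_closed[of f "bsrc B f" "btrg B f"] by (simp add: hom1_def)

text \<open>This holds for the square of any oplax functor. A structural cell of the square is the
  image under \<open>F\<close> of a structural cell, followed by a structural cell at images. Each
  coherence law is accordingly pasted from the law at images and the image of the law, with
  naturality of \<open>Fcomp\<close> to bring the layers together.\<close>

lemma oplax_functor_square: "oplax_functor B (square_endo B F)"
proof (intro oplax_functor.intro oplax_functor_axioms.intro bicategory_axioms, unfold square_endo_def endo.simps)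
  fix f g \<alpha> assume "\<alpha> \<in> hom2 f g"
  then show "F_2 (F_2 \<alpha>) \<in> hom2 (F_1 (F_1 f)) (F_1 (F_1 g))" by (intro F2_closed)
next
  fix f g h \<alpha> \<beta> assume "\<alpha> \<in> hom2 f g" "\<beta> \<in> hom2 g h"
  then show "F_2 (F_2 (\<beta> \<bullet> \<alpha>)) = F_2 (F_2 \<beta>) \<bullet> F_2 (F_2 \<alpha>)"
    by (simp add: F2_vcomp[of \<alpha> f g \<beta> h] F2_vcomp[OF F2_closed F2_closed, of \<alpha> f g \<beta> h])
next
  fix x assume "x \<in> BOb B"
  then show "vpath [F_2 (u x), u (F_0 x)] \<in> hom2 (F_1 (F_1 (\<one> x))) (\<one> (F_0 (F_0 x)))"
    by (auto intro!: vcomp_closed F2_closed Funit_closed F0_closed)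
next
  fix f x y g z assume *: "f \<in> hom1 x y" "g \<in> hom1 y z"
  then show "vpath [F_2 (c g f), c (F_1 g) (F_1 f)] \<in> hom2 (F_1 (F_1 (g \<odot> f))) (F_1 (F_1 g) \<odot> F_1 (F_1 f))"
    by (auto intro!: vcomp_closed F2_closed Fcomp_closed F1_closed)
  fix \<alpha> f' \<beta> g' assume \<alpha>: "\<alpha> \<in> hom2 f f'" and \<beta>: "\<beta> \<in> hom2 g g'"
  note f'g' = hom2_hom1[OF \<alpha> *(1)] hom2_hom1[OF \<beta> *(2)]
  note c = Fcomp_closed[OF *] and c' = Fcomp_closed[OF f'g'] and \<alpha>\<beta> = hcomp_closed[OF * \<alpha> \<beta>]
  note F_\<alpha>\<beta> = hcomp_closed[OF F1_closed[OF *(1)] F1_closed[OF *(2)] F2_closed[OF \<alpha>] F2_closed[OF \<beta>]]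
  note FF = Fcomp_closed[OF F1_closed[OF *(1)] F1_closed[OF *(2)]]
  note FF' = Fcomp_closed[OF F1_closed[OF f'g'(1)] F1_closed[OF f'g'(2)]]
  have "(c (F_1 g') (F_1 f') \<bullet> F_2 (c g' f')) \<bullet> F_2 (F_2 (\<beta> \<star> \<alpha>))
      = c (F_1 g') (F_1 f') \<bullet> F_2 (c g' f' \<bullet> F_2 (\<beta> \<star> \<alpha>))"
    by (simp only: vcomp_assoc[OF F2_closed[OF F2_closed[OF \<alpha>\<beta>]] F2_closed[OF c'] FF'] F2_vcomp[OF F2_closed[OF \<alpha>\<beta>] c'])
  also have "\<dots> = c (F_1 g') (F_1 f') \<bullet> (F_2 (F_2 \<beta> \<star> F_2 \<alpha>) \<bullet> F_2 (c g f))"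
    by (simp only: Fcomp_natural[OF * \<alpha> \<beta>] F2_vcomp[OF c F_\<alpha>\<beta>])
  also have "\<dots> = (c (F_1 g') (F_1 f') \<bullet> F_2 (F_2 \<beta> \<star> F_2 \<alpha>)) \<bullet> F_2 (c g f)"
    by (simp only: vcomp_assoc[OF F2_closed[OF c] F2_closed[OF F_\<alpha>\<beta>] FF'])
  also have "\<dots> = ((F_2 (F_2 \<beta>) \<star> F_2 (F_2 \<alpha>)) \<bullet> c (F_1 g) (F_1 f)) \<bullet> F_2 (c g f)"
    by (simp only: Fcomp_natural[OF F1_closed[OF *(1)] F1_closed[OF *(2)] F2_closed[OF \<alpha>] F2_closed[OF \<beta>]])
  also have "\<dots> = (F_2 (F_2 \<beta>) \<star> F_2 (F_2 \<alpha>)) \<bullet> (c (F_1 g) (F_1 f) \<bullet> F_2 (c g f))"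
    by (rule vcomp_assoc[OF F2_closed[OF c] FF hcomp_closed[OF F1_closed[OF F1_closed[OF *(1)]]
        F1_closed[OF F1_closed[OF *(2)]] F2_closed[OF F2_closed[OF \<alpha>]] F2_closed[OF F2_closed[OF \<beta>]]]])
  finally show "vpath [F_2 (c g' f'), c (F_1 g') (F_1 f')] \<bullet> F_2 (F_2 (\<beta> \<star> \<alpha>))
     = (F_2 (F_2 \<beta>) \<star> F_2 (F_2 \<alpha>)) \<bullet> vpath [F_2 (c g f), c (F_1 g) (F_1 f)]"
    by simp
next
  fix f w x g y h z assume f: "f \<in> hom1 w x" and g: "g \<in> hom1 x y" and h: "h \<in> hom1 y z"
  note Ff = F1_closed[OF f] and Fg = F1_closed[OF g] and Fh = F1_closed[OF h]
  note FFf = F1_closed[OF Ff] and FFg = F1_closed[OF Fg] and FFh = F1_closed[OF Fh]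
  note gf = comp_closed[OF f g] and hg = comp_closed[OF g h]
  note Fgf = F1_closed[OF gf] and Fhg = F1_closed[OF hg]
  note FgFf = comp_closed[OF Ff Fg] and FhFg = comp_closed[OF Fg Fh]
  note c_gf = Fcomp_closed[OF f g] and c_hg = Fcomp_closed[OF g h]
  note c_hg_f = Fcomp_closed[OF f hg] and c_h_gf = Fcomp_closed[OF gf h]
  note d_gf = Fcomp_closed[OF Ff Fg] and d_hg = Fcomp_closed[OF Fg Fh]
  note d_hg_f = Fcomp_closed[OF Ff FhFg] and d_h_gf = Fcomp_closed[OF FgFf Fh]
  note e_hg_f = Fcomp_closed[OF Ff Fhg] and e_h_gf = Fcomp_closed[OF Fgf Fh]
  note a = assoc_closed[OF f g h] and Fa = assoc_closed[OF Ff Fg Fh] and FFa = assoc_closed[OF FFf FFg FFh]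
  note A1 = rwhisker_closed[OF FFf F1_closed[OF FhFg] d_hg]
  note A2 = rwhisker_closed[OF FFf F1_closed[OF Fhg] F2_closed[OF c_hg]]
  note A3 = rwhisker_closed[OF Ff Fhg c_hg]
  note B1 = lwhisker_closed[OF F1_closed[OF FgFf] FFh d_gf]
  note B2 = lwhisker_closed[OF F1_closed[OF Fgf] FFh F2_closed[OF c_gf]]
  note B3 = lwhisker_closed[OF Fgf Fh c_gf]
  \<comment> \<open>Naturality of \<open>Fcomp\<close> in its left argument, with an identity on the
    right: this exchanges the inner layer with the outer one.\<close>
  have nat1: "(F_2 (c h g) \<rhd> F_1 (F_1 f)) \<bullet> c (F_1 (h \<odot> g)) (F_1 f) = c (F_1 h \<odot> F_1 g) (F_1 f) \<bullet> F_2 (c h g \<rhd> F_1 f)"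
    using Fcomp_natural[OF Ff Fhg id_closed[OF hom1_Arr[OF Ff]] c_hg] F2_id[OF hom1_Arr[OF Ff]] by (simp add: rwhisker_def)
  have nat2: "(F_1 (F_1 h) \<lhd> F_2 (c g f)) \<bullet> c (F_1 h) (F_1 (g \<odot> f)) = c (F_1 h) (F_1 g \<odot> F_1 f) \<bullet> F_2 (F_1 h \<lhd> c g f)"
    using Fcomp_natural[OF Fgf Fh c_gf id_closed[OF hom1_Arr[OF Fh]]] F2_id[OF hom1_Arr[OF Fh]] by (simp add: lwhisker_def)
  have ass1: "\<a> (F_1 h) (F_1 g) (F_1 f) \<bullet> ((c h g \<rhd> F_1 f) \<bullet> c (h \<odot> g) f)
      = (F_1 h \<lhd> c g f) \<bullet> (c h (g \<odot> f) \<bullet> F_2 (\<a> h g f))"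
    using Fcomp_assoc[OF f g h] by simp
  have ass2: "\<a> (F_1 (F_1 h)) (F_1 (F_1 g)) (F_1 (F_1 f)) \<bullet> ((c (F_1 h) (F_1 g) \<rhd> F_1 (F_1 f)) \<bullet> c (F_1 h \<odot> F_1 g) (F_1 f))
      = (F_1 (F_1 h) \<lhd> c (F_1 g) (F_1 f)) \<bullet> (c (F_1 h) (F_1 g \<odot> F_1 f) \<bullet> F_2 (\<a> (F_1 h) (F_1 g) (F_1 f)))"
    using Fcomp_assoc[OF Ff Fg Fh] by simp
  let ?a = "\<a> (F_1 (F_1 h)) (F_1 (F_1 g)) (F_1 (F_1 f))" and ?A1 = "c (F_1 h) (F_1 g) \<rhd> F_1 (F_1 f)"
    and ?A2 = "F_2 (c h g) \<rhd> F_1 (F_1 f)" and ?C1 = "c (F_1 (h \<odot> g)) (F_1 f)" and ?C2 = "F_2 (c (h \<odot> g) f)"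
    and ?B1 = "F_1 (F_1 h) \<lhd> c (F_1 g) (F_1 f)" and ?B2 = "F_1 (F_1 h) \<lhd> F_2 (c g f)"
    and ?D = "c (F_1 h) (F_1 g \<odot> F_1 f)" and ?E = "c (F_1 h \<odot> F_1 g) (F_1 f)"
    and ?G1 = "c (F_1 h) (F_1 (g \<odot> f))" and ?G2 = "F_2 (c h (g \<odot> f))"
  have "?a \<bullet> (((c (F_1 h) (F_1 g) \<bullet> F_2 (c h g)) \<rhd> F_1 (F_1 f)) \<bullet> (?C1 \<bullet> ?C2))
      = ?a \<bullet> ((?A1 \<bullet> ?A2) \<bullet> (?C1 \<bullet> ?C2))"
    by (simp only: rwhisker_vcomp[OF FFf F1_closed[OF Fhg] F2_closed[OF c_hg] d_hg])
  also have "\<dots> = ?a \<bullet> (?A1 \<bullet> ((?A2 \<bullet> ?C1) \<bullet> ?C2))"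
    by (simp only: vcomp_assoc[OF vcomp_closed[OF F2_closed[OF c_hg_f] e_hg_f] A2 A1] vcomp_assoc[OF F2_closed[OF c_hg_f] e_hg_f A2])
  also have "\<dots> = ?a \<bullet> ((?A1 \<bullet> ?E) \<bullet> (F_2 (c h g \<rhd> F_1 f) \<bullet> ?C2))"
    by (simp only: nat1 vcomp_assoc[OF F2_closed[OF c_hg_f] F2_closed[OF A3] d_hg_f]
        vcomp_assoc[OF vcomp_closed[OF F2_closed[OF c_hg_f] F2_closed[OF A3]] d_hg_f A1])
  also have "\<dots> = (?a \<bullet> (?A1 \<bullet> ?E)) \<bullet> (F_2 (c h g \<rhd> F_1 f) \<bullet> ?C2)"
    by (rule vcomp_assoc[symmetric, OF vcomp_closed[OF F2_closed[OF c_hg_f] F2_closed[OF A3]] vcomp_closed[OF d_hg_f A1] FFa])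
  \<comment> \<open>The outer layer: associativity of \<open>Fcomp\<close> at the images under
    \<open>F_1\<close>.\<close>
  also have "\<dots> = (?B1 \<bullet> (?D \<bullet> F_2 (\<a> (F_1 h) (F_1 g) (F_1 f)))) \<bullet> F_2 ((c h g \<rhd> F_1 f) \<bullet> c (h \<odot> g) f)"
    by (simp only: ass2 F2_vcomp[OF c_hg_f A3])
  also have "\<dots> = ?B1 \<bullet> (?D \<bullet> F_2 (\<a> (F_1 h) (F_1 g) (F_1 f) \<bullet> ((c h g \<rhd> F_1 f) \<bullet> c (h \<odot> g) f)))"
    by (simp only: F2_vcomp[OF vcomp_closed[OF c_hg_f A3] Fa]
        vcomp_assoc[OF F2_closed[OF vcomp_closed[OF c_hg_f A3]] vcomp_closed[OF F2_closed[OF Fa] d_h_gf] B1]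
        vcomp_assoc[OF F2_closed[OF vcomp_closed[OF c_hg_f A3]] F2_closed[OF Fa] d_h_gf])
  \<comment> \<open>The inner layer: associativity of \<open>Fcomp\<close> itself, now underneath
    \<open>F_2\<close>.\<close>
  also have "\<dots> = ?B1 \<bullet> (?D \<bullet> (F_2 (F_1 h \<lhd> c g f) \<bullet> (?G2 \<bullet> F_2 (F_2 (\<a> h g f)))))"
    by (simp only: ass1 F2_vcomp[OF vcomp_closed[OF F2_closed[OF a] c_h_gf] B3] F2_vcomp[OF F2_closed[OF a] c_h_gf])
  also have "\<dots> = ?B1 \<bullet> ((?B2 \<bullet> ?G1) \<bullet> (?G2 \<bullet> F_2 (F_2 (\<a> h g f))))"
    by (simp only: nat2 vcomp_assoc[OF vcomp_closed[OF F2_closed[OF F2_closed[OF a]] F2_closed[OF c_h_gf]] F2_closed[OF B3] d_h_gf])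
  also have "\<dots> = (?B1 \<bullet> ?B2) \<bullet> ((?G1 \<bullet> ?G2) \<bullet> F_2 (F_2 (\<a> h g f)))"
    by (simp only: vcomp_assoc[OF vcomp_closed[OF F2_closed[OF F2_closed[OF a]] F2_closed[OF c_h_gf]] e_h_gf B2]
        vcomp_assoc[OF vcomp_closed[OF vcomp_closed[OF F2_closed[OF F2_closed[OF a]] F2_closed[OF c_h_gf]] e_h_gf] B2 B1]
        vcomp_assoc[OF F2_closed[OF F2_closed[OF a]] F2_closed[OF c_h_gf] e_h_gf])
  also have "\<dots> = (F_1 (F_1 h) \<lhd> (c (F_1 g) (F_1 f) \<bullet> F_2 (c g f))) \<bullet> ((?G1 \<bullet> ?G2) \<bullet> F_2 (F_2 (\<a> h g f)))"
    by (simp only: lwhisker_vcomp[OF F1_closed[OF Fgf] FFh F2_closed[OF c_gf] d_gf])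
  finally show "vpath [vpath [F_2 (c (h \<odot> g) f), c (F_1 (h \<odot> g)) (F_1 f)],
        vpath [F_2 (c h g), c (F_1 h) (F_1 g)] \<rhd> F_1 (F_1 f), \<a> (F_1 (F_1 h)) (F_1 (F_1 g)) (F_1 (F_1 f))]
      = vpath [F_2 (F_2 (\<a> h g f)), vpath [F_2 (c h (g \<odot> f)), c (F_1 h) (F_1 (g \<odot> f))],
        F_1 (F_1 h) \<lhd> vpath [F_2 (c g f), c (F_1 g) (F_1 f)]]"
    by simp
next
  fix f x y assume f: "f \<in> hom1 x y"
  note Ff = F1_closed[OF f] note FFf = F1_closed[OF Ff]
  note x = hom1_Ob(1)[OF f] and y = hom1_Ob(2)[OF f]
  note ox = one_closed[OF x] and oy = one_closed[OF y]
  note oFx = one_closed[OF F0_closed[OF x]] and oFy = one_closed[OF F0_closed[OF y]]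
  note ux = Funit_closed[OF x] and uy = Funit_closed[OF y]
  note uFx = Funit_closed[OF F0_closed[OF x]] and uFy = Funit_closed[OF F0_closed[OF y]]
  note cl = Fcomp_closed[OF f oy] and cr = Fcomp_closed[OF ox f]
  note dl = Fcomp_closed[OF Ff oFy] and dr = Fcomp_closed[OF oFx Ff]
  note el = Fcomp_closed[OF Ff F1_closed[OF oy]] and er = Fcomp_closed[OF F1_closed[OF ox] Ff]
  note wl = rwhisker_closed[OF Ff F1_closed[OF oy] uy] and wr = lwhisker_closed[OF F1_closed[OF ox] Ff ux]
  note vl = rwhisker_closed[OF FFf F1_closed[OF oFy] uFy] and vr = lwhisker_closed[OF F1_closed[OF oFx] FFf uFx]
  note zl = rwhisker_closed[OF FFf F1_closed[OF F1_closed[OF oy]] F2_closed[OF uy]]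
  note zr = lwhisker_closed[OF F1_closed[OF F1_closed[OF ox]] FFf F2_closed[OF ux]]
  \<comment> \<open>The unit laws follow the same pattern; the layers are exchanged by naturality of
    \<open>Fcomp\<close> at the unit cell.\<close>
  have natl: "(F_2 (u y) \<rhd> F_1 (F_1 f)) \<bullet> c (F_1 (\<one> y)) (F_1 f) = c (\<one> (F_0 y)) (F_1 f) \<bullet> F_2 (u y \<rhd> F_1 f)"
    using Fcomp_natural[OF Ff F1_closed[OF oy] id_closed[OF hom1_Arr[OF Ff]] uy] F2_id[OF hom1_Arr[OF Ff]]
    by (simp add: rwhisker_def)
  have natr: "(F_1 (F_1 f) \<lhd> F_2 (u x)) \<bullet> c (F_1 f) (F_1 (\<one> x)) = c (F_1 f) (\<one> (F_0 x)) \<bullet> F_2 (F_1 f \<lhd> u x)"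
    using Fcomp_natural[OF F1_closed[OF ox] Ff ux id_closed[OF hom1_Arr[OF Ff]]] F2_id[OF hom1_Arr[OF Ff]]
    by (simp add: lwhisker_def)
  have "\<l> (F_1 (F_1 f)) \<bullet> (((u (F_0 y) \<bullet> F_2 (u y)) \<rhd> F_1 (F_1 f)) \<bullet> (c (F_1 (\<one> y)) (F_1 f) \<bullet> F_2 (c (\<one> y) f)))
    = \<l> (F_1 (F_1 f)) \<bullet> ((u (F_0 y) \<rhd> F_1 (F_1 f)) \<bullet> (((F_2 (u y) \<rhd> F_1 (F_1 f)) \<bullet> c (F_1 (\<one> y)) (F_1 f)) \<bullet> F_2 (c (\<one> y) f)))"
    by (simp only: rwhisker_vcomp[OF FFf F1_closed[OF F1_closed[OF oy]] F2_closed[OF uy] uFy]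
        vcomp_assoc[OF vcomp_closed[OF F2_closed[OF cl] el] zl vl] vcomp_assoc[OF F2_closed[OF cl] el zl])
  also have "\<dots> = (\<l> (F_1 (F_1 f)) \<bullet> ((u (F_0 y) \<rhd> F_1 (F_1 f)) \<bullet> c (\<one> (F_0 y)) (F_1 f))) \<bullet> (F_2 (u y \<rhd> F_1 f) \<bullet> F_2 (c (\<one> y) f))"
    by (simp only: natl vcomp_assoc[OF F2_closed[OF cl] F2_closed[OF wl] dl]
        vcomp_assoc[OF vcomp_closed[OF F2_closed[OF cl] F2_closed[OF wl]] dl vl]
        vcomp_assoc[OF vcomp_closed[OF F2_closed[OF cl] F2_closed[OF wl]] vcomp_closed[OF dl vl] lunit_closed[OF FFf]])
  also have "\<dots> = F_2 (\<l> (F_1 f)) \<bullet> F_2 ((u y \<rhd> F_1 f) \<bullet> c (\<one> y) f)"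
    using Fcomp_lunit[OF Ff] by (simp only: vpath.simps F2_vcomp[OF cl wl])
  also have "\<dots> = F_2 (F_2 (\<l> f))"
    using Fcomp_lunit[OF f] by (simp only: vpath.simps F2_vcomp[OF vcomp_closed[OF cl wl] lunit_closed[OF Ff], symmetric])
  finally show "vpath [vpath [F_2 (c (\<one> y) f), c (F_1 (\<one> y)) (F_1 f)],
        vpath [F_2 (u y), u (F_0 y)] \<rhd> F_1 (F_1 f), \<l> (F_1 (F_1 f))] = F_2 (F_2 (\<l> f))"
    by simp
  have "\<r> (F_1 (F_1 f)) \<bullet> ((F_1 (F_1 f) \<lhd> (u (F_0 x) \<bullet> F_2 (u x))) \<bullet> (c (F_1 f) (F_1 (\<one> x)) \<bullet> F_2 (c f (\<one> x))))
    = \<r> (F_1 (F_1 f)) \<bullet> ((F_1 (F_1 f) \<lhd> u (F_0 x)) \<bullet> (((F_1 (F_1 f) \<lhd> F_2 (u x)) \<bullet> c (F_1 f) (F_1 (\<one> x))) \<bullet> F_2 (c f (\<one> x))))"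
    by (simp only: lwhisker_vcomp[OF F1_closed[OF F1_closed[OF ox]] FFf F2_closed[OF ux] uFx]
        vcomp_assoc[OF vcomp_closed[OF F2_closed[OF cr] er] zr vr] vcomp_assoc[OF F2_closed[OF cr] er zr])
  also have "\<dots> = (\<r> (F_1 (F_1 f)) \<bullet> ((F_1 (F_1 f) \<lhd> u (F_0 x)) \<bullet> c (F_1 f) (\<one> (F_0 x)))) \<bullet> (F_2 (F_1 f \<lhd> u x) \<bullet> F_2 (c f (\<one> x)))"
    by (simp only: natr vcomp_assoc[OF F2_closed[OF cr] F2_closed[OF wr] dr]
        vcomp_assoc[OF vcomp_closed[OF F2_closed[OF cr] F2_closed[OF wr]] dr vr]
        vcomp_assoc[OF vcomp_closed[OF F2_closed[OF cr] F2_closed[OF wr]] vcomp_closed[OF dr vr] runit_closed[OF FFf]])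
  also have "\<dots> = F_2 (\<r> (F_1 f)) \<bullet> F_2 ((F_1 f \<lhd> u x) \<bullet> c f (\<one> x))"
    using Fcomp_runit[OF Ff] by (simp only: vpath.simps F2_vcomp[OF cr wr])
  also have "\<dots> = F_2 (F_2 (\<r> f))"
    using Fcomp_runit[OF f] by (simp only: vpath.simps F2_vcomp[OF vcomp_closed[OF cr wr] runit_closed[OF Ff], symmetric])
  finally show "vpath [vpath [F_2 (c f (\<one> x)), c (F_1 f) (F_1 (\<one> x))],
        F_1 (F_1 f) \<lhd> vpath [F_2 (u x), u (F_0 x)], \<r> (F_1 (F_1 f))] = F_2 (F_2 (\<r> f))"
    by simp
qed (auto intro: F0_closed F1_closed simp: F2_id F1_Arr)

end

context set_monad
begin

text \<open>\<open>L_unitor\<close> and \<open>L_compositor\<close> are lax structure in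
  \<open>PROF\<close>. Read in \<open>co PROF\<close> they point the other way, as the record for
  oplax functors asks.\<close>

definition L_endo :: "('u cat, 'u prof, 'u ptrans) endo" where
  "L_endo = \<lparr>F0 = L_cat T, F1 = L_prof T, F2 = L_cell T, Funit = L_unitor T, Fcomp = L_compositor T\<rparr>"

lemma L_endo_simps [simp]: "F0 L_endo = L_cat T" "F1 L_endo = L_prof T" "F2 L_endo = L_cell T"
    "Funit L_endo = L_unitor T" "Fcomp L_endo = L_compositor T"
  by (simp_all add: L_endo_def)

lemma L_cell_bid: "L_cell T (bid PROF F) = bid PROF (L_prof T F)"
proof (rule cell_eqI)
  fix A B t assume "el (Dom (bid PROF (L_prof T F))) A B t"
  then have t: "el (L_prof T F) A B t" by simp
  have "sends (L_cell T (bid PROF F)) A B t (fam_ar (idx B) (rdx t) (cpt t))"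
    by (rule sends_L_cell) (simp_all add: t sends_bid el_L_cpt[OF t])
  then show "\<exists>s. sends (L_cell T (bid PROF F)) A B t s \<and> sends (bid PROF (L_prof T F)) A B t s"
    using sends_bid[OF t] el_L_eta[OF t] by auto
qed simp_all

lemma L_cell_vcomp:
  assumes \<alpha>: "\<alpha> \<in> cells F G" and \<beta>: "\<beta> \<in> cells G H"
  shows "L_cell T (\<beta> \<cdot> \<alpha>) = L_cell T \<beta> \<cdot> L_cell T \<alpha>"
proof (rule cell_eqI)
  fix A B t assume "el (Dom (L_cell T \<beta> \<cdot> L_cell T \<alpha>)) A B t"
  then have t: "el (L_prof T F) A B t" by (simp add: cell_Dom[OF \<alpha>])
  note 1 = sends_Cpt[OF \<alpha> el_L_cpt[OF t]] and 2 = sends_Cpt[OF \<beta> cell_el[OF \<alpha> el_L_cpt[OF t]]]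
  have t1: "el (L_prof T (Dom \<alpha>)) A B t" using t by (simp add: cell_Dom[OF \<alpha>])
  let ?s = "fam_ar (idx B) (rdx t) (\<lambda>y. Cpt \<alpha> (ob A (rdx t y)) (ob B y) (cpt t y))"
  have s: "sends (L_cell T \<alpha>) A B t ?s"
    by (rule sends_L_cell[OF t1]) (simp_all add: 1)
  note s' = sends_el[OF L_cell_cell[OF \<alpha>] s]
  have "sends (L_cell T \<beta>) A B ?s (fam_ar (idx B) (rdx t) (\<lambda>y. Cpt \<beta> (ob A (rdx t y)) (ob B y) (Cpt \<alpha> (ob A (rdx t y)) (ob B y) (cpt t y))))"
    by (rule sends_L_cell) (simp_all add: cell_Dom[OF \<beta>] s' 2)
  note 3 = sends_vcomp[OF s this]
  have "sends (L_cell T (\<beta> \<cdot> \<alpha>)) A B t (fam_ar (idx B) (rdx t) (\<lambda>y. Cpt \<beta> (ob A (rdx t y)) (ob B y) (Cpt \<alpha> (ob A (rdx t y)) (ob B y) (cpt t y))))"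
    by (rule sends_L_cell) (simp_all add: t1 sends_vcomp[OF 1 2])
  with 3 show "\<exists>s. sends (L_cell T (\<beta> \<cdot> \<alpha>)) A B t s \<and> sends (L_cell T \<beta> \<cdot> L_cell T \<alpha>) A B t s"
    by blast
qed simp_all

lemma L_compositor_natural:
  assumes GF: "Src G = Trg F" and \<alpha>: "\<alpha> \<in> cells F F'" and \<beta>: "\<beta> \<in> cells G G'"
  shows "L_cell T (\<beta> \<ast> \<alpha>) \<cdot> L_compositor T G F = L_compositor T G' F' \<cdot> (L_cell T \<beta> \<ast> L_cell T \<alpha>)"
proof (rule cell_eqI)
  note F = cell_PR(1)[OF \<alpha>] and G = cell_PR(1)[OF \<beta>] and F' = cell_PR(2)[OF \<alpha>] and G' = cell_PR(2)[OF \<beta>]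
  have GF': "Src G' = Trg F'"
    using GF cell_Src[OF \<beta>] cell_Trg[OF \<alpha>] by simp
  have LGF: "Src (L_prof T G) = Trg (L_prof T F)" using GF by simp
  fix A D p assume "el (Dom (L_compositor T G' F' \<cdot> (L_cell T \<beta> \<ast> L_cell T \<alpha>))) A D p"
  then have "el (comp_prof (L_prof T G) (L_prof T F)) A D p" by (simp add: cell_Dom[OF \<alpha>] cell_Dom[OF \<beta>])
  then obtain B s t where p: "p = coend_in (L_prof T G) (L_prof T F) A D B s t"
    and s: "el (L_prof T G) A B s" and t: "el (L_prof T F) B D t"
    by (rule el_compE[OF PR_L_prof[OF G] PR_L_prof[OF F] LGF])
  have s': "sends (L_cell T \<beta>) A B s (fam_ar (idx B) (rdx s) (\<lambda>y. Cpt \<beta> (ob A (rdx s y)) (ob B y) (cpt s y)))"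
    by (rule sends_L_cell) (simp_all add: s sends_Cpt[OF \<beta> el_L_cpt[OF s]] cell_Dom[OF \<beta>])
  have t': "sends (L_cell T \<alpha>) B D t (fam_ar (idx D) (rdx t) (\<lambda>y. Cpt \<alpha> (ob B (rdx t y)) (ob D y) (cpt t y)))"
    by (rule sends_L_cell) (simp_all add: t sends_Cpt[OF \<alpha> el_L_cpt[OF t]] cell_Dom[OF \<alpha>])
  let ?r = "fam_ar (idx D) (\<lambda>y. rdx s (rdx t y)) (\<lambda>y. coend_in G' F' (ob A (rdx s (rdx t y))) (ob D y) (ob B (rdx t y))
    (Cpt \<beta> (ob A (rdx s (rdx t y))) (ob B (rdx t y)) (cpt s (rdx t y))) (Cpt \<alpha> (ob B (rdx t y)) (ob D y) (cpt t y)))"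
  have "sends (L_compositor T G' F' \<cdot> (L_cell T \<beta> \<ast> L_cell T \<alpha>)) A D p ?r"
    unfolding p
    by (rule sends_vcomp[OF sends_hcomp[OF L_cell_cell[OF \<beta>] L_cell_cell[OF \<alpha>] LGF s' t']
      sends_L_compositor[OF G' F' GF' sends_el[OF L_cell_cell[OF \<beta>] s'] sends_el[OF L_cell_cell[OF \<alpha>] t']]])
      (simp_all add: el_L_rdx[OF t])
  moreover
  let ?q = "fam_ar (idx D) (\<lambda>y. rdx s (rdx t y)) (\<lambda>y. coend_in G F (ob A (rdx s (rdx t y))) (ob D y) (ob B (rdx t y))
    (cpt s (rdx t y)) (cpt t y))"
  have q: "sends (L_compositor T G F) A D p ?q"
    unfolding p by (rule sends_L_compositor[OF G F GF s t]) simp_all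
  have "sends (L_cell T (\<beta> \<ast> \<alpha>)) A D ?q ?r"
  proof (rule sends_L_cell)
    show "el (L_prof T (Dom (\<beta> \<ast> \<alpha>))) A D ?q"
      using sends_el[OF L_compositor_cell[OF G F GF] q] by (simp add: cell_Dom[OF \<alpha>] cell_Dom[OF \<beta>])
  qed (simp_all add: sends_hcomp_Cpt[OF \<beta> \<alpha> GF el_L_cpt[OF s] el_L_cpt[OF t]] el_L_rdx[OF t])
  note sends_vcomp[OF q this]
  ultimately show "\<exists>y. sends (L_cell T (\<beta> \<ast> \<alpha>) \<cdot> L_compositor T G F) A D p y
      \<and> sends (L_compositor T G' F' \<cdot> (L_cell T \<beta> \<ast> L_cell T \<alpha>)) A D p y"
    by blast
qed (simp_all add: cell_Dom[OF \<alpha>] cell_Dom[OF \<beta>] cell_Cod[OF \<alpha>] cell_Cod[OF \<beta>])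

text \<open>At each index both sides contain the same three components. They come out bracketed to
  the right on one path, and \<open>L\<close> of the inverse associator rebrackets them at every
  index.\<close>

lemma L_compositor_assoc:
  assumes H: "PR H" and G: "PR G" and F: "PR F" and HG: "Src H = Trg G" and GF: "Src G = Trg F"
  shows "(L_compositor T (comp_prof H G) F \<cdot> (L_compositor T H G \<triangleright> L_prof T F))
      \<cdot> \<aa>' (L_prof T H) (L_prof T G) (L_prof T F)
    = (L_cell T (\<aa>' H G F) \<cdot> L_compositor T H (comp_prof G F))
      \<cdot> (L_prof T H \<triangleleft> L_compositor T G F)"
proof (rule cell_eqI)
  note HGp = PR_comp[OF H G HG] and GFp = PR_comp[OF G F GF]
  have *: "Src (comp_prof H G) = Trg F" "Src H = Trg (comp_prof G F)" using HG GF by simp_all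
  note LH = PR_L_prof[OF H] and LG = PR_L_prof[OF G] and LF = PR_L_prof[OF F]
  have L: "Src (L_prof T H) = Trg (L_prof T G)" "Src (L_prof T G) = Trg (L_prof T F)"
    "Src (comp_prof (L_prof T H) (L_prof T G)) = Trg (L_prof T F)"
    "Src (L_prof T H) = Trg (comp_prof (L_prof T G) (L_prof T F))" using HG GF by simp_all
  fix A E p assume "el (Dom ((L_cell T (\<aa>' H G F) \<cdot> L_compositor T H (comp_prof G F))
      \<cdot> (L_prof T H \<triangleleft> L_compositor T G F))) A E p"
  then have "el (comp_prof (L_prof T H) (comp_prof (L_prof T G) (L_prof T F))) A E p" by simp
  then obtain B r q where p: "p = coend_in (L_prof T H) (comp_prof (L_prof T G) (L_prof T F)) A E B r q"
    and r: "el (L_prof T H) A B r" and q': "el (comp_prof (L_prof T G) (L_prof T F)) B E q"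
    by (rule el_compE[OF LH PR_comp[OF LG LF L(2)] L(4)])
  from q' obtain D s t where q: "q = coend_in (L_prof T G) (L_prof T F) B E D s t"
    and s: "el (L_prof T G) B D s" and t: "el (L_prof T F) D E t"
    by (rule el_compE[OF LG LF L(2)])
  note el = el_L_cpt[OF r el_L_rdx[OF s el_L_rdx[OF t]]] el_L_cpt[OF s el_L_rdx[OF t]] el_L_cpt[OF t]
  let ?r1 = "fam_ar (idx D) (\<lambda>y. rdx r (rdx s y)) (\<lambda>y. coend_in H G (ob A (rdx r (rdx s y))) (ob D y) (ob B (rdx s y))
    (cpt r (rdx s y)) (cpt s y))"
  let ?z = "fam_ar (idx E) (\<lambda>y. rdx r (rdx s (rdx t y))) (\<lambda>y. coend_in (comp_prof H G) F (ob A (rdx r (rdx s (rdx t y)))) (ob E y)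
     (ob D (rdx t y)) (coend_in H G (ob A (rdx r (rdx s (rdx t y)))) (ob D (rdx t y)) (ob B (rdx s (rdx t y)))
      (cpt r (rdx s (rdx t y))) (cpt s (rdx t y))) (cpt t y))"
  let ?q1 = "fam_ar (idx E) (\<lambda>y. rdx s (rdx t y)) (\<lambda>y. coend_in G F (ob B (rdx s (rdx t y))) (ob E y) (ob D (rdx t y))
    (cpt s (rdx t y)) (cpt t y))"
  let ?w = "fam_ar (idx E) (\<lambda>y. rdx r (rdx s (rdx t y))) (\<lambda>y. coend_in H (comp_prof G F) (ob A (rdx r (rdx s (rdx t y)))) (ob E y)
     (ob B (rdx s (rdx t y))) (cpt r (rdx s (rdx t y)))
     (coend_in G F (ob B (rdx s (rdx t y))) (ob E y) (ob D (rdx t y)) (cpt s (rdx t y)) (cpt t y)))"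
  have r1: "sends (L_compositor T H G) A D (coend_in (L_prof T H) (L_prof T G) A D B r s) ?r1"
    by (rule sends_L_compositor[OF H G HG r s]) simp_all
  note r1' = sends_el[OF L_compositor_cell[OF H G HG] r1]
  have q1: "sends (L_compositor T G F) B E q ?q1"
    unfolding q by (rule sends_L_compositor[OF G F GF s t]) simp_all
  note q1' = sends_el[OF L_compositor_cell[OF G F GF] q1]
  note 1 = sends_assoc_inv[OF LH LG LF L(1,2) r s t, folded q, folded p]
  note 2 = sends_rwhisker[OF L_compositor_cell[OF H G HG] LF L(3) t r1]
  have 3: "sends (L_compositor T (comp_prof H G) F) A E (coend_in (L_prof T (comp_prof H G)) (L_prof T F) A E D ?r1 t) ?z"
    by (rule sends_L_compositor[OF HGp F *(1) r1' t]) (simp_all add: el_L_rdx[OF t])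
  note 4 = sends_lwhisker[OF L_compositor_cell[OF G F GF] LH L(4) r q1, folded p]
  have 5: "sends (L_compositor T H (comp_prof G F)) A E (coend_in (L_prof T H) (L_prof T (comp_prof G F)) A E B r ?q1) ?w"
    by (rule sends_L_compositor[OF H GFp *(2) r q1']) simp_all
  note w = sends_el[OF L_compositor_cell[OF H GFp *(2)] 5]
  have 6: "sends (L_cell T (\<aa>' H G F)) A E ?w ?z"
    by (rule sends_L_cell) (simp_all add: w sends_assoc_inv[OF H G F HG GF el])
  show "\<exists>y. sends ((L_compositor T (comp_prof H G) F \<cdot> (L_compositor T H G \<triangleright> L_prof T F))
      \<cdot> \<aa>' (L_prof T H) (L_prof T G) (L_prof T F)) A E p y \<and>
    sends ((L_cell T (\<aa>' H G F) \<cdot> L_compositor T H (comp_prof G F))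
      \<cdot> (L_prof T H \<triangleleft> L_compositor T G F)) A E p y"
    using sends_vcomp[OF 1 sends_vcomp[OF 2 3]] sends_vcomp[OF 4 sends_vcomp[OF 5 6]] by blast
qed simp_all

text \<open>The identity of \<open>A\<close> is a family of identities, so the compositor inserts an
  identity at each index, which is the effect of \<open>L\<close> applied to the inverse
  unitor.\<close>

lemma L_compositor_lunit:
  assumes F: "PR F"
  shows "(L_compositor T (hom_prof (Trg F)) F \<cdot> (L_unitor T (Trg F) \<triangleright> L_prof T F)) \<cdot> \<ll>' (L_prof T F)
    = L_cell T (\<ll>' F)"
proof (rule cell_eqI)
  note C = PR_Trg[OF F] and LF = PR_L_prof[OF F]
  fix A B t assume "el (Dom (L_cell T (\<ll>' F))) A B t"
  then have t: "el (L_prof T F) A B t" by simp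
  have A: "A \<in> Ob (L_cat T (Trg F))" using el_Ob[OF t] by simp
  note 1 = sends_lunit_inv[OF LF t]
  note I = ar_L_Ide[OF C A]
  have 2: "sends (L_unitor T (Trg F) \<triangleright> L_prof T F) A B (coend_in (hom_prof (L_cat T (Trg F))) (L_prof T F) A B A (Ide (L_cat T (Trg F)) A) t)
    (coend_in (L_prof T (hom_prof (Trg F))) (L_prof T F) A B A (Ide (L_cat T (Trg F)) A) t)"
    by (rule sends_rwhisker[OF L_unitor_cell[OF C] LF _ t sends_L_unitor[OF I]]) simp
  let ?z = "fam_ar (idx B) (rdx t) (\<lambda>y. coend_in (hom_prof (Trg F)) F (ob A (rdx t y)) (ob B y) (ob A (rdx t y)) (Ide (Trg F) (ob A (rdx t y))) (cpt t y))"
  have 3: "sends (L_compositor T (hom_prof (Trg F)) F) A B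
      (coend_in (L_prof T (hom_prof (Trg F))) (L_prof T F) A B A (Ide (L_cat T (Trg F)) A) t) ?z"
    by (rule sends_L_compositor[OF PR_hom_prof[OF C] F _ _ t]) (simp_all add: I Ide_L el_L_rdx[OF t] I[unfolded Ide_L])
  have 4: "sends (L_cell T (\<ll>' F)) A B t ?z"
    by (rule sends_L_cell) (simp_all add: t sends_lunit_inv[OF F el_L_cpt[OF t]])
  show "\<exists>y. sends ((L_compositor T (hom_prof (Trg F)) F \<cdot> (L_unitor T (Trg F) \<triangleright> L_prof T F)) \<cdot> \<ll>' (L_prof T F)) A B t y
    \<and> sends (L_cell T (\<ll>' F)) A B t y"
    using sends_vcomp[OF 1[simplified] sends_vcomp[OF 2 3]] 4 by blast
qed simp_all

lemma L_compositor_runit: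
  assumes F: "PR F"
  shows "(L_compositor T F (hom_prof (Src F)) \<cdot> (L_prof T F \<triangleleft> L_unitor T (Src F))) \<cdot> \<rr>' (L_prof T F)
    = L_cell T (\<rr>' F)"
proof (rule cell_eqI)
  note C = PR_Src[OF F] and LF = PR_L_prof[OF F]
  fix A B t assume "el (Dom (L_cell T (\<rr>' F))) A B t"
  then have t: "el (L_prof T F) A B t" by simp
  have B: "B \<in> Ob (L_cat T (Src F))" using el_Ob[OF t] by simp
  note 1 = sends_runit_inv[OF LF t]
  note I = ar_L_Ide[OF C B]
  have 2: "sends (L_prof T F \<triangleleft> L_unitor T (Src F)) A B (coend_in (L_prof T F) (hom_prof (L_cat T (Src F))) A B B t (Ide (L_cat T (Src F)) B))
    (coend_in (L_prof T F) (L_prof T (hom_prof (Src F))) A B B t (Ide (L_cat T (Src F)) B))"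
    by (rule sends_lwhisker[OF L_unitor_cell[OF C] LF _ t sends_L_unitor[OF I]]) simp
  let ?z = "fam_ar (idx B) (rdx t) (\<lambda>y. coend_in F (hom_prof (Src F)) (ob A (rdx t y)) (ob B y) (ob B y) (cpt t y) (Ide (Src F) (ob B y)))"
  have 3: "sends (L_compositor T F (hom_prof (Src F))) A B
      (coend_in (L_prof T F) (L_prof T (hom_prof (Src F))) A B B t (Ide (L_cat T (Src F)) B)) ?z"
    by (rule sends_L_compositor[OF F PR_hom_prof[OF C] _ t]) (simp_all add: I Ide_L el_L_rdx[OF t] I[unfolded Ide_L])
  have 4: "sends (L_cell T (\<rr>' F)) A B t ?z"
    by (rule sends_L_cell) (simp_all add: t sends_runit_inv[OF F el_L_cpt[OF t]])
  show "\<exists>y. sends ((L_compositor T F (hom_prof (Src F)) \<cdot> (L_prof T F \<triangleleft> L_unitor T (Src F))) \<cdot> \<rr>' (L_prof T F)) A B t y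
    \<and> sends (L_cell T (\<rr>' F)) A B t y"
    using sends_vcomp[OF 1[simplified] sends_vcomp[OF 2 3]] 4 by blast
qed simp_all

lemma oplax_functor_L: "oplax_functor (co PROF) L_endo"
proof (intro oplax_functor.intro oplax_functor_axioms.intro bicategory_co_PROF)
  fix f g f' g' :: "'u prof" and x y z \<alpha> \<beta>
  assume "f \<in> hom1\<^bsub>co PROF\<^esub> x y" "g \<in> hom1\<^bsub>co PROF\<^esub> y z" "\<alpha> \<in> hom2\<^bsub>co PROF\<^esub> f f'" "\<beta> \<in> hom2\<^bsub>co PROF\<^esub> g g'"
  then show "Fcomp L_endo g' f' \<bullet>\<^bsub>co PROF\<^esub> F2 L_endo (\<beta> \<star>\<^bsub>co PROF\<^esub> \<alpha>)
      = (F2 L_endo \<beta> \<star>\<^bsub>co PROF\<^esub> F2 L_endo \<alpha>) \<bullet>\<^bsub>co PROF\<^esub> Fcomp L_endo g f"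
    using L_compositor_natural[of g' f' \<alpha> f \<beta> g] cell_Src[of \<beta> g' g] cell_Trg[of \<alpha> f' f] by simp
qed (simp_all add: category_L_cat PR_L_prof L_cell_cell L_cell_bid L_cell_vcomp L_unitor_cell L_compositor_cell
    L_compositor_assoc L_compositor_lunit L_compositor_runit)

end

section \<open>Functors as profunctors\<close>

lemma catfunctor_Src: "catfunctor f \<Longrightarrow> category (FSrc f)"
  and catfunctor_Trg: "catfunctor f \<Longrightarrow> category (FTrg f)"
  by (simp_all add: catfunctor_def)

lemma catfunctor_FOb: "catfunctor f \<Longrightarrow> a \<in> Ob (FSrc f) \<Longrightarrow> FOb f a \<in> Ob (FTrg f)"
  by (rule catfunctor.FOb_closed)

lemma ar_FAr: "catfunctor f \<Longrightarrow> ar (FSrc f) a b u \<Longrightarrow> ar (FTrg f) (FOb f a) (FOb f b) (FAr f a b u)"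
  by (simp add: ar_def catfunctor.FOb_closed catfunctor.FAr_closed)

lemma FAr_Ide: "catfunctor f \<Longrightarrow> a \<in> Ob (FSrc f) \<Longrightarrow> FAr f a a (Ide (FSrc f) a) = Ide (FTrg f) (FOb f a)"
  by (rule catfunctor.FAr_Ide)

lemma FAr_Cmp: "catfunctor f \<Longrightarrow> ar (FSrc f) a b u \<Longrightarrow> ar (FSrc f) b c v \<Longrightarrow>
    FAr f a c (Cmp (FSrc f) a b c v u) = Cmp (FTrg f) (FOb f a) (FOb f b) (FOb f c) (FAr f b c v) (FAr f a b u)"
  by (simp add: ar_def catfunctor.FAr_Cmp)

lemma catfunctorI:
  assumes "category (FSrc f)" "category (FTrg f)"
    and "\<And>a. a \<in> Ob (FSrc f) \<Longrightarrow> FOb f a \<in> Ob (FTrg f)"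
    and "\<And>a b u. ar (FSrc f) a b u \<Longrightarrow> ar (FTrg f) (FOb f a) (FOb f b) (FAr f a b u)"
    and "\<And>a. a \<in> Ob (FSrc f) \<Longrightarrow> FAr f a a (Ide (FSrc f) a) = Ide (FTrg f) (FOb f a)"
    and "\<And>a b c u v. ar (FSrc f) a b u \<Longrightarrow> ar (FSrc f) b c v \<Longrightarrow>
      FAr f a c (Cmp (FSrc f) a b c v u) = Cmp (FTrg f) (FOb f a) (FOb f b) (FOb f c) (FAr f b c v) (FAr f a b u)"
  shows "catfunctor f"
  using assms by (intro catfunctor.intro catfunctor_axioms.intro) (auto simp: ar_def)

lemma id_func_simps [simp]: "FSrc (id_func C) = C" "FTrg (id_func C) = C" "FOb (id_func C) a = a" "FAr (id_func C) a b u = u"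
  by (simp_all add: id_func_def)

lemma comp_func_simps [simp]: "FSrc (comp_func g f) = FSrc f" "FTrg (comp_func g f) = FTrg g"
    "FOb (comp_func g f) a = FOb g (FOb f a)" "FAr (comp_func g f) a b u = FAr g (FOb f a) (FOb f b) (FAr f a b u)"
  by (simp_all add: comp_func_def)

lemma catfunctor_id: "category C \<Longrightarrow> catfunctor (id_func C)"
  by (rule catfunctorI) simp_all

lemma catfunctor_comp:
  assumes f: "catfunctor f" and g: "catfunctor g" and gf: "FSrc g = FTrg f"
  shows "catfunctor (comp_func g f)"
proof (rule catfunctorI)
  fix a b c u v assume *: "ar (FSrc (comp_func g f)) a b u" "ar (FSrc (comp_func g f)) b c v"
  then show "FAr (comp_func g f) a c (Cmp (FSrc (comp_func g f)) a b c v u)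
    = Cmp (FTrg (comp_func g f)) (FOb (comp_func g f) a) (FOb (comp_func g f) b) (FOb (comp_func g f) c)
       (FAr (comp_func g f) b c v) (FAr (comp_func g f) a b u)"
    using ar_FAr[OF f, of a b u] ar_FAr[OF f, of b c v] FAr_Cmp[OF g, unfolded gf] by (simp add: FAr_Cmp[OF f])
next
  fix a b u assume "ar (FSrc (comp_func g f)) a b u"
  then show "ar (FTrg (comp_func g f)) (FOb (comp_func g f) a) (FOb (comp_func g f) b) (FAr (comp_func g f) a b u)"
    using ar_FAr[OF f, of a b u] ar_FAr[OF g, of "FOb f a" "FOb f b" "FAr f a b u"] gf by simp
next
  fix a assume "a \<in> Ob (FSrc (comp_func g f))"
  then show "FOb (comp_func g f) a \<in> Ob (FTrg (comp_func g f))"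
    and "FAr (comp_func g f) a a (Ide (FSrc (comp_func g f)) a) = Ide (FTrg (comp_func g f)) (FOb (comp_func g f) a)"
    using catfunctor_FOb[OF f, of a] catfunctor_FOb[OF g, of "FOb f a"] FAr_Ide[OF f, of a] FAr_Ide[OF g, of "FOb f a"] gf
    by simp_all
qed (use f g in \<open>simp_all add: catfunctor_Src catfunctor_Trg\<close>)

lemma diamond_simps [simp]: "Src (diamond f) = FSrc f" "Trg (diamond f) = FTrg f"
  by (simp_all add: diamond_def)

lemma el_diamond: "catfunctor f \<Longrightarrow> el (diamond f) d c x \<longleftrightarrow> c \<in> Ob (FSrc f) \<and> ar (FTrg f) d (FOb f c) x"
  by (auto simp: el_def ar_def diamond_def catfunctor_FOb)

lemma Act_diamond: "Act (diamond f) d' d c c' u v x = Cmp (FTrg f) d' (FOb f c) (FOb f c') (FAr f c c' v)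
       (Cmp (FTrg f) d' d (FOb f c) x u)"
  by (simp add: diamond_def)

context
  fixes f :: "'u::zf_universe func"
  assumes f: "catfunctor f"
begin

private lemmas cat_S = catfunctor_Src[OF f] and cat_T = catfunctor_Trg[OF f]

lemma lact_diamond: "ar (FTrg f) e d u \<Longrightarrow> el (diamond f) d c x \<Longrightarrow> lact (diamond f) e d c u x = Cmp (FTrg f) e d (FOb f c) x u"
  unfolding lact_def Act_diamond diamond_simps
  by (simp add: el_diamond[OF f] FAr_Ide[OF f] Cmp_Ide_l[OF cat_T ar_Cmp[OF cat_T]])

lemma ract_diamond: "ar (FSrc f) c c' v \<Longrightarrow> el (diamond f) d c x \<Longrightarrow>
    ract (diamond f) d c c' v x = Cmp (FTrg f) d (FOb f c) (FOb f c') (FAr f c c' v) x"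
  unfolding ract_def Act_diamond diamond_simps by (simp add: el_diamond[OF f] Cmp_Ide_r[OF cat_T])

lemma profunctor_diamond: "profunctor (diamond f)"
proof (intro profunctor.intro profunctor_axioms.intro)
  show "category (Src (diamond f))" "category (Trg (diamond f))"
    using cat_S cat_T by simp_all
next
  fix d d' c c' u v x
  assume "d \<in> Ob (Trg (diamond f))" "d' \<in> Ob (Trg (diamond f))" "c \<in> Ob (Src (diamond f))"
    "c' \<in> Ob (Src (diamond f))" "u \<in> elts (Hom (Trg (diamond f)) d' d)"
    "v \<in> elts (Hom (Src (diamond f)) c c')" "x \<in> elts (El (diamond f) d c)"
  then have "ar (FTrg f) d' d u" "ar (FSrc f) c c' v" "ar (FTrg f) d (FOb f c) x"
    by (simp_all add: ar_def diamond_def catfunctor_FOb[OF f])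
  then have "ar (FTrg f) d' (FOb f c') (Act (diamond f) d' d c c' u v x)"
    unfolding Act_diamond by (intro ar_Cmp[OF cat_T] ar_FAr[OF f])
  then show "Act (diamond f) d' d c c' u v x \<in> elts (El (diamond f) d' c')"
    by (simp add: ar_def) (simp add: diamond_def)
next
  fix d c x
  assume "d \<in> Ob (Trg (diamond f))" "c \<in> Ob (Src (diamond f))" "x \<in> elts (El (diamond f) d c)"
  then have "ar (FTrg f) d (FOb f c) x" and "c \<in> Ob (FSrc f)"
    by (simp_all add: ar_def diamond_def catfunctor_FOb[OF f])
  then show "Act (diamond f) d d c c (Ide (Trg (diamond f)) d) (Ide (Src (diamond f)) c) x = x"
    unfolding Act_diamond diamond_simps by (simp add: FAr_Ide[OF f] Cmp_Ide_l[OF cat_T] Cmp_Ide_r[OF cat_T])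
next
  fix d d' d'' c c' c'' u u' v v' x
  assume "d \<in> Ob (Trg (diamond f))" "d' \<in> Ob (Trg (diamond f))" "d'' \<in> Ob (Trg (diamond f))"
   "c \<in> Ob (Src (diamond f))" "c' \<in> Ob (Src (diamond f))" "c'' \<in> Ob (Src (diamond f))"
   "u \<in> elts (Hom (Trg (diamond f)) d' d)" "u' \<in> elts (Hom (Trg (diamond f)) d'' d')"
   "v \<in> elts (Hom (Src (diamond f)) c c')" "v' \<in> elts (Hom (Src (diamond f)) c' c'')"
   "x \<in> elts (El (diamond f) d c)"
  then have u: "ar (FTrg f) d' d u" "ar (FTrg f) d'' d' u'" and v: "ar (FSrc f) c c' v" "ar (FSrc f) c' c'' v'"
    and x: "ar (FTrg f) d (FOb f c) x"
    by (simp_all add: ar_def diamond_def catfunctor_FOb[OF f])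
  note fv = ar_FAr[OF f v(1)] ar_FAr[OF f v(2)] and xu = ar_Cmp[OF cat_T u(1) x]
  show "Act (diamond f) d'' d c c'' (Cmp (Trg (diamond f)) d'' d' d u u') (Cmp (Src (diamond f)) c c' c'' v' v) x
    = Act (diamond f) d'' d' c' c'' u' v' (Act (diamond f) d' d c c' u v x)"
    unfolding Act_diamond diamond_simps FAr_Cmp[OF f v]
    by (simp add: Cmp_Cmp[OF cat_T u(2,1) x, symmetric] Cmp_Cmp[OF cat_T ar_Cmp[OF cat_T u(2) xu] fv] Cmp_Cmp[OF cat_T u(2) xu fv(1)])
qed

lemma PR_diamond: "PR (diamond f)"
proof -
  have "small_generated (diamond f)"
  proof (rule small_generatedI)
    fix c assume "c \<in> Ob (Src (diamond f))"
    then have c: "c \<in> Ob (FSrc f)" by simp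
    note fc = ar_Ide[OF cat_T catfunctor_FOb[OF f c]]
    have "ar (FTrg f) e (FOb f c) u \<Longrightarrow> u = lact (diamond f) e (FOb f c) c u (Ide (FTrg f) (FOb f c))" for e u
      using c fc by (simp add: lact_diamond el_diamond[OF f] Cmp_Ide_l[OF cat_T])
    then show "\<exists>(I::'u) d x. (\<forall>i\<in>elts I. el (diamond f) (d i) c (x i)) \<and> (\<forall>e y. el (diamond f) e c y \<longrightarrow>
      (\<exists>i\<in>elts I. \<exists>u. ar (Trg (diamond f)) e (d i) u \<and> y = lact (diamond f) e (d i) c u (x i)))"
      using c fc
      by (intro exI[of _ one] exI[of _ "\<lambda>_. FOb f c"] exI[of _ "\<lambda>_. Ide (FTrg f) (FOb f c)"]) (auto simp: el_diamond[OF f])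
  qed
  then show ?thesis
    by (simp add: PR_def profunctor_diamond)
qed

context
  fixes P :: "'u prof"
  assumes P: "PR P" and Pf: "Src P = FTrg f"
begin

text \<open>Co-Yoneda: the second factor \<open>g\<close> is an identity acted on by
  \<open>g\<close>, so it glides to the first factor.\<close>

lemma coend_diamond:
  assumes "el P y b t" "ar (FTrg f) b (FOb f c) g" "c \<in> Ob (FSrc f)"
  shows "coend_in P (diamond f) y c b t g = coyoneda P f y c (ract P y b (FOb f c) g t)"
  unfolding coyoneda_def
  using coend_glide[of "diamond f" b "FOb f c" g P y t c "Ide (FTrg f) (FOb f c)"] assms
  by (simp add: el_diamond[OF f] ar_Ide[OF cat_T] catfunctor_FOb[OF f] lact_diamond Cmp_Ide_l[OF cat_T])

lemma el_coyoneda: "el P y (FOb f c) t \<Longrightarrow> c \<in> Ob (FSrc f) \<Longrightarrow> el (comp_prof P (diamond f)) y c (coyoneda P f y c t)"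
  unfolding coyoneda_def
  by (intro el_comp P PR_diamond) (simp_all add: Pf el_diamond[OF f] ar_Ide[OF cat_T] catfunctor_FOb[OF f])

lemma el_comp_diamondE:
  assumes "el (comp_prof P (diamond f)) y c p"
  obtains t where "p = coyoneda P f y c t" "el P y (FOb f c) t" "c \<in> Ob (FSrc f)"
proof -
  obtain b t g where p: "p = coend_in P (diamond f) y c b t g" and t: "el P y b t" and "el (diamond f) b c g"
    by (rule el_compE[OF P PR_diamond _ assms]) (simp_all add: Pf)
  then have g: "ar (FTrg f) b (FOb f c) g" and c: "c \<in> Ob (FSrc f)" by (simp_all add: el_diamond[OF f])
  show thesis
    using that[OF _ el_ract[OF PR_profunctor[OF P]] c] g t c Pf coend_diamond[OF t g c] p by simp
qed

text \<open>The other direction of co-Yoneda, \<open>[t, g]\<close> to \<open>t\<close> acted on by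
  \<open>g\<close>, evaluated at the chosen representative. The inverse cells below use it to decode
  a class into a single element.\<close>

lemma ract_comps:
  assumes t: "el P y b t" and g: "ar (FTrg f) b (FOb f c) g" and c: "c \<in> Ob (FSrc f)"
    and p: "p = coend_in P (diamond f) y c b t g"
  shows "ract P y (comp1 p) (FOb f c) (comp3 p) (comp2 p) = ract P y b (FOb f c) g t"
proof (rule coend_rec[where \<phi> = "\<lambda>b t g. ract P y b (FOb f c) g t", OF PR_profunctor[OF P] profunctor_diamond _ t _ _ p])
  show "el (diamond f) b c g" using g c by (simp add: el_diamond[OF f])
  fix d d' v x z assume "ar (Trg (diamond f)) d d' v" "el P y d x" "el (diamond f) d' c z"
  then show "ract P y d' (FOb f c) z (ract P y d d' v x) = ract P y d (FOb f c) (lact (diamond f) d d' c v z) x"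
    using ract_ract[OF PR_profunctor[OF P], of d d' v "FOb f c" z y x] by (simp add: lact_diamond el_diamond[OF f] Pf)
qed (simp_all add: Pf)

lemma coyoneda_eval: "el P y (FOb f c) t \<Longrightarrow> c \<in> Ob (FSrc f) \<Longrightarrow> p = coyoneda P f y c t \<Longrightarrow>
    ract P y (comp1 p) (FOb f c) (comp3 p) (comp2 p) = t"
  using ract_comps[of y "FOb f c" t c "Ide (FTrg f) (FOb f c)" p] ract_Ide[OF PR_profunctor[OF P], of y "FOb f c" t]
  by (simp add: coyoneda_def ar_Ide[OF cat_T] catfunctor_FOb[OF f] Pf)

end

end

text \<open>Naturality of one of two mutually inverse families gives that of the other, by
  cancelling in the naturality square. The inverses of the canonical maps become cells in this way,
  without checking their sections against the actions.\<close>

lemma inverse_cell: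
  assumes \<alpha>: "\<alpha> \<in> cells F G"
    and 1: "\<And>d c y. el G d c y \<Longrightarrow> el F d c (\<psi> d c y)" "\<And>d c y. el G d c y \<Longrightarrow> Cpt \<alpha> d c (\<psi> d c y) = y"
    and 2: "\<And>d c x. el F d c x \<Longrightarrow> \<psi> d c (Cpt \<alpha> d c x) = x"
  shows "ptr G F \<psi> \<in> cells G F" and "mutually_inverse PROF \<alpha> (ptr G F \<psi>)"
proof -
  show \<beta>: "ptr G F \<psi> \<in> cells G F"
  proof (rule cellI)
    fix d d' c c' u v y assume *: "ar (Trg G) d' d u" "ar (Src G) c c' v" "el G d c y"
    then have uv: "ar (Trg F) d' d u" "ar (Src F) c c' v" by (simp_all add: cell_Src[OF \<alpha>] cell_Trg[OF \<alpha>])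
    have "Act G d' d c c' u v y = Cpt \<alpha> d' c' (Act F d' d c c' u v (\<psi> d c y))"
      by (simp add: cell_Act[OF \<alpha> uv 1(1)[OF *(3)]] 1(2)[OF *(3)])
    then show "\<psi> d' c' (Act G d' d c c' u v y) = Act F d' d c c' u v (\<psi> d c y)"
      by (simp add: 2 el_Act[OF PR_profunctor[OF cell_PR(1)[OF \<alpha>]] uv 1(1)[OF *(3)]])
  qed (simp_all add: cell_PR[OF \<alpha>] cell_Src[OF \<alpha>] cell_Trg[OF \<alpha>] 1)
  have "ptr G F \<psi> \<cdot> \<alpha> = bid PROF F"
  proof (rule cell_eqI)
    fix d c x assume "el (Dom (bid PROF F)) d c x"
    then have x: "el F d c x" by simp
    have "sends (ptr G F \<psi>) d c (Cpt \<alpha> d c x) x"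
      by (rule sends_ptr, rule cell_el[OF \<alpha> x], rule 2[OF x])
    with sends_vcomp[OF sends_Cpt[OF \<alpha> x]] sends_bid[OF x]
    show "\<exists>y. sends (ptr G F \<psi> \<cdot> \<alpha>) d c x y \<and> sends (bid PROF F) d c x y" by blast
  qed (simp_all add: cell_Dom[OF \<alpha>])
  moreover have "\<alpha> \<cdot> ptr G F \<psi> = bid PROF G"
  proof (rule cell_eqI)
    fix d c y assume "el (Dom (bid PROF G)) d c y"
    then have y: "el G d c y" by simp
    have "sends (ptr G F \<psi>) d c y (\<psi> d c y)"
      by (rule sends_ptr[OF y refl])
    from sends_vcomp[OF this sends_Cpt[OF \<alpha> 1(1)[OF y]]] sends_bid[OF y] 1(2)[OF y]
    show "\<exists>z. sends (\<alpha> \<cdot> ptr G F \<psi>) d c y z \<and> sends (bid PROF G) d c y z" by auto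
  qed (simp_all add: cell_Cod[OF \<alpha>])
  ultimately show "mutually_inverse PROF \<alpha> (ptr G F \<psi>)"
    using \<alpha> \<beta> unfolding mutually_inverse_def by (simp add: hom2_def)
qed

context
  fixes g f :: "'u::zf_universe func"
  assumes g: "catfunctor g" and f: "catfunctor f" and gf: "FSrc g = FTrg f"
begin

private lemmas cat_gT = catfunctor_Trg[OF g] and cat_fT = catfunctor_Trg[OF f]

text \<open>The arrow obtained from \<open>x\<close> and the image of \<open>y\<close> under
  \<open>g\<close> depends only on \<open>[x, y]\<close>, by functoriality of \<open>g\<close> and
  associativity in its target.\<close>

lemma diamond_comp_cell: "diamond_comp g f \<in> cells (comp_prof (diamond g) (diamond f)) (diamond (comp_func g f))"
  and sends_diamond_comp: "el (diamond g) e b x \<Longrightarrow> el (diamond f) b a y \<Longrightarrow>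
    sends (diamond_comp g f) e a (coend_in (diamond g) (diamond f) e a b x y)
      (Cmp (FTrg g) e (FOb g b) (FOb g (FOb f a)) (FAr g b (FOb f a) y) x)"
proof -
  let ?\<phi> = "\<lambda>e a b x y. Cmp (FTrg g) e (FOb g b) (FOb g (FOb f a)) (FAr g b (FOb f a) y) x"
  have eq: "diamond_comp g f = ptr (comp_prof (diamond g) (diamond f)) (diamond (comp_func g f))
      (\<lambda>e c p. ?\<phi> e c (comp1 p) (comp2 p) (comp3 p))"
    by (simp add: diamond_comp_def)
  have 1: "?\<phi> e c d' (ract (diamond g) e d d' v x) y = ?\<phi> e c d x (lact (diamond f) d d' c v y)"
    if v: "ar (Trg (diamond f)) d d' v" and x: "el (diamond g) e d x" and y: "el (diamond f) d' c y" for e c d d' v x y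
  proof -
    have v: "ar (FTrg f) d d' v" "ar (FSrc g) d d' v" using v gf by simp_all
    have y': "ar (FSrc g) d' (FOb f c) y" and x': "ar (FTrg g) e (FOb g d) x" using x y gf by (simp_all add: el_diamond f g)
    show ?thesis
      by (simp add: ract_diamond[OF g v(2) x] lact_diamond[OF f v(1) y] gf[symmetric] FAr_Cmp[OF g v(2) y']
         Cmp_Cmp[OF cat_gT x' ar_FAr[OF g v(2)] ar_FAr[OF g y']])
  qed
  have 2: "el (diamond (comp_func g f)) e c (?\<phi> e c d x y)" if "el (diamond g) e d x" "el (diamond f) d c y" for e c d x y
    using that gf by (auto simp: el_diamond f g catfunctor_comp intro!: ar_Cmp[OF cat_gT] ar_FAr[OF g])
  have 3: "?\<phi> e' c' d (lact (diamond g) e' e d u x) (ract (diamond f) d c c' v y)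
      = Act (diamond (comp_func g f)) e' e c c' u v (?\<phi> e c d x y)"
    if u: "ar (Trg (diamond g)) e' e u" and v: "ar (Src (diamond f)) c c' v" and x: "el (diamond g) e d x"
      and y: "el (diamond f) d c y" for e e' c c' d u v x y
  proof -
    have u: "ar (FTrg g) e' e u" and v: "ar (FSrc f) c c' v" using u v by simp_all
    have y': "ar (FSrc g) d (FOb f c) y" and x': "ar (FTrg g) e (FOb g d) x" using x y gf by (simp_all add: el_diamond f g)
    have fv: "ar (FSrc g) (FOb f c) (FOb f c') (FAr f c c' v)" using ar_FAr[OF f v] gf by simp
    show ?thesis
      unfolding Act_diamond
      by (simp add: ract_diamond[OF f v y] lact_diamond[OF g u x] gf[symmetric] FAr_Cmp[OF g y' fv]
         Cmp_Cmp[OF cat_gT ar_Cmp[OF cat_gT u x'] ar_FAr[OF g y'] ar_FAr[OF g fv]] Cmp_Cmp[OF cat_gT u x' ar_FAr[OF g y']])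
  qed
  note * = coend_cell[where \<phi> = ?\<phi>, OF PR_diamond[OF g] PR_diamond[OF f] _ PR_diamond[OF catfunctor_comp[OF f g gf]] _ _ 1 2 3 eq]
  show "diamond_comp g f \<in> cells (comp_prof (diamond g) (diamond f)) (diamond (comp_func g f))"
    by (rule *(1)) (simp_all add: gf)
  show "sends (diamond_comp g f) e a (coend_in (diamond g) (diamond f) e a b x y) (?\<phi> e a b x y)"
    if "el (diamond g) e b x" "el (diamond f) b a y"
    by (rule *(2)) (simp_all add: gf that)
qed

lemma diamond_comp_inv_cell: "diamond_comp_inv g f \<in> cells (diamond (comp_func g f)) (comp_prof (diamond g) (diamond f))"
  and sends_diamond_comp_inv: "ar (FTrg g) e (FOb g (FOb f a)) x \<Longrightarrow> a \<in> Ob (FSrc f) \<Longrightarrow>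
    sends (diamond_comp_inv g f) e a x (coend_in (diamond g) (diamond f) e a (FOb f a) x (Ide (FTrg f) (FOb f a)))"
proof -
  let ?\<phi> = "\<lambda>e a x. coend_in (diamond g) (diamond f) e a (FOb f a) x (Ide (FTrg f) (FOb f a))"
  note gfc = catfunctor_comp[OF f g gf]
  have PRs: "PR (diamond g)" "PR (diamond f)" "Src (diamond g) = Trg (diamond f)"
    using gf by (simp_all add: f g PR_diamond)
  have i: "el (diamond f) (FOb f a) a (Ide (FTrg f) (FOb f a))" if "a \<in> Ob (FSrc f)" for a
    using that by (simp add: el_diamond[OF f] ar_Ide[OF cat_fT] catfunctor_FOb[OF f])
  have xg: "el (diamond g) e (FOb f a) x" if "el (diamond (comp_func g f)) e a x" for e a x
    using that gf by (simp add: el_diamond g gfc catfunctor_FOb[OF f])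
  show "sends (diamond_comp_inv g f) e a x (?\<phi> e a x)" if "ar (FTrg g) e (FOb g (FOb f a)) x" "a \<in> Ob (FSrc f)"
    unfolding diamond_comp_inv_def by (rule sends_ptr) (simp_all add: el_diamond gfc that)
  show "diamond_comp_inv g f \<in> cells (diamond (comp_func g f)) (comp_prof (diamond g) (diamond f))"
    unfolding diamond_comp_inv_def
  proof (rule cellI)
    fix e a x assume "el (diamond (comp_func g f)) e a x"
    then show "el (comp_prof (diamond g) (diamond f)) e a (?\<phi> e a x)"
      using el_Ob(2) by (intro el_comp PRs xg i) fastforce+
  next
    fix d d' c c' u v x assume uv: "ar (Trg (diamond (comp_func g f))) d' d u" "ar (Src (diamond (comp_func g f))) c c' v"
      and x: "el (diamond (comp_func g f)) d c x"
    have u: "ar (FTrg g) d' d u" and v: "ar (FSrc f) c c' v" using uv by simp_all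
    have fv: "ar (FTrg f) (FOb f c) (FOb f c') (FAr f c c' v)" by (rule ar_FAr[OF f v])
    have fv': "ar (FSrc g) (FOb f c) (FOb f c') (FAr f c c' v)" using fv gf by simp
    note x' = xg[OF x]
    have xu: "el (diamond g) d' (FOb f c) (Cmp (FTrg g) d' d (FOb g (FOb f c)) x u)"
      using x' u by (simp add: el_diamond[OF g] ar_Cmp[OF cat_gT])
    have "Act (comp_prof (diamond g) (diamond f)) d' d c c' u v (?\<phi> d c x)
      = coend_in (diamond g) (diamond f) d' c' (FOb f c) (Cmp (FTrg g) d' d (FOb g (FOb f c)) x u) (FAr f c c' v)"
      using Act_comp[OF PRs x' i[OF ar_Ob(1)[OF v]] _ _, of d' u c' v] u v x'
      by (simp add: lact_diamond[OF g] ract_diamond[OF f v i[OF ar_Ob(1)[OF v]]] Cmp_Ide_r[OF cat_fT fv])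
    also have "\<dots> = coend_in (diamond g) (diamond f) d' c' (FOb f c) (Cmp (FTrg g) d' d (FOb g (FOb f c)) x u)
        (lact (diamond f) (FOb f c) (FOb f c') c' (FAr f c c' v) (Ide (FTrg f) (FOb f c')))"
      by (simp add: lact_diamond[OF f fv i[OF ar_Ob(2)[OF v]]] Cmp_Ide_l[OF cat_fT fv])
    \<comment> \<open>The image of \<open>v\<close> under \<open>f\<close>, written as an action on
      an identity in the second factor, glides to the first.\<close>
    also have "\<dots> = coend_in (diamond g) (diamond f) d' c' (FOb f c')
        (ract (diamond g) d' (FOb f c) (FOb f c') (FAr f c c' v) (Cmp (FTrg g) d' d (FOb g (FOb f c)) x u)) (Ide (FTrg f) (FOb f c'))"
      using coend_glide[OF _ xu i[OF ar_Ob(2)[OF v]]] fv by simp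
    also have "\<dots> = ?\<phi> d' c' (Act (diamond (comp_func g f)) d' d c c' u v x)"
      by (simp add: ract_diamond[OF g fv' xu] Act_diamond)
    finally show "?\<phi> d' c' (Act (diamond (comp_func g f)) d' d c c' u v x)
      = Act (comp_prof (diamond g) (diamond f)) d' d c c' u v (?\<phi> d c x)" ..
  qed (simp_all add: PR_diamond[OF gfc] PR_comp[OF PRs])
qed

end

text \<open>The record \<open>nattrans\<close> carries data only; typing of the functors and
  naturality of the components are asserted separately here.\<close>

definition natural :: "'u::zf_universe nattrans \<Rightarrow> bool" where
  "natural n \<longleftrightarrow> catfunctor (NDom n) \<and> catfunctor (NCod n) \<and> FSrc (NDom n) = FSrc (NCod n) \<and> FTrg (NDom n) = FTrg (NCod n) \<and>
    (\<forall>a\<in>Ob (FSrc (NDom n)). ar (FTrg (NDom n)) (FOb (NDom n) a) (FOb (NCod n) a) (NCpt n a)) \<and>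
    (\<forall>a b u. ar (FSrc (NDom n)) a b u \<longrightarrow>
      Cmp (FTrg (NDom n)) (FOb (NDom n) a) (FOb (NDom n) b) (FOb (NCod n) b) (NCpt n b) (FAr (NDom n) a b u)
      = Cmp (FTrg (NDom n)) (FOb (NDom n) a) (FOb (NCod n) a) (FOb (NCod n) b) (FAr (NCod n) a b u) (NCpt n a))"

lemma diamond_cell_cell:
  assumes "natural n"
  shows "diamond_cell n \<in> cells (diamond (NDom n)) (diamond (NCod n))"
proof -
  let ?f = "NDom n" and ?g = "NCod n"
  have f: "catfunctor ?f" and g: "catfunctor ?g" and S: "FSrc ?g = FSrc ?f" and Tr: "FTrg ?g = FTrg ?f"
    and n: "\<And>a. a \<in> Ob (FSrc ?f) \<Longrightarrow> ar (FTrg ?f) (FOb ?f a) (FOb ?g a) (NCpt n a)"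
    and nat: "\<And>a b u. ar (FSrc ?f) a b u \<Longrightarrow>
      Cmp (FTrg ?f) (FOb ?f a) (FOb ?f b) (FOb ?g b) (NCpt n b) (FAr ?f a b u)
      = Cmp (FTrg ?f) (FOb ?f a) (FOb ?g a) (FOb ?g b) (FAr ?g a b u) (NCpt n a)"
    using assms by (auto simp: natural_def)
  note T = catfunctor_Trg[OF f]
  show ?thesis
    unfolding diamond_cell_def
  proof (rule cellI)
    fix d c x assume "el (diamond ?f) d c x"
    then show "el (diamond ?g) d c (Cmp (FTrg ?f) d (FOb ?f c) (FOb ?g c) (NCpt n c) x)"
      by (simp add: el_diamond f g S Tr ar_Cmp[OF T _ n])
  next
    fix d d' c c' u v x assume "ar (Trg (diamond ?f)) d' d u" "ar (Src (diamond ?f)) c c' v" "el (diamond ?f) d c x"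
    then have u: "ar (FTrg ?f) d' d u" and v: "ar (FSrc ?f) c c' v" and x: "ar (FTrg ?f) d (FOb ?f c) x"
      by (simp_all add: el_diamond f)
    have gv: "ar (FTrg ?f) (FOb ?g c) (FOb ?g c') (FAr ?g c c' v)" using ar_FAr[OF g, of c c' v] v by (simp add: S Tr)
    note xu = ar_Cmp[OF T u x] and nc = n[OF ar_Ob(1)[OF v]] and nc' = n[OF ar_Ob(2)[OF v]]
    show "Cmp (FTrg ?f) d' (FOb ?f c') (FOb ?g c') (NCpt n c') (Act (diamond ?f) d' d c c' u v x)
      = Act (diamond ?g) d' d c c' u v (Cmp (FTrg ?f) d (FOb ?f c) (FOb ?g c) (NCpt n c) x)"
      unfolding Act_diamond Tr
      by (simp add: Cmp_Cmp[OF T xu ar_FAr[OF f v] nc', symmetric] nat[OF v] Cmp_Cmp[OF T xu nc gv] Cmp_Cmp[OF T u x nc])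
  qed (simp_all add: PR_diamond f g S Tr)
qed

lemma sends_diamond_cell: "natural n \<Longrightarrow> ar (FTrg (NDom n)) d (FOb (NDom n) c) x \<Longrightarrow> c \<in> Ob (FSrc (NDom n)) \<Longrightarrow>
    sends (diamond_cell n) d c x (Cmp (FTrg (NDom n)) d (FOb (NDom n) c) (FOb (NCod n) c) (NCpt n c) x)"
  unfolding diamond_cell_def by (rule sends_ptr) (simp_all add: el_diamond natural_def)

lemma diamond_unit_cell: "category C \<Longrightarrow> diamond_unit C \<in> cells (diamond (id_func C)) (hom_prof C)"
  and diamond_unit_inv_cell: "category C \<Longrightarrow> diamond_unit_inv C \<in> cells (hom_prof C) (diamond (id_func C))"
  and sends_diamond_unit: "category C \<Longrightarrow> ar C a b u \<Longrightarrow> sends (diamond_unit C) a b u u"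
  and sends_diamond_unit_inv: "category C \<Longrightarrow> ar C a b u \<Longrightarrow> sends (diamond_unit_inv C) a b u u"
proof -
  assume C: "category C"
  note i = catfunctor_id[OF C]
  show "diamond_unit C \<in> cells (diamond (id_func C)) (hom_prof C)"
    "diamond_unit_inv C \<in> cells (hom_prof C) (diamond (id_func C))"
    unfolding diamond_unit_def diamond_unit_inv_def
    by (rule cellI; simp add: PR_diamond[OF i] PR_hom_prof[OF C] el_diamond[OF i] ar_Ob; simp add: hom_prof_def diamond_def)+
  show "sends (diamond_unit C) a b u u" "sends (diamond_unit_inv C) a b u u" if "ar C a b u"
    unfolding diamond_unit_def diamond_unit_inv_def by (rule sends_ptr; simp add: that el_diamond[OF i] ar_Ob[OF that])+
qed

lemma Act_lact: "profunctor P \<Longrightarrow> ar (Trg P) y' y u \<Longrightarrow> ar (Src P) c c' v \<Longrightarrow> ar (Trg P) y d h \<Longrightarrow> el P d c x \<Longrightarrow>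
    Act P y' y c c' u v (lact P y d c h x) = lact P y' d c' (Cmp (Trg P) y' y d h u) (ract P d c c' v x)"
  using ract_lact[of P y d h c c' v x] lact_ract[of P y d h c c' v x] lact_lact[of P y d h y' u c' "ract P d c c' v x"]
    lact_ract[of P y' y u c c' v "lact P y d c h x"]
  by (simp add: el_lact el_ract)

section \<open>Canonical cells along a pair of functors, and their inverses\<close>

context
  fixes f g :: "'u::zf_universe func" and P F :: "'u prof" and \<kappa> :: "'u \<Rightarrow> 'u \<Rightarrow> 'u \<Rightarrow> 'u" and \<alpha> :: "'u ptrans"
  assumes f: "catfunctor f" and g: "catfunctor g" and P: "PR P" and F: "PR F"
    and types: "FSrc f = Src F" "FSrc g = Trg F" "Src P = FTrg f" "Trg P = FTrg g"
    and \<kappa>: "\<And>d c x. el F d c x \<Longrightarrow> el P (FOb g d) (FOb f c) (\<kappa> d c x)"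
    and \<kappa>_Act: "\<And>d d' c c' u v x. ar (Trg F) d' d u \<Longrightarrow> ar (Src F) c c' v \<Longrightarrow> el F d c x \<Longrightarrow>
      \<kappa> d' c' (Act F d' d c c' u v x) = Act P (FOb g d') (FOb g d) (FOb f c) (FOb f c') (FAr g d' d u) (FAr f c c' v) (\<kappa> d c x)"
    and \<alpha>: "\<alpha> = ptr (comp_prof (diamond g) F) (comp_prof P (diamond f))
      (\<lambda>y c p. coyoneda P f y c (lact P y (FOb g (comp1 p)) (FOb f c) (comp2 p) (\<kappa> (comp1 p) c (comp3 p))))"
begin

private lemmas cT = catfunctor_Trg[OF g] and pP = PR_profunctor[OF P] and pF = PR_profunctor[OF F]

private lemma \<kappa>_lact: "ar (Trg F) d' d u \<Longrightarrow> el F d c x \<Longrightarrow>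
    \<kappa> d' c (lact F d' d c u x) = lact P (FOb g d') (FOb g d) (FOb f c) (FAr g d' d u) (\<kappa> d c x)"
  using \<kappa>_Act[of d' d u c c "Ide (Src F) c" x] FAr_Ide[OF f, of c] ar_Ide[OF PR_Src[OF F] el_Ob(2)] el_Ob(2)[of F d c x]
  by (simp add: lact_def types)

private lemma \<kappa>_ract: "ar (Src F) c c' v \<Longrightarrow> el F d c x \<Longrightarrow>
    \<kappa> d c' (ract F d c c' v x) = ract P (FOb g d) (FOb f c) (FOb f c') (FAr f c c' v) (\<kappa> d c x)"
  using \<kappa>_Act[of d d "Ide (Trg F) d" c c' v x] FAr_Ide[OF g, of d] ar_Ide[OF PR_Trg[OF F] el_Ob(1)] el_Ob(1)[of F d c x]
  by (simp add: ract_def types)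

text \<open>The arrow \<open>v\<close> reaches the representable factor as its image under
  \<open>f\<close>, and co-Yoneda moves it into \<open>t\<close>. A normal form that is acted on is
  thus again a normal form.\<close>

lemma Act_coyoneda:
  assumes t: "el P y (FOb f c) t" and c: "c \<in> Ob (FSrc f)" and u: "ar (Trg P) y' y u" and v: "ar (FSrc f) c c' v"
  shows "Act (comp_prof P (diamond f)) y' y c c' u v (coyoneda P f y c t)
    = coyoneda P f y' c' (Act P y' y (FOb f c) (FOb f c') u (FAr f c c' v) t)"
proof -
  have i: "el (diamond f) (FOb f c) c (Ide (FTrg f) (FOb f c))"
    using c by (simp add: el_diamond[OF f] ar_Ide catfunctor_Trg[OF f] catfunctor_FOb[OF f])
  have fv: "ar (FTrg f) (FOb f c) (FOb f c') (FAr f c c' v)" by (rule ar_FAr[OF f v])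
  have "Act (comp_prof P (diamond f)) y' y c c' u v (coyoneda P f y c t)
    = coend_in P (diamond f) y' c' (FOb f c) (lact P y' y (FOb f c) u t) (FAr f c c' v)"
    unfolding coyoneda_def using Act_comp[OF P PR_diamond[OF f] _ t i u, of c' v] v types
    by (simp add: ract_diamond[OF f v i] Cmp_Ide_r[OF catfunctor_Trg[OF f] fv])
  then show ?thesis
    using coend_diamond[OF f P types(3) el_lact[OF pP u t] fv ar_Ob(2)[OF v]] fv
    by (simp add: ract_lact[OF pP u _ t] types)
qed

text \<open>Unit and multiplication are both of this kind, with \<open>L_prof T F\<close> for
  \<open>P\<close>: the unit has \<open>eta_el\<close> for \<open>\<kappa>\<close>, the
  multiplication has \<open>mu_el\<close> and the twofold extension in place of \<open>F\<close>.
  Compatibility of \<open>\<kappa>\<close> with the actions makes the map invariant under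
  gliding.\<close>

lemma canonical_cell: "\<alpha> \<in> cells (comp_prof (diamond g) F) (comp_prof P (diamond f))"
  and sends_canonical: "ar (FTrg g) y (FOb g d) h \<Longrightarrow> el F d c x \<Longrightarrow>
    sends \<alpha> y c (coend_in (diamond g) F y c d h x) (coyoneda P f y c (lact P y (FOb g d) (FOb f c) h (\<kappa> d c x)))"
proof -
  let ?\<phi> = "\<lambda>y c d h x. coyoneda P f y c (lact P y (FOb g d) (FOb f c) h (\<kappa> d c x))"
  have 1: "?\<phi> e c d' (ract (diamond g) e d d' v x) y = ?\<phi> e c d x (lact F d d' c v y)"
    if v: "ar (Trg F) d d' v" and x: "el (diamond g) e d x" and y: "el F d' c y" for e c d d' v x y
    using v x lact_lact[OF pP, of "FOb g d" "FOb g d'" "FAr g d d' v" e x "FOb f c" "\<kappa> d' c y"] \<kappa>[OF y] ar_FAr[OF g, of d d' v]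
    by (simp add: ract_diamond[OF g] \<kappa>_lact[OF v y] el_diamond[OF g] types)
  have 2: "el (comp_prof P (diamond f)) e c (?\<phi> e c d x y)"
    if "el (diamond g) e d x" "el F d c y" for e c d x y
    using that \<kappa>[OF that(2)] el_Ob(2)[OF that(2)]
    by (auto intro!: el_coyoneda[OF f P] el_lact[OF pP] simp: types el_diamond[OF g])
  have 3: "?\<phi> e' c' d (lact (diamond g) e' e d u x) (ract F d c c' v y)
      = Act (comp_prof P (diamond f)) e' e c c' u v (?\<phi> e c d x y)"
    if u: "ar (Trg (diamond g)) e' e u" and v: "ar (Src F) c c' v" and x: "el (diamond g) e d x" and y: "el F d c y"
    for e e' c c' d u v x y
  proof -
    have u: "ar (FTrg g) e' e u" and x': "ar (FTrg g) e (FOb g d) x" using u x by (simp_all add: el_diamond[OF g])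
    have fv: "ar (Src P) (FOb f c) (FOb f c') (FAr f c c' v)" using ar_FAr[OF f, of c c' v] v by (simp add: types)
    show ?thesis
      using Act_coyoneda[OF el_lact[OF pP _ \<kappa>[OF y]], of e x e' u c' v]
        Act_lact[OF pP _ fv _ \<kappa>[OF y], of e' e u x] u v x x' ar_Ob(1)[OF v]
      by (simp add: types lact_diamond[OF g] \<kappa>_ract[OF v y])
  qed
  note * = coend_cell[where \<phi> = ?\<phi>, OF PR_diamond[OF g] F _ PR_comp[OF P PR_diamond[OF f]] _ _ 1 2 3 \<alpha>]
  show "\<alpha> \<in> cells (comp_prof (diamond g) F) (comp_prof P (diamond f))"
    by (rule *(1)) (simp_all add: types)
  show "sends \<alpha> y c (coend_in (diamond g) F y c d h x) (?\<phi> y c d h x)"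
    if "ar (FTrg g) y (FOb g d) h" "el F d c x"
    by (rule *(2)) (use that el_Ob(1)[OF that(2)] in \<open>simp_all add: types el_diamond[OF g]\<close>)
qed

text \<open>A section \<open>N\<close> of \<open>[h, x] \<mapsto> \<kappa>(x) h\<close> which respects the coend relation inverts the canonical cell.\<close>

context
  fixes N :: "'u \<Rightarrow> 'u \<Rightarrow> 'u \<Rightarrow> 'u" and \<beta> :: "'u ptrans"
  assumes N: "\<And>y c t. el P y (FOb f c) t \<Longrightarrow> c \<in> Ob (Src F) \<Longrightarrow>
      \<exists>d h x. N y c t = coend_in (diamond g) F y c d h x \<and> ar (FTrg g) y (FOb g d) h \<and> el F d c x \<and>
        lact P y (FOb g d) (FOb f c) h (\<kappa> d c x) = t"
    and N_canonical: "\<And>y d c h x. ar (FTrg g) y (FOb g d) h \<Longrightarrow> el F d c x \<Longrightarrow>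
      N y c (lact P y (FOb g d) (FOb f c) h (\<kappa> d c x)) = coend_in (diamond g) F y c d h x"
    and \<beta>: "\<beta> = ptr (comp_prof P (diamond f)) (comp_prof (diamond g) F)
      (\<lambda>y c p. N y c (ract P y (comp1 p) (FOb f c) (comp3 p) (comp2 p)))"
begin

lemma canonical_inverse_cell: "\<beta> \<in> cells (comp_prof P (diamond f)) (comp_prof (diamond g) F)"
  and canonical_mutually_inverse: "mutually_inverse PROF \<alpha> \<beta>"
  and sends_canonical_inverse: "el P y b t \<Longrightarrow> ar (FTrg f) b (FOb f c) k \<Longrightarrow> c \<in> Ob (Src F) \<Longrightarrow>
    sends \<beta> y c (coend_in P (diamond f) y c b t k) (N y c (ract P y b (FOb f c) k t))"
proof -
  let ?\<psi> = "\<lambda>y c p. N y c (ract P y (comp1 p) (FOb f c) (comp3 p) (comp2 p))"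
  have gF: "Src (diamond g) = Trg F" using types by simp
  have 1: "el (comp_prof (diamond g) F) y c (?\<psi> y c p) \<and> Cpt \<alpha> y c (?\<psi> y c p) = p"
    if p': "el (comp_prof P (diamond f)) y c p" for y c p
  proof -
    obtain t where p: "p = coyoneda P f y c t" and t: "el P y (FOb f c) t" and c: "c \<in> Ob (FSrc f)"
      by (rule el_comp_diamondE[OF f P types(3) p'])
    obtain d h x where n: "N y c t = coend_in (diamond g) F y c d h x" "ar (FTrg g) y (FOb g d) h" "el F d c x"
      "lact P y (FOb g d) (FOb f c) h (\<kappa> d c x) = t"
      using N[OF t] c types by auto
    have h: "el (diamond g) y d h" using n(2) el_Ob(1)[OF n(3)] by (simp add: el_diamond[OF g] types)
    show ?thesis
      using sends_canonical[OF n(2,3)] el_comp[OF PR_diamond[OF g] F gF h n(3)]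
      by (simp add: coyoneda_eval[OF f P types(3) t c refl] n(1,4) p sends_def)
  qed
  \<comment> \<open>The canonical cell produces a normal form, from which
    \<open>coyoneda_eval\<close> recovers the argument of \<open>N\<close>; then
    \<open>N_canonical\<close> applies.\<close>
  have 2: "?\<psi> y c (Cpt \<alpha> y c q) = q" if q': "el (comp_prof (diamond g) F) y c q" for y c q
  proof -
    obtain d h x where q: "q = coend_in (diamond g) F y c d h x" and h: "el (diamond g) y d h" and x: "el F d c x"
      by (rule el_compE[OF PR_diamond[OF g] F gF q'])
    have h': "ar (FTrg g) y (FOb g d) h" using h by (simp add: el_diamond[OF g])
    have e: "Cpt \<alpha> y c q = coyoneda P f y c (lact P y (FOb g d) (FOb f c) h (\<kappa> d c x))"
      using sends_canonical[OF h' x] by (simp add: q sends_def)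
    show ?thesis
      using coyoneda_eval[OF f P types(3) _ _ e] N_canonical[OF h' x] el_lact[OF pP _ \<kappa>[OF x], of y h] h' el_Ob(2)[OF x]
      by (simp add: types q)
  qed
  show "\<beta> \<in> cells (comp_prof P (diamond f)) (comp_prof (diamond g) F)" "mutually_inverse PROF \<alpha> \<beta>"
    unfolding \<beta> using inverse_cell[OF canonical_cell, of ?\<psi>] 1 2 by blast+
  show "sends \<beta> y c (coend_in P (diamond f) y c b t k) (N y c (ract P y b (FOb f c) k t))"
    if "el P y b t" "ar (FTrg f) b (FOb f c) k" "c \<in> Ob (Src F)"
    unfolding \<beta>
  proof (rule sends_ptr)
    show "el (comp_prof P (diamond f)) y c (coend_in P (diamond f) y c b t k)"
      using that by (intro el_comp P PR_diamond f) (simp_all add: types el_diamond[OF f])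
  qed (use ract_comps[OF f P types(3) that(1,2)] that types in simp)
qed

end

end

section \<open>Unit and multiplication\<close>

lemma elts_mu_idx: "elts (mu_idx A) = (\<Union>x\<in>elts (idx A). pr x ` elts (idx (ob A x)))"
proof -
  have "{pr x z | x z. x \<in> elts (idx A) \<and> z \<in> elts (idx (ob A x))} = (\<Union>x\<in>elts (idx A). pr x ` elts (idx (ob A x)))"
    by auto
  then show ?thesis
    unfolding mu_idx_def by (simp add: small_UN small_image)
qed

lemma pr_in_mu_idx [simp]: "pr x z \<in> elts (mu_idx A) \<longleftrightarrow> x \<in> elts (idx A) \<and> z \<in> elts (idx (ob A x))"
  by (auto simp: elts_mu_idx)

lemma mu_idxE [elim!]:
  assumes "s \<in> elts (mu_idx A)"
  obtains x z where "s = pr x z" "x \<in> elts (idx A)" "z \<in> elts (idx (ob A x))"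
  using assms by (auto simp: elts_mu_idx)

lemma mu_idx_cong: "idx A = idx B \<Longrightarrow> (\<And>x. x \<in> elts (idx B) \<Longrightarrow> idx (ob A x) = idx (ob B x)) \<Longrightarrow> mu_idx A = mu_idx B"
  by (auto intro!: injD[OF elts_inj])

lemma L_func_simps [simp]: "FSrc (L_func T f) = L_cat T (FSrc f)" "FTrg (L_func T f) = L_cat T (FTrg f)"
    "FOb (L_func T f) A = fam_ob (idx A) (\<lambda>x. FOb f (ob A x)) (lab A)"
    "FAr (L_func T f) A B p = fam_ar (idx B) (rdx p) (\<lambda>x. FAr f (ob A (rdx p x)) (ob B x) (cpt p x))"
  by (simp_all add: L_func_def)

lemma L_eta_simps [simp]: "FSrc (L_eta T C) = C" "FTrg (L_eta T C) = L_cat T C" "FOb (L_eta T C) = eta_ob T"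
    "FAr (L_eta T C) a b u = eta_el u"
  by (simp_all add: L_eta_def)

lemma L_mu_simps [simp]: "FSrc (L_mu T C) = L_cat T (L_cat T C)" "FTrg (L_mu T C) = L_cat T C" "FOb (L_mu T C) = mu_ob T"
    "FAr (L_mu T C) A B t = mu_el B t"
  by (simp_all add: L_mu_def)

lemma eta_ob_simps [simp]: "idx (eta_ob T c) = one" "ob (eta_ob T c) star = c" "lab (eta_ob T c) = TUnit T one star"
  by (simp_all add: eta_ob_def)

lemma eta_el_simps [simp]: "rdx (eta_el r) star = star" "cpt (eta_el r) star = r"
  by (simp_all add: eta_el_def)

lemma mu_ob_simps [simp]: "idx (mu_ob T A) = mu_idx A"
    "x \<in> elts (idx A) \<Longrightarrow> z \<in> elts (idx (ob A x)) \<Longrightarrow> ob (mu_ob T A) (pr x z) = ob (ob A x) z"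
  by (auto simp: mu_ob_def)

lemma mu_el_simps [simp]:
  "x \<in> elts (idx B) \<Longrightarrow> z \<in> elts (idx (ob B x)) \<Longrightarrow> rdx (mu_el B t) (pr x z) = pr (rdx t x) (rdx (cpt t x) z)"
  "x \<in> elts (idx B) \<Longrightarrow> z \<in> elts (idx (ob B x)) \<Longrightarrow> cpt (mu_el B t) (pr x z) = cpt (cpt t x) z"
  by (auto simp: mu_el_def)

lemma fam_ar_eta [simp]: "fam_ar X (rdx (fam_ar X r \<zeta>)) (cpt (fam_ar X r \<zeta>)) = fam_ar X r \<zeta>"
  by simp

context set_monad
begin

lemma eta_ob_Ob [simp]: "eta_ob T c \<in> Ob (L_cat T C) \<longleftrightarrow> c \<in> Ob C"
  by (simp add: eta_ob_def TUnit_in)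

text \<open>By naturality of the unit, a map from the one-point set carries the unit label to the
  unit at its value. An index map for an arrow from \<open>A\<close> to \<open>eta_ob T c\<close>
  therefore singles out one index of \<open>A\<close> whose unit is the label of
  \<open>A\<close>.\<close>

lemma lmap_eta: "A \<in> Ob (L_cat T C) \<Longrightarrow> lmap A (eta_ob T c) r \<longleftrightarrow> r star \<in> elts (idx A) \<and> TUnit T (idx A) (r star) = lab A"
  using tm_TUnit[of one r "idx A" star] by (auto simp: lmap_def)

text \<open>The formula for the label of a disjoint union is the Kleisli extension along the labels
  of the summands, each pushed along its inclusion.\<close>

lemma lab_mu: "lab (mu_ob T A) = bind (idx A) (mu_idx A) (lab A) (\<lambda>x. tm (idx (ob A x)) (mu_idx A) (pr x) (lab (ob A x)))"
  by (simp add: mu_ob_def bind_def tm_def)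

lemma pr_lab: "A \<in> Ob (L_cat T (L_cat T C)) \<Longrightarrow> x \<in> elts (idx A) \<Longrightarrow> (\<And>z. z \<in> elts (idx (ob A x)) \<Longrightarrow> f z \<in> elts Y) \<Longrightarrow>
    tm (idx (ob A x)) Y f (lab (ob A x)) \<in> elts (TOb T Y)"
  by (rule tm_closed) (auto intro: L_Ob_lab L_Ob_ob)

text \<open>The label of a disjoint union can be pushed along \<open>f\<close> one summand at a
  time. Most label computations below start from this form.\<close>

lemma tm_lab_mu:
  assumes A: "A \<in> Ob (L_cat T (L_cat T C))"
    and f: "\<And>x z. x \<in> elts (idx A) \<Longrightarrow> z \<in> elts (idx (ob A x)) \<Longrightarrow> f (pr x z) \<in> elts Y"
  shows "tm (mu_idx A) Y f (lab (mu_ob T A)) = bind (idx A) Y (lab A) (\<lambda>x. tm (idx (ob A x)) Y (\<lambda>z. f (pr x z)) (lab (ob A x)))"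
proof -
  have "tm (mu_idx A) Y f (lab (mu_ob T A))
      = bind (idx A) Y (lab A) (\<lambda>x. tm (mu_idx A) Y f (tm (idx (ob A x)) (mu_idx A) (pr x) (lab (ob A x))))"
    unfolding lab_mu by (rule tm_bind) (auto simp: L_Ob_lab[OF A] f intro!: pr_lab[OF A])
  also have "\<dots> = bind (idx A) Y (lab A) (\<lambda>x. tm (idx (ob A x)) Y (\<lambda>z. f (pr x z)) (lab (ob A x)))"
    by (rule bind_cong, rule tm_tm) (auto simp: f L_Ob_lab[OF L_Ob_ob[OF A]])
  finally show ?thesis .
qed

lemma mu_ob_Ob: "A \<in> Ob (L_cat T (L_cat T C)) \<Longrightarrow> mu_ob T A \<in> Ob (L_cat T C)"
proof -
  assume A: "A \<in> Ob (L_cat T (L_cat T C))"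
  have "lab (mu_ob T A) \<in> elts (TOb T (mu_idx A))"
    unfolding lab_mu by (rule bind_closed) (auto simp: L_Ob_lab[OF A] intro!: pr_lab[OF A])
  moreover have "fam_ob (idx (mu_ob T A)) (ob (mu_ob T A)) (lab (mu_ob T A)) = mu_ob T A"
    by (simp add: mu_ob_def)
  ultimately show ?thesis
    unfolding L_Ob_iff[of "mu_ob T A"] by (auto simp: L_Ob_ob[OF L_Ob_ob[OF A]])
qed

text \<open>On the summand at \<open>x\<close> the map is \<open>s x\<close> followed by the
  inclusion of the summand at \<open>r x\<close>. The inner maps turn the labels of the summands of
  \<open>B\<close> into labels of summands of \<open>A\<close>; the outer map is then taken out by
  \<open>bind_tm\<close>.\<close>

lemma lmap_mu:
  assumes A: "A \<in> Ob (L_cat T (L_cat T C))" and B: "B \<in> Ob (L_cat T (L_cat T D))"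
    and r: "lmap A B r" and s: "\<And>x. x \<in> elts (idx B) \<Longrightarrow> lmap (ob A (r x)) (ob B x) (s x)"
    and q: "\<And>x z. x \<in> elts (idx B) \<Longrightarrow> z \<in> elts (idx (ob B x)) \<Longrightarrow> q (pr x z) = pr (r x) (s x z)"
  shows "lmap (mu_ob T A) (mu_ob T B) q"
proof -
  have q_in: "q (pr x z) \<in> elts (mu_idx A)" if "x \<in> elts (idx B)" "z \<in> elts (idx (ob B x))" for x z
    using that lmapD[OF r] lmapD[OF s] by (auto simp: q)
  have "tm (mu_idx B) (mu_idx A) q (lab (mu_ob T B))
      = bind (idx B) (mu_idx A) (lab B) (\<lambda>x. tm (idx (ob B x)) (mu_idx A) (\<lambda>z. q (pr x z)) (lab (ob B x)))"
    using tm_lab_mu[OF B, of q "mu_idx A"] q_in by blast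
  also have "\<dots> = bind (idx B) (mu_idx A) (lab B) (\<lambda>x. tm (idx (ob A (r x))) (mu_idx A) (pr (r x)) (lab (ob A (r x))))"
  proof (rule bind_cong)
    fix x assume x: "x \<in> elts (idx B)"
    have "tm (idx (ob B x)) (mu_idx A) (\<lambda>z. q (pr x z)) (lab (ob B x))
        = tm (idx (ob B x)) (mu_idx A) (\<lambda>z. pr (r x) (s x z)) (lab (ob B x))"
      by (rule fun_cong[OF tm_cong]) (simp add: q x)
    also have "\<dots> = tm (idx (ob A (r x))) (mu_idx A) (pr (r x)) (tm (idx (ob B x)) (idx (ob A (r x))) (s x) (lab (ob B x)))"
      using lmapD[OF r x] lmapD[OF s[OF x]]
      by (intro tm_tm[symmetric]) (auto simp: L_Ob_lab[OF L_Ob_ob[OF B x]])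
    finally show "tm (idx (ob B x)) (mu_idx A) (\<lambda>z. q (pr x z)) (lab (ob B x))
        = tm (idx (ob A (r x))) (mu_idx A) (pr (r x)) (lab (ob A (r x)))"
      using s[OF x] by (simp add: lmap_def)
  qed
  also have "\<dots> = bind (idx A) (mu_idx A) (tm (idx B) (idx A) r (lab B))
      (\<lambda>x. tm (idx (ob A x)) (mu_idx A) (pr x) (lab (ob A x)))"
    by (rule bind_tm[symmetric]) (auto simp: lmapD[OF r] L_Ob_lab[OF B] intro!: pr_lab[OF A])
  finally show ?thesis
    using q_in r by (auto simp: lmap_def lab_mu)
qed

lemma el_mu_el:
  assumes t: "el (L_prof T (L_prof T F)) A B t"
  shows "el (L_prof T F) (mu_ob T A) (mu_ob T B) (mu_el B t)"
proof -
  have A: "A \<in> Ob (L_cat T (L_cat T (Trg F)))" and B: "B \<in> Ob (L_cat T (L_cat T (Src F)))" using el_Ob[OF t] by simp_all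
  note t2 = el_L_cpt[OF t]
  have "lmap (mu_ob T A) (mu_ob T B) (\<lambda>s. pr (rdx t (pfst s)) (rdx (cpt t (pfst s)) (psnd s)))"
    by (rule lmap_mu[OF A B el_L_lmap[OF t] el_L_lmap[OF t2]]) simp_all
  then show ?thesis
    unfolding mu_el_def
    by (intro el_L_fam mu_ob_Ob A B) (auto simp: el_L_rdx[OF t] el_L_rdx[OF t2] intro!: el_L_cpt[OF t2])
qed

lemma el_LL_hom_prof: "el (L_prof T (L_prof T (hom_prof C))) A B t = ar (L_cat T (L_cat T C)) A B t"
  unfolding el_L_prof[of "L_prof T (hom_prof C)"] ar_L_cat[of "L_cat T C"] by simp

lemma ar_mu_el: "ar (L_cat T (L_cat T C)) A B t \<Longrightarrow> ar (L_cat T C) (mu_ob T A) (mu_ob T B) (mu_el B t)"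
  using el_mu_el[of "hom_prof C" A B t] by (simp add: el_LL_hom_prof)

lemma mu_el_eqI: "(\<And>x z. x \<in> elts (idx B) \<Longrightarrow> z \<in> elts (idx (ob B x)) \<Longrightarrow> r (pr x z) = pr (rdx t x) (rdx (cpt t x) z)) \<Longrightarrow>
    (\<And>x z. x \<in> elts (idx B) \<Longrightarrow> z \<in> elts (idx (ob B x)) \<Longrightarrow> \<zeta> (pr x z) = cpt (cpt t x) z) \<Longrightarrow>
    mu_el B t = fam_ar (mu_idx B) r \<zeta>"
  unfolding mu_el_def by (rule fam_ar_cong) auto

text \<open>The compatibility required of \<open>\<kappa>\<close> in the case of the multiplication.
  A pair index is reindexed coordinate by coordinate, so the two sides can be compared at each
  pair.\<close>

lemma mu_el_Act:
  assumes "ar (L_cat T (L_cat T (Trg F))) A' A u" "ar (L_cat T (L_cat T (Src F))) B B' v" "el (L_prof T (L_prof T F)) A B t"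
  shows "mu_el B' (Act (L_prof T (L_prof T F)) A' A B B' u v t)
    = Act (L_prof T F) (mu_ob T A') (mu_ob T A) (mu_ob T B) (mu_ob T B') (mu_el A u) (mu_el B' v) (mu_el B t)"
  unfolding Act_L mu_ob_simps using assms
  by (intro mu_el_eqI)
    (simp_all add: ar_L_rdx ar_L_rdx[OF ar_L_cpt] el_L_rdx el_L_rdx[OF el_L_cpt])

lemma L_func_Ob: "catfunctor f \<Longrightarrow> A \<in> Ob (L_cat T (FSrc f)) \<Longrightarrow> FOb (L_func T f) A \<in> Ob (L_cat T (FTrg f))"
  by (simp add: L_Ob_lab L_Ob_ob catfunctor_FOb)

lemma lmap_fam_ob: "lmap A (fam_ob (idx B) h (lab B)) r \<longleftrightarrow> lmap A B r" "lmap (fam_ob (idx A) h (lab A)) B r \<longleftrightarrow> lmap A B r"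
  by (simp_all add: lmap_def)

text \<open>\<open>L_func\<close> changes only the objects of a family and keeps its indices and
  label, so the two profunctors have literally the same elements. Hence \<open>L_diamond_inv\<close>
  can act as the identity.\<close>

lemma el_L_diamond: "catfunctor f \<Longrightarrow> el (L_prof T (diamond f)) A B t \<longleftrightarrow>
    B \<in> Ob (L_cat T (FSrc f)) \<and> ar (L_cat T (FTrg f)) A (FOb (L_func T f) B) t"
  using L_func_Ob[of f B] unfolding el_L_prof ar_L_cat by (auto simp: lmap_fam_ob el_diamond L_Ob_ob)

lemma catfunctor_L_func:
  assumes f: "catfunctor f"
  shows "catfunctor (L_func T f)"
proof (rule catfunctorI)
  show "category (FSrc (L_func T f))" "category (FTrg (L_func T f))"
    using f by (simp_all add: category_L_cat catfunctor_Src catfunctor_Trg)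
  fix A assume A: "A \<in> Ob (FSrc (L_func T f))"
  then show "FOb (L_func T f) A \<in> Ob (FTrg (L_func T f))"
    using L_func_Ob[OF f] by simp
  show "FAr (L_func T f) A A (Ide (FSrc (L_func T f)) A) = Ide (FTrg (L_func T f)) (FOb (L_func T f) A)"
    using A by (simp add: Ide_L FAr_Ide[OF f] L_Ob_ob)
next
  fix A B p assume "ar (FSrc (L_func T f)) A B p"
  then have p: "ar (L_cat T (FSrc f)) A B p" by simp
  have "A \<in> Ob (L_cat T (FSrc f))" "B \<in> Ob (L_cat T (FSrc f))" using ar_Ob[OF p] by simp_all
  then show "ar (FTrg (L_func T f)) (FOb (L_func T f) A) (FOb (L_func T f) B) (FAr (L_func T f) A B p)"
    using L_func_Ob[OF f] ar_L_lmap[OF p] ar_L_rdx[OF p]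
    by (auto simp: lmap_fam_ob intro!: ar_L_fam ar_FAr[OF f] ar_L_cpt[OF p])
next
  fix A B D p q assume "ar (FSrc (L_func T f)) A B p" "ar (FSrc (L_func T f)) B D q"
  then have p: "ar (L_cat T (FSrc f)) A B p" and q: "ar (L_cat T (FSrc f)) B D q" by simp_all
  show "FAr (L_func T f) A D (Cmp (FSrc (L_func T f)) A B D q p) = Cmp (FTrg (L_func T f)) (FOb (L_func T f) A)
    (FOb (L_func T f) B) (FOb (L_func T f) D) (FAr (L_func T f) B D q) (FAr (L_func T f) A B p)"
    by (simp add: Cmp_L ar_L_rdx[OF p] ar_L_rdx[OF q] FAr_Cmp[OF f ar_L_cpt[OF p] ar_L_cpt[OF q]])
qed

lemma L_diamond_inv_cell: "catfunctor f \<Longrightarrow> L_diamond_inv T f \<in> cells (diamond (L_func T f)) (L_prof T (diamond f))"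
  and sends_L_diamond_inv: "catfunctor f \<Longrightarrow> el (diamond (L_func T f)) A B t \<Longrightarrow> sends (L_diamond_inv T f) A B t t"
proof -
  assume f: "catfunctor f"
  note Lf = catfunctor_L_func[OF f]
  show "sends (L_diamond_inv T f) A B t t" if "el (diamond (L_func T f)) A B t"
    unfolding L_diamond_inv_def by (rule sends_ptr[OF that]) simp
  show "L_diamond_inv T f \<in> cells (diamond (L_func T f)) (L_prof T (diamond f))"
    unfolding L_diamond_inv_def
  proof (rule cellI)
    fix A A' B B' u v t
    assume "ar (Trg (diamond (L_func T f))) A' A u" "ar (Src (diamond (L_func T f))) B B' v" "el (diamond (L_func T f)) A B t"
    then have u: "ar (L_cat T (FTrg f)) A' A u" and v: "ar (L_cat T (FSrc f)) B B' v"
      and t: "ar (L_cat T (FTrg f)) A (FOb (L_func T f) B) t"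
      by (simp_all add: el_diamond[OF Lf])
    show "Act (diamond (L_func T f)) A' A B B' u v t = Act (L_prof T (diamond f)) A' A B B' u v t"
      unfolding Act_diamond Act_L using ar_L_rdx[OF t] by (simp add: Cmp_L ar_L_rdx[OF v])
  qed (simp_all add: PR_diamond[OF Lf] PR_L_prof[OF PR_diamond[OF f]] el_diamond[OF Lf] el_L_diamond[OF f])
qed

lemma catfunctor_L_eta:
  assumes C: "category C"
  shows "catfunctor (L_eta T C)"
proof (rule catfunctorI)
  fix a b c u v assume "ar (FSrc (L_eta T C)) a b u" "ar (FSrc (L_eta T C)) b c v"
  then show "FAr (L_eta T C) a c (Cmp (FSrc (L_eta T C)) a b c v u)
    = Cmp (FTrg (L_eta T C)) (FOb (L_eta T C) a) (FOb (L_eta T C) b) (FOb (L_eta T C) c) (FAr (L_eta T C) b c v) (FAr (L_eta T C) a b u)"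
    unfolding L_eta_simps Cmp_L by (subst (1) eta_el_def) (rule fam_ar_cong, auto)
next
  fix a b u assume "ar (FSrc (L_eta T C)) a b u"
  then show "ar (FTrg (L_eta T C)) (FOb (L_eta T C) a) (FOb (L_eta T C) b) (FAr (L_eta T C) a b u)"
    using ar_Ob[of C a b u] unfolding L_eta_simps eta_el_def
    by (intro ar_L_fam) (auto simp: lmap_def tm_id TUnit_in)
next
  fix a assume "a \<in> Ob (FSrc (L_eta T C))"
  show "FAr (L_eta T C) a a (Ide (FSrc (L_eta T C)) a) = Ide (FTrg (L_eta T C)) (FOb (L_eta T C) a)"
    unfolding L_eta_simps Ide_L eta_el_def by (rule fam_ar_cong) auto
qed (simp_all add: C category_L_cat)

lemma catfunctor_L_mu:
  assumes C: "category C"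
  shows "catfunctor (L_mu T C)"
proof (rule catfunctorI)
  fix A assume "A \<in> Ob (FSrc (L_mu T C))"
  then show "FAr (L_mu T C) A A (Ide (FSrc (L_mu T C)) A) = Ide (FTrg (L_mu T C)) (FOb (L_mu T C) A)"
    by (auto simp: Ide_L intro!: mu_el_eqI)
next
  fix A B D p q assume "ar (FSrc (L_mu T C)) A B p" "ar (FSrc (L_mu T C)) B D q"
  then have p: "ar (L_cat T (L_cat T C)) A B p" and q: "ar (L_cat T (L_cat T C)) B D q" by simp_all
  show "FAr (L_mu T C) A D (Cmp (FSrc (L_mu T C)) A B D q p)
    = Cmp (FTrg (L_mu T C)) (FOb (L_mu T C) A) (FOb (L_mu T C) B) (FOb (L_mu T C) D) (FAr (L_mu T C) B D q) (FAr (L_mu T C) A B p)"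
    unfolding L_mu_simps Cmp_L mu_ob_simps
    by (intro mu_el_eqI) (simp_all add: ar_L_rdx[OF p] ar_L_rdx[OF q] ar_L_rdx[OF ar_L_cpt[OF p]] ar_L_rdx[OF ar_L_cpt[OF q]])
qed (simp_all add: C category_L_cat mu_ob_Ob ar_mu_el)

end

text \<open>By co-Yoneda the classes \<open>[t, 1]\<close> exhaust a composite with
  \<open>diamond f\<close>, so an equation of cells out of it is tested on them.\<close>

lemma cell_eq_diamondI:
  assumes f: "catfunctor f" and P: "PR P" and Pf: "Src P = FTrg f"
    and "ext_cell \<alpha>" "ext_cell \<beta>" "Dom \<alpha> = comp_prof P (diamond f)" "Dom \<beta> = comp_prof P (diamond f)" "Cod \<alpha> = Cod \<beta>"
    and eq: "\<And>y c t. el P y (FOb f c) t \<Longrightarrow> c \<in> Ob (FSrc f) \<Longrightarrow>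
      \<exists>q. sends \<alpha> y c (coyoneda P f y c t) q \<and> sends \<beta> y c (coyoneda P f y c t) q"
  shows "\<alpha> = \<beta>"
proof (rule cell_eqI)
  fix y c p assume "el (Dom \<beta>) y c p"
  then have "el (comp_prof P (diamond f)) y c p" using assms by simp
  then show "\<exists>q. sends \<alpha> y c p q \<and> sends \<beta> y c p q"
    by (rule el_comp_diamondE[OF f P Pf]) (use eq in blast)
qed (use assms in simp_all)

lemma sends_rwhisker_coyoneda:
  assumes "\<beta> \<in> cells P Q" "catfunctor f" "Src P = FTrg f" "c \<in> Ob (FSrc f)" "sends \<beta> y (FOb f c) t t'"
  shows "sends (\<beta> \<triangleright> diamond f) y c (coyoneda P f y c t) (coyoneda Q f y c t')"
  unfolding coyoneda_def using assms
  by (intro sends_rwhisker[OF assms(1) PR_diamond])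
    (simp_all add: el_diamond ar_Ide catfunctor_Trg catfunctor_FOb)

lemma reindex_simps [simp]: "s \<in> elts (idx B) \<Longrightarrow> rdx (reindex C B g) s = g s"
    "s \<in> elts (idx B) \<Longrightarrow> cpt (reindex C B g) s = Ide C (ob B s)"
  by (simp_all add: reindex_def)

section \<open>Splitting elements over units and over disjoint unions\<close>

definition mu_split :: "'u::zf_universe \<Rightarrow> 'u \<Rightarrow> ('u \<Rightarrow> 'u) \<Rightarrow> 'u" where
  "mu_split y K r = fam_ob (idx K) (\<lambda>x. fam_ob (idx (ob K x)) (\<lambda>z. ob y (r (pr x z))) (lab (ob K x))) (lab K)"

text \<open>Currying: a family indexed by pairs becomes a family of families, with identity index
  maps at both levels.\<close>

definition mu_flat :: "'u::zf_universe \<Rightarrow> ('u \<Rightarrow> 'u) \<Rightarrow> 'u" where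
  "mu_flat K \<zeta> = fam_ar (idx K) (\<lambda>x. x) (\<lambda>x. fam_ar (idx (ob K x)) (\<lambda>z. z) (\<lambda>z. \<zeta> (pr x z)))"

lemma mu_split_simps [simp]: "idx (mu_split y K r) = idx K" "lab (mu_split y K r) = lab K"
    "x \<in> elts (idx K) \<Longrightarrow> idx (ob (mu_split y K r) x) = idx (ob K x)"
    "x \<in> elts (idx K) \<Longrightarrow> lab (ob (mu_split y K r) x) = lab (ob K x)"
    "x \<in> elts (idx K) \<Longrightarrow> z \<in> elts (idx (ob K x)) \<Longrightarrow> ob (ob (mu_split y K r) x) z = ob y (r (pr x z))"
    "mu_idx (mu_split y K r) = mu_idx K"
  by (auto simp: mu_split_def intro: mu_idx_cong)

lemma mu_flat_simps [simp]: "x \<in> elts (idx K) \<Longrightarrow> rdx (mu_flat K \<zeta>) x = x"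
    "x \<in> elts (idx K) \<Longrightarrow> z \<in> elts (idx (ob K x)) \<Longrightarrow> rdx (cpt (mu_flat K \<zeta>) x) z = z"
    "x \<in> elts (idx K) \<Longrightarrow> z \<in> elts (idx (ob K x)) \<Longrightarrow> cpt (cpt (mu_flat K \<zeta>) x) z = \<zeta> (pr x z)"
  by (simp_all add: mu_flat_def)

lemma mu_split_cong: "(\<And>x z. x \<in> elts (idx K) \<Longrightarrow> z \<in> elts (idx (ob K x)) \<Longrightarrow> ob y (r (pr x z)) = ob y' (r' (pr x z))) \<Longrightarrow>
    mu_split y K r = mu_split y' K r'"
  unfolding mu_split_def by (intro fam_ob_cong refl)

lemma mu_flat_cong: "(\<And>x z. x \<in> elts (idx K) \<Longrightarrow> z \<in> elts (idx (ob K x)) \<Longrightarrow> \<zeta> (pr x z) = \<zeta>' (pr x z)) \<Longrightarrow>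
    mu_flat K \<zeta> = mu_flat K \<zeta>'"
  unfolding mu_flat_def by (intro fam_ar_cong refl)

context set_monad
begin

lemma ar_reindex: "category C \<Longrightarrow> A \<in> Ob (L_cat T C) \<Longrightarrow> B \<in> Ob (L_cat T C) \<Longrightarrow> lmap A B g \<Longrightarrow>
    (\<And>s. s \<in> elts (idx B) \<Longrightarrow> ob A (g s) = ob B s) \<Longrightarrow> ar (L_cat T C) A B (reindex C B g)"
  unfolding reindex_def by (rule ar_L_fam) (auto simp: L_Ob_ob intro: ar_Ide)

lemma reindex_cong: "(\<And>s. s \<in> elts (idx B) \<Longrightarrow> g s = g' s) \<Longrightarrow> reindex C B g = reindex C B g'"
  unfolding reindex_def by (rule fam_ar_cong) auto

text \<open>Over a unit object an element has the single index \<open>star\<close>. It amounts to an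
  index of \<open>y\<close> and one element of \<open>F\<close>; the index becomes the arrow of the
  representative, the element its second factor.\<close>

definition eta_sec :: "'u prof \<Rightarrow> 'u \<Rightarrow> 'u \<Rightarrow> 'u \<Rightarrow> 'u" where
  "eta_sec F y c t = coend_in (diamond (L_eta T (Trg F))) F y c (ob y (rdx t star))
     (reindex (Trg F) (eta_ob T (ob y (rdx t star))) (\<lambda>_. rdx t star)) (cpt t star)"

text \<open>The inner \<open>ract\<close> brings a class to its co-Yoneda form, on which the section
  is defined. \<open>mu1\<close> follows the same pattern.\<close>

definition eta1 :: "'u prof \<Rightarrow> 'u ptrans" where
  "eta1 F = ptr (comp_prof (L_prof T F) (diamond (L_eta T (Src F)))) (comp_prof (diamond (L_eta T (Trg F))) F)
     (\<lambda>y c p. eta_sec F y c (ract (L_prof T F) y (comp1 p) (eta_ob T c) (comp3 p) (comp2 p)))"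

definition mu_sec :: "'u prof \<Rightarrow> 'u \<Rightarrow> 'u \<Rightarrow> 'u \<Rightarrow> 'u" where
  "mu_sec F y K t = coend_in (diamond (L_mu T (Trg F))) (L_prof T (L_prof T F)) y K (mu_split y K (rdx t))
     (reindex (Trg F) (mu_ob T (mu_split y K (rdx t))) (rdx t)) (mu_flat K (cpt t))"

definition mu1 :: "'u prof \<Rightarrow> 'u ptrans" where
  "mu1 F = ptr (comp_prof (L_prof T F) (diamond (L_mu T (Src F)))) (comp_prof (diamond (L_mu T (Trg F))) (L_prof T (L_prof T F)))
     (\<lambda>y K p. mu_sec F y K (ract (L_prof T F) y (comp1 p) (mu_ob T K) (comp3 p) (comp2 p)))"

lemma eta1_simps [simp]: "Dom (eta1 F) = comp_prof (L_prof T F) (diamond (L_eta T (Src F)))"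
    "Cod (eta1 F) = comp_prof (diamond (L_eta T (Trg F))) F" "ext_cell (eta1 F)"
  by (simp_all add: eta1_def)

lemma mu1_simps [simp]: "Dom (mu1 F) = comp_prof (L_prof T F) (diamond (L_mu T (Src F)))"
    "Cod (mu1 F) = comp_prof (diamond (L_mu T (Trg F))) (L_prof T (L_prof T F))" "ext_cell (mu1 F)"
  by (simp_all add: mu1_def)

lemma el_eta_el: "el F d c x \<Longrightarrow> el (L_prof T F) (eta_ob T d) (eta_ob T c) (eta_el x)"
  using el_Ob[of F d c x] unfolding eta_el_def by (intro el_L_fam) (auto simp: lmap_def tm_id TUnit_in)

lemma ar_eta_split: "category C \<Longrightarrow> y \<in> Ob (L_cat T C) \<Longrightarrow> x \<in> elts (idx y) \<Longrightarrow> TUnit T (idx y) x = lab y \<Longrightarrow>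
    ar (L_cat T C) y (eta_ob T (ob y x)) (reindex C (eta_ob T (ob y x)) (\<lambda>_. x))"
  by (rule ar_reindex) (auto simp: lmap_eta L_Ob_ob)

context
  fixes F :: "'u prof"
  assumes F: "PR F"
begin

private lemmas FP = PR_profunctor[OF F] and FS = PR_Src[OF F] and FT = PR_Trg[OF F]
private lemmas LFP = PR_L_prof[OF F]

lemma eta_sec_props:
  assumes t: "el (L_prof T F) y (eta_ob T c) t"
  shows "ar (L_cat T (Trg F)) y (eta_ob T (ob y (rdx t star))) (reindex (Trg F) (eta_ob T (ob y (rdx t star))) (\<lambda>_. rdx t star))"
    and "el F (ob y (rdx t star)) c (cpt t star)"
proof -
  have y: "y \<in> Ob (L_cat T (Trg F))" using el_Ob(1)[OF t] by simp
  show "ar (L_cat T (Trg F)) y (eta_ob T (ob y (rdx t star))) (reindex (Trg F) (eta_ob T (ob y (rdx t star))) (\<lambda>_. rdx t star))"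
    using el_L_lmap[OF t] by (intro ar_eta_split FT y) (auto simp: lmap_eta[OF y])
  show "el F (ob y (rdx t star)) c (cpt t star)"
    using el_L_cpt[OF t, of star] by simp
qed

text \<open>An arrow \<open>h\<close> into \<open>eta_ob T d\<close> is a pure reindexing followed
  by the image under the unit of its single component. Gliding this component into \<open>x\<close>
  gives the representative that \<open>eta_sec\<close> selects.\<close>

lemma eta_sec_lact:
  assumes h: "ar (L_cat T (Trg F)) y (eta_ob T d) h" and x: "el F d c x"
  shows "eta_sec F y c (lact (L_prof T F) y (eta_ob T d) (eta_ob T c) h (eta_el x)) = coend_in (diamond (L_eta T (Trg F))) F y c d h x"
proof -
  let ?g = "L_eta T (Trg F)" and ?P = "L_prof T F"
  note g = catfunctor_L_eta[OF FT]
  let ?s = "lact ?P y (eta_ob T d) (eta_ob T c) h (eta_el x)" and ?d = "ob y (rdx h star)"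
  let ?r = "reindex (Trg F) (eta_ob T ?d) (\<lambda>_. rdx h star)"
  have s: "el ?P y (eta_ob T c) ?s" using el_lact[OF PR_profunctor[OF LFP] _ el_eta_el[OF x], of y h] h by simp
  have hc: "ar (Trg F) ?d d (cpt h star)" using ar_L_cpt[OF h, of star] by simp
  have s_simps: "rdx ?s star = rdx h star" "cpt ?s star = lact F ?d d c (cpt h star) x"
    by (simp_all add: lact_L)
  have r: "el (diamond ?g) y ?d ?r"
    using eta_sec_props(1)[OF s] ar_Ob(1)[OF hc] by (simp add: s_simps el_diamond[OF g])
  have "ract (diamond ?g) y ?d d (cpt h star) ?r = h"
    using ract_diamond[OF g _ r, of d "cpt h star"] hc
    by (simp, intro fam_eqI[OF _ ar_L_eta[OF h]]) (auto simp: Cmp_L Cmp_Ide_r[OF FT hc])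
  then show ?thesis
    using coend_glide[OF hc r x] by (simp add: eta_sec_def s_simps)
qed

text \<open>The general inversion with \<open>eta_el\<close> for \<open>\<kappa>\<close>. The last
  statement evaluates the inverse at arbitrary classes \<open>[t, k]\<close>, which is what the
  chases meet when \<open>k\<close> is not an identity.\<close>

lemma
  shows eta1_cell: "eta1 F \<in> cells (comp_prof (L_prof T F) (diamond (L_eta T (Src F)))) (comp_prof (diamond (L_eta T (Trg F))) F)"
    and eta1_inverse: "mutually_inverse PROF (eta_canonical T F) (eta1 F)"
    and sends_eta1: "el (L_prof T F) y b t \<Longrightarrow> ar (L_cat T (Src F)) b (eta_ob T c) k \<Longrightarrow> c \<in> Ob (Src F) \<Longrightarrow>
      sends (eta1 F) y c (coend_in (L_prof T F) (diamond (L_eta T (Src F))) y c b t k)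
        (eta_sec F y c (ract (L_prof T F) y b (eta_ob T c) k t))"
proof -
  let ?f = "L_eta T (Src F)" and ?g = "L_eta T (Trg F)" and ?P = "L_prof T F"
  note f = catfunctor_L_eta[OF FS] and g = catfunctor_L_eta[OF FT]
  have ty: "FSrc ?f = Src F" "FSrc ?g = Trg F" "Src ?P = FTrg ?f" "Trg ?P = FTrg ?g" by simp_all
  have k1: "el ?P (FOb ?g d) (FOb ?f c) (eta_el x)" if "el F d c x" for d c x
    using el_eta_el[OF that] by simp
  have k2: "eta_el (Act F d' d c c' u v x) = Act ?P (FOb ?g d') (FOb ?g d) (FOb ?f c) (FOb ?f c') (FAr ?g d' d u) (FAr ?f c c' v) (eta_el x)"
    for d d' c c' u v x
    unfolding Act_L L_eta_simps by (subst (1) eta_el_def) (rule fam_ar_cong, auto)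
  have al: "eta_canonical T F = ptr (comp_prof (diamond ?g) F) (comp_prof ?P (diamond ?f))
      (\<lambda>y c p. coyoneda ?P ?f y c (lact ?P y (FOb ?g (comp1 p)) (FOb ?f c) (comp2 p) (eta_el (comp3 p))))"
    by (simp add: eta_canonical_def Let_def)
  have N: "\<exists>d h x. eta_sec F y c t = coend_in (diamond ?g) F y c d h x \<and> ar (FTrg ?g) y (FOb ?g d) h \<and> el F d c x \<and>
      lact ?P y (FOb ?g d) (FOb ?f c) h (eta_el x) = t"
    if "el ?P y (FOb ?f c) t" "c \<in> Ob (Src F)" for y c t
  proof -
    have t: "el ?P y (eta_ob T c) t" using that by simp
    have "lact ?P y (eta_ob T (ob y (rdx t star))) (eta_ob T c) (reindex (Trg F) (eta_ob T (ob y (rdx t star))) (\<lambda>_. rdx t star)) (eta_el (cpt t star)) = t"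
      by (rule fam_eqI[OF _ el_L_eta[OF t]]) (auto simp: lact_L lact_Ide[OF FP eta_sec_props(2)[OF t]])
    then show ?thesis
      using eta_sec_props[OF t] by (auto simp: eta_sec_def)
  qed
  have Nc: "eta_sec F y c (lact ?P y (FOb ?g d) (FOb ?f c) h (eta_el x)) = coend_in (diamond ?g) F y c d h x"
    if "ar (FTrg ?g) y (FOb ?g d) h" "el F d c x" for y d c h x
    using eta_sec_lact[of y d h c x] that by simp
  have be: "eta1 F = ptr (comp_prof ?P (diamond ?f)) (comp_prof (diamond ?g) F)
      (\<lambda>y c p. eta_sec F y c (ract ?P y (comp1 p) (FOb ?f c) (comp3 p) (comp2 p)))"
    by (simp add: eta1_def)
  note * = canonical_inverse_cell canonical_mutually_inverse sends_canonical_inverse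
  note ** = *[where f = ?f and g = ?g and \<kappa> = "\<lambda>d c x. eta_el x", OF f g LFP F ty k1 k2 al N Nc be]
  show "eta1 F \<in> cells (comp_prof ?P (diamond ?f)) (comp_prof (diamond ?g) F)" "mutually_inverse PROF (eta_canonical T F) (eta1 F)"
    by (rule **(1) **(2); assumption)+
  show "sends (eta1 F) y c (coend_in ?P (diamond ?f) y c b t k) (eta_sec F y c (ract ?P y b (eta_ob T c) k t))"
    if "el ?P y b t" "ar (L_cat T (Src F)) b (eta_ob T c) k" "c \<in> Ob (Src F)"
    using **(3)[of y b t c k] that by simp
qed

lemma sends_eta1_coyoneda:
  assumes t: "el (L_prof T F) y (eta_ob T c) t" and c: "c \<in> Ob (Src F)"
  shows "sends (eta1 F) y c (coyoneda (L_prof T F) (L_eta T (Src F)) y c t) (eta_sec F y c t)"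
  using sends_eta1[OF t ar_Ide[OF category_L_cat[OF FS]] c] ract_Ide[OF PR_profunctor[OF LFP] t] c by (simp add: coyoneda_def)

end

lemma mu_split_Ob:
  assumes "y \<in> Ob (L_cat T D)" "K \<in> Ob (L_cat T (L_cat T C))" "lmap y (mu_ob T K) r"
  shows "mu_split y K r \<in> Ob (L_cat T (L_cat T D))"
  using assms lmapD[OF assms(3)] unfolding mu_split_def
  by (auto simp: L_Ob_lab L_Ob_lab[OF L_Ob_ob] L_Ob_ob)

text \<open>The label of a disjoint union is computed from the index sets and labels of both levels,
  and \<open>mu_split\<close> takes these over from \<open>K\<close>.\<close>

lemma lab_mu_split: "lab (mu_ob T (mu_split y K r)) = lab (mu_ob T K)"
  unfolding lab_mu by (simp, rule bind_cong) simp

lemma lmap_mu_split: "lmap y (mu_ob T (mu_split y' K r')) r \<longleftrightarrow> lmap y (mu_ob T K) r"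
  by (simp add: lmap_def lab_mu_split)

lemma lmap_idI: "B \<in> Ob (L_cat T C) \<Longrightarrow> idx A = idx B \<Longrightarrow> lab A = lab B \<Longrightarrow> (\<And>x. x \<in> elts (idx B) \<Longrightarrow> r x = x) \<Longrightarrow> lmap A B r"
  using tm_id[OF L_Ob_lab[of B C]] tm_cong[of "idx B" r "\<lambda>x. x" "idx B"] by (simp add: lmap_def)

lemma ar_mu_split:
  assumes "category D" "y \<in> Ob (L_cat T D)" "K \<in> Ob (L_cat T (L_cat T C))" "lmap y (mu_ob T K) r"
  shows "ar (L_cat T D) y (mu_ob T (mu_split y K r)) (reindex D (mu_ob T (mu_split y K r)) r)"
  using assms by (intro ar_reindex mu_ob_Ob mu_split_Ob) (auto simp: lmap_mu_split)

text \<open>Index maps are identities at both levels, so the label conditions reduce to equality of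
  labels. At a hom profunctor the lemma produces arrows between families of families.\<close>

lemma el_mu_flat:
  assumes A: "A \<in> Ob (L_cat T (L_cat T (Trg F)))" and K: "K \<in> Ob (L_cat T (L_cat T (Src F)))"
    and "idx A = idx K" "lab A = lab K"
    and "\<And>x. x \<in> elts (idx K) \<Longrightarrow> idx (ob A x) = idx (ob K x)" "\<And>x. x \<in> elts (idx K) \<Longrightarrow> lab (ob A x) = lab (ob K x)"
    and "\<And>x z. x \<in> elts (idx K) \<Longrightarrow> z \<in> elts (idx (ob K x)) \<Longrightarrow> el F (ob (ob A x) z) (ob (ob K x) z) (\<zeta> (pr x z))"
  shows "el (L_prof T (L_prof T F)) A K (mu_flat K \<zeta>)"
proof -
  have *: "el (L_prof T F) (ob A x) (ob K x) (fam_ar (idx (ob K x)) (\<lambda>z. z) (\<lambda>z. \<zeta> (pr x z)))" if "x \<in> elts (idx K)" for x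
    using assms that L_Ob_ob[OF A, of x] L_Ob_ob[OF K, of x] by (intro el_L_fam lmap_idI) auto
  show ?thesis
    unfolding mu_flat_def by (rule el_L_fam) (use assms * in \<open>auto intro!: lmap_idI[OF K]\<close>)
qed

lemma el_mu_flat_split:
  assumes t: "el (L_prof T F) y (mu_ob T K) t" and K: "K \<in> Ob (L_cat T (L_cat T (Src F)))"
  shows "el (L_prof T (L_prof T F)) (mu_split y K (rdx t)) K (mu_flat K (cpt t))"
proof (rule el_mu_flat[OF mu_split_Ob[OF _ K el_L_lmap[OF t]] K])
  show "el F (ob (ob (mu_split y K (rdx t)) x) z) (ob (ob K x) z) (cpt t (pr x z))"
    if "x \<in> elts (idx K)" "z \<in> elts (idx (ob K x))" for x z
    using el_L_cpt[OF t, of "pr x z"] that by simp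
qed (use el_Ob(1)[OF t] in simp_all)

context
  fixes F :: "'u prof"
  assumes F: "PR F"
begin

private lemmas FP' = PR_profunctor[OF F] and FS' = PR_Src[OF F] and FT' = PR_Trg[OF F]
private lemmas LFP' = PR_L_prof[OF F] and LLFP' = PR_L_prof[OF PR_L_prof[OF F]]

lemma lact_mu_flat:
  assumes t: "el (L_prof T F) y (mu_ob T K) t"
  shows "lact (L_prof T F) y (mu_ob T (mu_split y K (rdx t))) (mu_ob T K)
      (reindex (Trg F) (mu_ob T (mu_split y K (rdx t))) (rdx t)) (mu_el K (mu_flat K (cpt t))) = t"
proof (rule fam_eqI[OF _ el_L_eta[OF t]])
  fix s assume "s \<in> elts (idx (mu_ob T K))"
  then have s: "s \<in> elts (mu_idx K)" by simp
  from s show "rdx (lact (L_prof T F) y (mu_ob T (mu_split y K (rdx t))) (mu_ob T K)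
      (reindex (Trg F) (mu_ob T (mu_split y K (rdx t))) (rdx t)) (mu_el K (mu_flat K (cpt t)))) s = rdx t s"
    by (auto simp: lact_L)
  from s show "cpt (lact (L_prof T F) y (mu_ob T (mu_split y K (rdx t))) (mu_ob T K)
      (reindex (Trg F) (mu_ob T (mu_split y K (rdx t))) (rdx t)) (mu_el K (mu_flat K (cpt t)))) s = cpt t s"
    using lact_Ide[OF FP' el_L_cpt[OF t, of s]] by (auto simp: lact_L)
qed (simp add: lact_L)

text \<open>The relation identifies \<open>[h, t]\<close> first with \<open>[h1, t1]\<close>, where \<open>t1\<close> does not reindex, then absorbs the family of \<open>h1\<close> into \<open>t1\<close>.\<close>

lemma mu_sec_lact:
  assumes h: "ar (L_cat T (Trg F)) y (mu_ob T H) h" and t: "el (L_prof T (L_prof T F)) H K t"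
  shows "mu_sec F y K (lact (L_prof T F) y (mu_ob T H) (mu_ob T K) h (mu_el K t))
    = coend_in (diamond (L_mu T (Trg F))) (L_prof T (L_prof T F)) y K H h t"
proof -
  let ?D = "Trg F" and ?LLF = "L_prof T (L_prof T F)"
  let ?g = "L_mu T ?D" and ?k = "mu_el K t"
  let ?s = "lact (L_prof T F) y (mu_ob T H) (mu_ob T K) h ?k"
  note g = catfunctor_L_mu[OF FT']
  note LD = category_L_cat[OF FT']
  have H: "H \<in> Ob (L_cat T (L_cat T ?D))" and K: "K \<in> Ob (L_cat T (L_cat T (Src F)))" using el_Ob[OF t] by simp_all
  have y: "y \<in> Ob (L_cat T ?D)" using ar_Ob[OF h] by simp
  note k = el_mu_el[OF t]
  have s: "el (L_prof T F) y (mu_ob T K) ?s" using el_lact[OF PR_profunctor[OF LFP'] _ k, of y h] h by simp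
  have mem: "rdx t x \<in> elts (idx H)" "rdx (cpt t x) z \<in> elts (idx (ob H (rdx t x)))"
    if "x \<in> elts (idx K)" "z \<in> elts (idx (ob K x))" for x z
    using el_L_rdx[OF t] el_L_rdx[OF el_L_cpt[OF t]] that by auto
  \<comment> \<open>The shape of \<open>K\<close> with the objects of \<open>H\<close> that
    \<open>t\<close> points to. The arrow \<open>?w\<close> performs the index maps of
    \<open>t\<close> with identity components, so that \<open>t\<close> is \<open>?t1\<close> acted
    on by \<open>?w\<close>.\<close>
  let ?H1 = "mu_split (mu_ob T H) K (rdx ?k)"
  let ?w = "fam_ar (idx K) (rdx t) (\<lambda>x. reindex ?D (ob ?H1 x) (rdx (cpt t x)))"
  let ?t1 = "mu_flat K (cpt ?k)" and ?h1 = "Cmp (L_cat T ?D) y (mu_ob T H) (mu_ob T ?H1) (mu_el ?H1 ?w) h"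
  have H1: "?H1 \<in> Ob (L_cat T (L_cat T ?D))" by (rule mu_split_Ob[OF mu_ob_Ob[OF H] K el_L_lmap[OF k]])
  have t1: "el ?LLF ?H1 K ?t1" by (rule el_mu_flat_split[OF k K])
  have w: "ar (L_cat T (L_cat T ?D)) H ?H1 ?w"
  proof (rule ar_L_fam[OF H H1])
    show "lmap H ?H1 (rdx t)" using el_L_lmap[OF t] by (simp add: lmap_def)
    fix x assume "x \<in> elts (idx ?H1)"
    then have x: "x \<in> elts (idx K)" by simp
    have "lmap (ob H (rdx t x)) (ob ?H1 x) (rdx (cpt t x))"
      using el_L_lmap[OF el_L_cpt[OF t x]] x by (simp add: lmap_def)
    then show "ar (L_cat T ?D) (ob H (rdx t x)) (ob ?H1 x) (reindex ?D (ob ?H1 x) (rdx (cpt t x)))"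
      using x mem by (intro ar_reindex FT' L_Ob_ob[OF H] L_Ob_ob[OF H1]) (simp_all add: el_L_rdx[OF t])
  qed simp
  have "lact ?LLF H ?H1 K ?w ?t1 = t"
  proof (rule fam_eqI[OF _ el_L_eta[OF t]])
    fix x assume x: "x \<in> elts (idx K)"
    note c = el_L_cpt[OF t x]
    show "cpt (lact ?LLF H ?H1 K ?w ?t1) x = cpt t x"
      unfolding lact_L[of "L_prof T F"] using x mem lact_Ide[OF FP' el_L_cpt[OF c]]
      by (intro fam_eqI[OF _ el_L_eta[OF c]]) (simp_all add: lact_L)
  qed (simp_all add: lact_L)
  moreover have h': "el (diamond ?g) y H h" using h H by (simp add: el_diamond[OF g])
  moreover have "ract (diamond ?g) y H ?H1 ?w h = ?h1"
    using ract_diamond[OF g _ h', of ?H1 ?w] w by simp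
  ultimately have 1: "coend_in (diamond ?g) ?LLF y K H h t = coend_in (diamond ?g) ?LLF y K ?H1 ?h1 ?t1"
    using coend_glide[of ?LLF H ?H1 ?w "diamond ?g" y h K ?t1] w t1 by simp
  have h1: "ar (L_cat T ?D) y (mu_ob T ?H1) ?h1"
    by (rule ar_Cmp[OF LD h]) (use ar_FAr[OF g, of H ?H1 ?w] w in simp)
  let ?H' = "mu_split y K (rdx ?s)" let ?h' = "reindex ?D (mu_ob T ?H') (rdx ?s)"
  \<comment> \<open>The components of \<open>?h1\<close> with identity index maps. The arrow
    \<open>?h1\<close> is the reindexing \<open>?h'\<close> followed by the union of
    \<open>?w'\<close>, and \<open>?w'\<close> acting on \<open>?t1\<close> gives the flat element
    used by \<open>mu_sec\<close>.\<close>
  let ?w' = "mu_flat K (cpt ?h1)"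
  have H': "?H' \<in> Ob (L_cat T (L_cat T ?D))" by (rule mu_split_Ob[OF y K el_L_lmap[OF s]])
  have rs: "rdx ?s (pr x z) = rdx ?h1 (pr x z)" if "x \<in> elts (idx K)" "z \<in> elts (idx (ob K x))" for x z
    using that by (simp add: lact_L Cmp_L)
  have h1_cpt: "cpt ?h1 (pr x z) = cpt h (pr (rdx t x) (rdx (cpt t x) z))"
    if xz: "x \<in> elts (idx K)" "z \<in> elts (idx (ob K x))" for x z
    using xz mem[OF xz] Cmp_Ide_l[OF FT' ar_L_cpt[OF h, of "pr (rdx t x) (rdx (cpt t x) z)"]] by (simp add: Cmp_L)
  have "el (L_prof T (L_prof T (hom_prof ?D))) ?H' ?H1 (mu_flat ?H1 (cpt ?h1))"
  proof (rule el_mu_flat)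
    show "el (hom_prof ?D) (ob (ob ?H' x) z) (ob (ob ?H1 x) z) (cpt ?h1 (pr x z))"
      if "x \<in> elts (idx ?H1)" "z \<in> elts (idx (ob ?H1 x))" for x z
      using ar_L_cpt[OF h1, of "pr x z"] that rs[of x z] by simp
  qed (use H1 H' in simp_all)
  moreover have "mu_flat ?H1 (cpt ?h1) = ?w'" by (simp add: mu_flat_def)
  ultimately have w': "ar (L_cat T (L_cat T ?D)) ?H' ?H1 ?w'" by (simp add: el_LL_hom_prof)
  have "lact ?LLF ?H' ?H1 K ?w' ?t1 = mu_flat K (cpt ?s)"
    unfolding lact_L[of "L_prof T F"] mu_flat_def[of K "cpt ?s"]
    by (rule fam_ar_cong) (simp_all add: lact_L rs h1_cpt)
  moreover have h'': "el (diamond ?g) y ?H' ?h'"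
    using ar_mu_split[OF FT' y K el_L_lmap[OF s]] H' by (simp add: el_diamond[OF g])
  moreover have "ract (diamond ?g) y ?H' ?H1 ?w' ?h' = ?h1"
  proof -
    have "Cmp (L_cat T ?D) y (mu_ob T ?H') (mu_ob T ?H1) (mu_el ?H1 ?w') ?h' = ?h1"
    proof (rule fam_eqI[OF _ ar_L_eta[OF h1]])
      fix p assume "p \<in> elts (idx (mu_ob T ?H1))"
      then obtain x z where p: "p = pr x z" and x: "x \<in> elts (idx K)" and z: "z \<in> elts (idx (ob K x))" by auto
      show "rdx (Cmp (L_cat T ?D) y (mu_ob T ?H') (mu_ob T ?H1) (mu_el ?H1 ?w') ?h') p = rdx ?h1 p"
        unfolding p Cmp_L[of _ y "mu_ob T ?H'"] using x z by (simp add: rs)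
      show "cpt (Cmp (L_cat T ?D) y (mu_ob T ?H') (mu_ob T ?H1) (mu_el ?H1 ?w') ?h') p = cpt ?h1 p"
        unfolding p Cmp_L[of _ y "mu_ob T ?H'"] using x z Cmp_Ide_r[OF FT' ar_L_cpt[OF h1, of "pr x z"]] by (simp add: rs)
    qed (simp add: Cmp_L)
    then show ?thesis
      using ract_diamond[OF g _ h'', of ?H1 ?w'] w' by simp
  qed
  ultimately have "coend_in (diamond ?g) ?LLF y K ?H1 ?h1 ?t1 = mu_sec F y K ?s"
    unfolding mu_sec_def using coend_glide[of ?LLF ?H' ?H1 ?w' "diamond ?g" y ?h' K ?t1] w' t1 by simp
  with 1 show ?thesis by simp
qed

text \<open>The general inversion with \<open>mu_el\<close> for \<open>\<kappa>\<close>: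
  \<open>lact_mu_flat\<close> shows that \<open>mu_sec\<close> is a section,
  \<open>mu_sec_lact\<close> that every factorization is equivalent to the selected one.\<close>

lemma
  shows mu1_cell: "mu1 F \<in> cells (comp_prof (L_prof T F) (diamond (L_mu T (Src F)))) (comp_prof (diamond (L_mu T (Trg F))) (L_prof T (L_prof T F)))"
    and mu1_inverse: "mutually_inverse PROF (mu_canonical T F) (mu1 F)"
    and sends_mu1: "el (L_prof T F) y b t \<Longrightarrow> ar (L_cat T (Src F)) b (mu_ob T K) k \<Longrightarrow> K \<in> Ob (L_cat T (L_cat T (Src F))) \<Longrightarrow>
      sends (mu1 F) y K (coend_in (L_prof T F) (diamond (L_mu T (Src F))) y K b t k)
        (mu_sec F y K (ract (L_prof T F) y b (mu_ob T K) k t))"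
proof -
  let ?f = "L_mu T (Src F)" and ?g = "L_mu T (Trg F)" and ?P = "L_prof T F" and ?Q = "L_prof T (L_prof T F)"
  note f = catfunctor_L_mu[OF FS'] and g = catfunctor_L_mu[OF FT']
  have ty: "FSrc ?f = Src ?Q" "FSrc ?g = Trg ?Q" "Src ?P = FTrg ?f" "Trg ?P = FTrg ?g" by simp_all
  have k1: "el ?P (FOb ?g d) (FOb ?f c) (mu_el c x)" if "el ?Q d c x" for d c x
    using el_mu_el[OF that] by simp
  have k2: "mu_el c' (Act ?Q d' d c c' u v x) = Act ?P (FOb ?g d') (FOb ?g d) (FOb ?f c) (FOb ?f c') (FAr ?g d' d u) (FAr ?f c c' v) (mu_el c x)"
    if "ar (Trg ?Q) d' d u" "ar (Src ?Q) c c' v" "el ?Q d c x" for d d' c c' u v x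
    using mu_el_Act[of F d' d u c c' v x] that by simp
  have al: "mu_canonical T F = ptr (comp_prof (diamond ?g) ?Q) (comp_prof ?P (diamond ?f))
      (\<lambda>y c p. coyoneda ?P ?f y c (lact ?P y (FOb ?g (comp1 p)) (FOb ?f c) (comp2 p) (mu_el c (comp3 p))))"
    by (simp add: mu_canonical_def Let_def)
  have N: "\<exists>d h x. mu_sec F y c t = coend_in (diamond ?g) ?Q y c d h x \<and> ar (FTrg ?g) y (FOb ?g d) h \<and> el ?Q d c x \<and>
      lact ?P y (FOb ?g d) (FOb ?f c) h (mu_el c x) = t"
    if "el ?P y (FOb ?f c) t" "c \<in> Ob (Src ?Q)" for y c t
  proof -
    have t: "el ?P y (mu_ob T c) t" and c: "c \<in> Ob (L_cat T (L_cat T (Src F)))" and y: "y \<in> Ob (L_cat T (Trg F))"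
      using that el_Ob(1)[OF that(1)] by simp_all
    show ?thesis
      using lact_mu_flat[OF t] el_mu_flat_split[OF t c] ar_mu_split[OF FT' y c el_L_lmap[OF t]]
      unfolding mu_sec_def L_mu_simps by blast
  qed
  have Nc: "mu_sec F y c (lact ?P y (FOb ?g d) (FOb ?f c) h (mu_el c x)) = coend_in (diamond ?g) ?Q y c d h x"
    if "ar (FTrg ?g) y (FOb ?g d) h" "el ?Q d c x" for y d c h x
    using mu_sec_lact[of y d h c x] that by simp
  have be: "mu1 F = ptr (comp_prof ?P (diamond ?f)) (comp_prof (diamond ?g) ?Q)
      (\<lambda>y c p. mu_sec F y c (ract ?P y (comp1 p) (FOb ?f c) (comp3 p) (comp2 p)))"
    by (simp add: mu1_def)
  note * = canonical_inverse_cell canonical_mutually_inverse sends_canonical_inverse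
  note ** = *[where f = ?f and g = ?g and \<kappa> = "\<lambda>d c x. mu_el c x", OF f g LFP' LLFP' ty k1 k2 al N Nc be]
  show "mu1 F \<in> cells (comp_prof ?P (diamond ?f)) (comp_prof (diamond ?g) ?Q)" "mutually_inverse PROF (mu_canonical T F) (mu1 F)"
    by (rule **(1) **(2); assumption)+
  show "sends (mu1 F) y K (coend_in ?P (diamond ?f) y K b t k) (mu_sec F y K (ract ?P y b (mu_ob T K) k t))"
    if "el ?P y b t" "ar (L_cat T (Src F)) b (mu_ob T K) k" "K \<in> Ob (L_cat T (L_cat T (Src F)))"
    using **(3)[of y b t K k] that by simp
qed

lemma sends_mu1_coyoneda:
  assumes t: "el (L_prof T F) y (mu_ob T K) t" and K: "K \<in> Ob (L_cat T (L_cat T (Src F)))"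
  shows "sends (mu1 F) y K (coyoneda (L_prof T F) (L_mu T (Src F)) y K t) (mu_sec F y K t)"
  using sends_mu1[OF t ar_Ide[OF category_L_cat[OF FS'] mu_ob_Ob[OF K]] K] ract_Ide[OF PR_profunctor[OF LFP'] t] by (simp add: coyoneda_def)

end

context
  fixes C :: "'u cat"
  assumes C: "category C"
begin

lemma ract_L_hom: "ar (L_cat T C) A B t \<Longrightarrow> ar (L_cat T C) B B' v \<Longrightarrow>
    ract (L_prof T (hom_prof C)) A B B' v t = Cmp (L_cat T C) A B B' v t"
  unfolding Cmp_L
  by (subst ract_L) (auto intro!: fam_ar_cong ract_hom_prof[OF C] ar_L_cpt simp: ar_L_rdx)

lemma lact_L_hom: "ar (L_cat T C) A B t \<Longrightarrow> ar (L_cat T C) A' A u \<Longrightarrow>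
    lact (L_prof T (hom_prof C)) A' A B u t = Cmp (L_cat T C) A' A B t u"
  unfolding Cmp_L lact_L
  by (auto intro!: fam_ar_cong lact_hom_prof[OF C] ar_L_cpt simp: ar_L_rdx)

text \<open>The case of an identity in \<open>eta_sec_lact\<close>: acting with \<open>x\<close> on
  the image of an identity gives \<open>x\<close> back.\<close>

lemma eta_sec_hom:
  assumes "ar (L_cat T C) y (eta_ob T c) x" "c \<in> Ob C"
  shows "eta_sec (hom_prof C) y c x = coend_in (diamond (L_eta T C)) (hom_prof C) y c c x (Ide C c)"
  using eta_sec_lact[OF PR_hom_prof[OF C], of y c x c "Ide C c"] lact_L_hom[of "eta_ob T c" "eta_ob T c" "eta_el (Ide C c)" y x]
    ar_FAr[OF catfunctor_L_eta[OF C], of c c "Ide C c"] FAr_Ide[OF catfunctor_L_eta[OF C], of c] assms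
    Cmp_Ide_l[OF category_L_cat[OF C] assms(1)]
  by (simp add: ar_Ide[OF C])

lemma mu_sec_hom:
  assumes "ar (L_cat T C) y (mu_ob T K) x" "K \<in> Ob (L_cat T (L_cat T C))"
  shows "mu_sec (hom_prof C) y K x
    = coend_in (diamond (L_mu T C)) (L_prof T (L_prof T (hom_prof C))) y K K x (Ide (L_cat T (L_cat T C)) K)"
  using mu_sec_lact[OF PR_hom_prof[OF C], of y K x K "Ide (L_cat T (L_cat T C)) K"]
    lact_L_hom[of "mu_ob T K" "mu_ob T K" "mu_el K (Ide (L_cat T (L_cat T C)) K)" y x]
    ar_FAr[OF catfunctor_L_mu[OF C], of K K "Ide (L_cat T (L_cat T C)) K"] FAr_Ide[OF catfunctor_L_mu[OF C], of K] assms
    Cmp_Ide_l[OF category_L_cat[OF C] assms(1)]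
  by (simp add: ar_Ide[OF category_L_cat[OF category_L_cat[OF C]]] el_LL_hom_prof)

end

section \<open>Transformation laws of the unit and the multiplication\<close>

lemma eta_natural:
  assumes \<alpha>: "\<alpha> \<in> cells F F'"
  shows "(diamond (L_eta T (Trg F)) \<triangleleft> \<alpha>) \<cdot> eta1 F
    = eta1 F' \<cdot> (L_cell T \<alpha> \<triangleright> diamond (L_eta T (Src F)))"
proof -
  note F = cell_PR(1)[OF \<alpha>] and F' = cell_PR(2)[OF \<alpha>]
  note S = PR_Src[OF F] and Tr = PR_Trg[OF F]
  note f = catfunctor_L_eta[OF S] and g = catfunctor_L_eta[OF Tr]
  have *: "(diamond (L_eta T (Trg F)) \<triangleleft> \<alpha>) \<cdot> eta1 F
    = eta1 F' \<cdot> (L_cell T \<alpha> \<triangleright> diamond (L_eta T (Src F)))"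
  proof (rule cell_eq_diamondI[OF f PR_L_prof[OF F]])
    fix y c t assume "el (L_prof T F) y (FOb (L_eta T (Src F)) c) t" "c \<in> Ob (FSrc (L_eta T (Src F)))"
    then have t: "el (L_prof T F) y (eta_ob T c) t" and c: "c \<in> Ob (Src F)" by simp_all
    note h = eta_sec_props[OF F t]
    let ?t' = "fam_ar one (rdx t) (\<lambda>x. Cpt \<alpha> (ob y (rdx t x)) (ob (eta_ob T c) x) (cpt t x))"
    have t': "sends (L_cell T \<alpha>) y (eta_ob T c) t ?t'"
      using sends_L_cell[of \<alpha> y "eta_ob T c" t "\<lambda>x. Cpt \<alpha> (ob y (rdx t x)) (ob (eta_ob T c) x) (cpt t x)" "rdx t"]
        t sends_Cpt[OF \<alpha> el_L_cpt[OF t]] by (simp add: cell_Dom[OF \<alpha>])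
    have 1: "sends (diamond (L_eta T (Trg F)) \<triangleleft> \<alpha>) y c (eta_sec F y c t) (eta_sec F' y c ?t')"
      unfolding eta_sec_def
      using sends_lwhisker[OF \<alpha> PR_diamond[OF g] _ _ sends_Cpt[OF \<alpha> h(2)]] h el_Ob(1)[OF h(2)]
      by (simp add: cell_Trg[OF \<alpha>] el_diamond[OF g])
    have 2: "sends (eta1 F') y c (coyoneda (L_prof T F') (L_eta T (Src F)) y c ?t') (eta_sec F' y c ?t')"
      using sends_eta1_coyoneda[OF F', of y c ?t'] sends_el[OF L_cell_cell[OF \<alpha>] t'] c by (simp add: cell_Src[OF \<alpha>])
    have 3: "sends (L_cell T \<alpha> \<triangleright> diamond (L_eta T (Src F))) y c (coyoneda (L_prof T F) (L_eta T (Src F)) y c t)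
      (coyoneda (L_prof T F') (L_eta T (Src F)) y c ?t')"
      by (rule sends_rwhisker_coyoneda[OF L_cell_cell[OF \<alpha>] f]) (use c t' in simp_all)
    show "\<exists>q. sends ((diamond (L_eta T (Trg F)) \<triangleleft> \<alpha>) \<cdot> eta1 F) y c (coyoneda (L_prof T F) (L_eta T (Src F)) y c t) q
      \<and> sends (eta1 F' \<cdot> (L_cell T \<alpha> \<triangleright> diamond (L_eta T (Src F)))) y c (coyoneda (L_prof T F) (L_eta T (Src F)) y c t) q"
      using sends_vcomp[OF sends_eta1_coyoneda[OF F t c] 1] sends_vcomp[OF 3 2] by blast
  qed (simp_all add: cell_Dom[OF \<alpha>] cell_Cod[OF \<alpha>] cell_Trg[OF \<alpha>])
  then show ?thesis .
qed

text \<open>A 2-cell changes components but no index maps, so an element and its image are split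
  over the same object by the same reindexing.\<close>

lemma mu_natural:
  assumes \<alpha>: "\<alpha> \<in> cells F F'"
  shows "(diamond (L_mu T (Trg F)) \<triangleleft> L_cell T (L_cell T \<alpha>)) \<cdot> mu1 F
    = mu1 F' \<cdot> (L_cell T \<alpha> \<triangleright> diamond (L_mu T (Src F)))"
proof -
  note F = cell_PR(1)[OF \<alpha>] and F' = cell_PR(2)[OF \<alpha>]
  note S = PR_Src[OF F] and Tr = PR_Trg[OF F]
  note f = catfunctor_L_mu[OF S] and g = catfunctor_L_mu[OF Tr]
  note L\<alpha> = L_cell_cell[OF \<alpha>]
  show ?thesis
  proof (rule cell_eq_diamondI[OF f PR_L_prof[OF F]])
    fix y K t assume "el (L_prof T F) y (FOb (L_mu T (Src F)) K) t" "K \<in> Ob (FSrc (L_mu T (Src F)))"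
    then have t: "el (L_prof T F) y (mu_ob T K) t" and K: "K \<in> Ob (L_cat T (L_cat T (Src F)))" by simp_all
    have y: "y \<in> Ob (L_cat T (Trg F))" using el_Ob[OF t] by simp
    let ?\<zeta> = "\<lambda>x. Cpt \<alpha> (ob y (rdx t x)) (ob (mu_ob T K) x) (cpt t x)"
    let ?t' = "fam_ar (mu_idx K) (rdx t) ?\<zeta>"
    have t': "sends (L_cell T \<alpha>) y (mu_ob T K) t ?t'"
      using sends_L_cell[of \<alpha> y "mu_ob T K" t ?\<zeta> "rdx t"] t sends_Cpt[OF \<alpha> el_L_cpt[OF t]] by (simp add: cell_Dom[OF \<alpha>])
    let ?H = "mu_split y K (rdx t)"
    have H: "mu_split y K (rdx ?t') = ?H" by (rule mu_split_cong) simp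
    have R: "reindex (Trg F) (mu_ob T ?H) (rdx ?t') = reindex (Trg F) (mu_ob T ?H) (rdx t)" by (rule reindex_cong) simp
    note flat = el_mu_flat_split[OF t K]
    have fl: "sends (L_cell T (L_cell T \<alpha>)) ?H K (mu_flat K (cpt t)) (mu_flat K (cpt ?t'))"
      unfolding mu_flat_def[of K "cpt ?t'"]
    proof (rule sends_L_cell)
      fix x assume x: "x \<in> elts (idx K)"
      show "sends (L_cell T \<alpha>) (ob ?H (rdx (mu_flat K (cpt t)) x)) (ob K x) (cpt (mu_flat K (cpt t)) x)
         (fam_ar (idx (ob K x)) (\<lambda>z. z) (\<lambda>z. cpt ?t' (pr x z)))"
        using el_L_cpt[OF flat x] x el_L_cpt[OF t, of "pr x _"]
        by (intro sends_L_cell) (auto simp: cell_Dom[OF \<alpha>] intro!: sends_Cpt[OF \<alpha>])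
    qed (use flat in \<open>simp_all add: cell_Dom[OF \<alpha>]\<close>)
    have 1: "sends (diamond (L_mu T (Trg F)) \<triangleleft> L_cell T (L_cell T \<alpha>)) y K (mu_sec F y K t) (mu_sec F' y K ?t')"
      unfolding mu_sec_def H cell_Trg[OF \<alpha>] R
      by (rule sends_lwhisker[OF L_cell_cell[OF L\<alpha>] PR_diamond[OF g] _ _ fl])
        (use ar_mu_split[OF Tr y K el_L_lmap[OF t]] mu_split_Ob[OF y K el_L_lmap[OF t]] in \<open>simp_all add: el_diamond[OF g]\<close>)
    have 2: "sends (mu1 F') y K (coyoneda (L_prof T F') (L_mu T (Src F)) y K ?t') (mu_sec F' y K ?t')"
      using sends_mu1_coyoneda[OF F', of y K ?t'] sends_el[OF L\<alpha> t'] K by (simp add: cell_Src[OF \<alpha>])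
    have 3: "sends (L_cell T \<alpha> \<triangleright> diamond (L_mu T (Src F))) y K (coyoneda (L_prof T F) (L_mu T (Src F)) y K t)
      (coyoneda (L_prof T F') (L_mu T (Src F)) y K ?t')"
      by (rule sends_rwhisker_coyoneda[OF L\<alpha> f]) (use K t' in simp_all)
    show "\<exists>q. sends ((diamond (L_mu T (Trg F)) \<triangleleft> L_cell T (L_cell T \<alpha>)) \<cdot> mu1 F) y K (coyoneda (L_prof T F) (L_mu T (Src F)) y K t) q
      \<and> sends (mu1 F' \<cdot> (L_cell T \<alpha> \<triangleright> diamond (L_mu T (Src F)))) y K (coyoneda (L_prof T F) (L_mu T (Src F)) y K t) q"
      using sends_vcomp[OF sends_mu1_coyoneda[OF F t K] 1] sends_vcomp[OF 3 2] by blast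
  qed (simp_all add: cell_Dom[OF \<alpha>] cell_Cod[OF \<alpha>] cell_Trg[OF \<alpha>])
qed

text \<open>Both paths send an arrow \<open>x\<close> to the class \<open>[x, 1]\<close>; on the
  left this is the value of \<open>eta1\<close> at a hom profunctor.\<close>

lemma eta_unit:
  assumes C: "category C"
  shows "(eta1 (hom_prof C) \<cdot> (L_unitor T C \<triangleright> diamond (L_eta T C))) \<cdot> \<ll>' (diamond (L_eta T C))
    = (diamond (L_eta T C) \<triangleleft> bid PROF (hom_prof C)) \<cdot> \<rr>' (diamond (L_eta T C))" (is "?l = ?r")
proof (rule cell_eqI)
  let ?e = "L_eta T C"
  note e = catfunctor_L_eta[OF C] note De = PR_diamond[OF e] note LC = category_L_cat[OF C]
  note hC = PR_hom_prof[OF C]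
  fix y c x assume "el (Dom ?r) y c x"
  then have x: "el (diamond ?e) y c x" by simp
  then have x': "ar (L_cat T C) y (eta_ob T c) x" and c: "c \<in> Ob C" by (simp_all add: el_diamond[OF e])
  note Iy = ar_Ide[OF LC ar_Ob(1)[OF x']]
  have 1: "sends (\<ll>' (diamond ?e)) y c x (coend_in (hom_prof (L_cat T C)) (diamond ?e) y c y (Ide (L_cat T C) y) x)"
    using sends_lunit_inv[OF De x] by simp
  have 2: "sends (L_unitor T C \<triangleright> diamond ?e) y c (coend_in (hom_prof (L_cat T C)) (diamond ?e) y c y (Ide (L_cat T C) y) x)
      (coend_in (L_prof T (hom_prof C)) (diamond ?e) y c y (Ide (L_cat T C) y) x)"
    by (rule sends_rwhisker[OF L_unitor_cell[OF C] De _ x sends_L_unitor[OF Iy]]) simp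
  have 3: "sends (eta1 (hom_prof C)) y c (coend_in (L_prof T (hom_prof C)) (diamond ?e) y c y (Ide (L_cat T C) y) x)
      (coend_in (diamond ?e) (hom_prof C) y c c x (Ide C c))"
    using sends_eta1[OF hC, of y y "Ide (L_cat T C) y" c x] Iy x' c
    by (simp add: ract_L_hom[OF C Iy x'] Cmp_Ide_r[OF LC x'] eta_sec_hom[OF C x' c])
  have 4: "sends (\<rr>' (diamond ?e)) y c x (coend_in (diamond ?e) (hom_prof C) y c c x (Ide C c))"
    using sends_runit_inv[OF De x] by simp
  have 5: "sends (diamond ?e \<triangleleft> bid PROF (hom_prof C)) y c (coend_in (diamond ?e) (hom_prof C) y c c x (Ide C c))
    (coend_in (diamond ?e) (hom_prof C) y c c x (Ide C c))"
    by (rule sends_lwhisker[OF bid_cell[OF hC] De _ x sends_bid]) (simp_all add: ar_Ide[OF C c])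
  show "\<exists>q. sends ?l y c x q \<and> sends ?r y c x q"
    using sends_vcomp[OF 1 sends_vcomp[OF 2 3]] sends_vcomp[OF 4 5] by blast
qed simp_all

lemma mu_unit:
  assumes C: "category C"
  shows "(mu1 (hom_prof C) \<cdot> (L_unitor T C \<triangleright> diamond (L_mu T C))) \<cdot> \<ll>' (diamond (L_mu T C))
    = (diamond (L_mu T C) \<triangleleft> (L_cell T (L_unitor T C) \<cdot> L_unitor T (L_cat T C))) \<cdot> \<rr>' (diamond (L_mu T C))"
    (is "?l = ?r")
proof (rule cell_eqI)
  let ?m = "L_mu T C"
  note m = catfunctor_L_mu[OF C] note Dm = PR_diamond[OF m] note LC = category_L_cat[OF C] note LLC = category_L_cat[OF LC]
  note hC = PR_hom_prof[OF C]
  fix y K x assume "el (Dom ?r) y K x"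
  then have x: "el (diamond ?m) y K x" by simp
  then have x': "ar (L_cat T C) y (mu_ob T K) x" and K: "K \<in> Ob (L_cat T (L_cat T C))" by (simp_all add: el_diamond[OF m])
  note Iy = ar_Ide[OF LC ar_Ob(1)[OF x']] and IK = ar_Ide[OF LLC K]
  have 1: "sends (\<ll>' (diamond ?m)) y K x (coend_in (hom_prof (L_cat T C)) (diamond ?m) y K y (Ide (L_cat T C) y) x)"
    using sends_lunit_inv[OF Dm x] by simp
  have 2: "sends (L_unitor T C \<triangleright> diamond ?m) y K (coend_in (hom_prof (L_cat T C)) (diamond ?m) y K y (Ide (L_cat T C) y) x)
      (coend_in (L_prof T (hom_prof C)) (diamond ?m) y K y (Ide (L_cat T C) y) x)"
    by (rule sends_rwhisker[OF L_unitor_cell[OF C] Dm _ x sends_L_unitor[OF Iy]]) simp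
  have 3: "sends (mu1 (hom_prof C)) y K (coend_in (L_prof T (hom_prof C)) (diamond ?m) y K y (Ide (L_cat T C) y) x)
      (coend_in (diamond ?m) (L_prof T (L_prof T (hom_prof C))) y K K x (Ide (L_cat T (L_cat T C)) K))"
    using sends_mu1[OF hC, of y y "Ide (L_cat T C) y" K x] Iy x' K
    by (simp add: ract_L_hom[OF C Iy x'] Cmp_Ide_r[OF LC x'] mu_sec_hom[OF C x' K])
  have 4: "sends (\<rr>' (diamond ?m)) y K x (coend_in (diamond ?m) (hom_prof (L_cat T (L_cat T C))) y K K x (Ide (L_cat T (L_cat T C)) K))"
    using sends_runit_inv[OF Dm x] by simp
  \<comment> \<open>The unitor of the square consists of two layers. On the identity of
    \<open>K\<close> the inner layer acts trivially at each index, and \<open>ar_L_eta\<close> folds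
    the resulting family back into the identity.\<close>
  have "sends (L_cell T (L_unitor T C)) K K (Ide (L_cat T (L_cat T C)) K)
      (fam_ar (idx K) (rdx (Ide (L_cat T (L_cat T C)) K)) (cpt (Ide (L_cat T (L_cat T C)) K)))"
    by (rule sends_L_cell) (use IK ar_L_cpt[OF IK] sends_L_unitor in \<open>simp_all add: el_L_prof ar_L_cat[of "L_cat T C"]\<close>)
  then have 5: "sends (L_cell T (L_unitor T C)) K K (Ide (L_cat T (L_cat T C)) K) (Ide (L_cat T (L_cat T C)) K)"
    by (simp only: ar_L_eta[OF IK])
  have 6: "sends (diamond ?m \<triangleleft> (L_cell T (L_unitor T C) \<cdot> L_unitor T (L_cat T C))) y K
    (coend_in (diamond ?m) (hom_prof (L_cat T (L_cat T C))) y K K x (Ide (L_cat T (L_cat T C)) K))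
    (coend_in (diamond ?m) (L_prof T (L_prof T (hom_prof C))) y K K x (Ide (L_cat T (L_cat T C)) K))"
    by (rule sends_lwhisker[OF vcomp_cell[OF L_unitor_cell[OF LC] L_cell_cell[OF L_unitor_cell[OF C]]] Dm _ x
        sends_vcomp[OF sends_L_unitor[OF IK] 5]]) simp
  show "\<exists>q. sends ?l y K x q \<and> sends ?r y K x q"
    using sends_vcomp[OF 1 sends_vcomp[OF 2 3]] sends_vcomp[OF 4 6] by blast
qed simp_all

text \<open>On one path the compositor combines \<open>s\<close> and \<open>t\<close> at the single
  index before splitting. On the other, \<open>t\<close> is split, then \<open>s\<close> is
  restricted to the index that \<open>t\<close> selects and split in turn. The same index of
  \<open>y\<close> and the same two components result.\<close>

lemma eta_comp:
  assumes G: "PR G" and F: "PR F" and GF: "Src G = Trg F"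
  shows "(eta1 (comp_prof G F) \<cdot> (L_compositor T G F \<triangleright> diamond (L_eta T (Src F))))
      \<cdot> \<aa>' (L_prof T G) (L_prof T F) (diamond (L_eta T (Src F)))
    = ((((diamond (L_eta T (Trg G)) \<triangleleft> bid PROF (comp_prof G F)) \<cdot> \<aa> (diamond (L_eta T (Trg G))) G F)
      \<cdot> (eta1 G \<triangleright> F)) \<cdot> \<aa>' (L_prof T G) (diamond (L_eta T (Trg F))) F)
      \<cdot> (L_prof T G \<triangleleft> eta1 F)" (is "?l = ?r")
proof (rule cell_eqI)
  let ?LG = "L_prof T G" and ?LF = "L_prof T F" and ?eC = "L_eta T (Src F)" and ?eD = "L_eta T (Trg F)" and ?eE = "L_eta T (Trg G)"
  note GFp = PR_comp[OF G F GF] and LG = PR_L_prof[OF G] and LF = PR_L_prof[OF F]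
  note eC = catfunctor_L_eta[OF PR_Src[OF F]] and eD = catfunctor_L_eta[OF PR_Trg[OF F]] and eE = catfunctor_L_eta[OF PR_Trg[OF G]]
  note C = PR_diamond[OF eC] and D = PR_diamond[OF eD] and E = PR_diamond[OF eE]
  have ty: "Src ?LF = Trg (diamond ?eC)" "Src ?LG = Trg ?LF" "Src ?LG = Trg (diamond ?eD)" "Src (diamond ?eD) = Trg F"
    "Src (diamond ?eE) = Trg G" "Src (diamond ?eE) = Trg (comp_prof G F)" "Src (comp_prof ?LG ?LF) = Trg (diamond ?eC)"
    "Src ?LG = Trg (comp_prof ?LF (diamond ?eC))" "Src (comp_prof ?LG (diamond ?eD)) = Trg F" "Src ?LF = FTrg ?eC"
    using GF by simp_all
  fix y c p assume "el (Dom ?r) y c p"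
  then have "el (comp_prof ?LG (comp_prof ?LF (diamond ?eC))) y c p" by simp
  then obtain B s q where p: "p = coend_in ?LG (comp_prof ?LF (diamond ?eC)) y c B s q" and s: "el ?LG y B s"
    and q': "el (comp_prof ?LF (diamond ?eC)) B c q"
    by (rule el_compE[OF LG PR_comp[OF LF C ty(1)] ty(8)])
  obtain t where q: "q = coyoneda ?LF ?eC B c t" and t: "el ?LF B (eta_ob T c) t" and c: "c \<in> Ob (Src F)"
    using el_comp_diamondE[OF eC LF ty(10) q'] by auto
  have I: "el (diamond ?eC) (eta_ob T c) c (Ide (L_cat T (Src F)) (eta_ob T c))"
    using c by (simp add: el_diamond[OF eC] ar_Ide[OF category_L_cat[OF PR_Src[OF F]]])
  have q2: "q = coend_in ?LF (diamond ?eC) B c (eta_ob T c) t (Ide (L_cat T (Src F)) (eta_ob T c))"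
    unfolding q coyoneda_def by simp
  have st: "rdx t star \<in> elts (idx B)" using el_L_rdx[OF t, of star] by simp
  let ?g = "cpt s (rdx t star)" and ?b = "ob B (rdx t star)" and ?a = "ob y (rdx s (rdx t star))"
  let ?z = "fam_ar one (\<lambda>x. rdx s (rdx t x)) (\<lambda>x. coend_in G F (ob y (rdx s (rdx t x))) (ob (eta_ob T c) x) (ob B (rdx t x))
      (cpt s (rdx t x)) (cpt t x))"
  have z: "sends (L_compositor T G F) y (eta_ob T c) (coend_in ?LG ?LF y (eta_ob T c) B s t) ?z"
    using sends_L_compositor[OF G F GF s t] by simp
  have z': "el (L_prof T (comp_prof G F)) y (eta_ob T c) ?z"
    by (rule sends_el[OF L_compositor_cell[OF G F GF] z])
  note 1 = sends_assoc_inv[OF LG LF C ty(2,1) s t I, folded q2, folded p]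
  note 2 = sends_rwhisker[OF L_compositor_cell[OF G F GF] C ty(7) I z]
  have 3: "sends (eta1 (comp_prof G F)) y c (coend_in (L_prof T (comp_prof G F)) (diamond ?eC) y c (eta_ob T c) ?z (Ide (L_cat T (Src F)) (eta_ob T c)))
     (coend_in (diamond ?eE) (comp_prof G F) y c ?a (reindex (Trg G) (eta_ob T ?a) (\<lambda>_. rdx s (rdx t star))) (coend_in G F ?a c ?b ?g (cpt t star)))"
    using sends_eta1_coyoneda[OF GFp, of y c ?z] z' c by (simp add: coyoneda_def eta_sec_def)
  let ?h = "reindex (Trg F) (eta_ob T ?b) (\<lambda>_. rdx t star)"
  note h = eta_sec_props[OF F t]
  have h': "el (diamond ?eD) B ?b ?h" using h el_Ob(1)[OF h(2)] by (simp add: el_diamond[OF eD])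
  note 4 = sends_lwhisker[OF eta1_cell[OF F] LG ty(8) s sends_eta1_coyoneda[OF F t c, folded q], folded p]
  note 5 = sends_assoc_inv[OF LG D F ty(3,4) s h' h(2), folded eta_sec_def]
  \<comment> \<open>The restriction of \<open>s\<close> to the one index that \<open>t\<close>
    selects. It is again an element over a unit object and can be split.\<close>
  let ?s' = "ract ?LG y B (eta_ob T ?b) ?h s"
  have hG: "ar (L_cat T (Src G)) B (eta_ob T ?b) ?h" using h(1) GF by simp
  have s': "el ?LG y (eta_ob T ?b) ?s'" by (rule el_ract[OF PR_profunctor[OF LG] _ s]) (use hG in simp)
  have s's: "rdx ?s' star = rdx s (rdx t star)" "cpt ?s' star = ?g"
    using ract_Ide[OF PR_profunctor[OF G] el_L_cpt[OF s st]] by (simp_all add: ract_L[OF s hG] GF)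
  have 6: "sends (eta1 G) y ?b (coend_in ?LG (diamond ?eD) y ?b B s ?h) (eta_sec G y ?b ?s')"
    using sends_eta1[OF G s hG] el_Ob(1)[OF h(2)] GF by simp
  note k = eta_sec_props[OF G s', unfolded s's]
  have k': "el (diamond ?eE) y ?a (reindex (Trg G) (eta_ob T ?a) (\<lambda>_. rdx s (rdx t star)))"
    using k el_Ob(1)[OF k(2)] by (simp add: el_diamond[OF eE])
  note 7 = sends_rwhisker[OF eta1_cell[OF G, unfolded GF] F ty(9) h(2) 6, unfolded eta_sec_def s's]
  note 8 = sends_assoc[OF E G F ty(5) GF k' k(2) h(2)]
  note 9 = sends_lwhisker[OF bid_cell[OF GFp] E ty(6) k' sends_bid[OF el_comp[OF G F GF k(2) h(2)]]]
  show "\<exists>q. sends ?l y c p q \<and> sends ?r y c p q"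
    using sends_vcomp[OF 1 sends_vcomp[OF 2 3]] sends_vcomp[OF 4 sends_vcomp[OF 5 sends_vcomp[OF 7 sends_vcomp[OF 8 9]]]] by blast
qed (simp_all add: GF)

text \<open>The compositor of the square works in two layers: first on the outer families, then at
  each outer index on the inner ones. The double family is written out because it has to be matched
  with a flat element.\<close>

lemma sends_L_compositor_square:
  assumes G: "PR G" and F: "PR F" and GF: "Src G = Trg F"
    and p: "el (L_prof T (L_prof T G)) A B p" and q: "el (L_prof T (L_prof T F)) B D q"
  shows "sends (L_cell T (L_compositor T G F) \<cdot> L_compositor T (L_prof T G) (L_prof T F)) A D
    (coend_in (L_prof T (L_prof T G)) (L_prof T (L_prof T F)) A D B p q)
    (fam_ar (idx D) (\<lambda>x. rdx p (rdx q x)) (\<lambda>x. fam_ar (idx (ob D x)) (\<lambda>z. rdx (cpt p (rdx q x)) (rdx (cpt q x) z))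
      (\<lambda>z. coend_in G F (ob (ob A (rdx p (rdx q x))) (rdx (cpt p (rdx q x)) (rdx (cpt q x) z))) (ob (ob D x) z)
        (ob (ob B (rdx q x)) (rdx (cpt q x) z)) (cpt (cpt p (rdx q x)) (rdx (cpt q x) z)) (cpt (cpt q x) z))))"
proof -
  let ?LG = "L_prof T G" and ?LF = "L_prof T F"
  note LG = PR_L_prof[OF G] and LF = PR_L_prof[OF F]
  have LGF: "Src ?LG = Trg ?LF" using GF by simp
  let ?z = "fam_ar (idx D) (\<lambda>x. rdx p (rdx q x)) (\<lambda>x. coend_in ?LG ?LF (ob A (rdx p (rdx q x))) (ob D x) (ob B (rdx q x))
      (cpt p (rdx q x)) (cpt q x))"
  have z: "sends (L_compositor T ?LG ?LF) A D (coend_in (L_prof T ?LG) (L_prof T ?LF) A D B p q) ?z"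
    by (rule sends_L_compositor[OF LG LF LGF p q]) simp_all
  show ?thesis
  proof (rule sends_vcomp[OF z sends_L_cell])
    fix x assume x: "x \<in> elts (idx D)"
    note * = sends_L_compositor[OF G F GF el_L_cpt[OF p el_L_rdx[OF q x]] el_L_cpt[OF q x]]
    show "sends (L_compositor T G F) (ob A (rdx ?z x)) (ob D x) (cpt ?z x)
      (fam_ar (idx (ob D x)) (\<lambda>z. rdx (cpt p (rdx q x)) (rdx (cpt q x) z))
      (\<lambda>z. coend_in G F (ob (ob A (rdx p (rdx q x))) (rdx (cpt p (rdx q x)) (rdx (cpt q x) z))) (ob (ob D x) z)
        (ob (ob B (rdx q x)) (rdx (cpt q x) z)) (cpt (cpt p (rdx q x)) (rdx (cpt q x) z)) (cpt (cpt q x) z)))"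
      using x by (simp only: rdx_fam_ar cpt_fam_ar) (rule *, simp_all)
  qed (use sends_el[OF L_compositor_cell[OF LG LF LGF] z] in simp_all)
qed

text \<open>Splitting the composite of \<open>s\<close> and \<open>t\<close> over \<open>K\<close>
  agrees with splitting \<open>t\<close> over \<open>K\<close> and the restricted \<open>s\<close>
  over the object so obtained, since \<open>mu_split\<close> preserves the shape of \<open>K\<close>
  each time. The flat parts are combined index by index.\<close>

lemma mu_comp:
  assumes G: "PR G" and F: "PR F" and GF: "Src G = Trg F"
  shows "(mu1 (comp_prof G F) \<cdot> (L_compositor T G F \<triangleright> diamond (L_mu T (Src F))))
      \<cdot> \<aa>' (L_prof T G) (L_prof T F) (diamond (L_mu T (Src F)))
    = ((((diamond (L_mu T (Trg G)) \<triangleleft> (L_cell T (L_compositor T G F) \<cdot> L_compositor T (L_prof T G) (L_prof T F)))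
      \<cdot> \<aa> (diamond (L_mu T (Trg G))) (L_prof T (L_prof T G)) (L_prof T (L_prof T F)))
      \<cdot> (mu1 G \<triangleright> L_prof T (L_prof T F))) \<cdot> \<aa>' (L_prof T G) (diamond (L_mu T (Trg F))) (L_prof T (L_prof T F)))
      \<cdot> (L_prof T G \<triangleleft> mu1 F)" (is "?l = ?r")
proof (rule cell_eqI)
  let ?LG = "L_prof T G" and ?LF = "L_prof T F" and ?mC = "L_mu T (Src F)" and ?mD = "L_mu T (Trg F)" and ?mE = "L_mu T (Trg G)"
  let ?LLG = "L_prof T ?LG" and ?LLF = "L_prof T ?LF"
  note GFp = PR_comp[OF G F GF] and LG = PR_L_prof[OF G] and LF = PR_L_prof[OF F]
  note LLG = PR_L_prof[OF LG] and LLF = PR_L_prof[OF LF]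
  note mC = catfunctor_L_mu[OF PR_Src[OF F]] and mD = catfunctor_L_mu[OF PR_Trg[OF F]] and mE = catfunctor_L_mu[OF PR_Trg[OF G]]
  note C = PR_diamond[OF mC] and D = PR_diamond[OF mD] and E = PR_diamond[OF mE]
  have ty: "Src ?LF = Trg (diamond ?mC)" "Src ?LG = Trg ?LF" "Src ?LG = Trg (diamond ?mD)" "Src (diamond ?mD) = Trg ?LLF"
    "Src (diamond ?mE) = Trg ?LLG" "Src (diamond ?mE) = Trg (comp_prof ?LLG ?LLF)" "Src (comp_prof ?LG ?LF) = Trg (diamond ?mC)"
    "Src ?LG = Trg (comp_prof ?LF (diamond ?mC))" "Src (comp_prof ?LG (diamond ?mD)) = Trg ?LLF" "Src ?LF = FTrg ?mC" "Src ?LLG = Trg ?LLF"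
    using GF by simp_all
  fix y K p assume "el (Dom ?r) y K p"
  then have "el (comp_prof ?LG (comp_prof ?LF (diamond ?mC))) y K p" by simp
  then obtain B s q where p: "p = coend_in ?LG (comp_prof ?LF (diamond ?mC)) y K B s q" and s: "el ?LG y B s"
    and q': "el (comp_prof ?LF (diamond ?mC)) B K q"
    by (rule el_compE[OF LG PR_comp[OF LF C ty(1)] ty(8)])
  obtain t where q: "q = coyoneda ?LF ?mC B K t" and t: "el ?LF B (mu_ob T K) t" and K: "K \<in> Ob (L_cat T (L_cat T (Src F)))"
    using el_comp_diamondE[OF mC LF ty(10) q'] by auto
  have B: "B \<in> Ob (L_cat T (Trg F))" and y: "y \<in> Ob (L_cat T (Trg G))" using el_Ob[OF t] el_Ob[OF s] by simp_all
  have I: "el (diamond ?mC) (mu_ob T K) K (Ide (L_cat T (Src F)) (mu_ob T K))"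
    using K mu_ob_Ob[OF K] by (simp add: el_diamond[OF mC] ar_Ide[OF category_L_cat[OF PR_Src[OF F]]])
  have q2: "q = coend_in ?LF (diamond ?mC) B K (mu_ob T K) t (Ide (L_cat T (Src F)) (mu_ob T K))"
    unfolding q coyoneda_def by simp
  have st: "rdx t (pr x z) \<in> elts (idx B)" if "x \<in> elts (idx K)" "z \<in> elts (idx (ob K x))" for x z
    using el_L_rdx[OF t, of "pr x z"] that by simp
  let ?\<zeta> = "\<lambda>x. coend_in G F (ob y (rdx s (rdx t x))) (ob (mu_ob T K) x) (ob B (rdx t x)) (cpt s (rdx t x)) (cpt t x)"
  let ?z = "fam_ar (mu_idx K) (\<lambda>x. rdx s (rdx t x)) ?\<zeta>"
  have z: "sends (L_compositor T G F) y (mu_ob T K) (coend_in ?LG ?LF y (mu_ob T K) B s t) ?z"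
    using sends_L_compositor[OF G F GF s t] by simp
  have z': "el (L_prof T (comp_prof G F)) y (mu_ob T K) ?z"
    by (rule sends_el[OF L_compositor_cell[OF G F GF] z])
  let ?H' = "mu_split y K (\<lambda>x. rdx s (rdx t x))" let ?k = "reindex (Trg G) (mu_ob T ?H') (\<lambda>x. rdx s (rdx t x))"
  note 1 = sends_assoc_inv[OF LG LF C ty(2,1) s t I, folded q2, folded p]
  note 2 = sends_rwhisker[OF L_compositor_cell[OF G F GF] C ty(7) I z]
  have sec_z: "mu_sec (comp_prof G F) y K ?z = coend_in (diamond ?mE) (L_prof T (L_prof T (comp_prof G F))) y K ?H' ?k (mu_flat K ?\<zeta>)"
  proof -
    have "mu_split y K (rdx ?z) = ?H'" "mu_flat K (cpt ?z) = mu_flat K ?\<zeta>"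
      by (rule mu_split_cong mu_flat_cong; simp)+
    moreover have "reindex (Trg G) (mu_ob T ?H') (rdx ?z) = ?k"
      by (rule reindex_cong) simp
    ultimately show ?thesis
      unfolding mu_sec_def comp_prof_simps by (simp only:)
  qed
  have 3: "sends (mu1 (comp_prof G F)) y K (coend_in (L_prof T (comp_prof G F)) (diamond ?mC) y K (mu_ob T K) ?z (Ide (L_cat T (Src F)) (mu_ob T K)))
     (coend_in (diamond ?mE) (L_prof T (L_prof T (comp_prof G F))) y K ?H' ?k (mu_flat K ?\<zeta>))"
    using sends_mu1_coyoneda[OF GFp, of y K ?z] z' K unfolding sec_z by (simp add: coyoneda_def)
  let ?H = "mu_split B K (rdx t)" let ?h = "reindex (Trg F) (mu_ob T ?H) (rdx t)"
  have H: "?H \<in> Ob (L_cat T (L_cat T (Trg F)))" by (rule mu_split_Ob[OF B K el_L_lmap[OF t]])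
  have h: "ar (L_cat T (Trg F)) B (mu_ob T ?H) ?h" by (rule ar_mu_split[OF PR_Trg[OF F] B K el_L_lmap[OF t]])
  have h': "el (diamond ?mD) B ?H ?h" using h H by (simp add: el_diamond[OF mD])
  note fl = el_mu_flat_split[OF t K]
  note 4 = sends_lwhisker[OF mu1_cell[OF F] LG ty(8) s sends_mu1_coyoneda[OF F t K, folded q], folded p]
  note 5 = sends_assoc_inv[OF LG D LLF ty(3,4) s h' fl, folded mu_sec_def]
  let ?s' = "ract ?LG y B (mu_ob T ?H) ?h s"
  have hG: "ar (L_cat T (Src G)) B (mu_ob T ?H) ?h" using h GF by simp
  have s': "el ?LG y (mu_ob T ?H) ?s'" by (rule el_ract[OF PR_profunctor[OF LG] _ s]) (use hG in simp)
  have s's: "rdx ?s' (pr x z) = rdx s (rdx t (pr x z))" "cpt ?s' (pr x z) = cpt s (rdx t (pr x z))"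
    if "x \<in> elts (idx K)" "z \<in> elts (idx (ob K x))" for x z
    using that ract_Ide[OF PR_profunctor[OF G] el_L_cpt[OF s st[OF that]]] by (simp_all add: ract_L[OF s hG] GF)
  \<comment> \<open>\<open>?H\<close> has the shape of \<open>K\<close>, so the second splitting is
    the splitting over \<open>K\<close> along the composite index map.\<close>
  have H'': "mu_split y ?H (rdx ?s') = ?H'"
    unfolding mu_split_def[of y ?H] mu_split_def[of y K] by (simp add: s's)
  have k_eq: "reindex (Trg G) (mu_ob T ?H') (rdx ?s') = ?k"
    by (rule reindex_cong) (auto simp: s's)
  have 6: "sends (mu1 G) y ?H (coend_in ?LG (diamond ?mD) y ?H B s ?h) (mu_sec G y ?H ?s')"
    using sends_mu1[OF G s hG] H GF by simp
  have HG: "?H \<in> Ob (L_cat T (L_cat T (Src G)))" using H GF by simp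
  note gf = el_mu_flat_split[OF s' HG, unfolded H'']
  have k': "el (diamond ?mE) y ?H' ?k"
    using ar_mu_split[OF PR_Trg[OF G] y HG el_L_lmap[OF s']] mu_split_Ob[OF y HG el_L_lmap[OF s']]
    by (simp add: el_diamond[OF mE] H'' k_eq)
  note 7 = sends_rwhisker[OF mu1_cell[OF G, unfolded GF] LLF ty(9) fl 6, unfolded mu_sec_def[of G] H'' k_eq]
  note 8 = sends_assoc[OF E LLG LLF ty(5,11) k' gf fl]
  \<comment> \<open>The right-hand side is the form delivered by
    \<open>sends_L_compositor_square\<close>. Both flat elements are identities on indices, so it
    collapses to one flat element.\<close>
  have fz: "mu_flat K ?\<zeta> = fam_ar (idx K) (\<lambda>x. rdx (mu_flat ?H (cpt ?s')) (rdx (mu_flat K (cpt t)) x))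
    (\<lambda>x. fam_ar (idx (ob K x)) (\<lambda>z. rdx (cpt (mu_flat ?H (cpt ?s')) (rdx (mu_flat K (cpt t)) x)) (rdx (cpt (mu_flat K (cpt t)) x) z))
      (\<lambda>z. coend_in G F (ob (ob ?H' (rdx (mu_flat ?H (cpt ?s')) (rdx (mu_flat K (cpt t)) x)))
          (rdx (cpt (mu_flat ?H (cpt ?s')) (rdx (mu_flat K (cpt t)) x)) (rdx (cpt (mu_flat K (cpt t)) x) z))) (ob (ob K x) z)
        (ob (ob ?H (rdx (mu_flat K (cpt t)) x)) (rdx (cpt (mu_flat K (cpt t)) x) z))
        (cpt (cpt (mu_flat ?H (cpt ?s')) (rdx (mu_flat K (cpt t)) x)) (rdx (cpt (mu_flat K (cpt t)) x) z)) (cpt (cpt (mu_flat K (cpt t)) x) z)))"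
    unfolding mu_flat_def[of K ?\<zeta>] by (simp add: s's)
  note 9 = sends_lwhisker[OF vcomp_cell[OF L_compositor_cell[OF LG LF ty(2)] L_cell_cell[OF L_compositor_cell[OF G F GF]]] E ty(6) k'
      sends_L_compositor_square[OF G F GF gf fl], folded fz]
  show "\<exists>q. sends ?l y K p q \<and> sends ?r y K p q"
    using sends_vcomp[OF 1 sends_vcomp[OF 2 3]] sends_vcomp[OF 4 sends_vcomp[OF 5 sends_vcomp[OF 7 sends_vcomp[OF 8 9]]]] by blast
qed (simp_all add: GF)

lemma oplax_transformation_eta:
  "oplax_transformation (co PROF) (id_endo (co PROF)) L_endo (\<lambda>C. diamond (L_eta T C)) eta1"
proof -
  interpret bicategory "co (PROF :: ('u cat, 'u prof, 'u ptrans) bicat)" by (rule bicategory_co_PROF)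
  show ?thesis
  proof (intro oplax_transformation.intro oplax_transformation_axioms.intro oplax_functor_id oplax_functor_L)
    fix f f' :: "'u prof" and x y \<alpha>
    assume "f \<in> hom1\<^bsub>co PROF\<^esub> x y" "\<alpha> \<in> hom2\<^bsub>co PROF\<^esub> f f'"
    then show "vpath\<^bsub>co PROF\<^esub> [diamond (L_eta T y) \<lhd>\<^bsub>co PROF\<^esub> F2 (id_endo (co PROF)) \<alpha>, eta1 f']
      = vpath\<^bsub>co PROF\<^esub> [eta1 f, F2 L_endo \<alpha> \<rhd>\<^bsub>co PROF\<^esub> diamond (L_eta T x)]"
      using eta_natural[of \<alpha> f' f] cell_Src[of \<alpha> f' f] cell_Trg[of \<alpha> f' f] by (auto simp: id_endo_def)
  qed (auto simp: id_endo_def PR_diamond catfunctor_L_eta eta1_cell eta_unit eta_comp)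
qed

text \<open>The source is the square of \<open>L_endo\<close>, whose unit and composition cells are
  composites of two layers; these are the nested cells in \<open>mu_unit\<close> and
  \<open>mu_comp\<close>.\<close>

lemma oplax_transformation_mu:
  "oplax_transformation (co PROF) (square_endo (co PROF) L_endo) L_endo (\<lambda>C. diamond (L_mu T C)) mu1"
proof -
  interpret oplax_functor "co (PROF :: ('u cat, 'u prof, 'u ptrans) bicat)" L_endo by (rule oplax_functor_L)
  show ?thesis
  proof (intro oplax_transformation.intro oplax_transformation_axioms.intro oplax_functor_square oplax_functor_L)
    fix f f' :: "'u prof" and x y \<alpha>
    assume "f \<in> hom1\<^bsub>co PROF\<^esub> x y" "\<alpha> \<in> hom2\<^bsub>co PROF\<^esub> f f'"
    then show "vpath\<^bsub>co PROF\<^esub> [diamond (L_mu T y) \<lhd>\<^bsub>co PROF\<^esub> F2 (square_endo (co PROF) L_endo) \<alpha>, mu1 f']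
      = vpath\<^bsub>co PROF\<^esub> [mu1 f, F2 L_endo \<alpha> \<rhd>\<^bsub>co PROF\<^esub> diamond (L_mu T x)]"
      using mu_natural[of \<alpha> f' f] cell_Src[of \<alpha> f' f] cell_Trg[of \<alpha> f' f] by (auto simp: square_endo_def)
  qed (auto simp: square_endo_def PR_diamond catfunctor_L_mu mu1_cell mu_unit mu_comp)
qed

end

section \<open>The modifications\<close>

text \<open>Two co-Yoneda reductions: the arrow left in the middle factor is written as an action on
  a pair of identities and glides into \<open>P\<close>. An element is then given by a single
  \<open>t\<close> over \<open>FOb f (FOb g c)\<close>.\<close>

lemma el_comp_diamond2E:
  assumes f: "catfunctor f" and g: "catfunctor g" and fg: "FSrc f = FTrg g" and P: "PR P" and Pf: "Src P = FTrg f"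
    and p: "el (comp_prof P (comp_prof (diamond f) (diamond g))) y c p"
  obtains t where "p = coend_in P (comp_prof (diamond f) (diamond g)) y c (FOb f (FOb g c)) t
      (coend_in (diamond f) (diamond g) (FOb f (FOb g c)) c (FOb g c) (Ide (FTrg f) (FOb f (FOb g c))) (Ide (FTrg g) (FOb g c)))"
    "el P y (FOb f (FOb g c)) t" "c \<in> Ob (FSrc g)"
proof -
  note Df = PR_diamond[OF f] and Dg = PR_diamond[OF g]
  have ty: "Src (diamond f) = Trg (diamond g)" "Src P = Trg (comp_prof (diamond f) (diamond g))" "Src (diamond f) = FTrg g"
    using fg Pf by simp_all
  obtain b t q where p: "p = coend_in P (comp_prof (diamond f) (diamond g)) y c b t q" and t: "el P y b t"
    and q: "el (comp_prof (diamond f) (diamond g)) b c q"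
    by (rule el_compE[OF P PR_comp[OF Df Dg ty(1)] ty(2) p])
  obtain k where q: "q = coyoneda (diamond f) g b c k" and k: "el (diamond f) b (FOb g c) k" and c: "c \<in> Ob (FSrc g)"
    by (rule el_comp_diamondE[OF g Df ty(3) q])
  have k': "ar (FTrg f) b (FOb f (FOb g c)) k" using k by (simp add: el_diamond[OF f])
  have gc: "FOb g c \<in> Ob (FSrc f)" using catfunctor_FOb[OF g c] fg by simp
  have I: "el (diamond f) (FOb f (FOb g c)) (FOb g c) (Ide (FTrg f) (FOb f (FOb g c)))"
    "el (diamond g) (FOb g c) c (Ide (FTrg g) (FOb g c))"
    using gc c fg by (simp_all add: el_diamond f g ar_Ide catfunctor_Trg catfunctor_FOb)
  let ?e = "coend_in (diamond f) (diamond g) (FOb f (FOb g c)) c (FOb g c) (Ide (FTrg f) (FOb f (FOb g c))) (Ide (FTrg g) (FOb g c))"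
  have "q = lact (comp_prof (diamond f) (diamond g)) b (FOb f (FOb g c)) c k ?e"
    using lact_comp[OF Df Dg ty(1) I, of b k] k' lact_diamond[OF f k' I(1)]
    by (simp add: q coyoneda_def Cmp_Ide_l[OF catfunctor_Trg[OF f] k'])
  then have "p = coend_in P (comp_prof (diamond f) (diamond g)) y c (FOb f (FOb g c)) (ract P y b (FOb f (FOb g c)) k t) ?e"
    using coend_glide[of "comp_prof (diamond f) (diamond g)" b "FOb f (FOb g c)" k P y t c ?e] k' t el_comp[OF Df Dg ty(1) I]
    by (simp add: p)
  then show thesis
    by (rule that) (use el_ract[OF PR_profunctor[OF P] _ t] k' Pf c in simp_all)
qed

context set_monad
begin

abbreviation Lmu :: "'u \<Rightarrow> 'u" where
  "Lmu W \<equiv> fam_ob (idx W) (\<lambda>x. mu_ob T (ob W x)) (lab W)"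

abbreviation Leta :: "'u \<Rightarrow> 'u" where
  "Leta A \<equiv> fam_ob (idx A) (\<lambda>x. eta_ob T (ob A x)) (lab A)"

text \<open>The component of \<open>L_assoc\<close> at \<open>W\<close>, named so that it stays
  folded while its selectors are rewritten.\<close>

definition mu_assoc :: "'u cat \<Rightarrow> 'u \<Rightarrow> 'u" where
  "mu_assoc C W = reindex C (mu_ob T (Lmu W)) (\<lambda>s. pr (pr (pfst s) (pfst (psnd s))) (psnd (psnd s)))"

definition mu_lunit :: "'u cat \<Rightarrow> 'u \<Rightarrow> 'u" where
  "mu_lunit C A = reindex C A (pr star)"

definition mu_runit :: "'u cat \<Rightarrow> 'u \<Rightarrow> 'u" where
  "mu_runit C A = reindex C (mu_ob T (Leta A)) pfst"

lemma mu_assoc_simps [simp]: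
  assumes "x \<in> elts (idx W)" "z \<in> elts (idx (ob W x))" "w \<in> elts (idx (ob (ob W x) z))"
  shows "rdx (mu_assoc C W) (pr x (pr z w)) = pr (pr x z) w" "cpt (mu_assoc C W) (pr x (pr z w)) = Ide C (ob (ob (ob W x) z) w)"
  using assms by (simp_all add: mu_assoc_def)

lemma mu_lunit_simps [simp]: "z \<in> elts (idx A) \<Longrightarrow> rdx (mu_lunit C A) z = pr star z"
    "z \<in> elts (idx A) \<Longrightarrow> cpt (mu_lunit C A) z = Ide C (ob A z)"
  by (simp_all add: mu_lunit_def)

lemma mu_runit_simps [simp]: "x \<in> elts (idx A) \<Longrightarrow> rdx (mu_runit C A) (pr x star) = x"
    "x \<in> elts (idx A) \<Longrightarrow> cpt (mu_runit C A) (pr x star) = Ide C (ob A x)"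
  by (simp_all add: mu_runit_def)

lemma Lmu_Ob: "W \<in> Ob (L_cat T (L_cat T (L_cat T C))) \<Longrightarrow> Lmu W \<in> Ob (L_cat T (L_cat T C))"
  by (simp add: L_Ob_lab L_Ob_ob mu_ob_Ob)

lemma Leta_Ob: "A \<in> Ob (L_cat T C) \<Longrightarrow> Leta A \<in> Ob (L_cat T (L_cat T C))"
  by (simp add: L_Ob_lab L_Ob_ob)

context
  fixes C :: "'u cat"
  assumes C: "category C"
begin

private lemmas LC = category_L_cat[OF C] and LLC = category_L_cat[OF category_L_cat[OF C]]
  and LLLC = category_L_cat[OF category_L_cat[OF category_L_cat[OF C]]]
private lemmas M = catfunctor_L_mu[OF C] and M2 = catfunctor_L_mu[OF category_L_cat[OF C]]
  and N = catfunctor_L_eta[OF C] and NL = catfunctor_L_eta[OF category_L_cat[OF C]]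

text \<open>The label condition is associativity of the Kleisli extension. Both labels unfold to the
  same double \<open>bind\<close> over the two outer levels, the innermost summand being included by
  \<open>pr (pr x z)\<close>.\<close>

lemma lmap_mu_assoc:
  assumes W: "W \<in> Ob (L_cat T (L_cat T (L_cat T C)))"
  shows "lmap (mu_ob T (mu_ob T W)) (mu_ob T (Lmu W)) (\<lambda>s. pr (pr (pfst s) (pfst (psnd s))) (psnd (psnd s)))"
proof -
  let ?X = "mu_idx (mu_ob T W)"
  let ?f = "\<lambda>s. pr (pr (pfst s) (pfst (psnd s))) (psnd (psnd s))"
  let ?q = "\<lambda>x z. tm (idx (ob (ob W x) z)) ?X (pr (pr x z)) (lab (ob (ob W x) z))"
  have Wx: "ob W x \<in> Ob (L_cat T (L_cat T C))" if "x \<in> elts (idx W)" for x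
    by (rule L_Ob_ob[OF W that])
  have Wxz: "ob (ob W x) z \<in> Ob (L_cat T C)" if "x \<in> elts (idx W)" "z \<in> elts (idx (ob W x))" for x z
    by (rule L_Ob_ob[OF Wx]) (rule that)+
  have q: "?q x z \<in> elts (TOb T ?X)" if "x \<in> elts (idx W)" "z \<in> elts (idx (ob W x))" for x z
    by (rule tm_closed) (use that in \<open>auto intro: L_Ob_lab Wxz\<close>)
  have "tm (mu_idx (Lmu W)) ?X ?f (lab (mu_ob T (Lmu W)))
      = bind (idx W) ?X (lab W) (\<lambda>x. tm (idx (ob (Lmu W) x)) ?X (\<lambda>p. ?f (pr x p)) (lab (ob (Lmu W) x)))"
    using tm_lab_mu[OF Lmu_Ob[OF W], of ?f ?X] by fastforce
  also have "\<dots> = bind (idx W) ?X (lab W) (\<lambda>x. bind (idx (ob W x)) ?X (lab (ob W x)) (?q x))"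
  proof (rule bind_cong)
    fix x assume x: "x \<in> elts (idx W)"
    show "tm (idx (ob (Lmu W) x)) ?X (\<lambda>p. ?f (pr x p)) (lab (ob (Lmu W) x)) = bind (idx (ob W x)) ?X (lab (ob W x)) (?q x)"
      using tm_lab_mu[OF Wx[OF x], of "\<lambda>p. ?f (pr x p)" ?X] x by simp
  qed
  finally have 1: "tm (mu_idx (Lmu W)) ?X ?f (lab (mu_ob T (Lmu W)))
    = bind (idx W) ?X (lab W) (\<lambda>x. bind (idx (ob W x)) ?X (lab (ob W x)) (?q x))" .
  let ?r = "\<lambda>y. tm (idx (ob (mu_ob T W) y)) ?X (pr y) (lab (ob (mu_ob T W) y))"
  have r: "?r y \<in> elts (TOb T ?X)" if "y \<in> elts (mu_idx W)" for y
    using that q by auto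
  have pl: "tm (idx (ob W x)) (mu_idx W) (pr x) (lab (ob W x)) \<in> elts (TOb T (mu_idx W))" if "x \<in> elts (idx W)" for x
    by (rule tm_closed) (use that in \<open>auto intro: L_Ob_lab Wx\<close>)
  have "lab (mu_ob T (mu_ob T W)) = bind (mu_idx W) ?X (lab (mu_ob T W)) ?r"
    unfolding lab_mu[of "mu_ob T W"] by simp
  \<comment> \<open>Associativity of \<open>bind\<close> replaces the extension over pairs by an
    extension over \<open>x\<close> of extensions over the pairs starting with
    \<open>x\<close>.\<close>
  also have "\<dots> = bind (idx W) ?X (lab W) (\<lambda>x. bind (mu_idx W) ?X (tm (idx (ob W x)) (mu_idx W) (pr x) (lab (ob W x))) ?r)"
    unfolding lab_mu[of W] by (rule bind_bind[OF pl L_Ob_lab[OF W] r])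
  also have "\<dots> = bind (idx W) ?X (lab W) (\<lambda>x. bind (idx (ob W x)) ?X (lab (ob W x)) (?q x))"
  proof (rule bind_cong)
    fix x assume x: "x \<in> elts (idx W)"
    have "bind (mu_idx W) ?X (tm (idx (ob W x)) (mu_idx W) (pr x) (lab (ob W x))) ?r = bind (idx (ob W x)) ?X (lab (ob W x)) (\<lambda>z. ?r (pr x z))"
      by (rule bind_tm[OF _ L_Ob_lab[OF Wx[OF x]] r]) (simp_all add: x)
    also have "\<dots> = bind (idx (ob W x)) ?X (lab (ob W x)) (?q x)"
      by (rule bind_cong) (simp add: x)
    finally show "bind (mu_idx W) ?X (tm (idx (ob W x)) (mu_idx W) (pr x) (lab (ob W x))) ?r = bind (idx (ob W x)) ?X (lab (ob W x)) (?q x)" .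
  qed
  finally show ?thesis
    using 1 by (auto simp: lmap_def)
qed

lemma ar_mu_assoc:
  assumes W: "W \<in> Ob (L_cat T (L_cat T (L_cat T C)))"
  shows "ar (L_cat T C) (mu_ob T (mu_ob T W)) (mu_ob T (Lmu W)) (mu_assoc C W)"
  unfolding mu_assoc_def
  by (rule ar_reindex[OF C mu_ob_Ob[OF mu_ob_Ob[OF W]] mu_ob_Ob[OF Lmu_Ob[OF W]] lmap_mu_assoc[OF W]]) auto

text \<open>Left unit law of \<open>bind\<close>: the outer label is the unit at
  \<open>star\<close>, so the label of the one summand remains, pushed along its inclusion.\<close>

lemma ar_mu_lunit:
  assumes A: "A \<in> Ob (L_cat T C)"
  shows "ar (L_cat T C) (mu_ob T (eta_ob T A)) A (mu_lunit C A)"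
  unfolding mu_lunit_def
proof (rule ar_reindex[OF C mu_ob_Ob A])
  have "lab (mu_ob T (eta_ob T A)) = bind one (mu_idx (eta_ob T A)) (TUnit T one star)
      (\<lambda>x. tm (idx A) (mu_idx (eta_ob T A)) (pr star) (lab A))"
    unfolding lab_mu eta_ob_simps by (rule bind_cong) simp
  also have "\<dots> = tm (idx A) (mu_idx (eta_ob T A)) (pr star) (lab A)"
    by (rule bind_TUnit_left) (auto intro!: tm_closed simp: L_Ob_lab[OF A])
  finally show "lmap (mu_ob T (eta_ob T A)) A (pr star)"
    by (simp add: lmap_def)
qed (simp_all add: A)

text \<open>Right unit law of \<open>bind\<close>: after the projection \<open>pfst\<close> each
  summand contributes the unit at its index.\<close>

lemma ar_mu_runit:
  assumes A: "A \<in> Ob (L_cat T C)"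
  shows "ar (L_cat T C) A (mu_ob T (Leta A)) (mu_runit C A)"
  unfolding mu_runit_def
proof (rule ar_reindex[OF C A mu_ob_Ob[OF Leta_Ob[OF A]]])
  have "tm (mu_idx (Leta A)) (idx A) pfst (lab (mu_ob T (Leta A)))
      = bind (idx A) (idx A) (lab A) (\<lambda>x. tm (idx (ob (Leta A) x)) (idx A) (\<lambda>z. pfst (pr x z)) (lab (ob (Leta A) x)))"
    using tm_lab_mu[OF Leta_Ob[OF A], of pfst "idx A"] by simp
  also have "\<dots> = bind (idx A) (idx A) (lab A) (TUnit T (idx A))"
    by (rule bind_cong) (simp add: tm_TUnit)
  finally show "lmap A (mu_ob T (Leta A)) pfst"
    by (auto simp: lmap_def bind_TUnit_right L_Ob_lab[OF A])
qed auto

text \<open>Checked at each triple index. Both sides carry the same component, composed with an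
  identity before it on one side and after it on the other.\<close>

lemma natural_L_assoc: "natural (L_assoc T C)"
proof -
  have LM: "catfunctor (L_func T (L_mu T C))" by (rule catfunctor_L_func[OF M])
  have "Cmp (L_cat T C) (mu_ob T (mu_ob T W)) (mu_ob T (mu_ob T V)) (mu_ob T (Lmu V)) (mu_assoc C V) (mu_el (mu_ob T V) (mu_el V p))
    = Cmp (L_cat T C) (mu_ob T (mu_ob T W)) (mu_ob T (Lmu W)) (mu_ob T (Lmu V))
       (mu_el (Lmu V) (fam_ar (idx V) (rdx p) (\<lambda>x. mu_el (ob V x) (cpt p x)))) (mu_assoc C W)"
    if p: "ar (L_cat T (L_cat T (L_cat T C))) W V p" for W V p
  proof -
    note p2 = ar_L_cpt[OF p] note p3 = ar_L_cpt[OF p2]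
    show ?thesis
      unfolding Cmp_L
      by (rule fam_ar_cong) (auto simp: ar_L_rdx[OF p] ar_L_rdx[OF p2] ar_L_rdx[OF p3]
          Cmp_Ide_l[OF C ar_L_cpt[OF p3]] Cmp_Ide_r[OF C ar_L_cpt[OF p3]])
  qed
  then show ?thesis
    unfolding natural_def L_assoc_def nattrans.simps mu_assoc_def[symmetric] comp_func_simps L_func_simps L_mu_simps
    using ar_mu_assoc by (auto intro: catfunctor_comp M M2 LM simp: mu_assoc_def)
qed

lemma natural_L_lunit: "natural (L_lunit T C)"
proof -
  have "Cmp (L_cat T C) (mu_ob T (eta_ob T A)) (mu_ob T (eta_ob T B)) B (mu_lunit C B) (mu_el (eta_ob T B) (eta_el p))
    = Cmp (L_cat T C) (mu_ob T (eta_ob T A)) A B p (mu_lunit C A)"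
    if p: "ar (L_cat T C) A B p" for A B p
    unfolding Cmp_L
    by (rule fam_ar_cong) (auto simp: ar_L_rdx[OF p] Cmp_Ide_l[OF C ar_L_cpt[OF p]] Cmp_Ide_r[OF C ar_L_cpt[OF p]])
  then show ?thesis
    unfolding natural_def L_lunit_def nattrans.simps mu_lunit_def[symmetric] comp_func_simps id_func_simps L_eta_simps L_mu_simps
    using ar_mu_lunit by (auto intro: catfunctor_comp M NL catfunctor_id LC)
qed

lemma natural_L_runit: "natural (L_runit T C)"
proof -
  have LN: "catfunctor (L_func T (L_eta T C))" by (rule catfunctor_L_func[OF N])
  have "Cmp (L_cat T C) A B (mu_ob T (Leta B)) (mu_runit C B) p
    = Cmp (L_cat T C) A (mu_ob T (Leta A)) (mu_ob T (Leta B))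
       (mu_el (Leta B) (fam_ar (idx B) (rdx p) (\<lambda>x. eta_el (cpt p x)))) (mu_runit C A)"
    if p: "ar (L_cat T C) A B p" for A B p
    unfolding Cmp_L
    by (rule fam_ar_cong) (auto simp: ar_L_rdx[OF p] Cmp_Ide_l[OF C ar_L_cpt[OF p]] Cmp_Ide_r[OF C ar_L_cpt[OF p]])
  then show ?thesis
    unfolding natural_def L_runit_def nattrans.simps comp_func_simps id_func_simps L_eta_simps L_mu_simps L_func_simps mu_runit_def[symmetric]
    using ar_mu_runit by (auto intro: catfunctor_comp M LN catfunctor_id LC)
qed

text \<open>The four constituents are evaluated once and for all at a class \<open>[g, k]\<close>:
  \<open>k\<close> is carried through the multiplication, the associativity reindexing follows, and
  an identity is left in the second factor. The later chases use this single value.\<close>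

lemma L_skew_m_cell: "L_skew_m T C \<in> cells (comp_prof (diamond (L_mu T C)) (diamond (L_mu T (L_cat T C))))
      (comp_prof (diamond (L_mu T C)) (L_prof T (diamond (L_mu T C))))"
  and sends_L_skew_m: "ar (L_cat T C) A (mu_ob T H) g \<Longrightarrow> ar (L_cat T (L_cat T C)) H (mu_ob T W) k \<Longrightarrow>
    W \<in> Ob (L_cat T (L_cat T (L_cat T C))) \<Longrightarrow>
    sends (L_skew_m T C) A W (coend_in (diamond (L_mu T C)) (diamond (L_mu T (L_cat T C))) A W H g k)
      (coend_in (diamond (L_mu T C)) (L_prof T (diamond (L_mu T C))) A W (Lmu W)
        (Cmp (L_cat T C) A (mu_ob T (mu_ob T W)) (mu_ob T (Lmu W)) (mu_assoc C W)
          (Cmp (L_cat T C) A (mu_ob T H) (mu_ob T (mu_ob T W)) (mu_el (mu_ob T W) k) g))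
        (Ide (L_cat T (L_cat T C)) (Lmu W)))" (is "_ \<Longrightarrow> _ \<Longrightarrow> _ \<Longrightarrow> ?s")
proof -
  have LM: "catfunctor (L_func T (L_mu T C))" by (rule catfunctor_L_func[OF M])
  have 1: "FSrc (L_mu T C) = FTrg (L_mu T (L_cat T C))" "FSrc (L_mu T C) = FTrg (L_func T (L_mu T C))" by simp_all
  have 2: "Src (diamond (L_mu T C)) = Trg (diamond (L_func T (L_mu T C)))" by simp
  note c1 = diamond_comp_cell[OF M M2 1(1)] and c2 = diamond_cell_cell[OF natural_L_assoc]
    and c3 = diamond_comp_inv_cell[OF M LM 1(2)]
    and c4 = lwhisker_cell[OF PR_diamond[OF M] L_diamond_inv_cell[OF M] 2]
  show "L_skew_m T C \<in> cells (comp_prof (diamond (L_mu T C)) (diamond (L_mu T (L_cat T C))))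
      (comp_prof (diamond (L_mu T C)) (L_prof T (diamond (L_mu T C))))"
    unfolding L_skew_m_def vpath.simps
    \<comment> \<open>The natural transformation is unfolded to expose its domain and codomain
      functors, and folded back so that the cell keeps its name.\<close>
    by (rule vcomp_cell[OF vcomp_cell[OF vcomp_cell[OF c1 c2[unfolded L_assoc_def nattrans.simps, folded L_assoc_def]] c3] c4])
  assume g: "ar (L_cat T C) A (mu_ob T H) g" and k: "ar (L_cat T (L_cat T C)) H (mu_ob T W) k" and W: "W \<in> Ob (L_cat T (L_cat T (L_cat T C)))"
  let ?g1 = "Cmp (L_cat T C) A (mu_ob T H) (mu_ob T (mu_ob T W)) (mu_el (mu_ob T W) k) g"
  let ?g2 = "Cmp (L_cat T C) A (mu_ob T (mu_ob T W)) (mu_ob T (Lmu W)) (mu_assoc C W) ?g1"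
  have g1: "ar (L_cat T C) A (mu_ob T (mu_ob T W)) ?g1" by (rule ar_Cmp[OF LC g ar_mu_el[OF k]])
  have g2: "ar (L_cat T C) A (mu_ob T (Lmu W)) ?g2" by (rule ar_Cmp[OF LC g1 ar_mu_assoc[OF W]])
  note LW = Lmu_Ob[OF W] note I = ar_Ide[OF LLC LW]
  have s1: "sends (diamond_comp (L_mu T C) (L_mu T (L_cat T C))) A W (coend_in (diamond (L_mu T C)) (diamond (L_mu T (L_cat T C))) A W H g k) ?g1"
    using sends_diamond_comp[OF M M2 1(1), of A H g W k] g k W ar_Ob(1)[OF k] by (simp add: el_diamond M M2)
  have s2: "sends (diamond_cell (L_assoc T C)) A W ?g1 ?g2"
    using sends_diamond_cell[OF natural_L_assoc, of A W ?g1] g1 W unfolding mu_assoc_def by (simp add: L_assoc_def)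
  have s3: "sends (diamond_comp_inv (L_mu T C) (L_func T (L_mu T C))) A W ?g2
      (coend_in (diamond (L_mu T C)) (diamond (L_func T (L_mu T C))) A W (Lmu W) ?g2 (Ide (L_cat T (L_cat T C)) (Lmu W)))"
    using sends_diamond_comp_inv[OF M LM 1(2), of A W ?g2] g2 W by simp
  have s4: "sends (diamond (L_mu T C) \<triangleleft> L_diamond_inv T (L_mu T C)) A W
      (coend_in (diamond (L_mu T C)) (diamond (L_func T (L_mu T C))) A W (Lmu W) ?g2 (Ide (L_cat T (L_cat T C)) (Lmu W)))
      (coend_in (diamond (L_mu T C)) (L_prof T (diamond (L_mu T C))) A W (Lmu W) ?g2 (Ide (L_cat T (L_cat T C)) (Lmu W)))"
    by (rule sends_lwhisker[OF L_diamond_inv_cell[OF M] PR_diamond[OF M] 2 _ sends_L_diamond_inv[OF M]])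
      (use g2 W LW I in \<open>simp_all add: el_diamond M LM\<close>)
  show ?s
    unfolding L_skew_m_def vpath.simps by (rule sends_vcomp[OF sends_vcomp[OF sends_vcomp[OF s1 s2] s3] s4])
qed

lemma L_skew_l_cell: "L_skew_l T C \<in> cells (comp_prof (diamond (L_mu T C)) (diamond (L_eta T (L_cat T C)))) (hom_prof (L_cat T C))"
  and sends_L_skew_l: "ar (L_cat T C) A (mu_ob T H) g \<Longrightarrow> ar (L_cat T (L_cat T C)) H (eta_ob T B) k \<Longrightarrow> B \<in> Ob (L_cat T C) \<Longrightarrow>
    sends (L_skew_l T C) A B (coend_in (diamond (L_mu T C)) (diamond (L_eta T (L_cat T C))) A B H g k)
      (Cmp (L_cat T C) A (mu_ob T (eta_ob T B)) B (mu_lunit C B)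
        (Cmp (L_cat T C) A (mu_ob T H) (mu_ob T (eta_ob T B)) (mu_el (eta_ob T B) k) g))" (is "_ \<Longrightarrow> _ \<Longrightarrow> _ \<Longrightarrow> ?s")
proof -
  have 1: "FSrc (L_mu T C) = FTrg (L_eta T (L_cat T C))" by simp
  note c1 = diamond_comp_cell[OF M NL 1] and c2 = diamond_cell_cell[OF natural_L_lunit] and c3 = diamond_unit_cell[OF LC]
  show "L_skew_l T C \<in> cells (comp_prof (diamond (L_mu T C)) (diamond (L_eta T (L_cat T C)))) (hom_prof (L_cat T C))"
    unfolding L_skew_l_def vpath.simps
    by (rule vcomp_cell[OF vcomp_cell[OF c1 c2[unfolded L_lunit_def nattrans.simps, folded L_lunit_def]] c3])
  assume g: "ar (L_cat T C) A (mu_ob T H) g" and k: "ar (L_cat T (L_cat T C)) H (eta_ob T B) k" and B: "B \<in> Ob (L_cat T C)"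
  let ?g1 = "Cmp (L_cat T C) A (mu_ob T H) (mu_ob T (eta_ob T B)) (mu_el (eta_ob T B) k) g"
  have g1: "ar (L_cat T C) A (mu_ob T (eta_ob T B)) ?g1" by (rule ar_Cmp[OF LC g ar_mu_el[OF k]])
  have s1: "sends (diamond_comp (L_mu T C) (L_eta T (L_cat T C))) A B (coend_in (diamond (L_mu T C)) (diamond (L_eta T (L_cat T C))) A B H g k) ?g1"
    using sends_diamond_comp[OF M NL 1, of A H g B k] g k B ar_Ob(1)[OF k] by (simp add: el_diamond M NL)
  have s2: "sends (diamond_cell (L_lunit T C)) A B ?g1 (Cmp (L_cat T C) A (mu_ob T (eta_ob T B)) B (mu_lunit C B) ?g1)"
    using sends_diamond_cell[OF natural_L_lunit, of A B ?g1] g1 B unfolding mu_lunit_def by (simp add: L_lunit_def)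
  show ?s
    unfolding L_skew_l_def vpath.simps
    by (rule sends_vcomp[OF sends_vcomp[OF s1 s2] sends_diamond_unit[OF LC ar_Cmp[OF LC g1 ar_mu_lunit[OF B]]]])
qed

lemma L_skew_r_cell: "L_skew_r T C \<in> cells (hom_prof (L_cat T C)) (comp_prof (diamond (L_mu T C)) (L_prof T (diamond (L_eta T C))))"
  and sends_L_skew_r: "ar (L_cat T C) A B g \<Longrightarrow>
    sends (L_skew_r T C) A B g (coend_in (diamond (L_mu T C)) (L_prof T (diamond (L_eta T C))) A B (Leta B)
      (Cmp (L_cat T C) A B (mu_ob T (Leta B)) (mu_runit C B) g) (Ide (L_cat T (L_cat T C)) (Leta B)))" (is "_ \<Longrightarrow> ?s")
proof -
  have LN: "catfunctor (L_func T (L_eta T C))" by (rule catfunctor_L_func[OF N])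
  have 1: "FSrc (L_mu T C) = FTrg (L_func T (L_eta T C))" by simp
  have 2: "Src (diamond (L_mu T C)) = Trg (diamond (L_func T (L_eta T C)))" by simp
  note c1 = diamond_unit_inv_cell[OF LC] and c2 = diamond_cell_cell[OF natural_L_runit]
    and c3 = diamond_comp_inv_cell[OF M LN 1]
    and c4 = lwhisker_cell[OF PR_diamond[OF M] L_diamond_inv_cell[OF N] 2]
  show "L_skew_r T C \<in> cells (hom_prof (L_cat T C)) (comp_prof (diamond (L_mu T C)) (L_prof T (diamond (L_eta T C))))"
    unfolding L_skew_r_def vpath.simps
    by (rule vcomp_cell[OF vcomp_cell[OF vcomp_cell[OF c1 c2[unfolded L_runit_def nattrans.simps, folded L_runit_def]] c3] c4])
  assume g: "ar (L_cat T C) A B g"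
  note B = ar_Ob(2)[OF g]
  let ?g2 = "Cmp (L_cat T C) A B (mu_ob T (Leta B)) (mu_runit C B) g"
  have g2: "ar (L_cat T C) A (mu_ob T (Leta B)) ?g2" by (rule ar_Cmp[OF LC g ar_mu_runit[OF B]])
  note LB = Leta_Ob[OF B] note I = ar_Ide[OF LLC LB]
  have s2: "sends (diamond_cell (L_runit T C)) A B g ?g2"
    using sends_diamond_cell[OF natural_L_runit, of A B g] g B unfolding mu_runit_def by (simp add: L_runit_def)
  have s3: "sends (diamond_comp_inv (L_mu T C) (L_func T (L_eta T C))) A B ?g2
      (coend_in (diamond (L_mu T C)) (diamond (L_func T (L_eta T C))) A B (Leta B) ?g2 (Ide (L_cat T (L_cat T C)) (Leta B)))"
    using sends_diamond_comp_inv[OF M LN 1, of A B ?g2] g2 B by simp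
  have s4: "sends (diamond (L_mu T C) \<triangleleft> L_diamond_inv T (L_eta T C)) A B
      (coend_in (diamond (L_mu T C)) (diamond (L_func T (L_eta T C))) A B (Leta B) ?g2 (Ide (L_cat T (L_cat T C)) (Leta B)))
      (coend_in (diamond (L_mu T C)) (L_prof T (diamond (L_eta T C))) A B (Leta B) ?g2 (Ide (L_cat T (L_cat T C)) (Leta B)))"
    by (rule sends_lwhisker[OF L_diamond_inv_cell[OF N] PR_diamond[OF M] 2 _ sends_L_diamond_inv[OF N]])
      (use g2 B LB I in \<open>simp_all add: el_diamond M LN\<close>)
  show ?s
    unfolding L_skew_r_def vpath.simps
    by (rule sends_vcomp[OF sends_vcomp[OF sends_vcomp[OF sends_diamond_unit_inv[OF LC g] s2] s3] s4])
qed

end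

end

section \<open>The five skew monad axioms\<close>

lemma el_diamond_Ide: "catfunctor f \<Longrightarrow> c \<in> Ob (FSrc f) \<Longrightarrow> el (diamond f) (FOb f c) c (Ide (FTrg f) (FOb f c))"
  by (simp add: el_diamond ar_Ide catfunctor_Trg catfunctor_FOb)

context set_monad
begin

lemma mu_el_Ide: "category C \<Longrightarrow> A \<in> Ob (L_cat T (L_cat T C)) \<Longrightarrow> mu_el A (Ide (L_cat T (L_cat T C)) A) = Ide (L_cat T C) (mu_ob T A)"
  using FAr_Ide[OF catfunctor_L_mu, of C A] by simp

context
  fixes C :: "'u cat"
  assumes C: "category C"
begin

private lemmas k1 = category_L_cat[OF C]
private lemmas k2 = category_L_cat[OF k1]
private lemmas k3 = category_L_cat[OF k2]
private lemmas m1 = catfunctor_L_mu[OF C] and m2 = catfunctor_L_mu[OF k1] and m3 = catfunctor_L_mu[OF k2]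
  and e1 = catfunctor_L_eta[OF C] and e2 = catfunctor_L_eta[OF k1] and e3 = catfunctor_L_eta[OF k2]
private lemmas pm1 = PR_diamond[OF m1] and pm2 = PR_diamond[OF m2] and pm3 = PR_diamond[OF m3]
  and pe1 = PR_diamond[OF e1] and pe2 = PR_diamond[OF e2] and pe3 = PR_diamond[OF e3]
private lemmas Lm1 = PR_L_prof[OF pm1] and Le1 = PR_L_prof[OF pe1] and Lm2 = PR_L_prof[OF pm2] and Le2 = PR_L_prof[OF pe2]

text \<open>The pentagon for disjoint unions, on elements. After two co-Yoneda reductions an element
  of the source is an arrow \<open>g\<close> into the iterated union of the four levels of
  \<open>W\<close>. The paths end in classes over \<open>Lmu H\<close> and over
  \<open>Lmu (Lmu W)\<close>, and the associativity reindexings at all entries of \<open>W\<close>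
  form the arrow between these objects.\<close>

lemma skew_axiom_i:
  "((((((diamond (L_mu T C) \<triangleleft> L_compositor T (diamond (L_mu T C)) (L_prof T (diamond (L_mu T C))))
    \<cdot> \<aa> (diamond (L_mu T C)) (L_prof T (diamond (L_mu T C))) (L_prof T (L_prof T (diamond (L_mu T C)))))
    \<cdot> (L_skew_m T C \<triangleright> L_prof T (L_prof T (diamond (L_mu T C)))))
    \<cdot> \<aa>' (diamond (L_mu T C)) (diamond (L_mu T (L_cat T C))) (L_prof T (L_prof T (diamond (L_mu T C)))))
    \<cdot> (diamond (L_mu T C) \<triangleleft> mu1 (diamond (L_mu T C))))
    \<cdot> \<aa> (diamond (L_mu T C)) (L_prof T (diamond (L_mu T C))) (diamond (L_mu T (L_cat T (L_cat T C)))))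
    \<cdot> (L_skew_m T C \<triangleright> diamond (L_mu T (L_cat T (L_cat T C))))
   = ((((((diamond (L_mu T C) \<triangleleft> L_cell T (L_skew_m T C))
    \<cdot> (diamond (L_mu T C) \<triangleleft> L_compositor T (diamond (L_mu T C)) (diamond (L_mu T (L_cat T C)))))
    \<cdot> \<aa> (diamond (L_mu T C)) (L_prof T (diamond (L_mu T C))) (L_prof T (diamond (L_mu T (L_cat T C)))))
    \<cdot> (L_skew_m T C \<triangleright> L_prof T (diamond (L_mu T (L_cat T C)))))
    \<cdot> \<aa>' (diamond (L_mu T C)) (diamond (L_mu T (L_cat T C))) (L_prof T (diamond (L_mu T (L_cat T C)))))
    \<cdot> (diamond (L_mu T C) \<triangleleft> L_skew_m T (L_cat T C)))
    \<cdot> \<aa> (diamond (L_mu T C)) (diamond (L_mu T (L_cat T C))) (diamond (L_mu T (L_cat T (L_cat T C))))" (is "?l = ?r")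
proof (rule cell_eqI)
  let ?m = "diamond (L_mu T C)" and ?m2 = "diamond (L_mu T (L_cat T C))" and ?m3 = "diamond (L_mu T (L_cat T (L_cat T C)))"
  let ?Lm = "L_prof T ?m" and ?Lmm = "L_prof T ?m2" and ?LC = "L_cat T C" let ?LLC = "L_cat T ?LC" and ?LLm = "L_prof T ?Lm"
  let ?LLLC = "L_cat T ?LLC"
  note LLm = PR_L_prof[OF Lm1]
  have ty: "Src ?m = Trg ?m2" "Src ?m = FTrg (L_mu T ?LC)" "Src (comp_prof ?m ?m2) = FTrg (L_mu T ?LLC)" "Src ?m = Trg ?Lm" by simp_all
  fix A W p assume "el (Dom ?r) A W p"
  then have p': "el (comp_prof (comp_prof ?m ?m2) ?m3) A W p" by simp
  obtain q where p: "p = coyoneda (comp_prof ?m ?m2) (L_mu T ?LLC) A W q" and q': "el (comp_prof ?m ?m2) A (mu_ob T W) q"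
    and W: "W \<in> Ob (L_cat T ?LLLC)"
    using el_comp_diamondE[OF m3 PR_comp[OF pm1 pm2 ty(1)] ty(3) p'] by auto
  let ?V = "mu_ob T W" let ?U = "mu_ob T ?V"
  obtain g where q: "q = coyoneda ?m (L_mu T ?LC) A ?V g" and gm: "el ?m A ?U g"
    using el_comp_diamondE[OF m2 pm1 ty(2) q'] by auto
  note V = mu_ob_Ob[OF W] note U = mu_ob_Ob[OF V] and LV = Lmu_Ob[OF V] and LW = Lmu_Ob[OF W] note LLW = Lmu_Ob[OF LW]
  have Wx: "ob W x \<in> Ob ?LLLC" if "x \<in> elts (idx W)" for x by (rule L_Ob_ob[OF W that])
  note LWx = Lmu_Ob[OF Wx]
  have g: "ar ?LC A (mu_ob T ?U) g" using gm by (simp add: el_diamond[OF m1])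
  have gx: "ar C (ob A (rdx g (pr (pr (pr x z) y) u))) (ob (ob (ob (ob W x) z) y) u) (cpt g (pr (pr (pr x z) y) u))"
    if "x \<in> elts (idx W)" "z \<in> elts (idx (ob W x))" "y \<in> elts (idx (ob (ob W x) z))" "u \<in> elts (idx (ob (ob (ob W x) z) y))" for x z y u
    using that ar_L_cpt[OF g, of "pr (pr (pr x z) y) u"] by simp
  let ?I = "Ide ?LLLC ?V" and ?J = "Ide ?LLC ?U" and ?K = "Ide ?LLC (Lmu ?V)"
  have eI: "el ?m3 ?V W ?I" using el_diamond_Ide[OF m3, of W] W by simp
  have eJ: "el ?m2 ?U ?V ?J" using el_diamond_Ide[OF m2, of ?V] V by simp
  have q2: "q = coend_in ?m ?m2 A ?V ?U g ?J" and p2: "p = coend_in (comp_prof ?m ?m2) ?m3 A W ?V q ?I"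
    unfolding q p coyoneda_def by simp_all
  let ?c = "Cmp ?LC A (mu_ob T ?U) (mu_ob T (Lmu ?V)) (mu_assoc C ?V) g"
  have "sends (L_skew_m T C) A ?V q (coend_in ?m ?Lm A ?V (Lmu ?V) ?c ?K)"
    using sends_L_skew_m[OF C g ar_Ide[OF k2 U] V] by (simp add: q2 mu_el_Ide[OF C U] Cmp_Ide_l[OF k1 g])
  then have l1: "sends (L_skew_m T C \<triangleright> ?m3) A W p (coend_in (comp_prof ?m ?Lm) ?m3 A W ?V (coend_in ?m ?Lm A ?V (Lmu ?V) ?c ?K) ?I)"
    unfolding p2 by (intro sends_rwhisker[OF L_skew_m_cell[OF C] pm3 _ eI]) simp_all
  have c: "ar ?LC A (mu_ob T (Lmu ?V)) ?c" by (rule ar_Cmp[OF k1 g ar_mu_assoc[OF C V]])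
  have ec: "el ?m A (Lmu ?V) ?c" using c LV by (simp add: el_diamond[OF m1])
  have eK: "el ?Lm (Lmu ?V) ?V ?K" using ar_Ide[OF k2 LV] V by (simp add: el_L_diamond[OF m1])
  have l2: "sends (\<aa> ?m ?Lm ?m3) A W (coend_in (comp_prof ?m ?Lm) ?m3 A W ?V (coend_in ?m ?Lm A ?V (Lmu ?V) ?c ?K) ?I)
    (coend_in ?m (comp_prof ?Lm ?m3) A W (Lmu ?V) ?c (coend_in ?Lm ?m3 (Lmu ?V) W ?V ?K ?I))"
    by (rule sends_assoc[OF pm1 Lm1 pm3 _ _ ec eK eI]) simp_all
  \<comment> \<open>\<open>?K\<close> is an identity, so splitting it over \<open>W\<close> puts
    \<open>Lmu (ob W x)\<close> at each \<open>x\<close> and leaves a flat element consisting of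
    identities. The two names prevent this from being unfolded in the chase.\<close>
  define H where "H = mu_split (Lmu ?V) W (rdx ?K)"
  define f where "f = mu_flat W (cpt ?K)"
  let ?h = "reindex ?LC (mu_ob T H) (rdx ?K)"
  have WS: "W \<in> Ob (L_cat T (L_cat T (Src ?m)))" and IS: "ar (L_cat T (Src ?m)) ?V ?V ?I" using W ar_Ide[OF k3 V] by simp_all
  have Hi: "idx H = idx W" "lab H = lab W" and rf: "x \<in> elts (idx W) \<Longrightarrow> rdx f x = x" for x
    by (simp_all add: H_def f_def)
  have Hx: "ob H x = Lmu (ob W x)" and fx: "cpt f x = Ide ?LLC (Lmu (ob W x))" if x: "x \<in> elts (idx W)" for x
  proof -
    show "ob H x = Lmu (ob W x)"
      unfolding H_def mu_split_def using x by simp (rule fam_ob_cong, simp_all add: Ide_L)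
    show "cpt f x = Ide ?LLC (Lmu (ob W x))"
      unfolding f_def mu_flat_def using x by (simp add: Ide_L[of ?LC])
  qed
  have H: "H \<in> Ob ?LLLC" unfolding H_def by (rule mu_split_Ob[OF LV WS el_L_lmap[OF eK]])
  have h: "ar ?LLC (Lmu ?V) (mu_ob T H) ?h" unfolding H_def by (rule ar_mu_split[OF k1 LV WS el_L_lmap[OF eK]])
  have eh: "el ?m2 (Lmu ?V) H ?h" using h H by (simp add: el_diamond[OF m2])
  note ef = el_mu_flat_split[OF eK WS, folded H_def f_def]
  have rK: "ract ?Lm (Lmu ?V) ?V ?V ?I ?K = ?K"
    using ract_Ide[OF PR_profunctor[OF Lm1] eK] by simp
  have l3: "sends (?m \<triangleleft> mu1 ?m) A W (coend_in ?m (comp_prof ?Lm ?m3) A W (Lmu ?V) ?c (coend_in ?Lm ?m3 (Lmu ?V) W ?V ?K ?I))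
    (coend_in ?m (comp_prof ?m2 ?LLm) A W (Lmu ?V) ?c (coend_in ?m2 ?LLm (Lmu ?V) W H ?h f))"
    using sends_lwhisker[OF mu1_cell[OF pm1] pm1 _ ec sends_mu1[OF pm1 eK IS WS]] unfolding mu_sec_def rK H_def[symmetric] f_def[symmetric] by simp
  have l4: "sends (\<aa>' ?m ?m2 ?LLm) A W (coend_in ?m (comp_prof ?m2 ?LLm) A W (Lmu ?V) ?c (coend_in ?m2 ?LLm (Lmu ?V) W H ?h f))
    (coend_in (comp_prof ?m ?m2) ?LLm A W H (coend_in ?m ?m2 A H (Lmu ?V) ?c ?h) f)"
    by (rule sends_assoc_inv[OF pm1 pm2 LLm _ _ ec eh ef]) simp_all
  let ?d = "Cmp ?LC A (mu_ob T (mu_ob T H)) (mu_ob T (Lmu H)) (mu_assoc C H)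
      (Cmp ?LC A (mu_ob T (Lmu ?V)) (mu_ob T (mu_ob T H)) (mu_el (mu_ob T H) ?h) ?c)" and ?N = "Ide ?LLC (Lmu H)"
  have l5: "sends (L_skew_m T C \<triangleright> ?LLm) A W (coend_in (comp_prof ?m ?m2) ?LLm A W H (coend_in ?m ?m2 A H (Lmu ?V) ?c ?h) f)
    (coend_in (comp_prof ?m ?Lm) ?LLm A W H (coend_in ?m ?Lm A H (Lmu H) ?d ?N) f)"
    by (rule sends_rwhisker[OF L_skew_m_cell[OF C] LLm _ ef sends_L_skew_m[OF C c h H]]) simp
  note LH = Lmu_Ob[OF H]
  have d: "ar ?LC A (mu_ob T (Lmu H)) ?d" by (rule ar_Cmp[OF k1 ar_Cmp[OF k1 c ar_mu_el[OF h]] ar_mu_assoc[OF C H]])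
  have ed: "el ?m A (Lmu H) ?d" using d LH by (simp add: el_diamond[OF m1])
  have eN: "el ?Lm (Lmu H) H ?N" using ar_Ide[OF k2 LH] H by (simp add: el_L_diamond[OF m1])
  have l6: "sends (\<aa> ?m ?Lm ?LLm) A W (coend_in (comp_prof ?m ?Lm) ?LLm A W H (coend_in ?m ?Lm A H (Lmu H) ?d ?N) f)
    (coend_in ?m (comp_prof ?Lm ?LLm) A W (Lmu H) ?d (coend_in ?Lm ?LLm (Lmu H) W H ?N f))"
    by (rule sends_assoc[OF pm1 Lm1 LLm _ _ ed eN ef]) simp_all
  \<comment> \<open>\<open>?N\<close> and \<open>f\<close> both consist of identities, so the
    compositor yields a pair of identities at each index.\<close>
  let ?w = "fam_ar (idx W) (\<lambda>x. x) (\<lambda>x. coend_in ?m ?Lm (mu_ob T (Lmu (ob W x))) (ob W x) (Lmu (ob W x))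
    (Ide ?LC (mu_ob T (Lmu (ob W x)))) (Ide ?LLC (Lmu (ob W x))))"
  have Is: "y \<in> elts (idx P) \<Longrightarrow> rdx (Ide (L_cat T C') P) y = y" "y \<in> elts (idx P) \<Longrightarrow> cpt (Ide (L_cat T C') P) y = Ide C' (ob P y)" for C' P y
    by (simp_all add: Ide_L)
  have w: "sends (L_compositor T ?m ?Lm) (Lmu H) W (coend_in ?Lm ?LLm (Lmu H) W H ?N f) ?w"
    by (rule sends_L_compositor[OF pm1 Lm1 ty(4) eN ef]) (simp_all add: Is Hx fx rf Hi)
  note w' = sends_el[OF L_compositor_cell[OF pm1 Lm1 ty(4)] w]
  have l7: "sends (?m \<triangleleft> L_compositor T ?m ?Lm) A W (coend_in ?m (comp_prof ?Lm ?LLm) A W (Lmu H) ?d (coend_in ?Lm ?LLm (Lmu H) W H ?N f))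
    (coend_in ?m (L_prof T (comp_prof ?m ?Lm)) A W (Lmu H) ?d ?w)"
    by (rule sends_lwhisker[OF L_compositor_cell[OF pm1 Lm1 ty(4)] pm1 _ ed w]) simp
  have r1: "sends (\<aa> ?m ?m2 ?m3) A W p (coend_in ?m (comp_prof ?m2 ?m3) A W ?U g (coend_in ?m2 ?m3 ?U W ?V ?J ?I))"
    unfolding p2 q2 by (rule sends_assoc[OF pm1 pm2 pm3 _ _ gm eJ eI]) simp_all
  let ?b = "mu_assoc ?LC W" and ?K2 = "Ide ?LLLC (Lmu W)"
  note b = ar_mu_assoc[OF k1 W]
  have "sends (L_skew_m T ?LC) ?U W (coend_in ?m2 ?m3 ?U W ?V ?J ?I) (coend_in ?m2 ?Lmm ?U W (Lmu W) ?b ?K2)"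
    using sends_L_skew_m[OF k1 ar_Ide[OF k2 U] ar_Ide[OF k3 V] W] Cmp_Ide_l[OF k2 ar_Ide[OF k2 U]] Cmp_Ide_r[OF k2 b]
    by (simp add: mu_el_Ide[OF k1 V])
  then have r2: "sends (?m \<triangleleft> L_skew_m T ?LC) A W (coend_in ?m (comp_prof ?m2 ?m3) A W ?U g (coend_in ?m2 ?m3 ?U W ?V ?J ?I))
    (coend_in ?m (comp_prof ?m2 ?Lmm) A W ?U g (coend_in ?m2 ?Lmm ?U W (Lmu W) ?b ?K2))"
    by (intro sends_lwhisker[OF L_skew_m_cell[OF k1] pm1 _ gm]) simp_all
  have eb: "el ?m2 ?U (Lmu W) ?b" using b LW by (simp add: el_diamond[OF m2])
  have eK2: "el ?Lmm (Lmu W) W ?K2" using ar_Ide[OF k3 LW] W by (simp add: el_L_diamond[OF m2])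
  have r3: "sends (\<aa>' ?m ?m2 ?Lmm) A W (coend_in ?m (comp_prof ?m2 ?Lmm) A W ?U g (coend_in ?m2 ?Lmm ?U W (Lmu W) ?b ?K2))
    (coend_in (comp_prof ?m ?m2) ?Lmm A W (Lmu W) (coend_in ?m ?m2 A (Lmu W) ?U g ?b) ?K2)"
    by (rule sends_assoc_inv[OF pm1 pm2 Lm2 _ _ gm eb eK2]) simp_all
  let ?k = "Cmp ?LC A (mu_ob T (mu_ob T (Lmu W))) (mu_ob T (Lmu (Lmu W))) (mu_assoc C (Lmu W))
      (Cmp ?LC A (mu_ob T ?U) (mu_ob T (mu_ob T (Lmu W))) (mu_el (mu_ob T (Lmu W)) ?b) g)" and ?K3 = "Ide ?LLC (Lmu (Lmu W))"
  have r4: "sends (L_skew_m T C \<triangleright> ?Lmm) A W (coend_in (comp_prof ?m ?m2) ?Lmm A W (Lmu W) (coend_in ?m ?m2 A (Lmu W) ?U g ?b) ?K2)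
    (coend_in (comp_prof ?m ?Lm) ?Lmm A W (Lmu W) (coend_in ?m ?Lm A (Lmu W) (Lmu (Lmu W)) ?k ?K3) ?K2)"
    by (rule sends_rwhisker[OF L_skew_m_cell[OF C] Lm2 _ eK2 sends_L_skew_m[OF C g b LW]]) simp
  have k: "ar ?LC A (mu_ob T (Lmu (Lmu W))) ?k" by (rule ar_Cmp[OF k1 ar_Cmp[OF k1 g ar_mu_el[OF b]] ar_mu_assoc[OF C LW]])
  have ek: "el ?m A (Lmu (Lmu W)) ?k" using k LLW by (simp add: el_diamond[OF m1])
  have eK3: "el ?Lm (Lmu (Lmu W)) (Lmu W) ?K3" using ar_Ide[OF k2 LLW] LW by (simp add: el_L_diamond[OF m1])
  have r5: "sends (\<aa> ?m ?Lm ?Lmm) A W (coend_in (comp_prof ?m ?Lm) ?Lmm A W (Lmu W) (coend_in ?m ?Lm A (Lmu W) (Lmu (Lmu W)) ?k ?K3) ?K2)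
    (coend_in ?m (comp_prof ?Lm ?Lmm) A W (Lmu (Lmu W)) ?k (coend_in ?Lm ?Lmm (Lmu (Lmu W)) W (Lmu W) ?K3 ?K2))"
    by (rule sends_assoc[OF pm1 Lm1 Lm2 _ _ ek eK3 eK2]) simp_all
  let ?y = "fam_ar (idx W) (\<lambda>x. x) (\<lambda>x. coend_in ?m ?m2 (mu_ob T (mu_ob T (ob W x))) (ob W x) (mu_ob T (ob W x))
    (Ide ?LC (mu_ob T (mu_ob T (ob W x)))) (Ide ?LLC (mu_ob T (ob W x))))"
  have y: "sends (L_compositor T ?m ?m2) (Lmu (Lmu W)) W (coend_in ?Lm ?Lmm (Lmu (Lmu W)) W (Lmu W) ?K3 ?K2) ?y"
    by (rule sends_L_compositor[OF pm1 pm2 ty(1) eK3 eK2]) (simp_all add: Is)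
  let ?z = "fam_ar (idx W) (\<lambda>x. x) (\<lambda>x. coend_in ?m ?Lm (mu_ob T (mu_ob T (ob W x))) (ob W x) (Lmu (ob W x))
    (mu_assoc C (ob W x)) (Ide ?LLC (Lmu (ob W x))))"
  have z: "sends (L_cell T (L_skew_m T C)) (Lmu (Lmu W)) W ?y ?z"
  proof (rule sends_L_cell)
    fix x assume x: "x \<in> elts (idx W)"
    note X = Wx[OF x] note mX = mu_ob_Ob[OF X] note IX = ar_Ide[OF k1 mu_ob_Ob[OF mX]]
    show "sends (L_skew_m T C) (ob (Lmu (Lmu W)) (rdx ?y x)) (ob W x) (cpt ?y x)
      (coend_in ?m ?Lm (mu_ob T (mu_ob T (ob W x))) (ob W x) (Lmu (ob W x)) (mu_assoc C (ob W x)) (Ide ?LLC (Lmu (ob W x))))"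
      using sends_L_skew_m[OF C IX ar_Ide[OF k2 mX] X] x Cmp_Ide_l[OF k1 IX] Cmp_Ide_r[OF k1 ar_mu_assoc[OF C X]]
      by (simp add: mu_el_Ide[OF C mX])
  qed (use sends_el[OF L_compositor_cell[OF pm1 pm2 ty(1)] y] in \<open>simp_all add: cell_Dom[OF L_skew_m_cell[OF C]]\<close>)
  have r67: "sends ((?m \<triangleleft> L_cell T (L_skew_m T C)) \<cdot> (?m \<triangleleft> L_compositor T ?m ?m2)) A W
    (coend_in ?m (comp_prof ?Lm ?Lmm) A W (Lmu (Lmu W)) ?k (coend_in ?Lm ?Lmm (Lmu (Lmu W)) W (Lmu W) ?K3 ?K2))
    (coend_in ?m (L_prof T (comp_prof ?m ?Lm)) A W (Lmu (Lmu W)) ?k ?z)"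
    by (rule sends_vcomp[OF sends_lwhisker[OF L_compositor_cell[OF pm1 pm2 ty(1)] pm1 _ ek y]
      sends_lwhisker[OF L_cell_cell[OF L_skew_m_cell[OF C]] pm1 _ ek z]]) simp_all
  \<comment> \<open>The arrow to glide along: at each outer index the rebracketing of the three
    inner levels.\<close>
  let ?v = "fam_ar (idx W) (\<lambda>x. x) (\<lambda>x. mu_assoc C (ob W x))"
  have v: "ar ?LLC (Lmu (Lmu W)) (Lmu H) ?v"
    by (rule ar_L_fam[OF LLW LH _ lmap_idI[OF LH]]) (auto simp: Hx Hi intro!: ar_mu_assoc[OF C] Wx)
  have "lact (L_prof T (comp_prof ?m ?Lm)) (Lmu (Lmu W)) (Lmu H) W ?v ?w = ?z"
    unfolding lact_L
  proof (rule fam_ar_cong)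
    fix x assume x: "x \<in> elts (idx W)"
    let ?X = "Lmu (ob W x)"
    have ex: "el ?m (mu_ob T ?X) ?X (Ide ?LC (mu_ob T ?X))" "el ?Lm ?X (ob W x) (Ide ?LLC ?X)"
      using el_diamond_Ide[OF m1, of ?X] LWx[OF x] ar_Ide[OF k2 LWx[OF x]] Wx[OF x] by (simp_all add: el_L_diamond[OF m1])
    note a = ar_mu_assoc[OF C Wx[OF x]]
    show "lact (comp_prof ?m ?Lm) (ob (Lmu (Lmu W)) (rdx ?v (rdx ?w x))) (ob (Lmu H) (rdx ?w x)) (ob W x) (cpt ?v (rdx ?w x)) (cpt ?w x)
      = coend_in ?m ?Lm (mu_ob T (mu_ob T (ob W x))) (ob W x) ?X (mu_assoc C (ob W x)) (Ide ?LLC ?X)"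
      using x lact_comp[OF pm1 Lm1 ty(4) ex, of "mu_ob T (mu_ob T (ob W x))" "mu_assoc C (ob W x)"] a
        lact_diamond[OF m1 _ ex(1), of "mu_ob T (mu_ob T (ob W x))" "mu_assoc C (ob W x)"] Cmp_Ide_l[OF k1 a] by (simp add: Hx Hi)
  qed simp_all
  moreover have "ract ?m A (Lmu (Lmu W)) (Lmu H) ?v ?k = ?d"
  proof -
    \<comment> \<open>The pentagon proper. At a fourfold index both sides reach the same rebracketed
      index of \<open>g\<close>, and the components differ by identities.\<close>
    have "Cmp ?LC A (mu_ob T (Lmu (Lmu W))) (mu_ob T (Lmu H)) (mu_el (Lmu H) ?v) ?k = ?d"
      unfolding Cmp_L[of C A "mu_ob T (Lmu (Lmu W))" "mu_ob T (Lmu H)"]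
    proof (rule fam_eqI[OF _ ar_L_eta[OF d]])
      fix s assume "s \<in> elts (idx (mu_ob T (Lmu H)))"
      then obtain x z y u where s: "s = pr x (pr z (pr y u))" and xz: "x \<in> elts (idx W)" "z \<in> elts (idx (ob W x))"
        "y \<in> elts (idx (ob (ob W x) z))" "u \<in> elts (idx (ob (ob (ob W x) z) y))" by (auto simp: Hx Hi)
      note * = xz gx[OF xz] and D = Cmp_Ide_r[OF C gx[OF xz]] Cmp_Ide_l[OF C gx[OF xz]]
      show "rdx (fam_ar (idx (mu_ob T (Lmu H))) (\<lambda>x. rdx ?k (rdx (mu_el (Lmu H) ?v) x)) (\<lambda>x. Cmp C (ob A (rdx ?k (rdx (mu_el (Lmu H) ?v) x)))
        (ob (mu_ob T (Lmu (Lmu W))) (rdx (mu_el (Lmu H) ?v) x)) (ob (mu_ob T (Lmu H)) x) (cpt (mu_el (Lmu H) ?v) x) (cpt ?k (rdx (mu_el (Lmu H) ?v) x)))) s = rdx ?d s"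
        using * by (simp add: s Hx Hi Cmp_L Is)
      show "cpt (fam_ar (idx (mu_ob T (Lmu H))) (\<lambda>x. rdx ?k (rdx (mu_el (Lmu H) ?v) x)) (\<lambda>x. Cmp C (ob A (rdx ?k (rdx (mu_el (Lmu H) ?v) x)))
        (ob (mu_ob T (Lmu (Lmu W))) (rdx (mu_el (Lmu H) ?v) x)) (ob (mu_ob T (Lmu H)) x) (cpt (mu_el (Lmu H) ?v) x) (cpt ?k (rdx (mu_el (Lmu H) ?v) x)))) s = cpt ?d s"
        using * D by (simp add: s Hx Hi Cmp_L Is)
    qed simp
    then show ?thesis using ract_diamond[OF m1 _ ek, of "Lmu H" ?v] v by simp
  qed
  ultimately have eq: "coend_in ?m (L_prof T (comp_prof ?m ?Lm)) A W (Lmu (Lmu W)) ?k ?z = coend_in ?m (L_prof T (comp_prof ?m ?Lm)) A W (Lmu H) ?d ?w"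
    using coend_glide[of "L_prof T (comp_prof ?m ?Lm)" "Lmu (Lmu W)" "Lmu H" ?v ?m A ?k W ?w] v ek w' by simp
  show "\<exists>q. sends ?l A W p q \<and> sends ?r A W p q"
    using sends_vcomp[OF l1 sends_vcomp[OF l2 sends_vcomp[OF l3 sends_vcomp[OF l4 sends_vcomp[OF l5 sends_vcomp[OF l6 l7]]]]]]
      sends_vcomp[OF r1 sends_vcomp[OF r2 sends_vcomp[OF r3 sends_vcomp[OF r4 sends_vcomp[OF r5 r67[unfolded eq]]]]]] by blast
qed (simp_all add: cell_Dom[OF L_skew_m_cell[OF C]] cell_Cod[OF L_skew_m_cell[OF C]])

text \<open>The triangle identity. The longer path ends in a class whose second factor is the family
  of all \<open>mu_lunit C (ob B x)\<close>. Gliding this family into the first factor makes its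
  reindexings cancel and leaves \<open>g\<close>.\<close>

lemma skew_axiom_ii:
  "(((((((diamond (L_mu T C) \<triangleleft> L_cell T (L_skew_l T C))
    \<cdot> (diamond (L_mu T C) \<triangleleft> L_compositor T (diamond (L_mu T C)) (diamond (L_eta T (L_cat T C)))))
    \<cdot> \<aa> (diamond (L_mu T C)) (L_prof T (diamond (L_mu T C))) (L_prof T (diamond (L_eta T (L_cat T C)))))
    \<cdot> (L_skew_m T C \<triangleright> L_prof T (diamond (L_eta T (L_cat T C)))))
    \<cdot> \<aa>' (diamond (L_mu T C)) (diamond (L_mu T (L_cat T C))) (L_prof T (diamond (L_eta T (L_cat T C)))))
    \<cdot> (diamond (L_mu T C) \<triangleleft> L_skew_r T (L_cat T C))) \<cdot> \<rr>' (diamond (L_mu T C)))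
   = (diamond (L_mu T C) \<triangleleft> L_unitor T (L_cat T C)) \<cdot> \<rr>' (diamond (L_mu T C))" (is "?l = ?r")
proof (rule cell_eqI)
  let ?m = "diamond (L_mu T C)" and ?m2 = "diamond (L_mu T (L_cat T C))" and ?e2 = "diamond (L_eta T (L_cat T C))"
  let ?Le = "L_prof T ?e2" and ?Lm = "L_prof T ?m" and ?LC = "L_cat T C" let ?LLC = "L_cat T ?LC"
  fix A B g assume "el (Dom ?r) A B g"
  then have gm: "el ?m A B g" by simp
  then have g: "ar ?LC A (mu_ob T B) g" and B: "B \<in> Ob ?LLC" by (simp_all add: el_diamond[OF m1])
  note LB = Leta_Ob[OF B] note r = ar_mu_runit[OF k1 B] note LLB = Lmu_Ob[OF LB]
  let ?I2 = "Ide (L_cat T ?LLC) (Leta B)" and ?I3 = "Ide ?LLC (Lmu (Leta B))" and ?rr = "mu_runit ?LC B"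
  have s1: "sends (\<rr>' ?m) A B g (coend_in ?m (hom_prof ?LLC) A B B g (Ide ?LLC B))"
    using sends_runit_inv[OF pm1 gm] by simp
  have "sends (L_skew_r T ?LC) B B (Ide ?LLC B) (coend_in ?m2 ?Le B B (Leta B) ?rr ?I2)"
    using sends_L_skew_r[OF k1 ar_Ide[OF k2 B]] by (simp add: Cmp_Ide_r[OF k2 r])
  then have s2: "sends (?m \<triangleleft> L_skew_r T ?LC) A B (coend_in ?m (hom_prof ?LLC) A B B g (Ide ?LLC B))
    (coend_in ?m (comp_prof ?m2 ?Le) A B B g (coend_in ?m2 ?Le B B (Leta B) ?rr ?I2))"
    by (intro sends_lwhisker[OF L_skew_r_cell[OF k1] pm1 _ gm]) simp_all
  have er: "el ?m2 B (Leta B) ?rr" using r LB by (simp add: el_diamond[OF m2])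
  have eI2: "el ?Le (Leta B) B ?I2" using ar_Ide[OF k3 LB] B by (simp add: el_L_diamond[OF e2])
  have s3: "sends (\<aa>' ?m ?m2 ?Le) A B (coend_in ?m (comp_prof ?m2 ?Le) A B B g (coend_in ?m2 ?Le B B (Leta B) ?rr ?I2))
    (coend_in (comp_prof ?m ?m2) ?Le A B (Leta B) (coend_in ?m ?m2 A (Leta B) B g ?rr) ?I2)"
    by (rule sends_assoc_inv[OF pm1 pm2 Le2 _ _ gm er eI2]) simp_all
  let ?c = "Cmp ?LC A (mu_ob T (mu_ob T (Leta B))) (mu_ob T (Lmu (Leta B))) (mu_assoc C (Leta B))
          (Cmp ?LC A (mu_ob T B) (mu_ob T (mu_ob T (Leta B))) (mu_el (mu_ob T (Leta B)) ?rr) g)"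
  have s4: "sends (L_skew_m T C \<triangleright> ?Le) A B
    (coend_in (comp_prof ?m ?m2) ?Le A B (Leta B) (coend_in ?m ?m2 A (Leta B) B g ?rr) ?I2)
    (coend_in (comp_prof ?m ?Lm) ?Le A B (Leta B) (coend_in ?m ?Lm A (Leta B) (Lmu (Leta B)) ?c ?I3) ?I2)"
    by (rule sends_rwhisker[OF L_skew_m_cell[OF C] Le2 _ eI2 sends_L_skew_m[OF C g r LB]]) simp
  have c: "ar ?LC A (mu_ob T (Lmu (Leta B))) ?c"
    by (rule ar_Cmp[OF k1 ar_Cmp[OF k1 g ar_mu_el[OF r]] ar_mu_assoc[OF C LB]])
  have ec: "el ?m A (Lmu (Leta B)) ?c" using c LLB by (simp add: el_diamond[OF m1])
  have eI3: "el ?Lm (Lmu (Leta B)) (Leta B) ?I3" using ar_Ide[OF k2 LLB] LB by (simp add: el_L_diamond[OF m1])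
  let ?q = "coend_in ?Lm ?Le (Lmu (Leta B)) B (Leta B) ?I3 ?I2"
  have s5: "sends (\<aa> ?m ?Lm ?Le) A B
    (coend_in (comp_prof ?m ?Lm) ?Le A B (Leta B) (coend_in ?m ?Lm A (Leta B) (Lmu (Leta B)) ?c ?I3) ?I2)
    (coend_in ?m (comp_prof ?Lm ?Le) A B (Lmu (Leta B)) ?c ?q)"
    by (rule sends_assoc[OF pm1 Lm1 Le2 _ _ ec eI3 eI2]) simp_all
  have ty: "Src ?m = Trg ?e2" by simp
  let ?q2 = "fam_ar (idx B) (\<lambda>x. x) (\<lambda>x. coend_in ?m ?e2 (mu_ob T (eta_ob T (ob B x))) (ob B x) (eta_ob T (ob B x))
    (Ide ?LC (mu_ob T (eta_ob T (ob B x)))) (Ide ?LLC (eta_ob T (ob B x))))"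
  have q2: "sends (L_compositor T ?m ?e2) (Lmu (Leta B)) B ?q ?q2"
    by (rule sends_L_compositor[OF pm1 pe2 ty eI3 eI2]) (simp_all add: Ide_L)
  let ?v = "fam_ar (idx B) (\<lambda>x. x) (\<lambda>x. mu_lunit C (ob B x))"
  have v1: "sends (L_cell T (L_skew_l T C)) (Lmu (Leta B)) B ?q2 ?v"
  proof (rule sends_L_cell)
    fix x assume x: "x \<in> elts (idx B)"
    have bx: "ob B x \<in> Ob ?LC" by (rule L_Ob_ob[OF B x])
    have "eta_ob T (ob B x) \<in> Ob ?LLC" using bx by simp
    note * = ar_Ide[OF k2 this] ar_Ide[OF k1 mu_ob_Ob[OF this]]
    show "sends (L_skew_l T C) (ob (Lmu (Leta B)) (rdx ?q2 x)) (ob B x) (cpt ?q2 x) (mu_lunit C (ob B x))"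
      using sends_L_skew_l[OF C *(2,1) bx] x mu_el_Ide[OF C, of "eta_ob T (ob B x)"] bx
        Cmp_Ide_l[OF k1 *(2)] Cmp_Ide_r[OF k1 ar_mu_lunit[OF C bx]] by simp
  qed (use sends_el[OF L_compositor_cell[OF pm1 pe2 ty] q2] in \<open>simp_all add: cell_Dom[OF L_skew_l_cell[OF C]]\<close>)
  have s67: "sends ((?m \<triangleleft> L_cell T (L_skew_l T C)) \<cdot> (?m \<triangleleft> L_compositor T ?m ?e2)) A B
    (coend_in ?m (comp_prof ?Lm ?Le) A B (Lmu (Leta B)) ?c ?q) (coend_in ?m (L_prof T (hom_prof ?LC)) A B (Lmu (Leta B)) ?c ?v)"
    by (rule sends_vcomp[OF sends_lwhisker[OF L_compositor_cell[OF pm1 pe2 ty] pm1 _ ec q2]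
      sends_lwhisker[OF L_cell_cell[OF L_skew_l_cell[OF C]] pm1 _ ec v1]]) simp_all
  have v: "ar ?LLC (Lmu (Leta B)) B ?v"
    using sends_el[OF L_cell_cell[OF L_skew_l_cell[OF C]] v1] by simp
  note IB = ar_Ide[OF k2 B]
  have "coend_in ?m (L_prof T (hom_prof ?LC)) A B (Lmu (Leta B)) ?c ?v
    = coend_in ?m (L_prof T (hom_prof ?LC)) A B B (Cmp ?LC A (mu_ob T (Lmu (Leta B))) (mu_ob T B) (mu_el B ?v) ?c) (Ide ?LLC B)"
    using coend_glide[of "L_prof T (hom_prof ?LC)" "Lmu (Leta B)" B ?v ?m A ?c B "Ide ?LLC B"] v IB ec
      ract_diamond[OF m1, of "Lmu (Leta B)" B ?v A ?c] lact_L_hom[OF k1 IB v] Cmp_Ide_l[OF k2 v] by simp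
  \<comment> \<open>The index \<open>pr x z\<close> is sent to \<open>pr x (pr star z)\<close>,
    rebracketed to \<open>pr (pr x star) z\<close>, and then loses \<open>star\<close> again before
    \<open>g\<close> is applied.\<close>
  also have "Cmp ?LC A (mu_ob T (Lmu (Leta B))) (mu_ob T B) (mu_el B ?v) ?c = g"
    unfolding Cmp_L[of C A "mu_ob T (Lmu (Leta B))"]
  proof (rule fam_eqI[OF _ ar_L_eta[OF g]])
    fix s assume "s \<in> elts (idx (mu_ob T B))"
    then obtain x z where s: "s = pr x z" and x: "x \<in> elts (idx B)" and z: "z \<in> elts (idx (ob B x))" by auto
    note gc = ar_L_cpt[OF g, of "pr x z"]
    show "rdx (fam_ar (idx (mu_ob T B)) (\<lambda>y. rdx ?c (rdx (mu_el B ?v) y))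
       (\<lambda>y. Cmp C (ob A (rdx ?c (rdx (mu_el B ?v) y))) (ob (mu_ob T (Lmu (Leta B))) (rdx (mu_el B ?v) y)) (ob (mu_ob T B) y)
         (cpt (mu_el B ?v) y) (cpt ?c (rdx (mu_el B ?v) y)))) s = rdx g s"
      using x z by (simp add: s Cmp_L Ide_L)
    show "cpt (fam_ar (idx (mu_ob T B)) (\<lambda>y. rdx ?c (rdx (mu_el B ?v) y))
       (\<lambda>y. Cmp C (ob A (rdx ?c (rdx (mu_el B ?v) y))) (ob (mu_ob T (Lmu (Leta B))) (rdx (mu_el B ?v) y)) (ob (mu_ob T B) y)
         (cpt (mu_el B ?v) y) (cpt ?c (rdx (mu_el B ?v) y)))) s = cpt g s"
      using x z gc by (simp add: s Cmp_L Ide_L Cmp_Ide_l[OF C])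
  qed simp
  finally have eq: "coend_in ?m (L_prof T (hom_prof ?LC)) A B (Lmu (Leta B)) ?c ?v = coend_in ?m (L_prof T (hom_prof ?LC)) A B B g (Ide ?LLC B)" .
  have r2: "sends (?m \<triangleleft> L_unitor T ?LC) A B (coend_in ?m (hom_prof ?LLC) A B B g (Ide ?LLC B))
    (coend_in ?m (L_prof T (hom_prof ?LC)) A B B g (Ide ?LLC B))"
    by (rule sends_lwhisker[OF L_unitor_cell[OF k1] pm1 _ gm sends_L_unitor[OF IB]]) simp
  show "\<exists>q. sends ?l A B g q \<and> sends ?r A B g q"
    using sends_vcomp[OF s1 r2] sends_vcomp[OF s1 sends_vcomp[OF s2 sends_vcomp[OF s3 sends_vcomp[OF s4 sends_vcomp[OF s5 s67[unfolded eq]]]]]]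
    by blast
qed (simp_all add: cell_Dom[OF L_skew_l_cell[OF C]] cell_Cod[OF L_skew_l_cell[OF C]])

text \<open>The target is representable, so its elements are arrows rather than classes. Both paths
  are evaluated to an arrow, and the two arrows are compared at each pair index.\<close>

lemma skew_axiom_iii:
  "((((\<ll> (diamond (L_mu T C)) \<cdot> (L_skew_l T C \<triangleright> diamond (L_mu T C)))
    \<cdot> \<aa>' (diamond (L_mu T C)) (diamond (L_eta T (L_cat T C))) (diamond (L_mu T C)))
    \<cdot> (diamond (L_mu T C) \<triangleleft> eta1 (diamond (L_mu T C))))
    \<cdot> \<aa> (diamond (L_mu T C)) (L_prof T (diamond (L_mu T C))) (diamond (L_eta T (L_cat T (L_cat T C)))))
    \<cdot> (L_skew_m T C \<triangleright> diamond (L_eta T (L_cat T (L_cat T C))))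
   = (\<rr> (diamond (L_mu T C)) \<cdot> (diamond (L_mu T C) \<triangleleft> L_skew_l T (L_cat T C)))
    \<cdot> \<aa> (diamond (L_mu T C)) (diamond (L_mu T (L_cat T C))) (diamond (L_eta T (L_cat T (L_cat T C))))" (is "?l = ?r")
proof (rule cell_eqI)
  let ?m = "diamond (L_mu T C)" and ?m2 = "diamond (L_mu T (L_cat T C))" and ?e2 = "diamond (L_eta T (L_cat T C))"
    and ?e3 = "diamond (L_eta T (L_cat T (L_cat T C)))"
  let ?Lm = "L_prof T ?m" and ?LC = "L_cat T C" let ?LLC = "L_cat T ?LC"
  have mm: "Src ?m = Trg ?m2" "Src ?m = FTrg (L_mu T ?LC)" "Src (comp_prof ?m ?m2) = FTrg (L_eta T ?LLC)" by simp_all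
  fix A B p assume "el (Dom ?r) A B p"
  then have p': "el (comp_prof (comp_prof ?m ?m2) ?e3) A B p"
    using el_comp_iff[OF pm1 PR_comp[OF pm2 pe3]] el_comp_iff[OF PR_comp[OF pm1 pm2] pe3]
    by (simp add: cell_Dom[OF L_skew_l_cell[OF k1]])
  obtain q where p: "p = coyoneda (comp_prof ?m ?m2) (L_eta T ?LLC) A B q" and q': "el (comp_prof ?m ?m2) A (eta_ob T B) q"
    and B: "B \<in> Ob ?LLC"
    using el_comp_diamondE[OF e3 PR_comp[OF pm1 pm2 mm(1)] mm(3) p'] by auto
  obtain g where q: "q = coyoneda ?m (L_mu T ?LC) A (eta_ob T B) g" and gm: "el ?m A (mu_ob T (eta_ob T B)) g"
    using el_comp_diamondE[OF m2 pm1 mm(2) q'] by auto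
  have eB: "eta_ob T B \<in> Ob (L_cat T ?LLC)" using B by simp
  note mB = mu_ob_Ob[OF eB] and LB = Lmu_Ob[OF eB]
  have g: "ar ?LC A (mu_ob T (mu_ob T (eta_ob T B))) g" using gm by (simp add: el_diamond[OF m1])
  let ?I = "Ide (L_cat T ?LLC) (eta_ob T B)" and ?J = "Ide ?LLC (mu_ob T (eta_ob T B))" and ?K = "Ide ?LLC (Lmu (eta_ob T B))"
  have eI: "el ?e3 (eta_ob T B) B ?I" using el_diamond_Ide[OF e3, of B] B by simp
  have eJ: "el ?m2 (mu_ob T (eta_ob T B)) (eta_ob T B) ?J" using el_diamond_Ide[OF m2, of "eta_ob T B"] eB by simp
  have q2: "q = coend_in ?m ?m2 A (eta_ob T B) (mu_ob T (eta_ob T B)) g ?J"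
    and p2: "p = coend_in (comp_prof ?m ?m2) ?e3 A B (eta_ob T B) q ?I"
    unfolding q p coyoneda_def by simp_all
  let ?c = "Cmp ?LC A (mu_ob T (mu_ob T (eta_ob T B))) (mu_ob T (Lmu (eta_ob T B))) (mu_assoc C (eta_ob T B)) g"
  have "sends (L_skew_m T C) A (eta_ob T B) q (coend_in ?m ?Lm A (eta_ob T B) (Lmu (eta_ob T B)) ?c ?K)"
    using sends_L_skew_m[OF C g ar_Ide[OF k2 mB] eB] by (simp add: q2 mu_el_Ide[OF C mB] Cmp_Ide_l[OF k1 g])
  then have s1: "sends (L_skew_m T C \<triangleright> ?e3) A B p
    (coend_in (comp_prof ?m ?Lm) ?e3 A B (eta_ob T B) (coend_in ?m ?Lm A (eta_ob T B) (Lmu (eta_ob T B)) ?c ?K) ?I)"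
    unfolding p2 by (intro sends_rwhisker[OF L_skew_m_cell[OF C] pe3 _ eI]) simp_all
  have c: "ar ?LC A (mu_ob T (Lmu (eta_ob T B))) ?c" by (rule ar_Cmp[OF k1 g ar_mu_assoc[OF C eB]])
  have ec: "el ?m A (Lmu (eta_ob T B)) ?c" using c LB by (simp add: el_diamond[OF m1])
  have eK: "el ?Lm (Lmu (eta_ob T B)) (eta_ob T B) ?K" using ar_Ide[OF k2 LB] eB by (simp add: el_L_diamond[OF m1])
  have s2: "sends (\<aa> ?m ?Lm ?e3) A B
    (coend_in (comp_prof ?m ?Lm) ?e3 A B (eta_ob T B) (coend_in ?m ?Lm A (eta_ob T B) (Lmu (eta_ob T B)) ?c ?K) ?I)
    (coend_in ?m (comp_prof ?Lm ?e3) A B (Lmu (eta_ob T B)) ?c (coend_in ?Lm ?e3 (Lmu (eta_ob T B)) B (eta_ob T B) ?K ?I))"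
    by (rule sends_assoc[OF pm1 Lm1 pe3 _ _ ec eK eI]) simp_all
  \<comment> \<open>\<open>?K\<close> is an identity with the single index \<open>star\<close>;
    splitting it over the unit gives the object \<open>mu_ob T B\<close> and an identity in the
    second factor.\<close>
  let ?d = "mu_ob T B" let ?h = "reindex ?LC (eta_ob T ?d) (\<lambda>_. star)" and ?i = "Ide ?LC ?d"
  have Ks: "rdx ?K star = star" "cpt ?K star = ?i" by (simp_all add: Ide_L[of ?LC])
  note h = eta_sec_props[OF pm1 eK, unfolded Ks]
  have sec: "eta_sec ?m (Lmu (eta_ob T B)) B ?K = coend_in ?e2 ?m (Lmu (eta_ob T B)) B ?d ?h ?i"
    unfolding eta_sec_def Ks by simp
  have s3: "sends (?m \<triangleleft> eta1 ?m) A B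
    (coend_in ?m (comp_prof ?Lm ?e3) A B (Lmu (eta_ob T B)) ?c (coend_in ?Lm ?e3 (Lmu (eta_ob T B)) B (eta_ob T B) ?K ?I))
    (coend_in ?m (comp_prof ?e2 ?m) A B (Lmu (eta_ob T B)) ?c (coend_in ?e2 ?m (Lmu (eta_ob T B)) B ?d ?h ?i))"
    using sends_lwhisker[OF eta1_cell[OF pm1] pm1 _ ec sends_eta1_coyoneda[OF pm1 eK]] B
    unfolding sec coyoneda_def by simp
  have h1: "ar ?LLC (Lmu (eta_ob T B)) (eta_ob T ?d) ?h" using h(1) by simp
  have dO: "?d \<in> Ob ?LC" by (rule mu_ob_Ob[OF B])
  have eh: "el ?e2 (Lmu (eta_ob T B)) ?d ?h" using h1 dO by (simp add: el_diamond[OF e2])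
  have ei: "el ?m ?d B ?i" using h(2) by simp
  have s4: "sends (\<aa>' ?m ?e2 ?m) A B
    (coend_in ?m (comp_prof ?e2 ?m) A B (Lmu (eta_ob T B)) ?c (coend_in ?e2 ?m (Lmu (eta_ob T B)) B ?d ?h ?i))
    (coend_in (comp_prof ?m ?e2) ?m A B ?d (coend_in ?m ?e2 A ?d (Lmu (eta_ob T B)) ?c ?h) ?i)"
    by (rule sends_assoc_inv[OF pm1 pe2 pm1 _ _ ec eh ei]) simp_all
  let ?w = "Cmp ?LC A (mu_ob T (eta_ob T ?d)) ?d (mu_lunit C ?d)
        (Cmp ?LC A (mu_ob T (Lmu (eta_ob T B))) (mu_ob T (eta_ob T ?d)) (mu_el (eta_ob T ?d) ?h) ?c)"
  have s5: "sends (L_skew_l T C \<triangleright> ?m) A B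
    (coend_in (comp_prof ?m ?e2) ?m A B ?d (coend_in ?m ?e2 A ?d (Lmu (eta_ob T B)) ?c ?h) ?i)
    (coend_in (hom_prof ?LC) ?m A B ?d ?w ?i)"
    by (rule sends_rwhisker[OF L_skew_l_cell[OF C] pm1 _ ei sends_L_skew_l[OF C c h1 dO]]) simp
  have w: "ar ?LC A ?d ?w" by (rule ar_Cmp[OF k1 ar_Cmp[OF k1 c ar_mu_el[OF h1]] ar_mu_lunit[OF C dO]])
  have s6: "sends (\<ll> ?m) A B (coend_in (hom_prof ?LC) ?m A B ?d ?w ?i) ?w"
    using sends_lunit[OF pm1, of A ?d ?w B ?i] w ei lact_diamond[OF m1, of A ?d ?w B ?i] Cmp_Ide_l[OF k1 w] by simp
  have r1: "sends (\<aa> ?m ?m2 ?e3) A B p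
    (coend_in ?m (comp_prof ?m2 ?e3) A B (mu_ob T (eta_ob T B)) g (coend_in ?m2 ?e3 (mu_ob T (eta_ob T B)) B (eta_ob T B) ?J ?I))"
    unfolding p2 q2 by (rule sends_assoc[OF pm1 pm2 pe3 _ _ gm eJ eI]) simp_all
  note mlB = ar_mu_lunit[OF k1 B]
  have "sends (L_skew_l T ?LC) (mu_ob T (eta_ob T B)) B (coend_in ?m2 ?e3 (mu_ob T (eta_ob T B)) B (eta_ob T B) ?J ?I) (mu_lunit ?LC B)"
    using sends_L_skew_l[OF k1 ar_Ide[OF k2 mB] ar_Ide[OF k3 eB] B]
    by (simp add: mu_el_Ide[OF k1 eB] Cmp_Ide_r[OF k2 mlB] Cmp_Ide_l[OF k2 ar_Ide[OF k2 mB]])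
  then have r2: "sends (?m \<triangleleft> L_skew_l T ?LC) A B
    (coend_in ?m (comp_prof ?m2 ?e3) A B (mu_ob T (eta_ob T B)) g (coend_in ?m2 ?e3 (mu_ob T (eta_ob T B)) B (eta_ob T B) ?J ?I))
    (coend_in ?m (hom_prof ?LLC) A B (mu_ob T (eta_ob T B)) g (mu_lunit ?LC B))"
    by (intro sends_lwhisker[OF L_skew_l_cell[OF k1] pm1 _ gm]) simp_all
  \<comment> \<open>Along \<open>?w\<close> the index \<open>pr x z\<close> becomes
    \<open>pr star (pr x z)\<close> and is rebracketed to \<open>pr (pr star x) z\<close>; the
    right-hand side reaches this index in one move.\<close>
  have "?w = Cmp ?LC A (mu_ob T (mu_ob T (eta_ob T B))) (mu_ob T B) (mu_el B (mu_lunit ?LC B)) g"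
  proof (rule fam_eqI[OF ar_L_eta[OF w]])
    fix s assume "s \<in> elts (idx ?d)"
    then obtain x z where s: "s = pr x z" and x: "x \<in> elts (idx B)" and z: "z \<in> elts (idx (ob B x))" by auto
    show "rdx ?w s = rdx (Cmp ?LC A (mu_ob T (mu_ob T (eta_ob T B))) (mu_ob T B) (mu_el B (mu_lunit ?LC B)) g) s"
      using x z by (simp add: s Cmp_L Ide_L)
    show "cpt ?w s = cpt (Cmp ?LC A (mu_ob T (mu_ob T (eta_ob T B))) (mu_ob T B) (mu_el B (mu_lunit ?LC B)) g) s"
      using x z ar_L_cpt[OF g, of "pr (pr star x) z"] by (simp add: s Cmp_L Ide_L Cmp_Ide_l[OF C])
  qed (simp add: Cmp_L)
  then have r3: "sends (\<rr> ?m) A B (coend_in ?m (hom_prof ?LLC) A B (mu_ob T (eta_ob T B)) g (mu_lunit ?LC B)) ?w"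
    using sends_runit[OF pm1 gm, of B "mu_lunit ?LC B"] mlB ract_diamond[OF m1 _ gm, of B "mu_lunit ?LC B"] by simp
  show "\<exists>q. sends ?l A B p q \<and> sends ?r A B p q"
    using sends_vcomp[OF s1 sends_vcomp[OF s2 sends_vcomp[OF s3 sends_vcomp[OF s4 sends_vcomp[OF s5 s6]]]]]
      sends_vcomp[OF r1 sends_vcomp[OF r2 r3]] by blast
qed (simp_all add: cell_Dom[OF L_skew_m_cell[OF C]])

text \<open>One path passes through \<open>mu1\<close> of the unit and ends with components
  \<open>?\<tau>\<close> in the second factor, the other keeps \<open>g\<close> in the first factor.
  The two classes are compared over a third object to which both middle objects map.\<close>

lemma skew_axiom_iv:
  "(((((((diamond (L_mu T C) \<triangleleft> L_compositor T (diamond (L_mu T C)) (L_prof T (diamond (L_eta T C))))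
    \<cdot> \<aa> (diamond (L_mu T C)) (L_prof T (diamond (L_mu T C))) (L_prof T (L_prof T (diamond (L_eta T C)))))
    \<cdot> (L_skew_m T C \<triangleright> L_prof T (L_prof T (diamond (L_eta T C)))))
    \<cdot> \<aa>' (diamond (L_mu T C)) (diamond (L_mu T (L_cat T C))) (L_prof T (L_prof T (diamond (L_eta T C)))))
    \<cdot> (diamond (L_mu T C) \<triangleleft> mu1 (diamond (L_eta T C))))
    \<cdot> \<aa> (diamond (L_mu T C)) (L_prof T (diamond (L_eta T C))) (diamond (L_mu T C)))
    \<cdot> (L_skew_r T C \<triangleright> diamond (L_mu T C))) \<cdot> \<ll>' (diamond (L_mu T C))
   = ((diamond (L_mu T C) \<triangleleft> L_cell T (L_skew_r T C)) \<cdot> (diamond (L_mu T C) \<triangleleft> L_unitor T (L_cat T C)))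
    \<cdot> \<rr>' (diamond (L_mu T C))" (is "?l = ?r")
proof (rule cell_eqI)
  let ?m = "diamond (L_mu T C)" and ?m2 = "diamond (L_mu T (L_cat T C))" and ?e = "diamond (L_eta T C)"
  let ?Lm = "L_prof T ?m" and ?Le = "L_prof T ?e" and ?LC = "L_cat T C" let ?LLC = "L_cat T ?LC" and ?LLe = "L_prof T ?Le"
  note LLe = PR_L_prof[OF Le1]
  have ty: "Src ?m = Trg ?Le" by simp
  fix A B g assume "el (Dom ?r) A B g"
  then have gm: "el ?m A B g" by simp
  then have g: "ar ?LC A (mu_ob T B) g" and B: "B \<in> Ob ?LLC" by (simp_all add: el_diamond[OF m1])
  have Bx: "ob B x \<in> Ob ?LC" if "x \<in> elts (idx B)" for x by (rule L_Ob_ob[OF B that])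
  note A = ar_Ob(1)[OF g] note EA = Leta_Ob[OF A] and rA = ar_mu_runit[OF C A]
  let ?I = "Ide ?LLC (Leta A)" and ?a = "mu_runit C A"
  have gx: "rdx g (pr x z) \<in> elts (idx A)" "ar C (ob A (rdx g (pr x z))) (ob (ob B x) z) (cpt g (pr x z))"
    if "x \<in> elts (idx B)" "z \<in> elts (idx (ob B x))" for x z
    using that ar_L_rdx[OF g, of "pr x z"] ar_L_cpt[OF g, of "pr x z"] by simp_all
  have s1: "sends (\<ll>' ?m) A B g (coend_in (hom_prof ?LC) ?m A B A (Ide ?LC A) g)"
    using sends_lunit_inv[OF pm1 gm] by simp
  have "sends (L_skew_r T C) A A (Ide ?LC A) (coend_in ?m ?Le A A (Leta A) ?a ?I)"
    using sends_L_skew_r[OF C ar_Ide[OF k1 A]] by (simp add: Cmp_Ide_r[OF k1 rA])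
  then have s2: "sends (L_skew_r T C \<triangleright> ?m) A B (coend_in (hom_prof ?LC) ?m A B A (Ide ?LC A) g)
    (coend_in (comp_prof ?m ?Le) ?m A B A (coend_in ?m ?Le A A (Leta A) ?a ?I) g)"
    by (intro sends_rwhisker[OF L_skew_r_cell[OF C] pm1 _ gm]) simp_all
  have ea: "el ?m A (Leta A) ?a" using rA EA by (simp add: el_diamond[OF m1])
  have eI: "el ?Le (Leta A) A ?I" using ar_Ide[OF k2 EA] A by (simp add: el_L_diamond[OF e1])
  have s3: "sends (\<aa> ?m ?Le ?m) A B (coend_in (comp_prof ?m ?Le) ?m A B A (coend_in ?m ?Le A A (Leta A) ?a ?I) g)
    (coend_in ?m (comp_prof ?Le ?m) A B (Leta A) ?a (coend_in ?Le ?m (Leta A) B A ?I g))"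
    by (rule sends_assoc[OF pm1 Le1 pm1 _ _ ea eI gm]) simp_all
  \<comment> \<open>Acting with \<open>g\<close> on the identity of \<open>Leta A\<close> places
    every component of \<open>g\<close> under the unit; the fact \<open>ts\<close> records the
    outcome.\<close>
  let ?t = "ract ?Le (Leta A) A (mu_ob T B) g ?I"
  have gS: "ar (L_cat T (Src ?e)) A (mu_ob T B) g" using g by simp
  have t: "el ?Le (Leta A) (mu_ob T B) ?t" by (rule el_ract[OF PR_profunctor[OF Le1] _ eI]) (use g in simp)
  have ts: "rdx ?t (pr x z) = rdx g (pr x z)" "cpt ?t (pr x z) = eta_el (cpt g (pr x z))"
    if xz: "x \<in> elts (idx B)" "z \<in> elts (idx (ob B x))" for x z
  proof -
    let ?y = "ob A (rdx g (pr x z))"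
    have "ar ?LC (eta_ob T ?y) (eta_ob T (ob (ob B x) z)) (eta_el (cpt g (pr x z)))"
      using ar_FAr[OF e1, of ?y "ob (ob B x) z" "cpt g (pr x z)"] gx[OF xz] by simp
    note * = Cmp_Ide_r[OF k1 this]
    show "rdx ?t (pr x z) = rdx g (pr x z)" "cpt ?t (pr x z) = eta_el (cpt g (pr x z))"
      unfolding ract_L[OF eI gS]
      using xz gx[OF xz] * el_diamond_Ide[OF e1, of ?y] ar_Ob[OF gx(2)[OF xz]]
        ract_diamond[OF e1, of ?y "ob (ob B x) z" "cpt g (pr x z)" "eta_ob T ?y" "Ide ?LC (eta_ob T ?y)"]
      by (simp_all add: Ide_L[of "L_cat T C"])
  qed
  let ?H = "mu_split (Leta A) B (rdx ?t)" let ?h = "reindex ?LC (mu_ob T ?H) (rdx ?t)" and ?ft = "mu_flat B (cpt ?t)"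
  have BS: "B \<in> Ob (L_cat T (L_cat T (Src ?e)))" using B by simp
  have H: "?H \<in> Ob (L_cat T ?LLC)" using mu_split_Ob[OF EA BS el_L_lmap[OF t]] .
  have h: "ar ?LLC (Leta A) (mu_ob T ?H) ?h" by (rule ar_mu_split[OF k1 EA BS el_L_lmap[OF t]])
  have eh: "el ?m2 (Leta A) ?H ?h" using h H by (simp add: el_diamond[OF m2])
  note t0 = el_mu_flat_split[OF t BS]
  have s4: "sends (?m \<triangleleft> mu1 ?e) A B (coend_in ?m (comp_prof ?Le ?m) A B (Leta A) ?a (coend_in ?Le ?m (Leta A) B A ?I g))
    (coend_in ?m (comp_prof ?m2 ?LLe) A B (Leta A) ?a (coend_in ?m2 ?LLe (Leta A) B ?H ?h ?ft))"
    using sends_lwhisker[OF mu1_cell[OF pe1] pm1 _ ea sends_mu1[OF pe1 eI gS BS]] unfolding mu_sec_def by simp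
  have s5: "sends (\<aa>' ?m ?m2 ?LLe) A B
    (coend_in ?m (comp_prof ?m2 ?LLe) A B (Leta A) ?a (coend_in ?m2 ?LLe (Leta A) B ?H ?h ?ft))
    (coend_in (comp_prof ?m ?m2) ?LLe A B ?H (coend_in ?m ?m2 A ?H (Leta A) ?a ?h) ?ft)"
    by (rule sends_assoc_inv[OF pm1 pm2 LLe _ _ ea eh t0]) simp_all
  let ?c = "Cmp ?LC A (mu_ob T (mu_ob T ?H)) (mu_ob T (Lmu ?H)) (mu_assoc C ?H)
      (Cmp ?LC A (mu_ob T (Leta A)) (mu_ob T (mu_ob T ?H)) (mu_el (mu_ob T ?H) ?h) ?a)" and ?K = "Ide ?LLC (Lmu ?H)"
  have s6: "sends (L_skew_m T C \<triangleright> ?LLe) A B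
    (coend_in (comp_prof ?m ?m2) ?LLe A B ?H (coend_in ?m ?m2 A ?H (Leta A) ?a ?h) ?ft)
    (coend_in (comp_prof ?m ?Lm) ?LLe A B ?H (coend_in ?m ?Lm A ?H (Lmu ?H) ?c ?K) ?ft)"
    by (rule sends_rwhisker[OF L_skew_m_cell[OF C] LLe _ t0 sends_L_skew_m[OF C rA h H]]) simp
  note LH = Lmu_Ob[OF H]
  have c: "ar ?LC A (mu_ob T (Lmu ?H)) ?c" by (rule ar_Cmp[OF k1 ar_Cmp[OF k1 rA ar_mu_el[OF h]] ar_mu_assoc[OF C H]])
  have ec: "el ?m A (Lmu ?H) ?c" using c LH by (simp add: el_diamond[OF m1])
  have eK: "el ?Lm (Lmu ?H) ?H ?K" using ar_Ide[OF k2 LH] H by (simp add: el_L_diamond[OF m1])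
  let ?q = "coend_in ?Lm ?LLe (Lmu ?H) B ?H ?K ?ft"
  have s7: "sends (\<aa> ?m ?Lm ?LLe) A B
    (coend_in (comp_prof ?m ?Lm) ?LLe A B ?H (coend_in ?m ?Lm A ?H (Lmu ?H) ?c ?K) ?ft)
    (coend_in ?m (comp_prof ?Lm ?LLe) A B (Lmu ?H) ?c ?q)"
    by (rule sends_assoc[OF pm1 Lm1 LLe _ _ ec eK t0]) simp_all
  let ?\<tau> = "cpt ?ft"
  let ?w = "fam_ar (idx B) (\<lambda>x. x) (\<lambda>x. coend_in ?m ?Le (mu_ob T (ob ?H x)) (ob B x) (ob ?H x) (Ide ?LC (mu_ob T (ob ?H x))) (?\<tau> x))"
  have w: "sends (L_compositor T ?m ?Le) (Lmu ?H) B ?q ?w"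
    by (rule sends_L_compositor[OF pm1 Le1 ty eK t0]) (simp_all add: Ide_L[of "L_cat T C"])
  have s8: "sends (?m \<triangleleft> L_compositor T ?m ?Le) A B (coend_in ?m (comp_prof ?Lm ?LLe) A B (Lmu ?H) ?c ?q)
    (coend_in ?m (L_prof T (comp_prof ?m ?Le)) A B (Lmu ?H) ?c ?w)"
    by (rule sends_lwhisker[OF L_compositor_cell[OF pm1 Le1 ty] pm1 _ ec w]) simp
  have r1: "sends (\<rr>' ?m) A B g (coend_in ?m (hom_prof ?LLC) A B B g (Ide ?LLC B))"
    using sends_runit_inv[OF pm1 gm] by simp
  note IB = ar_Ide[OF k2 B]
  let ?w' = "fam_ar (idx B) (\<lambda>x. x) (\<lambda>x. coend_in ?m ?Le (ob B x) (ob B x) (Leta (ob B x)) (mu_runit C (ob B x)) (Ide ?LLC (Leta (ob B x))))"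
  have w': "sends (L_cell T (L_skew_r T C)) B B (Ide ?LLC B) ?w'"
  proof (rule sends_L_cell)
    fix x assume x: "x \<in> elts (idx B)"
    show "sends (L_skew_r T C) (ob B (rdx (Ide ?LLC B) x)) (ob B x) (cpt (Ide ?LLC B) x)
      (coend_in ?m ?Le (ob B x) (ob B x) (Leta (ob B x)) (mu_runit C (ob B x)) (Ide ?LLC (Leta (ob B x))))"
      using sends_L_skew_r[OF C ar_Ide[OF k1 Bx[OF x]]] x by (simp add: Cmp_Ide_r[OF k1 ar_mu_runit[OF C Bx[OF x]]] Ide_L[of "L_cat T C" B])
  qed (use IB in \<open>simp_all add: cell_Dom[OF L_skew_r_cell[OF C]] Ide_L[of "L_cat T C"]\<close>)
  have r2: "sends ((?m \<triangleleft> L_cell T (L_skew_r T C)) \<cdot> (?m \<triangleleft> L_unitor T ?LC)) A B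
    (coend_in ?m (hom_prof ?LLC) A B B g (Ide ?LLC B)) (coend_in ?m (L_prof T (comp_prof ?m ?Le)) A B B g ?w')"
    by (rule sends_vcomp[OF sends_lwhisker[OF L_unitor_cell[OF k1] pm1 _ gm sends_L_unitor[OF IB]]
      sends_lwhisker[OF L_cell_cell[OF L_skew_r_cell[OF C]] pm1 _ gm w']]) simp_all
  txt \<open>Both sides are pulled back from the same element \<open>z\<close> over \<open>P\<close>.\<close>
  let ?P = "fam_ob (idx B) (\<lambda>x. mu_ob T (Leta (ob B x))) (lab B)"
  let ?z = "fam_ar (idx B) (\<lambda>x. x) (\<lambda>x. coend_in ?m ?Le (mu_ob T (Leta (ob B x))) (ob B x) (Leta (ob B x))
    (Ide ?LC (mu_ob T (Leta (ob B x)))) (Ide ?LLC (Leta (ob B x))))"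
  \<comment> \<open>\<open>?v1\<close> is the image of each \<open>?\<tau> x\<close> under the
    multiplication, \<open>?v2\<close> is the right unit reindexing at each \<open>ob B x\<close>;
    both are arrows into \<open>?P\<close>.\<close>
  let ?v1 = "fam_ar (idx B) (\<lambda>x. x) (\<lambda>x. mu_el (Leta (ob B x)) (?\<tau> x))" and ?v2 = "fam_ar (idx B) (\<lambda>x. x) (\<lambda>x. mu_runit C (ob B x))"
  have mEx: "mu_ob T (Leta (ob B x)) \<in> Ob ?LC" if "x \<in> elts (idx B)" for x
    by (rule mu_ob_Ob[OF Leta_Ob[OF Bx[OF that]]])
  have P: "?P \<in> Ob ?LLC" using mEx by (simp add: L_Ob_lab[OF B])
  have \<tau>: "ar ?LLC (ob ?H x) (Leta (ob B x)) (?\<tau> x)" "el ?Le (ob ?H x) (ob B x) (?\<tau> x)" if x: "x \<in> elts (idx B)" for x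
    using el_L_cpt[OF t0 x] x by (simp_all add: el_L_diamond[OF e1])
  have ex: "el ?m (mu_ob T (Leta (ob B x))) (Leta (ob B x)) (Ide ?LC (mu_ob T (Leta (ob B x))))"
    "el ?Le (Leta (ob B x)) (ob B x) (Ide ?LLC (Leta (ob B x)))" if x: "x \<in> elts (idx B)" for x
    using el_diamond_Ide[OF m1, of "Leta (ob B x)"] Leta_Ob[OF Bx[OF x]] Bx[OF x] ar_Ide[OF k2 Leta_Ob[OF Bx[OF x]]]
    by (simp_all add: el_L_diamond[OF e1])
  have z: "el (L_prof T (comp_prof ?m ?Le)) ?P B ?z"
    using P B by (intro el_L_fam lmap_idI[OF B]) (auto intro!: el_comp[OF pm1 Le1 ty] ex)
  have v1: "ar ?LLC (Lmu ?H) ?P ?v1"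
    using ar_mu_el[OF \<tau>(1)] by (intro ar_L_fam[OF LH P _ lmap_idI[OF P]]) auto
  have v2: "ar ?LLC B ?P ?v2"
    using ar_mu_runit[OF C Bx] by (intro ar_L_fam[OF B P _ lmap_idI[OF P]]) auto
  have "lact (L_prof T (comp_prof ?m ?Le)) (Lmu ?H) ?P B ?v1 ?z = ?w"
    unfolding lact_L
  proof (rule fam_ar_cong)
    fix x assume x: "x \<in> elts (idx B)"
    let ?E = "Leta (ob B x)"
    have Hx: "ob ?H x \<in> Ob ?LLC" using L_Ob_ob[OF H, of x] x by simp
    have iH: "el ?m (mu_ob T (ob ?H x)) (ob ?H x) (Ide ?LC (mu_ob T (ob ?H x)))" using el_diamond_Ide[OF m1, of "ob ?H x"] Hx by simp
    note \<tau>x = \<tau>(1)[OF x] note m\<tau> = ar_mu_el[OF \<tau>x]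
    have "lact ?Le (ob ?H x) ?E (ob B x) (?\<tau> x) (Ide ?LLC ?E) = ?\<tau> x"
    proof -
      have "lact ?Le (ob ?H x) ?E (ob B x) (?\<tau> x) (Ide ?LLC ?E) = Cmp ?LLC (ob ?H x) ?E ?E (Ide ?LLC ?E) (?\<tau> x)"
        unfolding lact_L Cmp_L[of ?LC]
      proof (rule fam_ar_cong)
        fix y assume y: "y \<in> elts (idx ?E)"
        then have y: "y \<in> elts (idx (ob B x))" by simp
        have "ob (ob B x) y \<in> Ob C" by (rule L_Ob_ob[OF Bx[OF x] y])
        then show "lact ?e (ob (ob ?H x) (rdx (?\<tau> x) (rdx (Ide ?LLC ?E) y))) (ob ?E (rdx (Ide ?LLC ?E) y)) (ob (ob B x) y) (cpt (?\<tau> x) (rdx (Ide ?LLC ?E) y)) (cpt (Ide ?LLC ?E) y)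
          = Cmp ?LC (ob (ob ?H x) (rdx (?\<tau> x) (rdx (Ide ?LLC ?E) y))) (ob ?E (rdx (Ide ?LLC ?E) y)) (ob ?E y) (cpt (Ide ?LLC ?E) y) (cpt (?\<tau> x) (rdx (Ide ?LLC ?E) y))"
          using y ar_L_cpt[OF \<tau>x, of y] lact_diamond[OF e1, of _ "eta_ob T (ob (ob B x) y)" _ "ob (ob B x) y" "Ide ?LC (eta_ob T (ob (ob B x) y))"]
            el_diamond_Ide[OF e1, of "ob (ob B x) y"] by (simp add: Ide_L[of "L_cat T C"])
      qed simp_all
      then show ?thesis by (simp add: Cmp_Ide_l[OF k2 \<tau>x])
    qed
    moreover have "ract ?m (mu_ob T (ob ?H x)) (ob ?H x) ?E (?\<tau> x) (Ide ?LC (mu_ob T (ob ?H x))) = mu_el ?E (?\<tau> x)"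
      using ract_diamond[OF m1 _ iH, of ?E "?\<tau> x"] \<tau>x Cmp_Ide_r[OF k1 m\<tau>] by simp
    \<comment> \<open>A gliding step within the class at the index \<open>x\<close>: the arrow
      \<open>?\<tau> x\<close> leaves the second factor and enters the first as its image under the
      multiplication.\<close>
    ultimately have "coend_in ?m ?Le (mu_ob T (ob ?H x)) (ob B x) (ob ?H x) (Ide ?LC (mu_ob T (ob ?H x))) (?\<tau> x)
      = coend_in ?m ?Le (mu_ob T (ob ?H x)) (ob B x) ?E (mu_el ?E (?\<tau> x)) (Ide ?LLC ?E)"
      using coend_glide[of ?Le "ob ?H x" ?E "?\<tau> x" ?m _ _ "ob B x" "Ide ?LLC ?E", OF _ iH ex(2)[OF x]] \<tau>x by simp
    moreover have "lact (comp_prof ?m ?Le) (mu_ob T (ob ?H x)) (mu_ob T ?E) (ob B x) (mu_el ?E (?\<tau> x))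
      (coend_in ?m ?Le (mu_ob T ?E) (ob B x) ?E (Ide ?LC (mu_ob T ?E)) (Ide ?LLC ?E))
      = coend_in ?m ?Le (mu_ob T (ob ?H x)) (ob B x) ?E (mu_el ?E (?\<tau> x)) (Ide ?LLC ?E)"
      using lact_comp[OF pm1 Le1 ty ex[OF x], of "mu_ob T (ob ?H x)" "mu_el ?E (?\<tau> x)"] m\<tau>
        lact_diamond[OF m1 _ ex(1)[OF x], of "mu_ob T (ob ?H x)" "mu_el ?E (?\<tau> x)"] Cmp_Ide_l[OF k1 m\<tau>] by simp
    ultimately show "lact (comp_prof ?m ?Le) (ob (Lmu ?H) (rdx ?v1 (rdx ?z x))) (ob ?P (rdx ?z x)) (ob B x) (cpt ?v1 (rdx ?z x)) (cpt ?z x)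
      = coend_in ?m ?Le (mu_ob T (ob ?H x)) (ob B x) (ob ?H x) (Ide ?LC (mu_ob T (ob ?H x))) (?\<tau> x)"
      using x by simp
  qed simp_all
  moreover have "lact (L_prof T (comp_prof ?m ?Le)) B ?P B ?v2 ?z = ?w'"
    unfolding lact_L
  proof (rule fam_ar_cong)
    fix x assume x: "x \<in> elts (idx B)"
    let ?E = "Leta (ob B x)"
    note r = ar_mu_runit[OF C Bx[OF x]]
    show "lact (comp_prof ?m ?Le) (ob B (rdx ?v2 (rdx ?z x))) (ob ?P (rdx ?z x)) (ob B x) (cpt ?v2 (rdx ?z x)) (cpt ?z x)
      = coend_in ?m ?Le (ob B x) (ob B x) ?E (mu_runit C (ob B x)) (Ide ?LLC ?E)"
      using x lact_comp[OF pm1 Le1 ty ex[OF x], of "ob B x" "mu_runit C (ob B x)"] r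
        lact_diamond[OF m1 _ ex(1)[OF x], of "ob B x" "mu_runit C (ob B x)"] Cmp_Ide_l[OF k1 r] by simp
  qed simp_all
  moreover have "ract ?m A (Lmu ?H) ?P ?v1 ?c = ract ?m A B ?P ?v2 g"
  proof -
    \<comment> \<open>At the index \<open>pr x (pr z star)\<close> both composites reduce to the
      index and component of \<open>g\<close> at \<open>pr x z\<close>.\<close>
    have "Cmp ?LC A (mu_ob T (Lmu ?H)) (mu_ob T ?P) (mu_el ?P ?v1) ?c = Cmp ?LC A (mu_ob T B) (mu_ob T ?P) (mu_el ?P ?v2) g"
      unfolding Cmp_L[of C A "mu_ob T (Lmu ?H)" "mu_ob T ?P"] Cmp_L[of C A "mu_ob T B" "mu_ob T ?P"]
    proof (rule fam_ar_cong)
      fix s assume "s \<in> elts (idx (mu_ob T ?P))"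
      then obtain x z where s: "s = pr x (pr z star)" and x: "x \<in> elts (idx B)" and z: "z \<in> elts (idx (ob B x))" by auto
      note xz = x z gx[OF x z] ts[OF x z] and D = Cmp_Ide_r[OF C gx(2)[OF x z]] Cmp_Ide_l[OF C gx(2)[OF x z]]
        Cmp_Ide_l[OF C ar_Ide[OF C ar_Ob(1)[OF gx(2)[OF x z]]]]
      show "rdx ?c (rdx (mu_el ?P ?v1) s) = rdx g (rdx (mu_el ?P ?v2) s)"
        using xz by (simp add: s Cmp_L Ide_L)
      show "Cmp C (ob A (rdx ?c (rdx (mu_el ?P ?v1) s))) (ob (mu_ob T (Lmu ?H)) (rdx (mu_el ?P ?v1) s)) (ob (mu_ob T ?P) s)
          (cpt (mu_el ?P ?v1) s) (cpt ?c (rdx (mu_el ?P ?v1) s))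
        = Cmp C (ob A (rdx g (rdx (mu_el ?P ?v2) s))) (ob (mu_ob T B) (rdx (mu_el ?P ?v2) s)) (ob (mu_ob T ?P) s)
          (cpt (mu_el ?P ?v2) s) (cpt g (rdx (mu_el ?P ?v2) s))"
        using xz D by (simp add: s Cmp_L Ide_L)
    qed simp_all
    then show ?thesis
      using ract_diamond[OF m1 _ ec, of ?P ?v1] ract_diamond[OF m1 _ gm, of ?P ?v2] v1 v2 by simp
  qed
  ultimately have eq: "coend_in ?m (L_prof T (comp_prof ?m ?Le)) A B (Lmu ?H) ?c ?w = coend_in ?m (L_prof T (comp_prof ?m ?Le)) A B B g ?w'"
    using coend_glide[of "L_prof T (comp_prof ?m ?Le)" "Lmu ?H" ?P ?v1 ?m A ?c B ?z]
      coend_glide[of "L_prof T (comp_prof ?m ?Le)" B ?P ?v2 ?m A g B ?z] v1 v2 ec gm z by simp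
  show "\<exists>q. sends ?l A B g q \<and> sends ?r A B g q"
    using sends_vcomp[OF r1 r2]
      sends_vcomp[OF s1 sends_vcomp[OF s2 sends_vcomp[OF s3 sends_vcomp[OF s4 sends_vcomp[OF s5 sends_vcomp[OF s6 sends_vcomp[OF s7 s8]]]]]]]
    unfolding eq by blast
qed (simp_all add: cell_Cod[OF L_skew_r_cell[OF C]])

text \<open>An arrow \<open>g\<close> into a unit object is one index \<open>?x\<close> of
  \<open>A\<close> and one component. The chase separates the two, carries the index through the
  unit constraints as a reindexing, and composes them to \<open>g\<close> again.\<close>

lemma skew_axiom_v:
  "((((((\<ll> (diamond (L_eta T C)) \<cdot> (L_skew_l T C \<triangleright> diamond (L_eta T C)))
    \<cdot> \<aa>' (diamond (L_mu T C)) (diamond (L_eta T (L_cat T C))) (diamond (L_eta T C)))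
    \<cdot> (diamond (L_mu T C) \<triangleleft> eta1 (diamond (L_eta T C))))
    \<cdot> \<aa> (diamond (L_mu T C)) (L_prof T (diamond (L_eta T C))) (diamond (L_eta T C)))
    \<cdot> (L_skew_r T C \<triangleright> diamond (L_eta T C))) \<cdot> \<ll>' (diamond (L_eta T C)))
   = bid PROF (diamond (L_eta T C))" (is "?l = ?r")
proof (rule cell_eqI)
  let ?m = "diamond (L_mu T C)" and ?e = "diamond (L_eta T C)" and ?e2 = "diamond (L_eta T (L_cat T C))"
  let ?Le = "L_prof T ?e" and ?LC = "L_cat T C"
  fix A c g assume "el (Dom ?r) A c g"
  then have ge: "el ?e A c g" by simp
  then have g: "ar ?LC A (eta_ob T c) g" and c: "c \<in> Ob C" by (simp_all add: el_diamond[OF e1])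
  note A = ar_Ob(1)[OF g] note LA = Leta_Ob[OF A] note I = ar_Ide[OF k2 LA] note r = ar_mu_runit[OF C A]
  let ?x = "rdx g star" let ?a = "eta_ob T (ob A ?x)"
  have x: "?x \<in> elts (idx A)" using ar_L_rdx[OF g, of star] by simp
  have cg: "ar C (ob A ?x) c (cpt g star)" using ar_L_cpt[OF g, of star] by simp
  have s1: "sends (\<ll>' ?e) A c g (coend_in (hom_prof ?LC) ?e A c A (Ide ?LC A) g)"
    using sends_lunit_inv[OF pe1 ge] by simp
  have r': "sends (L_skew_r T C) A A (Ide ?LC A) (coend_in ?m ?Le A A (Leta A) (mu_runit C A) (Ide (L_cat T ?LC) (Leta A)))"
    using sends_L_skew_r[OF C ar_Ide[OF k1 A]] by (simp add: Cmp_Ide_r[OF k1 r])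
  have s2: "sends (L_skew_r T C \<triangleright> ?e) A c (coend_in (hom_prof ?LC) ?e A c A (Ide ?LC A) g)
      (coend_in (comp_prof ?m ?Le) ?e A c A (coend_in ?m ?Le A A (Leta A) (mu_runit C A) (Ide (L_cat T ?LC) (Leta A))) g)"
    by (rule sends_rwhisker[OF L_skew_r_cell[OF C] pe1 _ ge r']) simp
  have em: "el ?m A (Leta A) (mu_runit C A)" using r LA by (simp add: el_diamond[OF m1])
  have eI: "el ?Le (Leta A) A (Ide (L_cat T ?LC) (Leta A))" using I A by (simp add: el_L_diamond[OF e1])
  have s3: "sends (\<aa> ?m ?Le ?e) A c
      (coend_in (comp_prof ?m ?Le) ?e A c A (coend_in ?m ?Le A A (Leta A) (mu_runit C A) (Ide (L_cat T ?LC) (Leta A))) g)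
      (coend_in ?m (comp_prof ?Le ?e) A c (Leta A) (mu_runit C A) (coend_in ?Le ?e (Leta A) c A (Ide (L_cat T ?LC) (Leta A)) g))"
    by (rule sends_assoc[OF pm1 Le1 pe1 _ _ em eI ge]) simp_all
  let ?t = "ract ?Le (Leta A) A (eta_ob T c) g (Ide (L_cat T ?LC) (Leta A))"
  have t: "el ?Le (Leta A) (eta_ob T c) ?t" by (rule el_ract[OF PR_profunctor[OF Le1] _ eI]) (use g in simp)
  have ecg: "ar ?LC ?a (eta_ob T c) (eta_el (cpt g star))"
    using ar_FAr[OF e1, of "ob A ?x" c "cpt g star"] cg by simp
  have gS: "ar (L_cat T (Src ?e)) A (eta_ob T c) g" using g by simp
  have ts: "rdx ?t star = ?x" "cpt ?t star = eta_el (cpt g star)"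
    using x ract_diamond[OF e1, of "ob A ?x" c "cpt g star" ?a "Ide ?LC ?a"] cg
      Cmp_Ide_r[OF k1 ecg] el_diamond_Ide[OF e1, of "ob A ?x"] ar_Ob[OF cg]
    unfolding ract_L[OF eI gS] by (simp_all add: Ide_L[of "L_cat T C"])
  note h = eta_sec_props[OF pe1 t, unfolded ts] let ?h = "reindex ?LC (eta_ob T ?a) (\<lambda>_. ?x)"
  have sec: "eta_sec ?e (Leta A) c ?t = coend_in ?e2 ?e (Leta A) c ?a ?h (eta_el (cpt g star))"
    unfolding eta_sec_def ts using x by simp
  have s4: "sends (?m \<triangleleft> eta1 ?e) A c
      (coend_in ?m (comp_prof ?Le ?e) A c (Leta A) (mu_runit C A) (coend_in ?Le ?e (Leta A) c A (Ide (L_cat T ?LC) (Leta A)) g))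
      (coend_in ?m (comp_prof ?e2 ?e) A c (Leta A) (mu_runit C A) (coend_in ?e2 ?e (Leta A) c ?a ?h (eta_el (cpt g star))))"
    using sends_lwhisker[OF eta1_cell[OF pe1] pm1 _ em sends_eta1[OF pe1 eI, of c g]] g c sec by simp
  have h1: "ar (L_cat T ?LC) (Leta A) (eta_ob T ?a) ?h" using h(1) x by simp
  have eh: "el ?e2 (Leta A) ?a ?h" using h1 ar_Ob[OF cg] by (simp add: el_diamond[OF e2])
  have ee: "el ?e ?a c (eta_el (cpt g star))" using h(2) x by simp
  have s5: "sends (\<aa>' ?m ?e2 ?e) A c
      (coend_in ?m (comp_prof ?e2 ?e) A c (Leta A) (mu_runit C A) (coend_in ?e2 ?e (Leta A) c ?a ?h (eta_el (cpt g star))))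
      (coend_in (comp_prof ?m ?e2) ?e A c ?a (coend_in ?m ?e2 A ?a (Leta A) (mu_runit C A) ?h) (eta_el (cpt g star)))"
    by (rule sends_assoc_inv[OF pm1 pe2 pe1 _ _ em eh ee]) simp_all
  have aO: "?a \<in> Ob ?LC" using ar_Ob[OF cg] by simp
  let ?w = "Cmp ?LC A (mu_ob T (eta_ob T ?a)) ?a (mu_lunit C ?a)
        (Cmp ?LC A (mu_ob T (Leta A)) (mu_ob T (eta_ob T ?a)) (mu_el (eta_ob T ?a) ?h) (mu_runit C A))"
  have s6: "sends (L_skew_l T C \<triangleright> ?e) A c
      (coend_in (comp_prof ?m ?e2) ?e A c ?a (coend_in ?m ?e2 A ?a (Leta A) (mu_runit C A) ?h) (eta_el (cpt g star)))
      (coend_in (hom_prof ?LC) ?e A c ?a ?w (eta_el (cpt g star)))"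
    by (rule sends_rwhisker[OF L_skew_l_cell[OF C] pe1 _ ee sends_L_skew_l[OF C r h1 aO]]) simp
  have w: "ar ?LC A ?a ?w"
    by (rule ar_Cmp[OF k1 ar_Cmp[OF k1 r ar_mu_el[OF h1]] ar_mu_lunit[OF C aO]])
  \<comment> \<open>\<open>?w\<close> is a reindexing at \<open>?x\<close> whose component is a
    composite of identities; \<open>eta_el\<close> restores the component of
    \<open>g\<close>.\<close>
  have "Cmp ?LC A ?a (eta_ob T c) (eta_el (cpt g star)) ?w = g"
    unfolding Cmp_L[of C A ?a "eta_ob T c"]
    by (rule fam_eqI[OF _ ar_L_eta[OF g]])
      (use x in \<open>auto simp: Cmp_L Ide_L Cmp_Ide_r[OF C cg] Cmp_Ide_l[OF C ar_Ide[OF C ar_Ob(1)[OF cg]]]\<close>)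
  then have s7: "sends (\<ll> ?e) A c (coend_in (hom_prof ?LC) ?e A c ?a ?w (eta_el (cpt g star))) g"
    using sends_lunit[OF pe1, of A ?a ?w c "eta_el (cpt g star)"] w ee lact_diamond[OF e1, of A ?a ?w c "eta_el (cpt g star)"] by simp
  show "\<exists>q. sends ?l A c g q \<and> sends ?r A c g q"
    using sends_bid[OF ge] sends_vcomp[OF s1 sends_vcomp[OF s2 sends_vcomp[OF s3 sends_vcomp[OF s4 sends_vcomp[OF s5 sends_vcomp[OF s6 s7]]]]]]
    by blast
qed simp_all

end

section \<open>Compatibility of the three modifications with a profunctor\<close>

lemma L_skew_l_modification:
  assumes F: "PR F"
  shows "(((((\<ll> (L_prof T F) \<cdot> (L_skew_l T (Trg F) \<triangleright> L_prof T F))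
    \<cdot> \<aa>' (diamond (L_mu T (Trg F))) (diamond (L_eta T (L_cat T (Trg F)))) (L_prof T F))
    \<cdot> (diamond (L_mu T (Trg F)) \<triangleleft> eta1 (L_prof T F)))
    \<cdot> \<aa> (diamond (L_mu T (Trg F))) (L_prof T (L_prof T F)) (diamond (L_eta T (L_cat T (Src F)))))
    \<cdot> (mu1 F \<triangleright> diamond (L_eta T (L_cat T (Src F)))))
    \<cdot> \<aa>' (L_prof T F) (diamond (L_mu T (Src F))) (diamond (L_eta T (L_cat T (Src F))))
   = \<rr> (L_prof T F) \<cdot> (L_prof T F \<triangleleft> L_skew_l T (Src F))" (is "?l = ?r")
proof (rule cell_eqI)
  let ?C = "Src F" and ?D = "Trg F" and ?LF = "L_prof T F" let ?LLF = "L_prof T ?LF" and ?LC = "L_cat T ?C" and ?LD = "L_cat T ?D"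
  let ?mC = "diamond (L_mu T ?C)" and ?mD = "diamond (L_mu T ?D)" and ?eC = "diamond (L_eta T ?LC)" and ?eD = "diamond (L_eta T ?LD)"
  note C = PR_Src[OF F] and D = PR_Trg[OF F] and LF = PR_L_prof[OF F]
  note LLF = PR_L_prof[OF LF] and LC = category_L_cat[OF C] and LD = category_L_cat[OF D]
  note LLC = category_L_cat[OF LC] and LLD = category_L_cat[OF LD]
  note mC = catfunctor_L_mu[OF C] and mD = catfunctor_L_mu[OF D] and eC = catfunctor_L_eta[OF LC] and eD = catfunctor_L_eta[OF LD]
  note pmC = PR_diamond[OF mC] and pmD = PR_diamond[OF mD] and peC = PR_diamond[OF eC] and peD = PR_diamond[OF eD]
  have ty: "FSrc (L_mu T ?C) = FTrg (L_eta T ?LC)" "Src ?LF = FTrg (L_mu T ?C)" by simp_all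
  fix A B p assume "el (Dom ?r) A B p"
  then have p': "el (comp_prof ?LF (comp_prof ?mC ?eC)) A B p" by (simp add: cell_Dom[OF L_skew_l_cell[OF C]])
  let ?E = "mu_ob T (eta_ob T B)"
  let ?J = "Ide ?LC ?E" and ?I = "Ide (L_cat T ?LC) (eta_ob T B)"
  obtain t where p: "p = coend_in ?LF (comp_prof ?mC ?eC) A B ?E t (coend_in ?mC ?eC ?E B (eta_ob T B) ?J ?I)"
    and t: "el ?LF A ?E t" and B: "B \<in> Ob ?LC"
    using el_comp_diamond2E[OF mC eC ty(1) LF ty(2) p'] by auto
  have A: "A \<in> Ob ?LD" using el_Ob[OF t] by simp
  have eB: "eta_ob T B \<in> Ob (L_cat T ?LC)" using B by simp
  note EB = mu_ob_Ob[OF eB]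
  have eI: "el ?eC (eta_ob T B) B ?I" using el_diamond_Ide[OF eC, of B] B by simp
  have eJ: "el ?mC ?E (eta_ob T B) ?J" using el_diamond_Ide[OF mC, of "eta_ob T B"] eB by simp
  have s1: "sends (\<aa>' ?LF ?mC ?eC) A B p (coend_in (comp_prof ?LF ?mC) ?eC A B (eta_ob T B) (coyoneda ?LF (L_mu T ?C) A (eta_ob T B) t) ?I)"
    using sends_assoc_inv[OF LF pmC peC _ _ t eJ eI] unfolding p coyoneda_def by simp
  \<comment> \<open>The family \<open>eta_ob T B\<close> has one outer index, so splitting
    \<open>t\<close> over it produces an object with the single entry at \<open>star\<close>, which
    the unit then picks out.\<close>
  let ?H = "mu_split A (eta_ob T B) (rdx t)" let ?h = "reindex ?D (mu_ob T ?H) (rdx t)" and ?t0 = "mu_flat (eta_ob T B) (cpt t)"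
  have H: "?H \<in> Ob (L_cat T ?LD)" by (rule mu_split_Ob[OF A eB el_L_lmap[OF t]])
  have h: "ar ?LD A (mu_ob T ?H) ?h" by (rule ar_mu_split[OF D A eB el_L_lmap[OF t]])
  have eh: "el ?mD A ?H ?h" using h H by (simp add: el_diamond[OF mD])
  note t0 = el_mu_flat_split[OF t eB]
  have s2: "sends (mu1 F \<triangleright> ?eC) A B (coend_in (comp_prof ?LF ?mC) ?eC A B (eta_ob T B) (coyoneda ?LF (L_mu T ?C) A (eta_ob T B) t) ?I)
    (coend_in (comp_prof ?mD ?LLF) ?eC A B (eta_ob T B) (coend_in ?mD ?LLF A (eta_ob T B) ?H ?h ?t0) ?I)"
    using sends_rwhisker[OF mu1_cell[OF F] peC _ eI sends_mu1_coyoneda[OF F t eB]] by (simp add: mu_sec_def)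
  have s3: "sends (\<aa> ?mD ?LLF ?eC) A B (coend_in (comp_prof ?mD ?LLF) ?eC A B (eta_ob T B) (coend_in ?mD ?LLF A (eta_ob T B) ?H ?h ?t0) ?I)
    (coend_in ?mD (comp_prof ?LLF ?eC) A B ?H ?h (coyoneda ?LLF (L_eta T ?LC) ?H B ?t0))"
    using sends_assoc[OF pmD LLF peC _ _ eh t0 eI] unfolding coyoneda_def by simp
  let ?d = "ob ?H star" let ?k = "reindex ?LD (eta_ob T ?d) (\<lambda>_. star)"
  have t0s: "rdx ?t0 star = star" by simp
  note kk = eta_sec_props[OF LF t0, unfolded t0s]
  have s4: "sends (?mD \<triangleleft> eta1 ?LF) A B (coend_in ?mD (comp_prof ?LLF ?eC) A B ?H ?h (coyoneda ?LLF (L_eta T ?LC) ?H B ?t0))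
    (coend_in ?mD (comp_prof ?eD ?LF) A B ?H ?h (coend_in ?eD ?LF ?H B ?d ?k (cpt ?t0 star)))"
    using sends_lwhisker[OF eta1_cell[OF LF] pmD _ eh sends_eta1_coyoneda[OF LF t0]] B by (simp add: eta_sec_def)
  have k: "ar (L_cat T ?LD) ?H (eta_ob T ?d) ?k" using kk(1) by simp
  have d: "?d \<in> Ob ?LD" using el_Ob(1)[OF kk(2)] by simp
  have ek: "el ?eD ?H ?d ?k" using k d by (simp add: el_diamond[OF eD])
  have s5: "sends (\<aa>' ?mD ?eD ?LF) A B (coend_in ?mD (comp_prof ?eD ?LF) A B ?H ?h (coend_in ?eD ?LF ?H B ?d ?k (cpt ?t0 star)))
    (coend_in (comp_prof ?mD ?eD) ?LF A B ?d (coend_in ?mD ?eD A ?d ?H ?h ?k) (cpt ?t0 star))"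
    by (rule sends_assoc_inv[OF pmD peD LF _ _ eh ek kk(2)]) simp_all
  let ?w = "Cmp ?LD A (mu_ob T (eta_ob T ?d)) ?d (mu_lunit ?D ?d) (Cmp ?LD A (mu_ob T ?H) (mu_ob T (eta_ob T ?d)) (mu_el (eta_ob T ?d) ?k) ?h)"
  have s6: "sends (L_skew_l T ?D \<triangleright> ?LF) A B (coend_in (comp_prof ?mD ?eD) ?LF A B ?d (coend_in ?mD ?eD A ?d ?H ?h ?k) (cpt ?t0 star))
    (coend_in (hom_prof ?LD) ?LF A B ?d ?w (cpt ?t0 star))"
    by (rule sends_rwhisker[OF L_skew_l_cell[OF D] LF _ kk(2) sends_L_skew_l[OF D h k d]]) simp
  have w: "ar ?LD A ?d ?w" by (rule ar_Cmp[OF LD ar_Cmp[OF LD h ar_mu_el[OF k]] ar_mu_lunit[OF D d]])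
  note mlB = ar_mu_lunit[OF C B]
  have mlB': "ar (L_cat T (Src F)) ?E B (mu_lunit ?C B)" by (rule mlB)
  \<comment> \<open>At \<open>z\<close> both sides have the index and the component of
    \<open>t\<close> at \<open>pr star z\<close>: on the left the index map sits in
    \<open>?w\<close> and the components in the flat part, on the right \<open>mu_lunit\<close>
    renames the indices of \<open>t\<close>.\<close>
  have "lact ?LF A ?d B ?w (cpt ?t0 star) = ract ?LF A ?E B (mu_lunit ?C B) t"
    unfolding lact_L ract_L[OF t mlB']
  proof (rule fam_ar_cong)
    fix z assume z: "z \<in> elts (idx B)"
    note c = el_L_cpt[OF t, of "pr star z"]
    show "rdx ?w (rdx (cpt ?t0 star) z) = rdx t (rdx (mu_lunit ?C B) z)" using z by (simp add: Cmp_L Ide_L)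
    show "lact F (ob A (rdx ?w (rdx (cpt ?t0 star) z))) (ob ?d (rdx (cpt ?t0 star) z)) (ob B z) (cpt ?w (rdx (cpt ?t0 star) z)) (cpt (cpt ?t0 star) z)
      = ract F (ob A (rdx t (rdx (mu_lunit ?C B) z))) (ob ?E (rdx (mu_lunit ?C B) z)) (ob B z) (cpt (mu_lunit ?C B) z) (cpt t (rdx (mu_lunit ?C B) z))"
      using z c lact_Ide[OF PR_profunctor[OF F], of "ob A (rdx t (pr star z))" "ob B z" "cpt t (pr star z)"]
        ract_Ide[OF PR_profunctor[OF F], of "ob A (rdx t (pr star z))" "ob B z" "cpt t (pr star z)"]
        Cmp_Ide_l[OF D ar_Ide[OF D], of "ob A (rdx t (pr star z))"] el_Ob(1)[of F "ob A (rdx t (pr star z))" "ob B z" "cpt t (pr star z)"]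
      by (simp add: Cmp_L Ide_L)
  qed simp
  then have s7: "sends (\<ll> ?LF) A B (coend_in (hom_prof ?LD) ?LF A B ?d ?w (cpt ?t0 star)) (ract ?LF A ?E B (mu_lunit ?C B) t)"
    using sends_lunit[OF LF, of A ?d ?w B "cpt ?t0 star"] w kk(2) by simp
  have "sends (L_skew_l T ?C) ?E B (coend_in ?mC ?eC ?E B (eta_ob T B) ?J ?I) (mu_lunit ?C B)"
    using sends_L_skew_l[OF C ar_Ide[OF LC EB] ar_Ide[OF LLC eB] B]
    by (simp add: mu_el_Ide[OF C eB] Cmp_Ide_r[OF LC mlB] Cmp_Ide_l[OF LC ar_Ide[OF LC EB]])
  then have r1: "sends (?LF \<triangleleft> L_skew_l T ?C) A B p (coend_in ?LF (hom_prof ?LC) A B ?E t (mu_lunit ?C B))"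
    unfolding p by (intro sends_lwhisker[OF L_skew_l_cell[OF C] LF _ t]) simp_all
  have r2: "sends (\<rr> ?LF) A B (coend_in ?LF (hom_prof ?LC) A B ?E t (mu_lunit ?C B)) (ract ?LF A ?E B (mu_lunit ?C B) t)"
    using sends_runit[OF LF t, of B "mu_lunit ?C B"] mlB by simp
  show "\<exists>q. sends ?l A B p q \<and> sends ?r A B p q"
    using sends_vcomp[OF s1 sends_vcomp[OF s2 sends_vcomp[OF s3 sends_vcomp[OF s4 sends_vcomp[OF s5 sends_vcomp[OF s6 s7]]]]]]
      sends_vcomp[OF r1 r2] by blast
qed (simp_all add: cell_Dom[OF L_skew_l_cell[OF PR_Src[OF F]]])

text \<open>One path restricts \<open>t\<close> to the union of \<open>Leta B\<close> and splits it,
  the other combines \<open>t\<close> with the identity of \<open>Leta A\<close>. Both middle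
  objects consist of unit objects on objects of \<open>A\<close>, indexed by \<open>B\<close> and by
  \<open>A\<close>; the index map of \<open>t\<close> with identity components is the arrow between
  them.\<close>

lemma L_skew_r_modification:
  assumes F: "PR F"
  shows "((((((diamond (L_mu T (Trg F)) \<triangleleft> L_cell T (eta1 F))
    \<cdot> (diamond (L_mu T (Trg F)) \<triangleleft> L_compositor T (L_prof T F) (diamond (L_eta T (Src F)))))
    \<cdot> \<aa> (diamond (L_mu T (Trg F))) (L_prof T (L_prof T F)) (L_prof T (diamond (L_eta T (Src F)))))
    \<cdot> (mu1 F \<triangleright> L_prof T (diamond (L_eta T (Src F)))))
    \<cdot> \<aa>' (L_prof T F) (diamond (L_mu T (Src F))) (L_prof T (diamond (L_eta T (Src F)))))
    \<cdot> (L_prof T F \<triangleleft> L_skew_r T (Src F))) \<cdot> \<rr>' (L_prof T F)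
   = (((diamond (L_mu T (Trg F)) \<triangleleft> L_compositor T (diamond (L_eta T (Trg F))) F)
    \<cdot> \<aa> (diamond (L_mu T (Trg F))) (L_prof T (diamond (L_eta T (Trg F)))) (L_prof T F))
    \<cdot> (L_skew_r T (Trg F) \<triangleright> L_prof T F)) \<cdot> \<ll>' (L_prof T F)" (is "?l = ?r")
proof (rule cell_eqI)
  let ?C = "Src F" and ?D = "Trg F" and ?LF = "L_prof T F" let ?LLF = "L_prof T ?LF" and ?LC = "L_cat T ?C" and ?LD = "L_cat T ?D"
  let ?mC = "diamond (L_mu T ?C)" and ?mD = "diamond (L_mu T ?D)" and ?eC = "diamond (L_eta T ?C)" and ?eD = "diamond (L_eta T ?D)"
  note C = PR_Src[OF F] and D = PR_Trg[OF F] and LF = PR_L_prof[OF F]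
  note LLF = PR_L_prof[OF LF] and LC = category_L_cat[OF C] and LD = category_L_cat[OF D]
  note LLC = category_L_cat[OF LC] and LLD = category_L_cat[OF LD]
  note mC = catfunctor_L_mu[OF C] and mD = catfunctor_L_mu[OF D] and eC = catfunctor_L_eta[OF C] and eD = catfunctor_L_eta[OF D]
  note pmC = PR_diamond[OF mC] and pmD = PR_diamond[OF mD] and peC = PR_diamond[OF eC] and peD = PR_diamond[OF eD]
  note LeC = PR_L_prof[OF peC] and LeD = PR_L_prof[OF peD]
  have ty: "Src ?LF = Trg ?eC" "Src ?eD = Trg F" by simp_all
  fix A B t assume "el (Dom ?r) A B t"
  then have t: "el ?LF A B t" by simp
  have A: "A \<in> Ob ?LD" and B: "B \<in> Ob ?LC" using el_Ob[OF t] by simp_all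
  note EB = Leta_Ob[OF B] and EA = Leta_Ob[OF A] and rB = ar_mu_runit[OF C B] and rA = ar_mu_runit[OF D A]
  let ?E = "Leta B" let ?I = "Ide (L_cat T ?LC) ?E" and ?b = "mu_runit ?C B" and ?a = "mu_runit ?D A" and ?J = "Ide (L_cat T ?LD) (Leta A)"
  have s1: "sends (\<rr>' ?LF) A B t (coend_in ?LF (hom_prof ?LC) A B B t (Ide ?LC B))"
    using sends_runit_inv[OF LF t] by simp
  have "sends (L_skew_r T ?C) B B (Ide ?LC B) (coend_in ?mC (L_prof T ?eC) B B ?E ?b ?I)"
    using sends_L_skew_r[OF C ar_Ide[OF LC B]] by (simp add: Cmp_Ide_r[OF LC rB])
  then have s2: "sends (?LF \<triangleleft> L_skew_r T ?C) A B (coend_in ?LF (hom_prof ?LC) A B B t (Ide ?LC B))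
    (coend_in ?LF (comp_prof ?mC (L_prof T ?eC)) A B B t (coend_in ?mC (L_prof T ?eC) B B ?E ?b ?I))"
    by (intro sends_lwhisker[OF L_skew_r_cell[OF C] LF _ t]) simp_all
  have eb: "el ?mC B ?E ?b" using rB EB by (simp add: el_diamond[OF mC])
  have eI: "el (L_prof T ?eC) ?E B ?I" using ar_Ide[OF LLC EB] B by (simp add: el_L_diamond[OF eC])
  have s3: "sends (\<aa>' ?LF ?mC (L_prof T ?eC)) A B
    (coend_in ?LF (comp_prof ?mC (L_prof T ?eC)) A B B t (coend_in ?mC (L_prof T ?eC) B B ?E ?b ?I))
    (coend_in (comp_prof ?LF ?mC) (L_prof T ?eC) A B ?E (coend_in ?LF ?mC A ?E B t ?b) ?I)"
    by (rule sends_assoc_inv[OF LF pmC LeC _ _ t eb eI]) simp_all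
  let ?t = "ract ?LF A B (mu_ob T ?E) ?b t"
  have t1: "el ?LF A (mu_ob T ?E) ?t" by (rule el_ract[OF PR_profunctor[OF LF] _ t]) (use rB in simp)
  have ts: "rdx ?t (pr y star) = rdx t y" "cpt ?t (pr y star) = cpt t y" if y: "y \<in> elts (idx B)" for y
    unfolding ract_L[OF t rB] using y ract_Ide[OF PR_profunctor[OF F] el_L_cpt[OF t y]] by simp_all
  let ?H = "mu_split A ?E (rdx ?t)" let ?h = "reindex ?D (mu_ob T ?H) (rdx ?t)" and ?ft = "mu_flat ?E (cpt ?t)"
  have H: "?H \<in> Ob (L_cat T ?LD)" by (rule mu_split_Ob[OF A EB el_L_lmap[OF t1]])
  have h: "ar ?LD A (mu_ob T ?H) ?h" by (rule ar_mu_split[OF D A EB el_L_lmap[OF t1]])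
  have eh: "el ?mD A ?H ?h" using h H by (simp add: el_diamond[OF mD])
  note t0 = el_mu_flat_split[OF t1 EB]
  have "sends (mu1 F) A ?E (coend_in ?LF ?mC A ?E B t ?b) (coend_in ?mD ?LLF A ?E ?H ?h ?ft)"
    using sends_mu1[OF F t rB EB] by (simp only: mu_sec_def)
  then have s4: "sends (mu1 F \<triangleright> L_prof T ?eC) A B (coend_in (comp_prof ?LF ?mC) (L_prof T ?eC) A B ?E (coend_in ?LF ?mC A ?E B t ?b) ?I)
    (coend_in (comp_prof ?mD ?LLF) (L_prof T ?eC) A B ?E (coend_in ?mD ?LLF A ?E ?H ?h ?ft) ?I)"
    by (intro sends_rwhisker[OF mu1_cell[OF F] LeC _ eI]) simp_all
  let ?q = "coend_in ?LLF (L_prof T ?eC) ?H B ?E ?ft ?I"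
  have s5: "sends (\<aa> ?mD ?LLF (L_prof T ?eC)) A B
    (coend_in (comp_prof ?mD ?LLF) (L_prof T ?eC) A B ?E (coend_in ?mD ?LLF A ?E ?H ?h ?ft) ?I)
    (coend_in ?mD (comp_prof ?LLF (L_prof T ?eC)) A B ?H ?h ?q)"
    by (rule sends_assoc[OF pmD LLF LeC _ _ eh t0 eI]) simp_all
  let ?q2 = "fam_ar (idx B) (\<lambda>y. y) (\<lambda>y. coyoneda ?LF (L_eta T ?C) (ob ?H y) (ob B y) (cpt ?ft y))"
  have q2: "sends (L_compositor T ?LF ?eC) ?H B ?q ?q2"
    by (rule sends_L_compositor[OF LF peC ty(1) t0 eI]) (simp_all add: Ide_L[of "L_cat T (Src F)"] coyoneda_def)
  let ?w = "fam_ar (idx B) (\<lambda>y. y) (\<lambda>y. coend_in ?eD F (eta_ob T (ob A (rdx t y))) (ob B y) (ob A (rdx t y))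
      (Ide ?LD (eta_ob T (ob A (rdx t y)))) (cpt t y))"
  \<comment> \<open>Each summand of \<open>Leta B\<close> has the one index \<open>star\<close>, so
    the splitting places a unit object at every \<open>y\<close>.\<close>
  have Hy: "ob ?H y = eta_ob T (ob A (rdx t y))" if y: "y \<in> elts (idx B)" for y
  proof -
    have "ob ?H y = fam_ob (idx (ob ?E y)) (\<lambda>z. ob A (rdx ?t (pr y z))) (lab (ob ?E y))"
      using y by (simp add: mu_split_def)
    also have "\<dots> = fam_ob one (\<lambda>_. ob A (rdx t y)) (TUnit T one star)"
      by (rule fam_ob_cong) (use y in \<open>auto simp: ts\<close>)
    finally show ?thesis by (simp add: eta_ob_def)
  qed
  have w: "sends (L_cell T (eta1 F)) ?H B ?q2 ?w"
  proof (rule sends_L_cell)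
    fix y assume "y \<in> elts (idx B)"
    then have y: "y \<in> elts (idx B)" by simp
    have c: "el ?LF (ob ?H y) (eta_ob T (ob B y)) (cpt ?ft y)" using el_L_cpt[OF t0, of y] y by simp
    have cs: "rdx (cpt ?ft y) star = star" "cpt (cpt ?ft y) star = cpt t y" "ob (ob ?H y) star = ob A (rdx t y)"
      using y by (simp_all add: ts)
    have "reindex ?D (eta_ob T (ob A (rdx t y))) (\<lambda>_. star) = Ide ?LD (eta_ob T (ob A (rdx t y)))"
      unfolding reindex_def Ide_L by (rule fam_ar_cong) auto
    then have "eta_sec F (ob ?H y) (ob B y) (cpt ?ft y)
      = coend_in ?eD F (eta_ob T (ob A (rdx t y))) (ob B y) (ob A (rdx t y)) (Ide ?LD (eta_ob T (ob A (rdx t y)))) (cpt t y)"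
      unfolding eta_sec_def cs Hy[OF y] by simp
    then show "sends (eta1 F) (ob ?H (rdx ?q2 y)) (ob B y) (cpt ?q2 y)
      (coend_in ?eD F (eta_ob T (ob A (rdx t y))) (ob B y) (ob A (rdx t y)) (Ide ?LD (eta_ob T (ob A (rdx t y)))) (cpt t y))"
      using sends_eta1_coyoneda[OF F c L_Ob_ob[OF B y]] y by simp
  qed (use sends_el[OF L_compositor_cell[OF LF peC ty(1)] q2] in simp_all)
  have s67: "sends ((?mD \<triangleleft> L_cell T (eta1 F)) \<cdot> (?mD \<triangleleft> L_compositor T ?LF ?eC)) A B
    (coend_in ?mD (comp_prof ?LLF (L_prof T ?eC)) A B ?H ?h ?q) (coend_in ?mD (L_prof T (comp_prof ?eD F)) A B ?H ?h ?w)"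
    by (rule sends_vcomp[OF sends_lwhisker[OF L_compositor_cell[OF LF peC ty(1)] pmD _ eh q2]
      sends_lwhisker[OF L_cell_cell[OF eta1_cell[OF F]] pmD _ eh w]]) simp_all
  have w': "el (L_prof T (comp_prof ?eD F)) ?H B ?w" by (rule sends_el[OF L_cell_cell[OF eta1_cell[OF F]] w])
  have r1: "sends (\<ll>' ?LF) A B t (coend_in (hom_prof ?LD) ?LF A B A (Ide ?LD A) t)"
    using sends_lunit_inv[OF LF t] by simp
  have "sends (L_skew_r T ?D) A A (Ide ?LD A) (coend_in ?mD (L_prof T ?eD) A A (Leta A) ?a ?J)"
    using sends_L_skew_r[OF D ar_Ide[OF LD A]] by (simp add: Cmp_Ide_r[OF LD rA])
  then have r2: "sends (L_skew_r T ?D \<triangleright> ?LF) A B (coend_in (hom_prof ?LD) ?LF A B A (Ide ?LD A) t)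
    (coend_in (comp_prof ?mD (L_prof T ?eD)) ?LF A B A (coend_in ?mD (L_prof T ?eD) A A (Leta A) ?a ?J) t)"
    by (intro sends_rwhisker[OF L_skew_r_cell[OF D] LF _ t]) simp_all
  have ea: "el ?mD A (Leta A) ?a" using rA EA by (simp add: el_diamond[OF mD])
  have eJ: "el (L_prof T ?eD) (Leta A) A ?J" using ar_Ide[OF LLD EA] A by (simp add: el_L_diamond[OF eD])
  have r3: "sends (\<aa> ?mD (L_prof T ?eD) ?LF) A B
    (coend_in (comp_prof ?mD (L_prof T ?eD)) ?LF A B A (coend_in ?mD (L_prof T ?eD) A A (Leta A) ?a ?J) t)
    (coend_in ?mD (comp_prof (L_prof T ?eD) ?LF) A B (Leta A) ?a (coend_in (L_prof T ?eD) ?LF (Leta A) B A ?J t))"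
    by (rule sends_assoc[OF pmD LeD LF _ _ ea eJ t]) simp_all
  let ?u = "fam_ar (idx B) (rdx t) (\<lambda>y. coend_in ?eD F (eta_ob T (ob A (rdx t y))) (ob B y) (ob A (rdx t y))
      (Ide ?LD (eta_ob T (ob A (rdx t y)))) (cpt t y))"
  have u: "sends (L_compositor T ?eD F) (Leta A) B (coend_in (L_prof T ?eD) ?LF (Leta A) B A ?J t) ?u"
    by (rule sends_L_compositor[OF peD F ty(2) eJ t]) (simp_all add: Ide_L[of "L_cat T (Trg F)"] el_L_rdx[OF t])
  have r4: "sends (?mD \<triangleleft> L_compositor T ?eD F) A B
    (coend_in ?mD (comp_prof (L_prof T ?eD) ?LF) A B (Leta A) ?a (coend_in (L_prof T ?eD) ?LF (Leta A) B A ?J t))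
    (coend_in ?mD (L_prof T (comp_prof ?eD F)) A B (Leta A) ?a ?u)"
    by (rule sends_lwhisker[OF L_compositor_cell[OF peD F ty(2)] pmD _ ea u]) simp
  \<comment> \<open>The arrow to glide along, with the index map of \<open>t\<close>. Its components
    are identities because \<open>?H\<close> has at \<open>y\<close> the unit object that
    \<open>Leta A\<close> has at \<open>rdx t y\<close>.\<close>
  let ?v = "fam_ar (idx B) (rdx t) (\<lambda>y. Ide ?LD (eta_ob T (ob A (rdx t y))))"
  have v: "ar (L_cat T ?LD) (Leta A) ?H ?v"
  proof (rule ar_L_fam[OF EA H])
    show "lmap (Leta A) ?H (rdx t)" using el_L_lmap[OF t] by (simp add: lmap_def)
    show "ar ?LD (ob (Leta A) (rdx t y)) (ob ?H y) (Ide ?LD (eta_ob T (ob A (rdx t y))))" if "y \<in> elts (idx ?H)" for y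
      using that ar_Ide[OF LD, of "eta_ob T (ob A (rdx t y))"] el_L_rdx[OF t, of y] L_Ob_ob[OF A, of "rdx t y"] by (simp add: Hy)
  qed simp
  have "lact (L_prof T (comp_prof ?eD F)) (Leta A) ?H B ?v ?w = ?u"
    unfolding lact_L
  proof (rule fam_ar_cong)
    fix y assume y: "y \<in> elts (idx B)"
    show "lact (comp_prof ?eD F) (ob (Leta A) (rdx ?v (rdx ?w y))) (ob ?H (rdx ?w y)) (ob B y) (cpt ?v (rdx ?w y)) (cpt ?w y)
      = coend_in ?eD F (eta_ob T (ob A (rdx t y))) (ob B y) (ob A (rdx t y)) (Ide ?LD (eta_ob T (ob A (rdx t y)))) (cpt t y)"
      using y lact_Ide[OF PR_profunctor[OF PR_comp[OF peD F ty(2)]] el_L_cpt[OF w' y]] by (simp add: Hy el_L_rdx[OF t])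
  qed simp_all
  \<comment> \<open>The right unit reindexing at \<open>A\<close> followed by the union of
    \<open>?v\<close> is the reindexing produced by the splitting of \<open>t\<close>.\<close>
  moreover have "ract ?mD A (Leta A) ?H ?v ?a = ?h"
  proof -
    have "Cmp ?LD A (mu_ob T (Leta A)) (mu_ob T ?H) (mu_el ?H ?v) ?a = ?h"
      unfolding Cmp_L
    proof (rule fam_eqI[OF _ ar_L_eta[OF h]])
      fix s assume "s \<in> elts (idx (mu_ob T ?H))"
      then obtain y where s: "s = pr y star" and y: "y \<in> elts (idx B)" by auto
      note ty = el_L_rdx[OF t y] note Ay = L_Ob_ob[OF A ty]
      show "rdx (fam_ar (idx (mu_ob T ?H)) (\<lambda>x. rdx ?a (rdx (mu_el ?H ?v) x)) (\<lambda>x. Cmp ?D (ob A (rdx ?a (rdx (mu_el ?H ?v) x)))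
        (ob (mu_ob T (Leta A)) (rdx (mu_el ?H ?v) x)) (ob (mu_ob T ?H) x) (cpt (mu_el ?H ?v) x) (cpt ?a (rdx (mu_el ?H ?v) x)))) s = rdx ?h s"
        using y ty by (simp add: s Ide_L ts)
      show "cpt (fam_ar (idx (mu_ob T ?H)) (\<lambda>x. rdx ?a (rdx (mu_el ?H ?v) x)) (\<lambda>x. Cmp ?D (ob A (rdx ?a (rdx (mu_el ?H ?v) x)))
        (ob (mu_ob T (Leta A)) (rdx (mu_el ?H ?v) x)) (ob (mu_ob T ?H) x) (cpt (mu_el ?H ?v) x) (cpt ?a (rdx (mu_el ?H ?v) x)))) s = cpt ?h s"
        using y ty Cmp_Ide_l[OF D ar_Ide[OF D Ay]] by (simp add: s Ide_L ts)
    qed simp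
    then show ?thesis using ract_diamond[OF mD _ ea, of ?H ?v] v by simp
  qed
  ultimately have eq: "coend_in ?mD (L_prof T (comp_prof ?eD F)) A B (Leta A) ?a ?u = coend_in ?mD (L_prof T (comp_prof ?eD F)) A B ?H ?h ?w"
    using coend_glide[of "L_prof T (comp_prof ?eD F)" "Leta A" ?H ?v ?mD A ?a B ?w] v ea w' by simp
  show "\<exists>q. sends ?l A B t q \<and> sends ?r A B t q"
    using sends_vcomp[OF s1 sends_vcomp[OF s2 sends_vcomp[OF s3 sends_vcomp[OF s4 sends_vcomp[OF s5 s67]]]]]
      sends_vcomp[OF r1 sends_vcomp[OF r2 sends_vcomp[OF r3 r4[unfolded eq]]]] by blast
qed simp_all

text \<open>An element \<open>t\<close> over the union of the three levels of \<open>W\<close> is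
  split after rebracketing, or in two rounds, over \<open>mu_ob T W\<close> and then over
  \<open>W\<close>. Since the unions are coded by pairs, the middle objects and the arrows of the
  two results are equal, and both chases end in the same class.\<close>

lemma L_skew_m_modification:
  assumes F: "PR F"
  shows "(((((diamond (L_mu T (Trg F)) \<triangleleft> L_cell T (mu1 F))
    \<cdot> (diamond (L_mu T (Trg F)) \<triangleleft> L_compositor T (L_prof T F) (diamond (L_mu T (Src F)))))
    \<cdot> \<aa> (diamond (L_mu T (Trg F))) (L_prof T (L_prof T F)) (L_prof T (diamond (L_mu T (Src F)))))
    \<cdot> (mu1 F \<triangleright> L_prof T (diamond (L_mu T (Src F)))))
    \<cdot> \<aa>' (L_prof T F) (diamond (L_mu T (Src F))) (L_prof T (diamond (L_mu T (Src F)))))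
    \<cdot> (L_prof T F \<triangleleft> L_skew_m T (Src F))
   = (((((((diamond (L_mu T (Trg F)) \<triangleleft> L_compositor T (diamond (L_mu T (Trg F))) (L_prof T (L_prof T F)))
    \<cdot> \<aa> (diamond (L_mu T (Trg F))) (L_prof T (diamond (L_mu T (Trg F)))) (L_prof T (L_prof T (L_prof T F))))
    \<cdot> (L_skew_m T (Trg F) \<triangleright> L_prof T (L_prof T (L_prof T F))))
    \<cdot> \<aa>' (diamond (L_mu T (Trg F))) (diamond (L_mu T (L_cat T (Trg F)))) (L_prof T (L_prof T (L_prof T F))))
    \<cdot> (diamond (L_mu T (Trg F)) \<triangleleft> mu1 (L_prof T F)))
    \<cdot> \<aa> (diamond (L_mu T (Trg F))) (L_prof T (L_prof T F)) (diamond (L_mu T (L_cat T (Src F)))))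
    \<cdot> (mu1 F \<triangleright> diamond (L_mu T (L_cat T (Src F)))))
    \<cdot> \<aa>' (L_prof T F) (diamond (L_mu T (Src F))) (diamond (L_mu T (L_cat T (Src F))))" (is "?l = ?r")
proof (rule cell_eqI)
  let ?C = "Src F" and ?D = "Trg F" and ?LF = "L_prof T F" let ?LLF = "L_prof T ?LF" and ?LC = "L_cat T ?C" and ?LD = "L_cat T ?D"
  let ?LLLF = "L_prof T ?LLF" and ?LLC = "L_cat T ?LC" and ?LLD = "L_cat T ?LD"
  let ?mC = "diamond (L_mu T ?C)" and ?mD = "diamond (L_mu T ?D)" and ?nC = "diamond (L_mu T ?LC)" and ?nD = "diamond (L_mu T ?LD)"
  note C = PR_Src[OF F] and D = PR_Trg[OF F] and LF = PR_L_prof[OF F]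
  note LLF = PR_L_prof[OF LF] and LC = category_L_cat[OF C] and LD = category_L_cat[OF D] note LLLF = PR_L_prof[OF LLF]
  note LLC = category_L_cat[OF LC] and LLD = category_L_cat[OF LD]
  note mC = catfunctor_L_mu[OF C] and mD = catfunctor_L_mu[OF D] and nC = catfunctor_L_mu[OF LC] and nD = catfunctor_L_mu[OF LD]
  note pmC = PR_diamond[OF mC] and pmD = PR_diamond[OF mD] and pnC = PR_diamond[OF nC] and pnD = PR_diamond[OF nD]
  note LmC = PR_L_prof[OF pmC] and LmD = PR_L_prof[OF pmD]
  have ty: "FSrc (L_mu T ?C) = FTrg (L_mu T ?LC)" "Src ?LF = FTrg (L_mu T ?C)" "Src ?LF = Trg ?mC" "Src ?mD = Trg ?LLF" by simp_all
  fix A W p assume "el (Dom ?r) A W p"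
  then have p': "el (comp_prof ?LF (comp_prof ?mC ?nC)) A W p" by simp
  let ?V = "mu_ob T W" let ?U = "mu_ob T ?V"
  let ?J = "Ide ?LC ?U" and ?I = "Ide ?LLC ?V"
  obtain t where p: "p = coend_in ?LF (comp_prof ?mC ?nC) A W ?U t (coend_in ?mC ?nC ?U W ?V ?J ?I)"
    and t: "el ?LF A ?U t" and W: "W \<in> Ob (L_cat T ?LLC)"
    using el_comp_diamond2E[OF mC nC ty(1) LF ty(2) p'] by auto
  have A: "A \<in> Ob ?LD" using el_Ob[OF t] by simp
  note V = mu_ob_Ob[OF W] note U = mu_ob_Ob[OF V] and LW = Lmu_Ob[OF W]
  have Is: "y \<in> elts (idx P) \<Longrightarrow> rdx (Ide (L_cat T C') P) y = y" "y \<in> elts (idx P) \<Longrightarrow> cpt (Ide (L_cat T C') P) y = Ide C' (ob P y)" for C' P y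
    by (simp_all add: Ide_L)
  let ?a = "mu_assoc ?C W" and ?K = "Ide ?LLC (Lmu W)"
  note a = ar_mu_assoc[OF C W] and IU = ar_Ide[OF LC U] and IV = ar_Ide[OF LLC V]
  have "sends (L_skew_m T ?C) ?U W (coend_in ?mC ?nC ?U W ?V ?J ?I) (coend_in ?mC (L_prof T ?mC) ?U W (Lmu W) ?a ?K)"
    using sends_L_skew_m[OF C IU IV W] Cmp_Ide_l[OF LC IU] Cmp_Ide_r[OF LC a] by (simp add: mu_el_Ide[OF C V])
  then have l1: "sends (?LF \<triangleleft> L_skew_m T ?C) A W p (coend_in ?LF (comp_prof ?mC (L_prof T ?mC)) A W ?U t (coend_in ?mC (L_prof T ?mC) ?U W (Lmu W) ?a ?K))"
    unfolding p by (intro sends_lwhisker[OF L_skew_m_cell[OF C] LF _ t]) simp_all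
  have ea: "el ?mC ?U (Lmu W) ?a" using a LW by (simp add: el_diamond[OF mC])
  have eK: "el (L_prof T ?mC) (Lmu W) W ?K" using ar_Ide[OF LLC LW] W by (simp add: el_L_diamond[OF mC])
  have l2: "sends (\<aa>' ?LF ?mC (L_prof T ?mC)) A W
    (coend_in ?LF (comp_prof ?mC (L_prof T ?mC)) A W ?U t (coend_in ?mC (L_prof T ?mC) ?U W (Lmu W) ?a ?K))
    (coend_in (comp_prof ?LF ?mC) (L_prof T ?mC) A W (Lmu W) (coend_in ?LF ?mC A (Lmu W) ?U t ?a) ?K)"
    by (rule sends_assoc_inv[OF LF pmC LmC _ _ t ea eK]) simp_all
  \<comment> \<open>\<open>t\<close> transported along the rebracketing of indices. Its splitting
    over \<open>Lmu W\<close> keeps the outer level and joins the two inner ones.\<close>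
  define t' where "t' = ract ?LF A ?U (mu_ob T (Lmu W)) ?a t"
  have t': "el ?LF A (mu_ob T (Lmu W)) t'" unfolding t'_def by (rule el_ract[OF PR_profunctor[OF LF] _ t]) (use a in simp)
  have ts: "rdx t' (pr x (pr z y)) = rdx t (pr (pr x z) y)" "cpt t' (pr x (pr z y)) = cpt t (pr (pr x z) y)"
    if "x \<in> elts (idx W)" "z \<in> elts (idx (ob W x))" "y \<in> elts (idx (ob (ob W x) z))" for x z y
    unfolding t'_def ract_L[OF t a] using that ract_Ide[OF PR_profunctor[OF F] el_L_cpt[OF t, of "pr (pr x z) y"]] by simp_all
  define H where "H = mu_split A (Lmu W) (rdx t')"
  define f where "f = mu_flat (Lmu W) (cpt t')"
  let ?h = "reindex ?D (mu_ob T H) (rdx t')"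
  have Ho: "H \<in> Ob (L_cat T ?LD)" unfolding H_def by (rule mu_split_Ob[OF A LW el_L_lmap[OF t']])
  have h: "ar ?LD A (mu_ob T H) ?h" unfolding H_def by (rule ar_mu_split[OF D A LW el_L_lmap[OF t']])
  have eh: "el ?mD A H ?h" using h Ho by (simp add: el_diamond[OF mD])
  note ef = el_mu_flat_split[OF t' LW, folded H_def f_def]
  have "sends (mu1 F) A (Lmu W) (coend_in ?LF ?mC A (Lmu W) ?U t ?a) (coend_in ?mD ?LLF A (Lmu W) H ?h f)"
    using sends_mu1[OF F t a LW] by (simp only: mu_sec_def t'_def[symmetric] H_def[symmetric] f_def[symmetric])
  then have l3: "sends (mu1 F \<triangleright> L_prof T ?mC) A W (coend_in (comp_prof ?LF ?mC) (L_prof T ?mC) A W (Lmu W) (coend_in ?LF ?mC A (Lmu W) ?U t ?a) ?K)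
    (coend_in (comp_prof ?mD ?LLF) (L_prof T ?mC) A W (Lmu W) (coend_in ?mD ?LLF A (Lmu W) H ?h f) ?K)"
    by (intro sends_rwhisker[OF mu1_cell[OF F] LmC _ eK]) simp_all
  let ?q = "coend_in ?LLF (L_prof T ?mC) H W (Lmu W) f ?K"
  have l4: "sends (\<aa> ?mD ?LLF (L_prof T ?mC)) A W (coend_in (comp_prof ?mD ?LLF) (L_prof T ?mC) A W (Lmu W) (coend_in ?mD ?LLF A (Lmu W) H ?h f) ?K)
    (coend_in ?mD (comp_prof ?LLF (L_prof T ?mC)) A W H ?h ?q)"
    by (rule sends_assoc[OF pmD LLF LmC _ _ eh ef eK]) simp_all
  let ?q2 = "fam_ar (idx W) (\<lambda>x. x) (\<lambda>x. coyoneda ?LF (L_mu T ?C) (ob H x) (ob W x) (cpt f x))"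
  have rf: "rdx f x = x" if "x \<in> elts (idx W)" for x using that by (simp add: f_def)
  have q2: "sends (L_compositor T ?LF ?mC) H W ?q ?q2"
    by (rule sends_L_compositor[OF LF pmC ty(3) ef eK]) (simp_all add: Is rf coyoneda_def)
  let ?w = "fam_ar (idx W) (\<lambda>x. x) (\<lambda>x. mu_sec F (ob H x) (ob W x) (cpt f x))"
  have w: "sends (L_cell T (mu1 F)) H W ?q2 ?w"
  proof (rule sends_L_cell)
    fix x assume x: "x \<in> elts (idx W)"
    have "el ?LF (ob H x) (mu_ob T (ob W x)) (cpt f x)" using el_L_cpt[OF ef, of x] x by (simp add: rf)
    then show "sends (mu1 F) (ob H (rdx ?q2 x)) (ob W x) (cpt ?q2 x) (mu_sec F (ob H x) (ob W x) (cpt f x))"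
      using sends_mu1_coyoneda[OF F _ L_Ob_ob[OF W x]] x by simp
  qed (use sends_el[OF L_compositor_cell[OF LF pmC ty(3)] q2] in simp_all)
  have l56: "sends ((?mD \<triangleleft> L_cell T (mu1 F)) \<cdot> (?mD \<triangleleft> L_compositor T ?LF ?mC)) A W
    (coend_in ?mD (comp_prof ?LLF (L_prof T ?mC)) A W H ?h ?q) (coend_in ?mD (L_prof T (comp_prof ?mD ?LLF)) A W H ?h ?w)"
    by (rule sends_vcomp[OF sends_lwhisker[OF L_compositor_cell[OF LF pmC ty(3)] pmD _ eh q2]
      sends_lwhisker[OF L_cell_cell[OF mu1_cell[OF F]] pmD _ eh w]]) simp_all
  have eJ: "el ?mC ?U ?V ?J" using el_diamond_Ide[OF mC, of ?V] V by simp
  have eI: "el ?nC ?V W ?I" using el_diamond_Ide[OF nC, of W] W by simp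
  have r1: "sends (\<aa>' ?LF ?mC ?nC) A W p (coend_in (comp_prof ?LF ?mC) ?nC A W ?V (coend_in ?LF ?mC A ?V ?U t ?J) ?I)"
    unfolding p by (rule sends_assoc_inv[OF LF pmC pnC _ _ t eJ eI]) simp_all
  \<comment> \<open>The first round of the other path: the two outer levels are joined in the index
    set \<open>mu_idx W\<close>. The second round, which yields \<open>K\<close>, separates
    them.\<close>
  define G where "G = mu_split A ?V (rdx t)"
  define s where "s = mu_flat ?V (cpt t)"
  let ?g = "reindex ?D (mu_ob T G) (rdx t)"
  have Go: "G \<in> Ob ?LLD" unfolding G_def by (rule mu_split_Ob[OF A V el_L_lmap[OF t]])
  have g: "ar ?LD A (mu_ob T G) ?g" unfolding G_def by (rule ar_mu_split[OF D A V el_L_lmap[OF t]])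
  have eg: "el ?mD A G ?g" using g Go by (simp add: el_diamond[OF mD])
  note es = el_mu_flat_split[OF t V, folded G_def s_def]
  have rt: "ract ?LF A ?U ?U ?J t = t" using ract_Ide[OF PR_profunctor[OF LF] t] by simp
  have "sends (mu1 F) A ?V (coend_in ?LF ?mC A ?V ?U t ?J) (coend_in ?mD ?LLF A ?V G ?g s)"
    using sends_mu1[OF F t IU V] by (simp only: mu_sec_def rt G_def[symmetric] s_def[symmetric])
  then have r2: "sends (mu1 F \<triangleright> ?nC) A W (coend_in (comp_prof ?LF ?mC) ?nC A W ?V (coend_in ?LF ?mC A ?V ?U t ?J) ?I)
    (coend_in (comp_prof ?mD ?LLF) ?nC A W ?V (coend_in ?mD ?LLF A ?V G ?g s) ?I)"
    by (intro sends_rwhisker[OF mu1_cell[OF F] pnC _ eI]) simp_all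
  have r3: "sends (\<aa> ?mD ?LLF ?nC) A W (coend_in (comp_prof ?mD ?LLF) ?nC A W ?V (coend_in ?mD ?LLF A ?V G ?g s) ?I)
    (coend_in ?mD (comp_prof ?LLF ?nC) A W G ?g (coend_in ?LLF ?nC G W ?V s ?I))"
    by (rule sends_assoc[OF pmD LLF pnC _ _ eg es eI]) simp_all
  define K where "K = mu_split G W (rdx s)"
  define u where "u = mu_flat W (cpt s)"
  let ?k = "reindex ?LD (mu_ob T K) (rdx s)"
  have WS: "W \<in> Ob (L_cat T (L_cat T (Src ?LF)))" and IS: "ar (L_cat T (Src ?LF)) ?V ?V ?I" and GS: "G \<in> Ob (L_cat T ?LD)" using W IV Go by simp_all
  have Ko: "K \<in> Ob (L_cat T ?LLD)" unfolding K_def by (rule mu_split_Ob[OF GS WS el_L_lmap[OF es]])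
  have k: "ar ?LLD G (mu_ob T K) ?k" unfolding K_def by (rule ar_mu_split[OF LD GS WS el_L_lmap[OF es]])
  have ek: "el ?nD G K ?k" using k Ko by (simp add: el_diamond[OF nD])
  note eu = el_mu_flat_split[OF es WS, folded K_def u_def]
  have rs: "ract ?LLF G ?V ?V ?I s = s" using ract_Ide[OF PR_profunctor[OF LLF] es] by simp
  have r4: "sends (?mD \<triangleleft> mu1 ?LF) A W (coend_in ?mD (comp_prof ?LLF ?nC) A W G ?g (coend_in ?LLF ?nC G W ?V s ?I))
    (coend_in ?mD (comp_prof ?nD ?LLLF) A W G ?g (coend_in ?nD ?LLLF G W K ?k u))"
    using sends_lwhisker[OF mu1_cell[OF LF] pmD _ eg sends_mu1[OF LF es IS WS]]
    unfolding mu_sec_def rs K_def[symmetric] u_def[symmetric] by simp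
  have r5: "sends (\<aa>' ?mD ?nD ?LLLF) A W (coend_in ?mD (comp_prof ?nD ?LLLF) A W G ?g (coend_in ?nD ?LLLF G W K ?k u))
    (coend_in (comp_prof ?mD ?nD) ?LLLF A W K (coend_in ?mD ?nD A K G ?g ?k) u)"
    by (rule sends_assoc_inv[OF pmD pnD LLLF _ _ eg ek eu]) simp_all
  let ?c = "Cmp ?LD A (mu_ob T (mu_ob T K)) (mu_ob T (Lmu K)) (mu_assoc ?D K)
      (Cmp ?LD A (mu_ob T G) (mu_ob T (mu_ob T K)) (mu_el (mu_ob T K) ?k) ?g)" and ?N = "Ide ?LLD (Lmu K)"
  have r6: "sends (L_skew_m T ?D \<triangleright> ?LLLF) A W (coend_in (comp_prof ?mD ?nD) ?LLLF A W K (coend_in ?mD ?nD A K G ?g ?k) u)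
    (coend_in (comp_prof ?mD (L_prof T ?mD)) ?LLLF A W K (coend_in ?mD (L_prof T ?mD) A K (Lmu K) ?c ?N) u)"
    by (rule sends_rwhisker[OF L_skew_m_cell[OF D] LLLF _ eu sends_L_skew_m[OF D g k Ko]]) simp
  note LK = Lmu_Ob[OF Ko]
  have c: "ar ?LD A (mu_ob T (Lmu K)) ?c" by (rule ar_Cmp[OF LD ar_Cmp[OF LD g ar_mu_el[OF k]] ar_mu_assoc[OF D Ko]])
  have ec: "el ?mD A (Lmu K) ?c" using c LK by (simp add: el_diamond[OF mD])
  have eN: "el (L_prof T ?mD) (Lmu K) K ?N" using ar_Ide[OF LLD LK] Ko by (simp add: el_L_diamond[OF mD])
  have r7: "sends (\<aa> ?mD (L_prof T ?mD) ?LLLF) A W (coend_in (comp_prof ?mD (L_prof T ?mD)) ?LLLF A W K (coend_in ?mD (L_prof T ?mD) A K (Lmu K) ?c ?N) u)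
    (coend_in ?mD (comp_prof (L_prof T ?mD) ?LLLF) A W (Lmu K) ?c (coend_in (L_prof T ?mD) ?LLLF (Lmu K) W K ?N u))"
    by (rule sends_assoc[OF pmD LmD LLLF _ _ ec eN eu]) simp_all
  have Gi: "idx G = mu_idx W" "\<And>v. v \<in> elts (mu_idx W) \<Longrightarrow> idx (ob G v) = idx (ob ?V v)" by (simp_all add: G_def)
  have Gx: "idx (ob G (pr x z)) = idx (ob (ob W x) z)" "ob G (pr x z) = fam_ob (idx (ob (ob W x) z)) (\<lambda>y. ob A (rdx t (pr (pr x z) y))) (lab (ob (ob W x) z))"
    if "x \<in> elts (idx W)" "z \<in> elts (idx (ob W x))" for x z
    using that by (simp_all add: G_def mu_split_def)
  have rs': "rdx s v = v" if "v \<in> elts (mu_idx W)" for v using that by (simp add: s_def)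
  have ss: "cpt s (pr x z) = fam_ar (idx (ob (ob W x) z)) (\<lambda>y. y) (\<lambda>y. cpt t (pr (pr x z) y))"
    if "x \<in> elts (idx W)" "z \<in> elts (idx (ob W x))" for x z
    using that by (simp add: s_def mu_flat_def)
  have Ki: "idx K = idx W" "lab K = lab W" and ru: "x \<in> elts (idx W) \<Longrightarrow> rdx u x = x" for x by (simp_all add: K_def u_def)
  have Kx: "ob K x = fam_ob (idx (ob W x)) (\<lambda>z. ob G (pr x z)) (lab (ob W x))" and ux: "cpt u x = fam_ar (idx (ob W x)) (\<lambda>z. z) (\<lambda>z. cpt s (pr x z))"
    if "x \<in> elts (idx W)" for x
    using that by (simp_all add: K_def u_def mu_split_def mu_flat_def rs')
  have mK: "mu_idx (ob K x) = mu_idx (ob W x)" "lab (mu_ob T (ob K x)) = lab (mu_ob T (ob W x))" if x: "x \<in> elts (idx W)" for x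
  proof -
    show *: "mu_idx (ob K x) = mu_idx (ob W x)" by (rule mu_idx_cong) (use x in \<open>simp_all add: Kx Gx\<close>)
    show "lab (mu_ob T (ob K x)) = lab (mu_ob T (ob W x))"
      unfolding lab_mu * using x by (simp add: Kx) (rule bind_cong, simp add: Gx)
  qed
  \<comment> \<open>Joining the inner levels of the twofold splitting gives the onefold splitting as
    an equal code: the same pairs as indices, the same objects of \<open>A\<close>, and equal labels
    by \<open>mK\<close>.\<close>
  have HK: "H = Lmu K"
  proof -
    have "ob H x = mu_ob T (ob K x)" if x: "x \<in> elts (idx W)" for x
    proof -
      have "ob H x = fam_ob (mu_idx (ob W x)) (\<lambda>v. ob A (rdx t' (pr x v))) (lab (mu_ob T (ob W x)))"
        using x by (simp add: H_def mu_split_def)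
      also have "\<dots> = fam_ob (mu_idx (ob K x)) (\<lambda>v. ob (ob (ob K x) (pfst v)) (psnd v)) (lab (mu_ob T (ob K x)))"
        unfolding mK[OF x] by (rule fam_ob_cong) (use x in \<open>auto simp: Kx Gx ts\<close>)
      finally show ?thesis by (simp add: mu_ob_def)
    qed
    then show ?thesis by (simp add: Ki) (simp add: H_def mu_split_def)
  qed
  \<comment> \<open>The element \<open>cpt f x\<close> is an identity on indices, so its splitting
    is \<open>ob K x\<close> with an identity arrow, and its flat part is the entry of
    \<open>u\<close> at \<open>x\<close>.\<close>
  have "mu_sec F (ob H x) (ob W x) (cpt f x) = coend_in ?mD ?LLF (mu_ob T (ob K x)) (ob W x) (ob K x) (Ide ?LD (mu_ob T (ob K x))) (cpt u x)"
    if x: "x \<in> elts (idx W)" for x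
  proof -
    have fx: "rdx (cpt f x) v = v" "cpt (cpt f x) v = cpt t' (pr x v)" if "v \<in> elts (mu_idx (ob W x))" for v
      using x that by (simp_all add: f_def mu_flat_def)
    have Hx: "ob H x = mu_ob T (ob K x)" using x by (simp add: HK Ki)
    have 1: "mu_split (mu_ob T (ob K x)) (ob W x) (rdx (cpt f x)) = ob K x"
      unfolding mu_split_def using x by (simp add: Kx) (auto intro!: fam_ob_cong simp: fx Gx)
    have 2: "reindex ?D (mu_ob T (ob K x)) (rdx (cpt f x)) = Ide ?LD (mu_ob T (ob K x))"
      unfolding reindex_def Ide_L using x by (auto intro!: fam_ar_cong simp: fx mK)
    have 3: "mu_flat (ob W x) (cpt (cpt f x)) = cpt u x"
      unfolding mu_flat_def ux[OF x] using x by (auto intro!: fam_ar_cong simp: fx ss ts)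
    show ?thesis unfolding mu_sec_def Hx 1 2 3 ..
  qed
  then have w2: "sends (L_compositor T ?mD ?LLF) (Lmu K) W (coend_in (L_prof T ?mD) ?LLLF (Lmu K) W K ?N u) ?w"
    by (intro sends_L_compositor[OF pmD LLF ty(4) eN eu]) (simp_all add: Is ru Ki)
  have r8: "sends (?mD \<triangleleft> L_compositor T ?mD ?LLF) A W
    (coend_in ?mD (comp_prof (L_prof T ?mD) ?LLLF) A W (Lmu K) ?c (coend_in (L_prof T ?mD) ?LLLF (Lmu K) W K ?N u))
    (coend_in ?mD (L_prof T (comp_prof ?mD ?LLF)) A W (Lmu K) ?c ?w)"
    by (rule sends_lwhisker[OF L_compositor_cell[OF pmD LLF ty(4)] pmD _ ec w2]) simp
  \<comment> \<open>The constituents of \<open>?c\<close> are reindexings with identity components,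
    and their index maps compose to that of \<open>t'\<close>.\<close>
  have hc: "?h = ?c"
    unfolding HK
  proof (rule fam_eqI[OF ar_L_eta[OF h[unfolded HK]] ar_L_eta[OF c]])
    fix v assume "v \<in> elts (idx (mu_ob T (Lmu K)))"
    then obtain x z y where v: "v = pr x (pr z y)" and xz: "x \<in> elts (idx W)" "z \<in> elts (idx (ob W x))" "y \<in> elts (idx (ob (ob W x) z))"
      by (auto simp: Ki Kx Gx)
    have "ob A (rdx t (pr (pr x z) y)) \<in> Ob ?D" using el_L_rdx[OF t, of "pr (pr x z) y"] xz by (auto intro: L_Ob_ob[OF A])
    note D = Cmp_Ide_r[OF D ar_Ide[OF D this]]
    show "rdx (reindex ?D (mu_ob T (Lmu K)) (rdx t')) v = rdx ?c v"
      using xz by (simp add: v Cmp_L Ki Kx Gx Gi rs' ts Is)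
    show "cpt (reindex ?D (mu_ob T (Lmu K)) (rdx t')) v = cpt ?c v"
      using xz D by (simp add: v Cmp_L Ki Kx Gx Gi rs' ts Is)
  qed
  have eq: "coend_in ?mD (L_prof T (comp_prof ?mD ?LLF)) A W (Lmu K) ?c ?w = coend_in ?mD (L_prof T (comp_prof ?mD ?LLF)) A W H ?h ?w"
    unfolding hc[symmetric] by (simp only: HK)
  show "\<exists>q. sends ?l A W p q \<and> sends ?r A W p q"
    using sends_vcomp[OF l1 sends_vcomp[OF l2 sends_vcomp[OF l3 sends_vcomp[OF l4 l56]]]]
      sends_vcomp[OF r1 sends_vcomp[OF r2 sends_vcomp[OF r3 sends_vcomp[OF r4 sends_vcomp[OF r5 sends_vcomp[OF r6 sends_vcomp[OF r7 r8[unfolded eq]]]]]]]] by blast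
qed (simp_all add: cell_Dom[OF L_skew_m_cell[OF PR_Src[OF F]]])

section \<open>Assembly of the skew monad\<close>

definition L_skew :: "('u cat, 'u prof, 'u ptrans) skew" where
  "L_skew = \<lparr>skfun = L_endo, sketa0 = (\<lambda>C. diamond (L_eta T C)), sketa1 = eta1,
     skmu0 = (\<lambda>C. diamond (L_mu T C)), skmu1 = mu1, skm = L_skew_m T, skl = L_skew_l T, skr = L_skew_r T\<rparr>"

lemma L_skew_simps: "skfun L_skew = L_endo" "sketa0 L_skew = (\<lambda>C. diamond (L_eta T C))" "sketa1 L_skew = eta1"
    "skmu0 L_skew = (\<lambda>C. diamond (L_mu T C))" "skmu1 L_skew = mu1" "skm L_skew = L_skew_m T" "skl L_skew = L_skew_l T" "skr L_skew = L_skew_r T"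
  by (simp_all add: L_skew_def)

text \<open>Unfolding \<open>co\<close> and \<open>vpath\<close> turns each closure condition,
  modification law and axiom into the lemma prepared for it, with the same bracketing.\<close>

lemma right_skew_monad_L: "right_skew_monad (co PROF) L_skew"
proof (intro right_skew_monad.intro right_skew_monad_axioms.intro; (unfold L_skew_simps L_endo_simps co_simps whisker_co hom1_co hom2_co vpath.simps)?)
  show "oplax_transformation (co PROF) (id_endo (co PROF)) L_endo (\<lambda>C. diamond (L_eta T C)) eta1" by (rule oplax_transformation_eta)
  show "oplax_transformation (co PROF) (square_endo (co PROF) L_endo) L_endo (\<lambda>C. diamond (L_mu T C)) mu1" by (rule oplax_transformation_mu)
qed (simp_all add: L_skew_m_cell L_skew_l_cell L_skew_r_cell L_skew_m_modification L_skew_l_modification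
  L_skew_r_modification skew_axiom_i skew_axiom_ii skew_axiom_iii skew_axiom_iv skew_axiom_v)

end

theorem theorem4p5:
  fixes T :: "'u::zf_universe set_monad"
  assumes "set_monad T"
  shows "\<exists>S. left_skew_monad (PROF :: ('u cat, 'u prof, 'u ptrans) bicat) S \<and> extends_L T S"
proof (intro exI conjI)
  interpret set_monad T by fact
  show "left_skew_monad PROF L_skew" unfolding left_skew_monad_def by (rule right_skew_monad_L)
  show "extends_L T L_skew"
    unfolding extends_L_def L_skew_simps by (simp add: eta1_inverse mu1_inverse)
qed

end
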